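(* Let $d\ge 2$, $\lambda_1,\dots,\lambda_d>0$, $\alpha_1,\dots,\alpha_d>0$ with $\sum_{i=1}^d\alpha_i=1$, $T>0$, and let $\mu$ be a probability measure on $\mathbb{R}$. Assume that $(\lambda_i)_{1\le i\le d}$ satisfies Condition (C). Then the variational problem $V(\mu)$ has a solution $p=(p_1,\dots,p_d)\in C((0,T],L)$ such that for almost every $(t,x)\in(0,T]\times\mathbb{R}$, $$\sum_{i=1}^d p_i(t,x)=(\mu*h_t)(x).$$
   Context: Condition (C): there exists a symmetric positive definite real $d\times d$ matrix $\Gamma$ such that for every $1\le k\le d$ the $d\times d$ matrix $\Gamma^{(k)}$ with coefficients $\Gamma^{(k)}_{ij}=\frac{\lambda_i+\lambda_j}{2}\left(\Gamma_{ij}+\Gamma_{kk}-\Gamma_{ik}-\Gamma_{jk}\right)$ is positive definite on $e_k^\perp=\{y\in\mathbb{R}^d: y_k=0\}$. Notation: $L=(L^2(\mathbb{R}))^d$, $H=(H^1(\mathbb{R}))^d$ with their usual norms; $(u,v)_d=\int_{\mathbb{R}}\sum_{i=1}^d u_i(x)v_i(x)\,dx$; $h_t(x)=\frac{1}{\sqrt{2\pi t}}e^{-x^2/(2t)}$; $\mathcal{D}=(\mathbb{R}_+)^d\setminus\{(0,\dots,0)\}$. For $\rho\in\mathcal{D}$, $A(\rho)=\frac12(I_d+M(\rho))$, where $M(\rho)$ is the $d\times d$ matrix with $$M_{ii}(\rho)=\frac{\left(\sum_{l\ne i}\lambda_l\rho_l\right)\left(\sum_{l\neq i}(\lambda_i-\lambda_l)\rho_l\right)}{\left(\sum_l\lambda_l\rho_l\right)^2},\qquad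 M_{ij}(\rho)=\frac{\lambda_i\rho_i\sum_{l\ne j}(\lambda_l-\lambda_j)\rho_l}{\left(\sum_l\lambda_l\rho_l\right)^2}\ (i\ne j).$$ Problem $V(\mu)$: find $p=(p_1,\dots,p_d)$ such that (1) $p\in L^2_{loc}((0,T];H)\cap L^\infty_{loc}((0,T];L)$; (2) $p$ takes values in $\mathcal{D}$ a.e. on $(0,T)\times\mathbb{R}$; (3) for all $v\in H$, $\frac{d}{dt}(v,p)_d+(\partial_xv,A(p)\partial_xp)_d=0$ in the sense of distributions on $(0,T)$; (4) for all $v\in H$, $(v,p(t))_d\to\sum_{i=1}^d\alpha_i\int_{\mathbb{R}}v_i(x)\mu(dx)$ as $t\to0^+$. Any $p$ satisfying (1)-(3) is a.e. equal to a function continuous from $(0,T]$ into $L$, and this continuous representative is always the one considered, so that (4) makes sense. *)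

theory Defs
  imports "HOL-Analysis.Analysis" "HOL-Probability.Probability"
begin

section \<open>Condition (C)\<close>

definition pos_def_on :: "(real^'d) set \<Rightarrow> real^'d^'d \<Rightarrow> bool" where
  "pos_def_on S A \<longleftrightarrow> (\<forall>y\<in>S. y \<noteq> 0 \<longrightarrow> y \<bullet> (A *v y) > 0)"

definition Gamma_k :: "('d \<Rightarrow> real) \<Rightarrow> real^'d^'d \<Rightarrow> 'd \<Rightarrow> real^'d^'d" where
  "Gamma_k lam G k =
     (\<chi> i j. (lam i + lam j) / 2 * (G$i$j + G$k$k - G$i$k - G$j$k))"

definition condition_C :: "('d::finite \<Rightarrow> real) \<Rightarrow> bool" where
  "condition_C lam \<longleftrightarrow>
     (\<exists>G::real^'d^'d. transpose G = G \<and> pos_def_on UNIV G \<and>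
        (\<forall>k. pos_def_on {y. y$k = 0} (Gamma_k lam G k)))"


section \<open>Distributional derivatives and function spaces\<close>

text \<open>The space of smooth real functions whose support is a compact subset of \<open>S\<close>.\<close>

definition test_funs :: "real set \<Rightarrow> (real \<Rightarrow> real) set" where
  "test_funs S = {\<phi>. (\<forall>k x. ((deriv ^^ k) \<phi>) differentiable (at x)) \<and>
                     (\<exists>K. compact K \<and> K \<subseteq> S \<and> (\<forall>x. x \<notin> K \<longrightarrow> \<phi> x = 0))}"

definition locally_integrable :: "real set \<Rightarrow> (real \<Rightarrow> 'v::euclidean_space) \<Rightarrow> bool" where
  "locally_integrable S f \<longleftrightarrow> (\<forall>K. compact K \<and> K \<subseteq> S \<longrightarrow> set_integrable lebesgue K f)"

text \<open>\<open>f' = g\<close> in the sense of distributions on the open set \<open>S\<close>. The functions \<open>f\<close> and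
  \<open>g\<close> are required to be locally integrable, so that both of them define distributions.\<close>

definition has_distr_deriv ::
    "real set \<Rightarrow> (real \<Rightarrow> 'v::euclidean_space) \<Rightarrow> (real \<Rightarrow> 'v) \<Rightarrow> bool" where
  "has_distr_deriv S f g \<longleftrightarrow>
     locally_integrable S f \<and> locally_integrable S g \<and>
     (\<forall>\<phi>\<in>test_funs S. (LINT x:S|lebesgue. deriv \<phi> x *\<^sub>R f x) = - (LINT x:S|lebesgue. \<phi> x *\<^sub>R g x))"

text \<open>Elements of \<open>L\<close> and \<open>H\<close> are represented by functions rather than by classes modulo null
  sets; every notion below except pointwise evaluation is invariant under changes on null sets.
  A vector \<open>(u\<^sub>1, \<dots>, u\<^sub>d)\<close> of functions is represented by one function with values in
  \<open>real^'d\<close>, so that \<open>L = L2\<close> and \<open>H = H1\<close> at this type.\<close>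

definition L2 :: "(real \<Rightarrow> 'v::euclidean_space) set" where
  "L2 = {u. u \<in> borel_measurable lebesgue \<and> integrable lebesgue (\<lambda>x. (norm (u x))\<^sup>2)}"

definition inner_L2 :: "(real \<Rightarrow> 'v::euclidean_space) \<Rightarrow> (real \<Rightarrow> 'v) \<Rightarrow> real" where
  "inner_L2 u v = (LINT x|lebesgue. u x \<bullet> v x)"

definition norm_L2 :: "(real \<Rightarrow> 'v::euclidean_space) \<Rightarrow> real" where
  "norm_L2 u = sqrt (LINT x|lebesgue. (norm (u x))\<^sup>2)"

definition H1 :: "(real \<Rightarrow> 'v::euclidean_space) set" where
  "H1 = {u \<in> L2. \<exists>g\<in>L2. has_distr_deriv UNIV u g}"

text \<open>Some representative of the weak derivative; for \<open>u \<in> H1\<close> it is unique up to a null set.\<close>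

definition weak_deriv :: "(real \<Rightarrow> 'v::euclidean_space) \<Rightarrow> real \<Rightarrow> 'v" where
  "weak_deriv u = (SOME g. g \<in> L2 \<and> has_distr_deriv UNIV u g)"

definition norm_H1 :: "(real \<Rightarrow> 'v::euclidean_space) \<Rightarrow> real" where
  "norm_H1 u = sqrt ((norm_L2 u)\<^sup>2 + (norm_L2 (weak_deriv u))\<^sup>2)"


section \<open>Spaces of functions of time with values in \<open>L\<close> or \<open>H\<close>\<close>

text \<open>Strong (Bochner) measurability on \<open>K\<close> of a map with values in the space \<open>X\<close> of
  functions seminormed by \<open>N\<close>: an a.e. limit of \<open>X\<close>-valued simple maps.\<close>

definition strongly_measurable_on ::
    "(real \<Rightarrow> 'v::euclidean_space) set \<Rightarrow> ((real \<Rightarrow> 'v) \<Rightarrow> real) \<Rightarrow> real set \<Rightarrow>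
     (real \<Rightarrow> real \<Rightarrow> 'v) \<Rightarrow> bool" where
  "strongly_measurable_on X N K p \<longleftrightarrow>
     (AE t in lebesgue_on K. p t \<in> X) \<and>
     (\<exists>s::nat \<Rightarrow> real \<Rightarrow> real \<Rightarrow> 'v.
        (\<forall>n. simple_function (lebesgue_on K) (s n) \<and> s n ` K \<subseteq> X) \<and>
        (AE t in lebesgue_on K. (\<lambda>n. N (\<lambda>x. p t x - s n t x)) \<longlonglongrightarrow> 0))"

definition L2_loc ::
    "real set \<Rightarrow> (real \<Rightarrow> 'v::euclidean_space) set \<Rightarrow> ((real \<Rightarrow> 'v) \<Rightarrow> real) \<Rightarrow>
     (real \<Rightarrow> real \<Rightarrow> 'v) set" where
  "L2_loc I X N = {p. \<forall>K. compact K \<and> K \<subseteq> I \<longrightarrow>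
     strongly_measurable_on X N K p \<and> set_integrable lebesgue K (\<lambda>t. (N (p t))\<^sup>2)}"

definition Linf_loc ::
    "real set \<Rightarrow> (real \<Rightarrow> 'v::euclidean_space) set \<Rightarrow> ((real \<Rightarrow> 'v) \<Rightarrow> real) \<Rightarrow>
     (real \<Rightarrow> real \<Rightarrow> 'v) set" where
  "Linf_loc I X N = {p. \<forall>K. compact K \<and> K \<subseteq> I \<longrightarrow>
     strongly_measurable_on X N K p \<and> (\<exists>C. AE t in lebesgue_on K. N (p t) \<le> C)}"

definition C_into_L :: "real set \<Rightarrow> (real \<Rightarrow> real \<Rightarrow> 'v::euclidean_space) set" where
  "C_into_L I = {p. (\<forall>t\<in>I. p t \<in> L2) \<and>
     (\<forall>t\<in>I. ((\<lambda>s. norm_L2 (\<lambda>x. p s x - p t x)) \<longlongrightarrow> 0) (at t within I))}"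


section \<open>The variational problem\<close>

definition domain_D :: "(real^'d) set" where
  "domain_D = {\<rho>. \<forall>i. \<rho>$i \<ge> 0} - {0}"

definition mat_M :: "('d::finite \<Rightarrow> real) \<Rightarrow> real^'d \<Rightarrow> real^'d^'d" where
  "mat_M lam \<rho> = (\<chi> i j.
     if i = j then
       (\<Sum>l\<in>UNIV - {i}. lam l * \<rho>$l) * (\<Sum>l\<in>UNIV - {i}. (lam i - lam l) * \<rho>$l)
         / (\<Sum>l\<in>UNIV. lam l * \<rho>$l)\<^sup>2
     else
       lam i * \<rho>$i * (\<Sum>l\<in>UNIV - {j}. (lam l - lam j) * \<rho>$l)
         / (\<Sum>l\<in>UNIV. lam l * \<rho>$l)\<^sup>2)"

definition mat_A :: "('d::finite \<Rightarrow> real) \<Rightarrow> real^'d \<Rightarrow> real^'d^'d" where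
  "mat_A lam \<rho> = (1/2) *\<^sub>R (mat 1 + mat_M lam \<rho>)"

definition heat_kernel :: "real \<Rightarrow> real \<Rightarrow> real" where
  "heat_kernel t x = 1 / sqrt (2 * pi * t) * exp (- x\<^sup>2 / (2 * t))"

definition heat_conv :: "real measure \<Rightarrow> real \<Rightarrow> real \<Rightarrow> real" where
  "heat_conv \<mu> t x = (LINT y|\<mu>. heat_kernel t (x - y))"

text \<open>A solution is represented by a jointly measurable function \<open>p t x\<close> of time and space, which
  gives statements for a.e. \<open>(t, x)\<close> their usual meaning, and it is the representative that
  is continuous from \<open>(0, T]\<close> into \<open>L\<close>. In the initial condition the values of \<open>v\<close> matter on
  \<open>\<mu>\<close>-charged points, hence \<open>v\<close> is the continuous representative, which every class in \<open>H\<close>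
  possesses.\<close>

definition V_solution ::
    "('d::finite \<Rightarrow> real) \<Rightarrow> ('d \<Rightarrow> real) \<Rightarrow> real \<Rightarrow> real measure \<Rightarrow>
     (real \<Rightarrow> real \<Rightarrow> real^'d) \<Rightarrow> bool" where
  "V_solution lam \<alpha> T \<mu> p \<longleftrightarrow>
     (\<lambda>(t, x). p t x) \<in> borel_measurable (lebesgue_on ({0<..T} \<times> UNIV)) \<and>
     p \<in> C_into_L {0<..T} \<and>
     p \<in> L2_loc {0<..T} H1 norm_H1 \<inter> Linf_loc {0<..T} L2 norm_L2 \<and>
     (AE (t, x) in lebesgue_on ({0<..<T} \<times> UNIV). p t x \<in> domain_D) \<and>
     (\<forall>v\<in>H1. has_distr_deriv {0<..<T}
        (\<lambda>t. inner_L2 v (p t))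
        (\<lambda>t. - inner_L2 (weak_deriv v) (\<lambda>x. mat_A lam (p t x) *v weak_deriv (p t) x))) \<and>
     (\<forall>v\<in>H1. continuous_on UNIV v \<longrightarrow>
        ((\<lambda>t. inner_L2 v (p t)) \<longlongrightarrow> (\<Sum>i\<in>UNIV. \<alpha> i * (LINT x|\<mu>. v x $ i))) (at_right 0))"

end

theory Submission
 imports Defs "HOL-Complex_Analysis.Great_Picard"
begin

text \<open>The system is the diffusion \<open>\<partial>\<^sub>t p = \<partial>\<^sub>x\<^sub>x F(p) / 2\<close> with \<open>F\<^sub>i(p) = \<lambda>\<^sub>i p\<^sub>i (\<Sum>\<^sub>l p\<^sub>l) / (\<Sum>\<^sub>l \<lambda>\<^sub>l p\<^sub>l)\<close>, since
 \<open>2 A\<close> is the derivative of \<open>F\<close>. Condition (C) makes \<open>F\<close> strongly monotone on the positive orthant for the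
 form of \<open>\<Gamma>\<close> plus a large multiple of the all-ones matrix. As \<open>F\<close> is homogeneous of degree one, the explicit
 difference scheme on the integers needs no scale: it contracts in a discrete \<open>H\<^sup>-\<^sup>1\<close> norm, and comparing a solution with
 its translates gives the decay of the \<open>L\<^sup>2\<close> norms of the solution and of its gradient at the rates of the heat kernel,
 for all initial masses at most one. After parabolic rescaling these bounds are equicontinuity estimates on
 \<open>t > 0\<close>, and a subsequence converges pointwise to the solution. Because the components of \<open>F(p)\<close> add up to those of
 \<open>p\<close>, the total density solves the heat equation weakly and is therefore the convolution with the heat kernel; in
 particular it is positive, which is what the chain rule for \<open>F(p)\<close> needs.\<close>

section \<open>The flux\<close>

text \<open>What survives is that \<open>flux lam\<close> itself is Lipschitz up to the origin and
  monotone for a suitable form. The initial datum is only a measure, so no energy bound is available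
  at time zero and every estimate has to be regularizing. All of them come from one comparison: the
  primitive of m(. + k) - m is the sum of m over k neighbouring cells, whose square sum is at most k
  by mass alone, and the dissipation in the contraction then controls the translates summed over
  time. The same contraction for two consecutive iterates makes the energy of the flow between cells
  decrease in time, which gives the gradient decay. In the step number n, the square sums of the
  solution and of its gradient decay like n^(-1/2) and n^(-3/2). The root n^(-3/4) of the latter has
  sums of order n^(1/4), and this yields the initial condition.\<close>

definition nonneg :: "(real^'d) set" where
 "nonneg = {\<rho>. \<forall>i. \<rho>$i \<ge> 0}"

definition total :: "real^'d => real" where
 "total \<rho> = (\<Sum>i\<in>UNIV. \<rho>$i)"

definition weighted :: "('d => real) => real^'d => real" where
 "weighted lam \<rho> = (\<Sum>i\<in>UNIV. lam i * \<rho>$i)"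

definition scale_by :: "('d => real) => real^'d => real^'d" where
 "scale_by lam \<rho> = (\<chi> i. lam i * \<rho>$i)"

definition flux :: "('d::finite => real) => real^'d => real^'d" where
 "flux lam \<rho> = (total \<rho> / weighted lam \<rho>) *\<^sub>R scale_by lam \<rho>"

lemma total_simps [simp]:
 "total 0 = 0" "total (x + y) = total x + total y" "total (x - y) = total x - total y"
 "total (c *\<^sub>R x) = c * total x" "total (- x) = - total x"
 by (simp_all add: total_def sum.distrib sum_subtractf sum_distrib_left sum_negf)

lemma weighted_simps [simp]:
 "weighted lam 0 = 0" "weighted lam (x + y) = weighted lam x + weighted lam y"
 "weighted lam (x - y) = weighted lam x - weighted lam y"
 "weighted lam (c *\<^sub>R x) = c * weighted lam x" "weighted lam (- x) = - weighted lam x"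
 by (simp_all add: weighted_def sum.distrib sum_subtractf sum_distrib_left sum_negf algebra_simps)

lemma scale_by_simps [simp]:
 "scale_by lam 0 = 0" "scale_by lam (x + y) = scale_by lam x + scale_by lam y"
 "scale_by lam (x - y) = scale_by lam x - scale_by lam y"
 "scale_by lam (c *\<^sub>R x) = c *\<^sub>R scale_by lam x" "scale_by lam (- x) = - scale_by lam x"
 "scale_by lam x $ i = lam i * x $ i"
 by (simp_all add: scale_by_def vec_eq_iff algebra_simps)

lemma total_scale_by [simp]: "total (scale_by lam x) = weighted lam x"
 by (simp add: total_def weighted_def)

lemma flux_0 [simp]: "flux lam 0 = 0"
 by (simp add: flux_def)

lemma nonneg_0 [simp]: "0 \<in> nonneg"
 by (simp add: nonneg_def)

lemma flux_scaleR: "flux lam (c *\<^sub>R x) = c *\<^sub>R flux lam x"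
 by (cases "c = 0") (simp_all add: flux_def)

lemma component_le_total: "x \<in> nonneg ==> x$i <= total x"
 unfolding total_def nonneg_def by (intro member_le_sum) auto

lemma total_nonneg: "x \<in> nonneg ==> 0 <= total x"
 unfolding total_def nonneg_def by (intro sum_nonneg) auto

lemma total_pos: "x \<in> nonneg ==> x ~= 0 ==> 0 < total x"
proof -
 assume x: "x \<in> nonneg" "x ~= 0"
 then obtain i where "x$i ~= 0" by (auto simp: vec_eq_iff)
 then have "0 < x$i" using x(1) by (simp add: nonneg_def order_less_le)
 then show ?thesis using component_le_total[OF x(1), of i] by linarith
qed

lemma abs_total_le: "\<bar>total x\<bar> <= real CARD('d) * norm (x::real^'d)"
proof -
 have "\<bar>total x\<bar> <= (\<Sum>i\<in>UNIV. \<bar>x$i\<bar>)" unfolding total_def by (rule sum_abs)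
 also have "... <= (\<Sum>i\<in>(UNIV::'d set). norm x)" by (intro sum_mono component_le_norm_cart)
 finally show ?thesis by simp
qed

lemma norm_le_total: "x \<in> nonneg ==> norm x <= total x"
 using norm_le_l1_cart[of x] by (simp add: total_def nonneg_def)

text \<open>A quadratic form attains its minimum over the unit vectors of a closed cone, and
  homogeneity spreads that minimum over the cone. Allowing any closed set stable under scalars
  covers both the full space and the hyperplane of zero total.\<close>

lemma pos_def_on_bound:
 fixes A :: "real^'d^'d"
 assumes "closed V" "!!c y. y \<in> V ==> c *\<^sub>R y \<in> V" "pos_def_on V A"
 obtains c where "c > 0" "!!y. y \<in> V ==> c * (norm y)\<^sup>2 <= y \<bullet> (A *v y)"
proof (cases "V \<inter> sphere 0 1 = {}")
 case True
 have "y = 0" if "y \<in> V" for y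
 proof (rule ccontr)
  assume "y ~= 0"
  then have "(1 / norm y) *\<^sub>R y \<in> V \<inter> sphere 0 1" using assms(2)[OF that] by simp
  with True show False by blast
 qed
 then show ?thesis using that[of 1] by fastforce
next
 case False
 have "compact (V \<inter> sphere 0 1)" using assms(1) by (simp add: closed_Int_compact)
 moreover have "continuous_on (V \<inter> sphere 0 1) (%y. y \<bullet> (A *v y))"
  by (intro continuous_intros matrix_vector_mult_linear_continuous_on)
 ultimately obtain z where z: "z \<in> V \<inter> sphere 0 1"
  "!!y. y \<in> V \<inter> sphere 0 1 ==> z \<bullet> (A *v z) <= y \<bullet> (A *v y)"
  using continuous_attains_inf[of "V \<inter> sphere 0 1"] False by blast
 define c where "c = z \<bullet> (A *v z)"
 have "c > 0" using z(1) assms(3) unfolding c_def pos_def_on_def by auto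
 moreover have "c * (norm y)\<^sup>2 <= y \<bullet> (A *v y)" if "y \<in> V" for y
 proof (cases "y = 0")
  case False
  then have "c <= ((1 / norm y) *\<^sub>R y) \<bullet> (A *v ((1 / norm y) *\<^sub>R y))"
   unfolding c_def by (intro z(2)) (simp add: assms(2) that)
  also have "... = y \<bullet> (A *v y) / (norm y)\<^sup>2"
   by (simp add: matrix_vector_mult_scaleR power2_eq_square)
  finally show ?thesis using False by (simp add: field_simps)
 qed simp
 ultimately show ?thesis using that by blast
qed

lemma symmetric_inner_commute:
 fixes G :: "real^'d^'d"
 assumes "transpose G = G"
 shows "x \<bullet> (G *v y) = y \<bullet> (G *v x)"
 by (metis assms dot_lmul_matrix inner_commute vector_transpose_matrix)

text \<open>On the hyperplane \<open>total y = 0\<close> the forms \<open>\<Gamma>\<^sup>(\<^sup>k\<^sup>)\<close> are the values at the vertices of the simplex of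
 a form that is affine in the weight vector \<open>w\<close>.\<close>

lemma Gamma_k_form:
 fixes G :: "real^'d^'d"
 assumes sym: "transpose G = G" and y: "total y = 0"
 shows "y \<bullet> (Gamma_k lam G k *v y) = scale_by lam y \<bullet> (G *v y) - weighted lam y * (G *v y)$k"
proof -
 let ?M = "%i j. G$i$j + G$k$k - G$i$k - G$j$k"
 have symG: "G$i$j = G$j$i" for i j by (metis sym transpose_def vec_lambda_beta)
 have "y \<bullet> (Gamma_k lam G k *v y) = (\<Sum>i\<in>UNIV. \<Sum>j\<in>UNIV. y$i * ((lam i + lam j) / 2 * ?M i j * y$j))"
  by (simp add: Gamma_k_def inner_vec_def matrix_vector_mult_def sum_distrib_left)
 \<comment> \<open>The kernel \<open>?M\<close> is symmetric in i and j, so both halves of the mean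
   of \<open>lam i\<close> and \<open>lam j\<close> contribute equally and \<open>lam i\<close>
   alone may be kept.\<close>
 also have "... = (\<Sum>i\<in>UNIV. \<Sum>j\<in>UNIV. (lam i * y$i * ?M i j * y$j) / 2)
   + (\<Sum>i\<in>UNIV. \<Sum>j\<in>UNIV. (lam j * y$j * ?M i j * y$i) / 2)"
  unfolding sum.distrib[symmetric] by (intro sum.cong refl) (simp add: field_simps)
 also have "(\<Sum>i\<in>UNIV. \<Sum>j\<in>UNIV. (lam j * y$j * ?M i j * y$i) / 2)
   = (\<Sum>i\<in>UNIV. \<Sum>j\<in>UNIV. (lam i * y$i * ?M i j * y$j) / 2)"
  by (subst sum.swap) (intro sum.cong refl, simp add: symG algebra_simps)
 also have "(\<Sum>i\<in>UNIV. \<Sum>j\<in>UNIV. (lam i * y$i * ?M i j * y$j) / 2)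
   + (\<Sum>i\<in>UNIV. \<Sum>j\<in>UNIV. (lam i * y$i * ?M i j * y$j) / 2)
   = (\<Sum>i\<in>UNIV. \<Sum>j\<in>UNIV. lam i * y$i * ?M i j * y$j)"
  unfolding sum.distrib[symmetric] by (intro sum.cong refl) simp
 also have "... = (\<Sum>i\<in>UNIV. lam i * y$i * (\<Sum>j\<in>UNIV. ?M i j * y$j))"
  by (simp add: sum_distrib_left mult.assoc)
 also have "... = (\<Sum>i\<in>UNIV. lam i * y$i * ((G *v y)$i - (G *v y)$k))"
 proof (intro sum.cong refl)
  fix i :: 'd
  \<comment> \<open>The terms of \<open>?M\<close> that do not depend on j are multiplied by
    \<open>total y\<close> and drop out.\<close>
  have "(\<Sum>j\<in>UNIV. ?M i j * y$j) = (\<Sum>j\<in>UNIV. G$i$j * y$j) + (G$k$k - G$i$k) * total y - (\<Sum>j\<in>UNIV. G$k$j * y$j)"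
  proof -
   have "?M i j * y$j = G$i$j * y$j + (G$k$k - G$i$k) * y$j - G$k$j * y$j" for j
    unfolding symG[of k j] by (simp add: left_diff_distrib distrib_right)
   then show ?thesis by (simp add: total_def sum.distrib sum_subtractf sum_distrib_left)
  qed
  then show "lam i * y$i * (\<Sum>j\<in>UNIV. ?M i j * y$j) = lam i * y$i * ((G *v y)$i - (G *v y)$k)"
   by (simp add: y matrix_vector_mult_def)
 qed
 also have "... = scale_by lam y \<bullet> (G *v y) - weighted lam y * (G *v y)$k"
  by (simp add: inner_vec_def weighted_def sum_distrib_right right_diff_distrib sum_subtractf)
 finally show ?thesis .
qed

text \<open>Row and column k of \<open>Gamma_k lam G k\<close> vanish, so its form does not see the
  coordinate y_k. Deleting that coordinate maps the hyperplane of zero total injectively into the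
  subspace used in Condition (C).\<close>

lemma Gamma_k_pos_def:
 fixes G :: "real^'d^'d"
 assumes sym: "transpose G = G" and pd: "pos_def_on {y. y$k = 0} (Gamma_k lam G k)"
 shows "pos_def_on {y. total y = 0} (Gamma_k lam G k)"
 unfolding pos_def_on_def
proof (intro ballI impI)
 fix y :: "real^'d" assume y: "y \<in> {y. total y = 0}" "y ~= 0"
 have symG: "G$i$j = G$j$i" for i j by (metis sym transpose_def vec_lambda_beta)
 define z where "z = y - axis k (y$k)"
 have zk: "z$i = (if i = k then 0 else y$i)" for i by (simp add: z_def axis_def)
 have "z ~= 0"
 proof
  assume "z = 0"
  then have y0: "y$i = 0" if "i ~= k" for i using zk[of i] that by simp
  have "total y = y$k" unfolding total_def
   by (subst sum.remove[of _ k]) (simp_all add: y0)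
  then have "y$i = 0" for i using y y0 by (cases "i = k") auto
  then show False using y(2) by (simp add: vec_eq_iff)
 qed
 then have "0 < z \<bullet> (Gamma_k lam G k *v z)"
  using pd zk[of k] unfolding pos_def_on_def by auto
 also have "z \<bullet> (Gamma_k lam G k *v z) = y \<bullet> (Gamma_k lam G k *v y)"
 proof -
  have "z$i * (Gamma_k lam G k $ i $ j * z$j) = y$i * (Gamma_k lam G k $ i $ j * y$j)" for i j
   by (cases "i = k"; cases "j = k") (simp_all add: zk Gamma_k_def symG)
  then show ?thesis unfolding inner_vec_def matrix_vector_mult_def vec_lambda_beta sum_distrib_left inner_real_def
   by (intro sum.cong refl)
 qed
 finally show "0 < y \<bullet> (Gamma_k lam G k *v y)" .
qed

text \<open>The difference of two values of the flux is expressed through the quotients below at two different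
 points. This replaces the mean value theorem and needs no differentiability at the boundary.\<close>

definition quot :: "('d::finite => real) => real^'d => real" where
 "quot lam \<rho> = total \<rho> / weighted lam \<rho>"

definition wgt :: "('d::finite => real) => real^'d => real^'d" where
 "wgt lam \<rho> = (1 / weighted lam \<rho>) *\<^sub>R scale_by lam \<rho>"

text \<open>For \<open>u = quot lam x\<close> and \<open>w = wgt lam x\<close> this is the
  derivative of \<open>flux lam\<close> at x in direction y. With u and w left independent, the same
  expression also represents finite differences of the flux.\<close>

definition dflux :: "('d::finite => real) => real => real^'d => real^'d => real^'d" where
 "dflux lam u w y = u *\<^sub>R (scale_by lam y - weighted lam y *\<^sub>R w) + total y *\<^sub>R w"

lemma dflux_simps:
 "dflux lam u w (x + y) = dflux lam u w x + dflux lam u w y"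
 "dflux lam u w (x - y) = dflux lam u w x - dflux lam u w y"
 "dflux lam u w (c *\<^sub>R x) = c *\<^sub>R dflux lam u w x"
 by (simp_all add: dflux_def algebra_simps)

lemma total_dflux: "total w = 1 ==> total (dflux lam u w y) = total y"
 by (simp add: dflux_def)

section \<open>Bounds and difference formulas for the flux\<close>

locale rates =
  fixes lam :: "'d::finite => real"
 assumes lam_pos: "!!i. lam i > 0"
begin

lemma lam_nonneg: "0 <= lam i"
 using lam_pos[of i] by simp

definition "lmax = (MAX i. lam i)"
definition "lmin = (MIN i. lam i)"

lemma lam_bounds: "lmin <= lam i" "lam i <= lmax" "0 < lmin" "0 < lmax"
proof -
 show 1: "lmin <= lam i" "lam i <= lmax" for i by (simp_all add: lmin_def lmax_def)
 show "0 < lmin" unfolding lmin_def using lam_pos by (subst Min_gr_iff) auto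
 then show "0 < lmax" using 1[of undefined] by linarith
qed

lemma weighted_bounds:
 assumes "x \<in> nonneg" shows "lmin * total x <= weighted lam x" "weighted lam x <= lmax * total x"
 using assms lam_bounds unfolding total_def weighted_def sum_distrib_left nonneg_def
 by (auto intro!: sum_mono mult_right_mono)

lemma weighted_pos: "x \<in> nonneg ==> x ~= 0 ==> 0 < weighted lam x"
 using weighted_bounds(1)[of x] total_pos[of x] lam_bounds(3)
 by (meson less_le_trans mult_pos_pos)

lemma quot_bounds:
 assumes "x \<in> nonneg" "x ~= 0" shows "1 / lmax <= quot lam x" "quot lam x <= 1 / lmin"
 using weighted_bounds[OF assms(1)] weighted_pos[OF assms] lam_bounds(3,4)
 by (simp_all add: quot_def field_simps)

lemma wgt_nonneg: "x \<in> nonneg ==> wgt lam x \<in> nonneg"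
proof (cases "x = 0")
 case False
 assume x: "x \<in> nonneg"
 then show ?thesis
  using weighted_pos[OF x False] lam_nonneg
  by (auto simp: wgt_def nonneg_def intro!: mult_nonneg_nonneg divide_nonneg_pos)
qed (simp add: wgt_def)

lemma total_wgt: "x \<in> nonneg ==> x ~= 0 ==> total (wgt lam x) = 1"
 using weighted_pos[of x] by (simp add: wgt_def)

text \<open>The product rule for differences, with the flux read as quotient times scaled vector:
  the quotient is evaluated at a, the weights at b, and no remainder is left.\<close>

lemma flux_diff_exact:
 assumes "a \<in> nonneg" "b \<in> nonneg" "a ~= 0" "b ~= 0"
 shows "flux lam a - flux lam b = dflux lam (quot lam a) (wgt lam b) (a - b)"
proof -
 have nz: "weighted lam a ~= 0" "weighted lam b ~= 0"
  using weighted_pos assms by (metis less_irrefl)+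
 have eq: "S / W * p - S' / W' * q = S / W * ((p - q) - (W - W') * (1 / W' * q)) + (S - S') * (1 / W' * q)"
  if "W ~= 0" "W' ~= 0" for S W S' W' p q :: real
  using that by (simp add: field_simps)
 show ?thesis
  unfolding flux_def dflux_def quot_def wgt_def vec_eq_iff
  using eq[OF nz, of "total a" _ "total b"] by simp
qed

text \<open>The origin belongs to the orthant but has no meaningful quotient or weights. If one
  point is the origin, homogeneity lets both coefficients be taken at the other point; if both are,
  any pair within the bounds will do.\<close>

lemma flux_diff:
 assumes "a \<in> nonneg" "b \<in> nonneg"
 obtains u w where "1 / lmax <= u" "u <= 1 / lmin" "w \<in> nonneg" "total w = 1"
  "flux lam a - flux lam b = dflux lam u w (a - b)"
proof -
 have le: "1 / lmax <= 1 / lmin"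
  using lam_bounds by (metis frac_le le_less_trans less_eq_real_def order_trans zero_le_one)
 consider "a ~= 0" "b ~= 0" | "a = 0" "b ~= 0" | "a ~= 0" "b = 0" | "a = 0" "b = 0" by blast
 then show thesis
 proof cases
  case 1
  then show ?thesis
   using that[OF quot_bounds[OF assms(1)] wgt_nonneg[OF assms(2)] total_wgt[OF assms(2)]
     flux_diff_exact[OF assms]] by blast
 next
  case 2
  have "weighted lam b ~= 0" using weighted_pos[OF assms(2)] 2 by simp
  then have "flux lam a - flux lam b = dflux lam (quot lam b) (wgt lam b) (a - b)"
   unfolding 2(1) by (simp add: dflux_def wgt_def flux_def)
  then show ?thesis
   using that quot_bounds[OF assms(2)] wgt_nonneg[OF assms(2)] total_wgt[OF assms(2)] 2 by blast
 next
  case 3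
  have "weighted lam a ~= 0" using weighted_pos[OF assms(1)] 3 by simp
  then have "flux lam a - flux lam b = dflux lam (quot lam a) (wgt lam a) (a - b)"
   unfolding 3(2) by (simp add: dflux_def wgt_def flux_def)
  then show ?thesis
   using that quot_bounds[OF assms(1)] wgt_nonneg[OF assms(1)] total_wgt[OF assms(1)] 3 by blast
 next
  case 4
  define w where "w = (axis undefined 1 :: real^'d)"
  have "w \<in> nonneg" "total w = 1"
   by (auto simp: w_def nonneg_def total_def axis_def)
  then show ?thesis using that[of "1 / lmax" w] le 4 by (simp add: dflux_def)
 qed
qed

lemma flux_nonneg: "x \<in> nonneg ==> flux lam x \<in> nonneg"
proof (cases "x = 0")
 case False
 assume x: "x \<in> nonneg"
 then show ?thesis
  using weighted_pos[OF x False] total_nonneg[OF x] lam_nonneg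
  by (auto simp: flux_def nonneg_def intro!: mult_nonneg_nonneg divide_nonneg_pos)
qed simp

lemma total_flux: "x \<in> nonneg ==> total (flux lam x) = total x"
 using weighted_pos[of x] by (cases "x = 0") (simp_all add: flux_def)

lemma flux_component_le:
 assumes "x \<in> nonneg" shows "flux lam x $ i <= (lmax / lmin) * x$i"
proof (cases "x = 0")
 case False
 have "flux lam x $ i = quot lam x * (lam i * x$i)" by (simp add: flux_def quot_def)
 also have "... <= 1 / lmin * (lmax * x$i)"
  using quot_bounds[OF assms False] lam_bounds lam_nonneg assms
  by (intro mult_mono) (auto simp: nonneg_def intro!: mult_right_mono mult_nonneg_nonneg)
 finally show ?thesis by (simp add: field_simps)
qed simp

lemma norm_scale_by_le: "norm (scale_by lam y) <= lmax * norm y"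
proof -
 have "norm (scale_by lam y) <= norm (lmax *\<^sub>R y)"
  using lam_bounds lam_nonneg by (intro norm_le_componentwise_cart) (auto simp: abs_mult intro!: mult_right_mono)
 then show ?thesis using lam_bounds(4) by simp
qed

lemma abs_weighted_le: "\<bar>weighted lam y\<bar> <= real CARD('d) * (lmax * norm y)"
 using abs_total_le[of "scale_by lam y"] norm_scale_by_le[of y]
 by (simp add: order_trans[OF _ mult_left_mono])

text \<open>The summands bound the three terms of \<open>dflux\<close>: u is at most
  \<open>1 / lmin\<close>, a weight vector has norm at most one, and a total is at most the
  dimension times the norm.\<close>

definition "Lip = 1 / lmin * (lmax + real CARD('d) * lmax) + real CARD('d)"

lemma Lip_pos: "Lip > 0"
 using lam_bounds unfolding Lip_def by (simp add: add_pos_nonneg)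

lemma norm_dflux_le:
 assumes u: "1 / lmax <= u" "u <= 1 / lmin" and w: "w \<in> nonneg" "total w = 1"
 shows "norm (dflux lam u w y) <= Lip * norm y"
proof -
 have w1: "norm w <= 1" using norm_le_total[OF w(1)] w(2) by simp
 have u0: "0 <= u" using u(1) lam_bounds(4) by (meson divide_nonneg_pos le_less order_trans zero_le_one)
 have sc: "norm (r *\<^sub>R w) <= R" if "\<bar>r\<bar> <= R" for r R
 proof -
  have "\<bar>r\<bar> * norm w <= R * 1" using that w1 by (intro mult_mono) auto
  then show ?thesis by simp
 qed
 have "norm (scale_by lam y - weighted lam y *\<^sub>R w) <= lmax * norm y + real CARD('d) * (lmax * norm y)"
  by (rule order_trans[OF norm_triangle_ineq4])
   (intro add_mono norm_scale_by_le sc abs_weighted_le)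
 then have "u * norm (scale_by lam y - weighted lam y *\<^sub>R w) <= 1 / lmin * (lmax * norm y + real CARD('d) * (lmax * norm y))"
  using u u0 lam_bounds(3) by (intro mult_mono) auto
 then have "norm (u *\<^sub>R (scale_by lam y - weighted lam y *\<^sub>R w)) <= 1 / lmin * (lmax * norm y + real CARD('d) * (lmax * norm y))"
  using u0 by simp
 moreover have "norm (total y *\<^sub>R w) <= real CARD('d) * norm y"
  by (rule sc[OF abs_total_le])
 ultimately have "norm (dflux lam u w y) <= 1 / lmin * (lmax * norm y + real CARD('d) * (lmax * norm y)) + real CARD('d) * norm y"
  unfolding dflux_def by (intro order_trans[OF norm_triangle_ineq] add_mono)
 also have "... = Lip * norm y" by (simp add: Lip_def algebra_simps add_divide_distrib)
 finally show ?thesis .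
qed

lemma flux_lipschitz:
 assumes "a \<in> nonneg" "b \<in> nonneg"
 shows "norm (flux lam a - flux lam b) <= Lip * norm (a - b)"
proof -
 obtain u w where "1 / lmax <= u" "u <= 1 / lmin" "w \<in> nonneg" "total w = 1"
  "flux lam a - flux lam b = dflux lam u w (a - b)"
  using flux_diff[OF assms] by blast
 then show ?thesis using norm_dflux_le by metis
qed

text \<open>This connects the problem with the flux: twice \<open>mat_A\<close> is the derivative of
  \<open>flux lam\<close>. The argument must be nonzero, so the weak form can be written with
  \<open>mat_A\<close> only after the total density is known to be positive.\<close>

lemma mat_A_eq:
 assumes x: "x \<in> nonneg" "x ~= 0"
 shows "2 *\<^sub>R (mat_A lam x *v y) = dflux lam (quot lam x) (wgt lam x) y"
proof -
 let ?W = "weighted lam x" and ?S = "total x"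
 have W: "?W > 0" by (rule weighted_pos[OF x])
 have rem: "(\<Sum>l\<in>UNIV - {i}. f l) = (\<Sum>l\<in>UNIV. f l) - f i" for f :: "'d => real" and i
  by (simp add: sum_diff1)
 have s1: "(\<Sum>l\<in>UNIV. (lam l - c) * x$l) = ?W - c * ?S" for c
  by (simp add: weighted_def total_def left_diff_distrib sum_subtractf sum_distrib_left)
 have s2: "(\<Sum>l\<in>UNIV. (c - lam l) * x$l) = c * ?S - ?W" for c
  by (simp add: weighted_def total_def left_diff_distrib sum_subtractf sum_distrib_left)
 have W0: "(\<Sum>l\<in>UNIV. lam l * x$l) = ?W" by (simp add: weighted_def)
 \<comment> \<open>Adding the identity turns the two cases of \<open>mat_M\<close> into one formula:
   a diagonal matrix plus a matrix of rank one.\<close>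
 have M: "(mat 1 + mat_M lam x)$i$j = (if i = j then lam i * ?S / ?W else 0) + lam i * x$i * (?W - lam j * ?S) / ?W\<^sup>2" for i j
 proof (cases "i = j")
  case True
  have "(mat 1 + mat_M lam x)$i$j = 1 + (?W - lam i * x$i) * (lam i * ?S - ?W) / ?W\<^sup>2"
   using True by (simp add: mat_def mat_M_def rem s2 W0)
  also have "... = lam i * ?S / ?W + lam i * x$i * (?W - lam i * ?S) / ?W\<^sup>2"
   using W by (simp add: field_simps power2_eq_square)
  finally show ?thesis using True by simp
 next
  case False
  then show ?thesis by (simp add: mat_def mat_M_def rem s1 W0)
 qed
 have "2 *\<^sub>R (mat_A lam x *v y) = (mat 1 + mat_M lam x) *v y"
  by (simp add: mat_A_def scaleR_matrix_vector_assoc[symmetric])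
 also have "... = dflux lam (quot lam x) (wgt lam x) y"
 proof (subst vec_eq_iff, intro allI)
  fix i
  have "((mat 1 + mat_M lam x) *v y)$i
   = (\<Sum>j\<in>UNIV. (if i = j then lam i * ?S / ?W * y$j else 0) + lam i * x$i / ?W * y$j - lam i * x$i * ?S / ?W\<^sup>2 * (lam j * y$j))"
  proof -
   have "((if i = j then p else 0) + q * (W - l * S) / W\<^sup>2) * z
    = (if i = j then p * z else 0) + q / W * z - q * S / W\<^sup>2 * (l * z)" if "W > 0" for i j :: 'd and p q W l S z :: real
    using that by (simp add: field_simps power2_eq_square)
   then show ?thesis
    unfolding matrix_vector_mult_def vec_lambda_beta M using W by (intro sum.cong refl)
  qed
  also have "... = lam i * ?S / ?W * y$i + lam i * x$i / ?W * total y - lam i * x$i * ?S / ?W\<^sup>2 * weighted lam y"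
   unfolding total_def[of y] weighted_def[of lam y] by (simp add: sum.distrib sum_subtractf sum_distrib_left)
  also have "... = dflux lam (quot lam x) (wgt lam x) y $ i"
   using W by (simp add: dflux_def quot_def wgt_def field_simps power2_eq_square)
  finally show "((mat 1 + mat_M lam x) *v y)$i = dflux lam (quot lam x) (wgt lam x) y $ i" .
 qed
 finally show ?thesis .
qed

end

text \<open>The lattice estimates use these properties only, so they are proved for an abstract F.
  One constant L serves as Lipschitz constant and as componentwise bound; the latter gives
  positivity of the scheme. Condition (C) stands behind \<open>G_lower\<close> and
  \<open>F_mono\<close>, and homogeneity \<open>F_scaleR\<close> lets one scheme serve all mesh
  sizes.\<close>

locale monotone_flux =
 fixes F :: "real^'d => real^'d" and G :: "real^'d^'d" and L c b M :: real
 assumes consts_pos: "L > 0" "c > 0" "b > 0" "M > 0"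
  and F_0 [simp]: "F 0 = 0"
  and F_scaleR: "!!s x. F (s *\<^sub>R x) = s *\<^sub>R F x"
  and F_nonneg: "!!x. x \<in> nonneg ==> F x \<in> nonneg"
  and total_F: "!!x. x \<in> nonneg ==> total (F x) = total x"
  and F_component_le: "!!x i. x \<in> nonneg ==> F x $ i <= L * x$i"
  and F_lipschitz: "!!x y. x \<in> nonneg ==> y \<in> nonneg ==> norm (F x - F y) <= L * norm (x - y)"
  and G_sym: "!!x y. x \<bullet> (G *v y) = y \<bullet> (G *v x)"
  and G_lower: "!!x. b * (norm x)\<^sup>2 <= x \<bullet> (G *v x)"
  and G_upper: "!!x. norm (G *v x) <= M * norm x"
  and F_mono: "!!x y. x \<in> nonneg ==> y \<in> nonneg ==>
   c * (norm (x - y))\<^sup>2 <= (F x - F y) \<bullet> (G *v (x - y))"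

text \<open>Adding a large multiple of the all-ones matrix to \<open>\<Gamma>\<close> makes the form coercive also
 in the directions that change the total mass, because the flux preserves the total mass.\<close>

lemma (in rates) flux_monotone:
 assumes "condition_C lam"
 obtains G L c b M where "monotone_flux (flux lam) G L c b M"
proof -
 obtain G0 :: "real^'d^'d" where sym0: "transpose G0 = G0" and pd0: "pos_def_on UNIV G0"
  and pdk: "!!k. pos_def_on {y. y$k = 0} (Gamma_k lam G0 k)"
  using assms unfolding condition_C_def by blast
 obtain b where b: "b > 0" "!!y. b * (norm y)\<^sup>2 <= y \<bullet> (G0 *v y)"
  using pos_def_on_bound[OF _ _ pd0] by auto
 have clV: "closed {y::real^'d. total y = 0}"
  unfolding total_def by (intro closed_Collect_eq continuous_intros)
 have "\<exists>c>0. \<forall>y::real^'d. total y = 0 --> c * (norm y)\<^sup>2 <= y \<bullet> (Gamma_k lam G0 k *v y)" for k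
  using pos_def_on_bound[OF clV _ Gamma_k_pos_def[OF sym0 pdk[of k]]] by auto
 then obtain ck where ck: "!!k. ck k > 0"
  "!!k y. total y = 0 ==> ck k * (norm y)\<^sup>2 <= y \<bullet> (Gamma_k lam G0 k *v y)"
  by metis
 define c0 where "c0 = (MIN k. ck k)"
 have c0: "c0 > 0" unfolding c0_def using ck(1) by (subst Min_gr_iff) auto
 have c0_le: "c0 <= ck k" for k by (simp add: c0_def)
 obtain M where M: "M > 0" "!!x. norm (G0 *v x) <= norm x * M"
  using bounded_linear.pos_bounded[OF matrix_vector_mul_bounded_linear[of G0]] by blast
 \<comment> \<open>\<alpha> is the coercivity of the form of \<open>G0\<close> on the hyperplane of
   zero total and \<beta> bounds every cross term. The summands of \<kappa> pay for one loss each: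
   \<beta> for the diagonal term of the mass direction, 2 \<beta>^2 / \<alpha> for the cross terms
   after Young's inequality, and \<alpha> so that a multiple of the squared total is left
   over.\<close>
 define \<alpha> where "\<alpha> = c0 / lmax"
 define \<beta> where "\<beta> = Lip * M"
 define \<kappa> where "\<kappa> = \<beta> + 2 * \<beta>\<^sup>2 / \<alpha> + \<alpha>"
 have pos: "\<alpha> > 0" "\<beta> > 0" using c0 lam_bounds(4) M(1) Lip_pos by (simp_all add: \<alpha>_def \<beta>_def)
 then have \<kappa>: "\<kappa> > 0" by (simp add: \<kappa>_def add_pos_nonneg)
 define G where "G = (\<chi> i j. G0$i$j + \<kappa> :: real^'d^'d)"
 define ones where "ones = (\<chi> i. 1 :: real^'d)"
 have inner_ones: "x \<bullet> ones = total x" for x by (simp add: inner_vec_def ones_def total_def)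
 have Gv: "G *v y = G0 *v y + (\<kappa> * total y) *\<^sub>R ones" for y
  by (simp add: G_def ones_def vec_eq_iff matrix_vector_mult_def distrib_right sum.distrib
    total_def sum_distrib_left)
 have Gform: "x \<bullet> (G *v y) = x \<bullet> (G0 *v y) + \<kappa> * total y * total x" for x y
  by (simp add: Gv inner_add_right inner_ones)
 define e where "e = (axis undefined 1 :: real^'d)"
 have e: "total e = 1" "norm e = 1" by (simp_all add: e_def total_def axis_def norm_axis_1[unfolded axis_def])
 have mono: "\<alpha> / 4 * (norm (x - y))\<^sup>2 <= (flux lam x - flux lam y) \<bullet> (G *v (x - y))"
  if xy: "x \<in> nonneg" "y \<in> nonneg" for x y
 proof -
  obtain u w where u: "1 / lmax <= u" "u <= 1 / lmin" and w: "w \<in> nonneg" "total w = 1"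
   and eq: "flux lam x - flux lam y = dflux lam u w (x - y)"
   using flux_diff[OF xy] by blast
  define z where "z = x - y"
  define s where "s = total z"
  \<comment> \<open>Splitting off the total along a fixed unit vector e of total one leaves a part
    in the hyperplane where the vertex forms are coercive.\<close>
  define z0 where "z0 = z - s *\<^sub>R e"
  have tz0: "total z0 = 0" by (simp add: z0_def s_def e)
  have z: "z = z0 + s *\<^sub>R e" by (simp add: z0_def)
  let ?D = "dflux lam u w"
  have wk: "w$k \<ge> 0" for k using w(1) by (simp add: nonneg_def)
  \<comment> \<open>Because the weights add up to one, the form at w is u times the w-average of the
    vertex forms.\<close>
  have "?D z0 \<bullet> (G0 *v z0) = u * (\<Sum>k\<in>UNIV. w$k * (scale_by lam z0 \<bullet> (G0 *v z0) - weighted lam z0 * (G0 *v z0)$k))"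
  proof -
   have "(\<Sum>k\<in>UNIV. w$k * (A - W * g$k)) = total w * A - W * (w \<bullet> g)" for A W and g :: "real^'d"
    by (simp add: right_diff_distrib sum_subtractf total_def sum_distrib_right inner_vec_def sum_distrib_left mult.left_commute)
   then show ?thesis by (simp add: dflux_def tz0 w(2) inner_diff_left)
  qed
  also have "... = u * (\<Sum>k\<in>UNIV. w$k * (z0 \<bullet> (Gamma_k lam G0 k *v z0)))"
   by (simp add: Gamma_k_form[OF sym0 tz0])
  also have "... \<ge> 1 / lmax * (\<Sum>k\<in>UNIV. w$k * (c0 * (norm z0)\<^sup>2))"
   (is "?l <= ?r")
  proof (intro mult_mono sum_mono mult_left_mono)
   show "c0 * (norm z0)\<^sup>2 <= z0 \<bullet> (Gamma_k lam G0 k *v z0)" for k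
    using ck(2)[OF tz0, of k] c0_le[of k] by (meson mult_right_mono order_trans zero_le_power2)
   show "0 <= u" using u(1) lam_bounds(4) order_trans[of 0 "1 / lmax" u] by simp
  qed (use u wk c0 in \<open>auto intro!: sum_nonneg\<close>)
  also have "1 / lmax * (\<Sum>k\<in>UNIV. w$k * (c0 * (norm z0)\<^sup>2)) = \<alpha> * (norm z0)\<^sup>2"
   using w(2) by (simp add: sum_distrib_right[symmetric] total_def \<alpha>_def)
  finally have t0: "\<alpha> * (norm z0)\<^sup>2 <= ?D z0 \<bullet> (G0 *v z0)" .
  have cs: "\<bar>?D p \<bullet> (G0 *v q)\<bar> <= \<beta> * (norm p * norm q)" for p q
  proof -
   have "\<bar>?D p \<bullet> (G0 *v q)\<bar> <= norm (?D p) * norm (G0 *v q)" by (rule Cauchy_Schwarz_ineq2)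
   also have "... <= (Lip * norm p) * (norm q * M)"
    using M(1) Lip_pos by (intro mult_mono M norm_dflux_le[OF u w]) auto
   finally show ?thesis by (simp add: \<beta>_def mult_ac)
  qed
  have "?D z \<bullet> (G0 *v z) = ?D z0 \<bullet> (G0 *v z0) + s * (?D z0 \<bullet> (G0 *v e)) + s * (?D e \<bullet> (G0 *v z0)) + s\<^sup>2 * (?D e \<bullet> (G0 *v e))"
   unfolding z by (simp add: dflux_simps matrix_vector_right_distrib matrix_vector_mult_scaleR inner_add_left inner_add_right
     power2_eq_square algebra_simps)
  moreover have "- (\<bar>s\<bar> * (\<beta> * norm z0)) <= s * (?D z0 \<bullet> (G0 *v e))"
   using mult_left_mono[OF cs[of z0 e], of "\<bar>s\<bar>"] e(2) abs_le_D2[of "s * (?D z0 \<bullet> (G0 *v e))" "\<bar>s\<bar> * (\<beta> * norm z0)"]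
   by (simp add: abs_mult)
  moreover have "- (\<bar>s\<bar> * (\<beta> * norm z0)) <= s * (?D e \<bullet> (G0 *v z0))"
   using mult_left_mono[OF cs[of e z0], of "\<bar>s\<bar>"] e(2) abs_le_D2[of "s * (?D e \<bullet> (G0 *v z0))" "\<bar>s\<bar> * (\<beta> * norm z0)"]
   by (simp add: abs_mult)
  moreover have "- (s\<^sup>2 * \<beta>) <= s\<^sup>2 * (?D e \<bullet> (G0 *v e))"
   using mult_left_mono[of "- \<beta>" "?D e \<bullet> (G0 *v e)" "s\<^sup>2"] cs[of e e] e(2) by (simp add: abs_le_iff)
  moreover have "2 * (\<bar>s\<bar> * (\<beta> * norm z0)) <= \<alpha> / 2 * (norm z0)\<^sup>2 + 2 * \<beta>\<^sup>2 / \<alpha> * s\<^sup>2"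
  proof -
   have "0 <= (\<alpha> * norm z0 - 2 * \<beta> * \<bar>s\<bar>)\<^sup>2" by simp
   also have "... = 2 * \<alpha> * (\<alpha> / 2 * (norm z0)\<^sup>2 + 2 * \<beta>\<^sup>2 / \<alpha> * s\<^sup>2 - 2 * (\<bar>s\<bar> * (\<beta> * norm z0)))"
    using pos by (simp add: power2_eq_square field_simps)
   finally show ?thesis using pos by (simp add: zero_le_mult_iff)
  qed
  moreover have "(norm z)\<^sup>2 <= 2 * (norm z0)\<^sup>2 + 2 * s\<^sup>2"
  proof -
   have "norm z <= norm z0 + \<bar>s\<bar>" unfolding z using norm_triangle_ineq[of z0 "s *\<^sub>R e"] e(2) by simp
   then have "(norm z)\<^sup>2 <= (norm z0 + \<bar>s\<bar>)\<^sup>2" by (intro power_mono) auto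
   also have "... <= 2 * (norm z0)\<^sup>2 + 2 * s\<^sup>2"
    using sum_squares_bound[of "norm z0" "\<bar>s\<bar>"] by (simp add: power2_sum)
   finally show ?thesis .
  qed
  then have "\<alpha> / 4 * (norm z)\<^sup>2 <= \<alpha> / 4 * (2 * (norm z0)\<^sup>2 + 2 * s\<^sup>2)" using pos by (intro mult_left_mono) auto
  \<comment> \<open>\<open>dflux\<close> preserves the total, so the added all-ones part contributes
    exactly \<kappa> s^2 and no cross term.\<close>
  moreover have "?D z \<bullet> (G *v z) = ?D z \<bullet> (G0 *v z) + \<kappa> * s\<^sup>2"
   by (simp add: Gform total_dflux[OF w(2)] s_def power2_eq_square)
  moreover have "\<kappa> * s\<^sup>2 = \<beta> * s\<^sup>2 + 2 * \<beta>\<^sup>2 / \<alpha> * s\<^sup>2 + \<alpha> * s\<^sup>2" by (simp add: \<kappa>_def distrib_right)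
  moreover have "0 <= \<alpha> * s\<^sup>2" using pos by simp
  ultimately have "\<alpha> / 4 * (norm z)\<^sup>2 <= ?D z \<bullet> (G *v z)" using t0 by (simp add: algebra_simps)
  then show ?thesis by (simp add: eq z_def)
 qed
 obtain M' where M': "M' > 0" "!!x. norm (G *v x) <= norm x * M'"
  using bounded_linear.pos_bounded[OF matrix_vector_mul_bounded_linear[of G]] by blast
 have "monotone_flux (flux lam) G (Lip + lmax / lmin) (\<alpha> / 4) b M'"
 proof
  show "0 < Lip + lmax / lmin" "0 < \<alpha> / 4" "0 < b" "0 < M'"
   using Lip_pos lam_bounds(3,4) pos b(1) M'(1) by (simp_all add: add_pos_pos)
  show "norm (flux lam x - flux lam y) <= (Lip + lmax / lmin) * norm (x - y)"
   if "x \<in> nonneg" "y \<in> nonneg" for x y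
  proof -
   have "Lip * norm (x - y) <= (Lip + lmax / lmin) * norm (x - y)"
    using lam_bounds(3,4) by (intro mult_right_mono) auto
   then show ?thesis using flux_lipschitz[OF that] by linarith
  qed
  show "flux lam x $ i <= (Lip + lmax / lmin) * x $ i" if "x \<in> nonneg" for x i
  proof -
   have "lmax / lmin * x$i <= (Lip + lmax / lmin) * x$i"
    using Lip_pos that by (intro mult_right_mono) (auto simp: nonneg_def)
   then show ?thesis using flux_component_le[OF that, of i] by linarith
  qed
  show "x \<bullet> (G *v y) = y \<bullet> (G *v x)" for x y
   using symmetric_inner_commute[OF sym0, of x y] by (simp add: Gform)
  show "b * (norm x)\<^sup>2 <= x \<bullet> (G *v x)" for x
  proof -
   have "0 <= \<kappa> * (total x * total x)" using \<kappa> by simp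
   then show ?thesis using b(2)[of x] by (simp add: Gform)
  qed
  show "norm (G *v x) <= M' * norm x" for x using M'(2)[of x] by (simp add: mult.commute)
 qed (use mono flux_nonneg total_flux in \<open>auto simp: flux_scaleR\<close>)
 then show thesis by (rule that)
qed

section \<open>Finitely supported functions on the integers\<close>

definition fsupp :: "(int => 'a::zero) => bool" where
 "fsupp f \<longleftrightarrow> finite {j. f j ~= 0}"

text \<open>Summation over all integers by \<open>infsum\<close> makes shift invariance and
  homogeneity hold without support conditions; finite support is needed only for additivity and
  comparison.\<close>

abbreviation zs :: "(int => real) => real" where
 "zs f \<equiv> infsum f UNIV"

definition nsq :: "(int => 'a::real_normed_vector) => real" where
 "nsq u = zs (%j. (norm (u j))\<^sup>2)"

lemma zs_eq_sum:
 assumes "finite A" "!!j. j \<notin> A ==> f j = 0" shows "zs f = sum f A"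
proof -
 have "zs f = infsum f A" using assms(2) by (intro infsum_cong_neutral) auto
 then show ?thesis using assms(1) by simp
qed

lemma fsupp_subset: "fsupp g ==> (!!j. g j = 0 ==> f j = 0) ==> fsupp f"
 unfolding fsupp_def by (rule finite_subset[rotated]) auto

lemma fsupp_subset2:
 assumes "fsupp g" "fsupp h" "!!j. g j = 0 ==> h j = 0 ==> f j = 0" shows "fsupp f"
proof -
 have "{j. f j ~= 0} \<subseteq> {j. g j ~= 0} \<union> {j. h j ~= 0}" using assms(3) by blast
 then show ?thesis using assms(1,2) unfolding fsupp_def by (meson finite_UnI finite_subset)
qed

lemma fsupp_0 [simp]: "fsupp (%j. 0)"
 by (simp add: fsupp_def)

lemma fsupp_shift [simp]: "fsupp (%j. f (j + k)) \<longleftrightarrow> fsupp f" for k :: int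
proof -
 have "{j. f (j + k) ~= 0} = (%j. j - k) ` {j. f j ~= 0}"
  by (auto simp: image_iff) (metis add_diff_cancel diff_add_cancel)
 moreover have "inj_on (%j. j - k) A" for A by (simp add: inj_on_def)
 ultimately show ?thesis unfolding fsupp_def by (metis finite_image_iff)
qed

lemma fsupp_shift_minus [simp]: "fsupp (%j. f (j - k)) \<longleftrightarrow> fsupp f" for k :: int
 using fsupp_shift[of f "- k"] by simp

lemma fsupp_add: "fsupp f ==> fsupp g ==> fsupp (%j. f j + g j)" for f g :: "int => 'a::monoid_add"
 by (erule (1) fsupp_subset2) simp

lemma fsupp_diff: "fsupp f ==> fsupp g ==> fsupp (%j. f j - g j)" for f g :: "int => 'a::group_add"
 by (erule (1) fsupp_subset2) simp

lemma fsupp_sum: "(!!i. i \<in> I ==> fsupp (f i)) ==> fsupp (%j. \<Sum>i\<in>I. f i j)"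
 for f :: "_ => int => 'a::comm_monoid_add"
 by (induction I rule: infinite_finite_induct) (auto intro!: fsupp_add)

lemma fsupp_obtain:
 assumes "fsupp f" obtains A where "finite A" "!!j. j \<notin> A ==> f j = 0"
 using assms unfolding fsupp_def by (metis (mono_tags) mem_Collect_eq)

lemma zs_add: "fsupp f ==> fsupp g ==> zs (%j. f j + g j) = zs f + zs g"
proof -
 assume fg: "fsupp f" "fsupp g"
 let ?A = "{j. f j ~= 0} \<union> {j. g j ~= 0}"
 have A: "finite ?A" using fg by (simp add: fsupp_def)
 show ?thesis
  by (subst (1 2 3) zs_eq_sum[OF A]) (auto simp: sum.distrib)
qed

lemma zs_cmult: "zs (%j. c * f j) = c * zs f"
 by (rule infsum_cmult_right')

lemma zs_diff: "fsupp f ==> fsupp g ==> zs (%j. f j - g j) = zs f - zs g"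
 using zs_add[of f "%j. - 1 * g j"] zs_cmult[of "- 1" g] by (simp add: fsupp_def)

lemma zs_mono:
 assumes "fsupp f" "fsupp g" "!!j. f j <= g j" shows "zs f <= zs g"
proof -
 let ?A = "{j. f j ~= 0} \<union> {j. g j ~= 0}"
 have A: "finite ?A" using assms by (simp add: fsupp_def)
 show ?thesis by (subst (1 2) zs_eq_sum[OF A]) (auto intro!: sum_mono assms(3))
qed

lemma zs_nonneg: "(!!j. 0 <= f j) ==> 0 <= zs f"
 by (rule infsum_nonneg) simp

lemma zs_shift [simp]: "zs (%j. f (j + k)) = zs f" for k :: int
 by (rule infsum_reindex_bij_betw) (rule bij_betw_byWitness[where f' = "%j. j - k"], auto)

lemma zs_shift_minus [simp]: "zs (%j. f (j - k)) = zs f" for k :: int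
 using zs_shift[of f "- k"] by simp

lemma zs_sum: "(!!i. i \<in> I ==> fsupp (f i)) ==> zs (%j. \<Sum>i\<in>I. f i j) = (\<Sum>i\<in>I. zs (f i))"
 by (induction I rule: infinite_finite_induct) (auto simp: zs_add fsupp_sum)

lemma sum_le_zs:
 assumes "finite A" "fsupp f" "!!j. 0 <= f j" shows "sum f A <= zs f"
proof -
 have "finite (A \<union> {j. f j ~= 0})" using assms(1,2) by (simp add: fsupp_def)
 then have "zs f = sum f (A \<union> {j. f j ~= 0})" by (rule zs_eq_sum) auto
 moreover have "sum f A <= sum f (A \<union> {j. f j ~= 0})"
  using assms by (intro sum_mono2) (auto simp: fsupp_def)
 ultimately show ?thesis by simp
qed

lemma fsupp_norm2 [simp]: "fsupp u ==> fsupp (%j. (norm (u j))\<^sup>2)"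
 by (rule fsupp_subset) auto

lemma nsq_nonneg [simp]: "0 <= nsq u"
 unfolding nsq_def by (rule zs_nonneg) simp

lemma nsq_shift [simp]: "nsq (%j. u (j + k)) = nsq u" "nsq (%j. u (j - k)) = nsq u" for k :: int
 unfolding nsq_def using zs_shift[of "%j. (norm (u j))\<^sup>2" k] zs_shift[of "%j. (norm (u j))\<^sup>2" "- k"] by simp_all

lemma norm_sum_power2_le: "(norm (sum f A))\<^sup>2 <= real (card A) * (\<Sum>i\<in>A. (norm (f i))\<^sup>2)"
proof -
 have "(norm (sum f A))\<^sup>2 <= (\<Sum>i\<in>A. 1 * norm (f i))\<^sup>2"
  by (intro power_mono) (auto intro: norm_sum)
 also have "... <= (\<Sum>i\<in>A. 1\<^sup>2) * (\<Sum>i\<in>A. (norm (f i))\<^sup>2)" by (rule Cauchy_Schwarz_ineq_sum)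
 finally show ?thesis by simp
qed

lemma nsq_sum_le:
 assumes "!!i. i \<in> I ==> fsupp (f i)"
 shows "nsq (%j. \<Sum>i\<in>I. f i j) <= real (card I) * (\<Sum>i\<in>I. nsq (f i))"
proof -
 have "nsq (%j. \<Sum>i\<in>I. f i j) <= zs (%j. real (card I) * (\<Sum>i\<in>I. (norm (f i j))\<^sup>2))"
  unfolding nsq_def
 proof (intro zs_mono norm_sum_power2_le)
  show "fsupp (%j. (norm (\<Sum>i\<in>I. f i j))\<^sup>2)" using assms by (intro fsupp_norm2 fsupp_sum)
  have "fsupp (%j. (\<Sum>i\<in>I. (norm (f i j))\<^sup>2))" using assms by (intro fsupp_sum) auto
  then show "fsupp (%j. real (card I) * (\<Sum>i\<in>I. (norm (f i j))\<^sup>2))" by (rule fsupp_subset) simp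
 qed
 also have "... = real (card I) * (\<Sum>i\<in>I. nsq (f i))"
  using assms unfolding nsq_def zs_cmult by (subst zs_sum) auto
 finally show ?thesis .
qed

lemma nsq_diff_le:
 assumes "fsupp f" "fsupp g" shows "nsq (%j. f j - g j) <= 2 * (nsq f + nsq g)"
proof -
 have "nsq (%j. f j - g j) <= zs (%j. 2 * ((norm (f j))\<^sup>2 + (norm (g j))\<^sup>2))"
  unfolding nsq_def
 proof (intro zs_mono)
  show "fsupp (%j. (norm (f j - g j))\<^sup>2)" "fsupp (%j. 2 * ((norm (f j))\<^sup>2 + (norm (g j))\<^sup>2))"
   by (rule fsupp_subset2[OF assms]; simp)+
  fix j
  have "(norm (f j - g j))\<^sup>2 <= (norm (f j) + norm (g j))\<^sup>2" by (intro power_mono norm_triangle_ineq4) simp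
  also have "... <= 2 * ((norm (f j))\<^sup>2 + (norm (g j))\<^sup>2)"
   using sum_squares_bound[of "norm (f j)" "norm (g j)"] by (simp add: power2_sum)
  finally show "(norm (f j - g j))\<^sup>2 <= 2 * ((norm (f j))\<^sup>2 + (norm (g j))\<^sup>2)" .
 qed
 also have "... = 2 * (nsq f + nsq g)"
  unfolding nsq_def zs_cmult using assms by (subst zs_add) auto
 finally show ?thesis .
qed

text \<open>Only f has finite support. The other factor enters through a bound on its finite partial
  sums, because it will come from increments of an arbitrary H1 test function.\<close>

lemma zs_mult_le:
 fixes f g :: "int => real"
 assumes f: "fsupp f" and S: "!!A. finite A ==> (\<Sum>j\<in>A. (g j)\<^sup>2) <= S"
 shows "\<bar>zs (%j. f j * g j)\<bar> <= sqrt (zs (%j. (f j)\<^sup>2)) * sqrt S"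
proof -
 obtain A where A: "finite A" "!!j. j \<notin> A ==> f j = 0" using fsupp_obtain[OF f] by blast
 have "\<bar>zs (%j. f j * g j)\<bar> = \<bar>\<Sum>j\<in>A. f j * g j\<bar>" using A by (subst zs_eq_sum[of A]) auto
 also have "... <= sqrt (\<Sum>j\<in>A. (f j)\<^sup>2) * sqrt (\<Sum>j\<in>A. (g j)\<^sup>2)"
  using real_sqrt_le_mono[OF Cauchy_Schwarz_ineq_sum[of f g A]] by (simp add: real_sqrt_mult)
 also have "... <= sqrt (zs (%j. (f j)\<^sup>2)) * sqrt S"
  using A S[OF A(1)] by (subst zs_eq_sum[of A]) (auto intro!: mult_left_mono sum_nonneg)
 finally show ?thesis .
qed

lemma zs_inner_le:
 fixes u v :: "int => 'a::real_inner"
 assumes u: "fsupp u" and S: "!!A. finite A ==> (\<Sum>j\<in>A. (norm (v j))\<^sup>2) <= S"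
 shows "\<bar>zs (%j. u j \<bullet> v j)\<bar> <= sqrt (nsq u) * sqrt S"
proof -
 obtain A where A: "finite A" "!!j. j \<notin> A ==> u j = 0" using fsupp_obtain[OF u] by blast
 have "\<bar>zs (%j. u j \<bullet> v j)\<bar> = \<bar>\<Sum>j\<in>A. u j \<bullet> v j\<bar>" using A by (subst zs_eq_sum[of A]) auto
 also have "... <= (\<Sum>j\<in>A. norm (u j) * norm (v j))"
  by (intro order_trans[OF sum_abs] sum_mono Cauchy_Schwarz_ineq2)
 also have "... = zs (%j. norm (u j) * norm (v j))" using A by (subst zs_eq_sum[of A]) auto
 also have "... <= \<bar>...\<bar>" by simp
 also have "... <= sqrt (nsq u) * sqrt S" unfolding nsq_def
  by (rule zs_mult_le[OF _ S]) (rule fsupp_subset[OF u], simp)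
 finally show ?thesis .
qed

lemma sum_norm2_le_nsq: "finite A ==> fsupp u ==> (\<Sum>j\<in>A. (norm (u j))\<^sup>2) <= nsq u"
 unfolding nsq_def by (rule sum_le_zs) auto

lemma sum_norm2_shift_le_nsq: "finite A ==> fsupp u ==> (\<Sum>j\<in>A. (norm (u (j + k)))\<^sup>2) <= nsq u" for k :: int
 using sum_norm2_le_nsq[of A "%j. u (j + k)"] by simp

text \<open>Agmon's inequality on the lattice: an increment of the squared norm is at most the norm
  of the difference times the sum of the two neighbouring norms. These are summed from the left of
  the support, and Cauchy-Schwarz separates the factors.\<close>

lemma discrete_agmon:
 fixes f :: "int => 'a::real_normed_vector"
 assumes f: "fsupp f"
 shows "(norm (f j))\<^sup>2 <= 2 * (sqrt (nsq f) * sqrt (nsq (%j. f (j + 1) - f j)))"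
proof -
 let ?d = "%i. f (i + 1) - f i"
 have fd: "fsupp ?d" by (intro fsupp_diff) (simp_all add: f)
 obtain J where J: "!!i. i <= J ==> f i = 0"
 proof -
  have "finite {i. f i ~= 0}" using f by (simp add: fsupp_def)
  then obtain K where "\<forall>i\<in>{i. f i ~= 0}. K <= i" using bdd_below_finite unfolding bdd_below_def by blast
  then show ?thesis by (intro that[of "K - 1"]) force
 qed
 have le: "(norm (f (J + int n)))\<^sup>2 <= (\<Sum>i\<in>{J..<J + int n}. norm (?d i) * norm (f (i + 1)) + norm (?d i) * norm (f i))" for n
 proof (induction n)
  case (Suc n)
  let ?i = "J + int n"
  have "(norm (f (?i + 1)))\<^sup>2 - (norm (f ?i))\<^sup>2 = (norm (f (?i + 1)) - norm (f ?i)) * (norm (f (?i + 1)) + norm (f ?i))"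
   by (simp add: power2_eq_square algebra_simps)
  also have "... <= norm (?d ?i) * (norm (f (?i + 1)) + norm (f ?i))"
   by (intro mult_right_mono norm_triangle_ineq2) auto
  finally have "(norm (f (?i + 1)))\<^sup>2 <= (norm (f ?i))\<^sup>2 + (norm (?d ?i) * norm (f (?i + 1)) + norm (?d ?i) * norm (f ?i))"
   by (simp add: distrib_left)
  moreover have "{J..<J + int (Suc n)} = insert ?i {J..<?i}" by auto
  ultimately show ?case using Suc by (simp add: add_ac)
 qed (simp add: J)
 have "(norm (f j))\<^sup>2 <= zs (%i. norm (?d i) * norm (f (i + 1)) + norm (?d i) * norm (f i))"
 proof (cases "j <= J")
  case True
  then show ?thesis using J by (simp add: zs_nonneg)
 next
  case False
  then have "j = J + int (nat (j - J))" by simp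
  then have "(norm (f j))\<^sup>2 <= (\<Sum>i\<in>{J..<j}. norm (?d i) * norm (f (i + 1)) + norm (?d i) * norm (f i))"
   using le[of "nat (j - J)"] by simp
  also have "... <= zs (%i. norm (?d i) * norm (f (i + 1)) + norm (?d i) * norm (f i))"
   by (rule sum_le_zs) (auto intro: fsupp_subset[OF fd])
  finally show ?thesis .
 qed
 also have "... = zs (%i. norm (?d i) * norm (f (i + 1))) + zs (%i. norm (?d i) * norm (f i))"
  by (rule zs_add; rule fsupp_subset[OF fd]; simp)
 also have "zs (%i. norm (?d i) * norm (f (i + 1))) <= sqrt (nsq ?d) * sqrt (nsq f)"
 proof -
  have "zs (%i. norm (?d i) * norm (f (i + 1))) <= sqrt (zs (%i. (norm (?d i))\<^sup>2)) * sqrt (nsq (%i. f (i + 1)))"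
   by (rule order_trans[OF abs_ge_self zs_mult_le]) (use f in \<open>auto intro: fsupp_subset[OF fd] sum_norm2_shift_le_nsq\<close>)
  then show ?thesis by (simp add: nsq_def[symmetric])
 qed
 also have "zs (%i. norm (?d i) * norm (f i)) <= sqrt (nsq ?d) * sqrt (nsq f)"
  unfolding nsq_def[of ?d]
  by (rule order_trans[OF abs_ge_self zs_mult_le]) (use f in \<open>auto intro: fsupp_subset[OF fd] sum_norm2_le_nsq\<close>)
 finally show ?thesis by (simp add: mult.commute)
qed

text \<open>Summation by parts interpolates the gradient between the function and its second
  difference. It is needed for time increments of the scheme, which are gradients of accumulated
  flows.\<close>

lemma nsq_gradient_eq:
 fixes W :: "int => 'a::real_inner"
 assumes W: "fsupp W"
 shows "nsq (%j. W (j + 1) - W j) <= sqrt (nsq W) * sqrt (nsq (%j. (W (j + 2) - W (j + 1)) - (W (j + 1) - W j)))"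
proof -
 define q where "q = (%j. W (j + 1) - W j)"
 have q: "fsupp q" unfolding q_def by (intro fsupp_diff) (simp_all add: W)
 have dq: "fsupp (%j. q (j + 1) - q j)" by (intro fsupp_diff) (simp_all add: q)
 have f1: "fsupp (%j. q j \<bullet> W (j + 1))" "fsupp (%j. q j \<bullet> W j)" "fsupp (%j. q (j + 1) \<bullet> W (j + 1))"
  by (rule fsupp_subset[OF q], simp)+ (rule fsupp_subset[of "%j. q (j + 1)"], simp_all add: q)
 have "nsq q = zs (%j. q j \<bullet> W (j + 1) - q j \<bullet> W j)"
  unfolding nsq_def by (simp add: power2_norm_eq_inner q_def inner_diff_right)
 also have "... = zs (%j. q j \<bullet> W (j + 1)) - zs (%j. q (j + 1) \<bullet> W (j + 1))"
  using zs_shift[of "%j. q j \<bullet> W j" 1] by (simp add: zs_diff f1)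
 also have "... = - zs (%j. (q (j + 1) - q j) \<bullet> W (j + 1))"
  by (simp add: inner_diff_left zs_diff f1)
 also have "... <= sqrt (nsq (%j. q (j + 1) - q j)) * sqrt (nsq (%j. W (j + 1)))"
  by (rule order_trans[OF abs_ge_minus_self zs_inner_le[OF dq]]) (simp add: sum_norm2_shift_le_nsq W)
 finally show ?thesis by (simp add: q_def mult.commute add.assoc)
qed

section \<open>The explicit lattice scheme\<close>

lemma telescope_le:
 fixes A d :: "nat => real"
 assumes "!!n. A (Suc n) + d n <= A n"
 shows "A (p + n) + (\<Sum>s<n. d (p + s)) <= A p"
proof (induction n)
 case (Suc n)
 then show ?case using assms[of "p + n"] by simp
qed simp

text \<open>The summand is (s + 1)^(-3/4) and is compared with an increment of the fourth root: if a
  <= b are fourth roots of consecutive integers, then 1 = b^4 - a^4 <= (b - a) 4 b^3.\<close>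

lemma sum_inverse_sqrt3_le: "(\<Sum>s<n. 1 / sqrt (real (Suc s) * sqrt (real (Suc s)))) <= 4 * sqrt (sqrt (real n))"
proof (induction n)
 case (Suc n)
 define a where "a = sqrt (sqrt (real n))"
 define b where "b = sqrt (sqrt (real (Suc n)))"
 have b: "b > 0" "0 <= a" "a <= b" by (simp_all add: a_def b_def)
 have b4: "b ^ 4 = real (Suc n)" "a ^ 4 = real n"
  by (simp_all add: a_def b_def power2_eq_square[symmetric] power4_eq_xxxx mult.assoc[symmetric])
   (simp_all add: mult.assoc)
 have sq: "sqrt (real (Suc n)) = b\<^sup>2" by (simp add: b_def)
 have "sqrt (real (Suc n) * sqrt (real (Suc n))) = sqrt (b ^ 4 * b\<^sup>2)" by (simp only: sq b4)
 also have "... = b ^ 3"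
 proof (rule real_sqrt_unique)
  show "(b ^ 3)\<^sup>2 = b ^ 4 * b\<^sup>2" by (simp add: power_add[symmetric] power_mult[symmetric])
 qed (use b in simp)
 finally have e: "sqrt (real (Suc n) * sqrt (real (Suc n))) = b ^ 3" .
 have "1 = b ^ 4 - a ^ 4" using b4 by simp
 also have "... = (b - a) * (b ^ 3 + b\<^sup>2 * a + b * a\<^sup>2 + a ^ 3)"
  by (simp add: power2_eq_square power3_eq_cube power4_eq_xxxx algebra_simps)
 also have "... <= (b - a) * (4 * b ^ 3)"
 proof (intro mult_left_mono)
  have "b\<^sup>2 * a <= b\<^sup>2 * b" "b * a\<^sup>2 <= b * b\<^sup>2" "a ^ 3 <= b ^ 3"
   using b by (auto intro!: mult_left_mono power_mono)
  then show "b ^ 3 + b\<^sup>2 * a + b * a\<^sup>2 + a ^ 3 <= 4 * b ^ 3"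
   by (simp add: power2_eq_square power3_eq_cube)
 qed (use b in simp)
 finally have "1 / b ^ 3 <= 4 * (b - a)" using b(1) by (simp add: field_simps)
 then show ?case using Suc e by (simp add: a_def[symmetric] b_def[symmetric] del: of_nat_Suc)
qed simp

context monotone_flux
begin

text \<open>\<open>Qs\<close> is the energy that the scheme decreases. It is applied to primitives
  of differences of solutions and is therefore a squared H^(-1) norm of these differences, weighted
  by G.\<close>

definition "Q x = x \<bullet> (G *v x)"
definition "Qs u = zs (%j. Q (u j))"

lemma Q_bounds: "b * (norm x)\<^sup>2 <= Q x" "Q x <= M * (norm x)\<^sup>2" "0 <= Q x"
proof -
 show 1: "b * (norm x)\<^sup>2 <= Q x" using G_lower by (simp add: Q_def)
 have "Q x <= norm x * norm (G *v x)" unfolding Q_def by (rule norm_cauchy_schwarz)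
 also have "... <= norm x * (M * norm x)" by (intro mult_left_mono G_upper) simp
 finally show "Q x <= M * (norm x)\<^sup>2" by (simp add: power2_eq_square algebra_simps)
 show "0 <= Q x" using 1 consts_pos(3) by (meson mult_nonneg_nonneg less_imp_le order_trans zero_le_power2)
qed

lemma Q_0 [simp]: "Q 0 = 0" by (simp add: Q_def)

lemma Q_add_scaleR: "Q (x + s *\<^sub>R y) = Q x + 2 * s * (y \<bullet> (G *v x)) + s\<^sup>2 * Q y"
 unfolding Q_def using G_sym[of x y]
 by (simp add: matrix_vector_right_distrib matrix_vector_mult_scaleR inner_add_left inner_add_right
   power2_eq_square distrib_left)

lemma fsupp_Q: "fsupp u ==> fsupp (%j. Q (u j))"
 by (erule fsupp_subset) simp

lemma Qs_bounds:
 assumes "fsupp u" shows "b * nsq u <= Qs u" "Qs u <= M * nsq u"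
proof -
 show "b * nsq u <= Qs u" "Qs u <= M * nsq u"
  unfolding nsq_def Qs_def zs_cmult[symmetric]
  by (intro zs_mono Q_bounds fsupp_Q assms; rule fsupp_subset[OF fsupp_norm2[OF assms]]; simp)+
qed

lemma Qs_nonneg: "0 <= Qs u"
 unfolding Qs_def by (rule zs_nonneg) (rule Q_bounds(3))

text \<open>The CFL number of the scheme: the first bound makes it contractive, the second one preserves positivity.\<close>

definition "r = min (c / (4 * M * L\<^sup>2)) (1 / (2 * L))"

lemma r_pos: "r > 0"
 using consts_pos by (simp add: r_def)

lemma r_le: "4 * M * L\<^sup>2 * r <= c" "2 * L * r <= 1"
proof -
 have "r <= c / (4 * M * L\<^sup>2)" "r <= 1 / (2 * L)" by (simp_all add: r_def)
 then show "4 * M * L\<^sup>2 * r <= c" "2 * L * r <= 1"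
  using consts_pos by (simp_all add: field_simps)
qed

text \<open>The scheme is contractive in the discrete analogue of \<open>H\<^sup>-\<^sup>1\<close>; \<open>u\<close> is a discrete
 primitive of \<open>x - y\<close>.\<close>

lemma nonexpansive:
 fixes u u' x y :: "int => real^'d"
 assumes xy: "!!j. x j \<in> nonneg" "!!j. y j \<in> nonneg" and u: "fsupp u"
  and grad: "!!j. u (j + 1) - u j = x j - y j"
  and u': "!!j. u' j = u j + r *\<^sub>R ((F (x j) - F (y j)) - (F (x (j - 1)) - F (y (j - 1))))"
 shows "Qs u' + r * c * nsq (%j. x j - y j) <= Qs u"
proof -
 define f where "f = (%j. F (x j) - F (y j))"
 define D where "D = nsq (%j. x j - y j)"
 have xy_supp: "fsupp (%j. x j - y j)" unfolding grad[symmetric] by (intro fsupp_diff) (simp_all add: u)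
 have f: "fsupp f" unfolding f_def by (rule fsupp_subset[OF xy_supp]) simp
 have nf: "nsq f <= L\<^sup>2 * D"
  unfolding D_def nsq_def zs_cmult[symmetric]
 proof (intro zs_mono)
  show "fsupp (%j. (norm (f j))\<^sup>2)" "fsupp (%j. L\<^sup>2 * (norm (x j - y j))\<^sup>2)"
   by (rule fsupp_norm2[OF f]) (rule fsupp_subset[OF xy_supp], simp)
  show "(norm (f j))\<^sup>2 <= L\<^sup>2 * (norm (x j - y j))\<^sup>2" for j
   using power_mono[OF F_lipschitz[OF xy], of j j 2] by (simp add: f_def power_mult_distrib)
 qed
 let ?I = "%p q. p \<bullet> (G *v q)"
 have s1: "fsupp (%j. ?I (f j) (u j))" "fsupp (%j. ?I (f j) (u (j + 1)))"
  "fsupp (%j. ?I (f (j - 1)) (u j))"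
  by (rule fsupp_subset[OF f], simp)+ (rule fsupp_subset[of "%j. f (j - 1)"], simp_all add: f)
 have s2: "fsupp (%j. f j - f (j - 1))" by (intro fsupp_diff) (simp_all add: f)
 have eq: "Q (u' j) = Q (u j) + 2 * r * (?I (f j) (u j) - ?I (f (j - 1)) (u j)) + r\<^sup>2 * Q (f j - f (j - 1))" for j
 proof -
  have "u' j = u j + r *\<^sub>R (f j - f (j - 1))" by (simp add: u' f_def)
  then show ?thesis by (simp only: Q_add_scaleR inner_diff_left)
 qed
 have "Qs u' = Qs u + 2 * r * (zs (%j. ?I (f j) (u j)) - zs (%j. ?I (f (j - 1)) (u j))) + r\<^sup>2 * Qs (%j. f j - f (j - 1))"
 proof -
  have a: "fsupp (%j. ?I (f j) (u j) - ?I (f (j - 1)) (u j))" by (intro fsupp_diff s1)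
  have b: "fsupp (%j. 2 * r * (?I (f j) (u j) - ?I (f (j - 1)) (u j)))" by (rule fsupp_subset[OF a]) simp
  have c: "fsupp (%j. r\<^sup>2 * Q (f j - f (j - 1)))" by (rule fsupp_subset[OF fsupp_Q[OF s2]]) simp
  show ?thesis unfolding Qs_def eq
   by (subst zs_add[OF fsupp_add[OF fsupp_Q[OF u] b] c], subst zs_add[OF fsupp_Q[OF u] b])
    (simp add: zs_cmult zs_diff s1)
 qed
 \<comment> \<open>The index shift moves the difference from f to u, whose increments are x - y;
   this produces the pairing to which \<open>F_mono\<close> applies.\<close>
 also have "zs (%j. ?I (f (j - 1)) (u j)) = zs (%j. ?I (f j) (u (j + 1)))"
  using zs_shift[of "%j. ?I (f (j - 1)) (u j)" 1] by simp
 also have "zs (%j. ?I (f j) (u j)) - zs (%j. ?I (f j) (u (j + 1))) = - zs (%j. ?I (f j) (x j - y j))"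
  unfolding grad[symmetric] matrix_vector_mult_diff_distrib inner_diff_right
  by (simp add: zs_diff s1)
 also have "c * D <= zs (%j. ?I (f j) (x j - y j))"
  unfolding D_def nsq_def zs_cmult[symmetric]
  by (intro zs_mono) (auto intro: fsupp_subset[OF xy_supp] fsupp_subset[OF f] simp: f_def F_mono xy)
 then have "Qs u + 2 * r * - zs (%j. ?I (f j) (x j - y j)) <= Qs u - 2 * r * (c * D)"
  using r_pos by simp
 \<comment> \<open>By the first bound in \<open>r_le\<close> the quadratic error of the explicit
   step costs at most r c D, half of the gain 2 r c D from monotonicity. The other half is the
   dissipation in the statement.\<close>
 also have "Qs (%j. f j - f (j - 1)) <= M * (2 * (nsq f + nsq f))"
 proof -
  have "nsq (%j. f j - f (j - 1)) <= 2 * (nsq f + nsq (%j. f (j - 1)))"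
   by (rule nsq_diff_le) (simp_all add: f)
  then have "M * nsq (%j. f j - f (j - 1)) <= M * (2 * (nsq f + nsq f))"
   using consts_pos by (intro mult_left_mono) auto
  then show ?thesis using Qs_bounds(2)[OF s2] by linarith
 qed
 then have "r\<^sup>2 * Qs (%j. f j - f (j - 1)) <= r\<^sup>2 * (4 * M * (L\<^sup>2 * D))"
  using nf consts_pos by (intro mult_left_mono) (auto intro: order_trans)
 also have "r\<^sup>2 * (4 * M * (L\<^sup>2 * D)) = r * ((4 * M * L\<^sup>2 * r) * D)" by (simp add: power2_eq_square)
 also have "... <= r * (c * D)"
  using r_pos r_le(1) by (intro mult_left_mono mult_right_mono) (auto simp: D_def)
 finally show ?thesis unfolding D_def by (simp add: algebra_simps)
qed

definition step :: "(int => real^'d) => int => real^'d" where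
 "step m j = m j + r *\<^sub>R ((F (m (j + 1)) - F (m j)) - (F (m j) - F (m (j - 1))))"

definition evol :: "nat => (int => real^'d) => int => real^'d" where
 "evol n = step ^^ n"

lemma evol_simps [simp]: "evol 0 m = m" "evol (Suc n) m = step (evol n m)"
 by (simp_all add: evol_def)

text \<open>The mass is bounded by one rather than equal to one, because restricting the initial
  measure to finitely many cells may lose some of it.\<close>

definition admissible :: "(int => real^'d) => bool" where
 "admissible m \<longleftrightarrow> fsupp m & (\<forall>j. m j \<in> nonneg) & zs (%j. total (m j)) <= 1"

lemma fsupp_F: "fsupp m ==> fsupp (%j. F (m j))"
 by (erule fsupp_subset) simp

lemma fsupp_step: "fsupp m ==> fsupp (step m)"
proof -
 assume m: "fsupp m"
 have "fsupp (%j. (F (m (j + 1)) - F (m j)) - (F (m j) - F (m (j - 1))))"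
  by (intro fsupp_diff fsupp_F) (simp_all add: m)
 then have "fsupp (%j. r *\<^sub>R ((F (m (j + 1)) - F (m j)) - (F (m j) - F (m (j - 1)))))"
  by (rule fsupp_subset) simp
 then show ?thesis unfolding step_def by (intro fsupp_add m)
qed

text \<open>The only negative term in the new value of cell j is the outflow 2 r F(m_j), and the
  second bound in \<open>r_le\<close> keeps each of its components below that of m_j.\<close>

lemma nonneg_step:
 assumes "!!j. m j \<in> nonneg" shows "step m j \<in> nonneg"
 unfolding nonneg_def
proof (clarify)
 fix i
 have "r * F (m j) $ i <= r * (L * m j $ i)"
  using r_pos by (intro mult_left_mono F_component_le assms) simp
 then have "2 * (r * F (m j) $ i) <= (2 * L * r) * m j $ i" by (simp add: mult_ac)
 also have "... <= 1 * m j $ i" using assms[of j] r_le(2) by (intro mult_right_mono) (auto simp: nonneg_def)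
 finally have 1: "2 * (r * F (m j) $ i) <= m j $ i" by simp
 have "0 <= F (m (j + 1)) $ i" "0 <= F (m (j - 1)) $ i"
  using F_nonneg[OF assms] by (simp_all add: nonneg_def)
 then have "0 <= r * F (m (j + 1)) $ i" "0 <= r * F (m (j - 1)) $ i"
  using r_pos by simp_all
 then show "0 <= step m j $ i" using 1 by (simp add: step_def algebra_simps)
qed

lemma fsupp_total: "fsupp m ==> fsupp (%j. total (m j))"
 by (erule fsupp_subset) simp

lemma total_step:
 assumes "!!j. m j \<in> nonneg"
 shows "total (step m j) = total (m j) + r * ((total (m (j + 1)) - total (m j)) - (total (m j) - total (m (j - 1))))"
 unfolding step_def total_simps total_F[OF assms] ..

lemma mass_step:
 assumes "fsupp m" "!!j. m j \<in> nonneg"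
 shows "zs (%j. total (step m j)) = zs (%j. total (m j))"
proof -
 let ?t = "%j. total (m j)"
 have t: "fsupp ?t" by (rule fsupp_total[OF assms(1)])
 have t1: "fsupp (%j. ?t (j + 1))" "fsupp (%j. ?t (j - 1))"
  by (rule fsupp_total, simp add: assms(1))+
 have d: "fsupp (%j. ?t (j + 1) - ?t j)" "fsupp (%j. ?t j - ?t (j - 1))" by (intro fsupp_diff t t1)+
 have "fsupp (%j. (?t (j + 1) - ?t j) - (?t j - ?t (j - 1)))" by (intro fsupp_diff d)
 then have rd: "fsupp (%j. r * ((?t (j + 1) - ?t j) - (?t j - ?t (j - 1))))" by (rule fsupp_subset) simp
 have "zs (%j. total (step m j)) = zs (%j. ?t j + r * ((?t (j + 1) - ?t j) - (?t j - ?t (j - 1))))"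
  by (simp only: total_step assms(2))
 also have "... = zs ?t"
  using zs_shift[of ?t 1] zs_shift_minus[of ?t 1]
  by (subst zs_add[OF t rd], subst zs_cmult, subst zs_diff[OF d], subst zs_diff[OF t1(1) t], subst zs_diff[OF t t1(2)]) simp
 finally show ?thesis .
qed

lemma admissible_evol: "admissible m ==> admissible (evol n m)"
 by (induction n) (auto simp: admissible_def fsupp_step nonneg_step mass_step)

lemma admissible_total_le:
 assumes "admissible m" "finite A" shows "(\<Sum>j\<in>A. total (m j)) <= 1"
proof -
 have "(\<Sum>j\<in>A. total (m j)) <= zs (%j. total (m j))"
  using assms by (intro sum_le_zs) (auto simp: admissible_def intro: fsupp_total total_nonneg)
 then show ?thesis using assms(1) by (simp add: admissible_def)
qed

section \<open>Comparison of a lattice solution with its translates\<close>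

definition shift_nsq :: "nat => (int => real^'d) => real" where
 "shift_nsq k m = nsq (%j. m (j + int k) - m j)"

text \<open>The discrete primitive of the difference between m shifted by k cells and m itself, see
  \<open>window_Suc_diff\<close>; hence the sequence to which the contraction is applied.\<close>

definition window :: "nat => (int => real^'d) => int => real^'d" where
 "window k m j = (\<Sum>i<k. m (j + int i))"

lemma window_Suc: "window (Suc k) m j = window k m j + m (j + int k)"
 by (simp add: window_def)

lemma window_Suc_diff: "window k m (j + 1) - window k m j = m (j + int k) - m j"
proof (induction k)
 case (Suc k)
 have "window (Suc k) m (j + 1) - window (Suc k) m j
   = (window k m (j + 1) - window k m j) + (m (j + 1 + int k) - m (j + int k))"
  unfolding window_Suc by (simp add: algebra_simps)
 also have "... = m (j + 1 + int k) - m j" unfolding Suc by simp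
 also have "j + 1 + int k = j + int (Suc k)" by simp
 finally show ?case .
qed (simp add: window_def)

lemma fsupp_window: "fsupp m ==> fsupp (window k m)"
 unfolding window_def by (intro fsupp_sum) simp

text \<open>Adding the scheme over k neighbouring cells telescopes the flux differences, so this
  primitive moves exactly as \<open>nonexpansive\<close> requires.\<close>

lemma window_step:
 "window k (step m) j = window k m j + r *\<^sub>R ((F (m (j + int k)) - F (m j)) - (F (m (j - 1 + int k)) - F (m (j - 1))))"
proof (induction k)
 case (Suc k)
 have e: "j + int (Suc k) = j + int k + 1" "j - 1 + int (Suc k) = j + int k" "j - 1 + int k = j + int k - 1" by simp_all
 show ?case unfolding window_Suc Suc unfolding e step_def by (simp add: scaleR_diff_right scaleR_add_right)
qed (simp add: window_def)

text \<open>The scheme is translation invariant, so the shifted solution is a second solution, and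
  \<open>nonexpansive\<close> can be summed over the time steps.\<close>

lemma shift_decay:
 assumes m: "admissible m"
 shows "Qs (window k (evol (p + n) m)) + (\<Sum>s<n. r * c * shift_nsq k (evol (p + s) m)) <= Qs (window k (evol p m))"
proof (rule telescope_le[of "%n. Qs (window k (evol n m))" "%n. r * c * shift_nsq k (evol n m)"])
 fix n
 let ?m = "evol n m"
 have "admissible ?m" by (rule admissible_evol[OF m])
 then show "Qs (window k (evol (Suc n) m)) + r * c * shift_nsq k ?m <= Qs (window k ?m)"
  unfolding shift_nsq_def
  by (intro nonexpansive[of "%j. ?m (j + int k)" ?m])
   (auto simp: admissible_def fsupp_window window_Suc_diff window_step)
qed

lemma norm_window_le:
 assumes "admissible m" shows "norm (window k m j) <= 1"
proof -
 have m: "m i \<in> nonneg" for i using assms by (simp add: admissible_def)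
 have "norm (window k m j) <= (\<Sum>i<k. total (m (j + int i)))"
  unfolding window_def by (intro sum_norm_le norm_le_total m)
 also have "... = (\<Sum>i\<in>(%i. j + int i) ` {..<k}. total (m i))"
  by (subst sum.reindex) (auto simp: inj_on_def)
 also have "... <= 1" by (intro admissible_total_le assms) auto
 finally show ?thesis .
qed

text \<open>Both factors of the squared norm are controlled by the mass: a single window has norm at
  most one, and every cell lies in k windows. No property of the initial datum beyond its mass
  enters.\<close>

lemma nsq_window_le:
 assumes m: "admissible m" shows "nsq (window k m) <= real k"
proof -
 have mn: "m i \<in> nonneg" for i using m by (simp add: admissible_def)
 have ft: "fsupp (%j. total (m (j + i)))" for i by (rule fsupp_total) (use m in \<open>simp add: admissible_def\<close>)
 have "nsq (window k m) <= zs (%j. \<Sum>i<k. total (m (j + int i)))"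
  unfolding nsq_def
 proof (intro zs_mono)
  show "fsupp (%j. (norm (window k m j))\<^sup>2)" using m by (simp add: admissible_def fsupp_window)
  show "fsupp (%j. \<Sum>i<k. total (m (j + int i)))" by (intro fsupp_sum ft)
  fix j
  have "(norm (window k m j))\<^sup>2 <= norm (window k m j) * 1"
   unfolding power2_eq_square using norm_window_le[OF m] by (intro mult_left_mono) auto
  also have "... <= (\<Sum>i<k. total (m (j + int i)))"
   unfolding window_def mult_1_right by (intro sum_norm_le norm_le_total mn)
  finally show "(norm (window k m j))\<^sup>2 <= (\<Sum>i<k. total (m (j + int i)))" .
 qed
 also have "... = (\<Sum>i<k. zs (%j. total (m (j + int i))))"
  by (rule zs_sum) (rule ft)
 also have "... = real k * zs (%j. total (m j))"
  using zs_shift[of "%j. total (m j)"] by simp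
 also have "... <= real k" using m by (simp add: admissible_def mult_left_le)
 finally show ?thesis .
qed

end

text \<open>Cauchy-Schwarz on each block of at most N neighbouring cells; the blocks are disjoint
  because the end points are ordered. With one block this is a Hoelder estimate, with many it bounds
  a quadratic variation.\<close>

lemma sum_blocks_le:
 fixes m :: "int => 'a::real_normed_vector"
 assumes a: "!!i. a i <= a (Suc i)" "!!i. a (Suc i) - a i <= int N" and m: "fsupp m"
 shows "(\<Sum>i<J. (norm (m (a (Suc i)) - m (a i)))\<^sup>2) <= real N * nsq (%j. m (j + 1) - m j)"
proof -
 let ?d = "%j. m (j + 1) - m j"
 have d: "fsupp ?d" by (intro fsupp_diff) (simp_all add: m)
 have tel: "m (p + int k) - m p = (\<Sum>j\<in>{p..<p + int k}. ?d j)" for p k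
 proof (induction k)
  case (Suc k)
  have "{p..<p + int (Suc k)} = insert (p + int k) {p..<p + int k}" by auto
  then have "(\<Sum>j\<in>{p..<p + int (Suc k)}. ?d j) = (m (p + int k + 1) - m (p + int k)) + (m (p + int k) - m p)"
   using Suc by simp
  also have "p + int k + 1 = p + int (Suc k)" by simp
  finally show ?case by simp
 qed simp
 have block: "(norm (m (a (Suc i)) - m (a i)))\<^sup>2 <= real N * (\<Sum>j\<in>{a i..<a (Suc i)}. (norm (?d j))\<^sup>2)" for i
 proof -
  have e: "a i + int (nat (a (Suc i) - a i)) = a (Suc i)" using a(1)[of i] by simp
  have "(norm (m (a (Suc i)) - m (a i)))\<^sup>2 <= real (card {a i..<a (Suc i)}) * (\<Sum>j\<in>{a i..<a (Suc i)}. (norm (?d j))\<^sup>2)"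
   using tel[of "a i" "nat (a (Suc i) - a i)"] norm_sum_power2_le[of ?d "{a i..<a (Suc i)}"] unfolding e by simp
  also have "... <= real N * (\<Sum>j\<in>{a i..<a (Suc i)}. (norm (?d j))\<^sup>2)"
   using a(2)[of i] by (intro mult_right_mono sum_nonneg) auto
  finally show ?thesis .
 qed
 have mono: "a 0 <= a i" for i by (induction i) (auto intro: order_trans a(1))
 have "(\<Sum>i<J. (norm (m (a (Suc i)) - m (a i)))\<^sup>2) <= real N * (\<Sum>j\<in>{a 0..<a J}. (norm (?d j))\<^sup>2)"
 proof (induction J)
  case (Suc J)
  have "{a 0..<a (Suc J)} = {a 0..<a J} \<union> {a J..<a (Suc J)}" using mono[of J] a(1)[of J] by auto
  then have "(\<Sum>j\<in>{a 0..<a (Suc J)}. (norm (?d j))\<^sup>2) = (\<Sum>j\<in>{a 0..<a J}. (norm (?d j))\<^sup>2) + (\<Sum>j\<in>{a J..<a (Suc J)}. (norm (?d j))\<^sup>2)"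
   by (simp only:) (intro sum.union_disjoint, auto)
  then show ?case using Suc block[of J] by (simp add: distrib_left)
 qed simp
 also have "... <= real N * nsq ?d" by (intro mult_left_mono sum_norm2_le_nsq d) auto
 finally show ?thesis .
qed

lemma nsq_mono_cmult:
 assumes "fsupp f" "fsupp g" "!!j. norm (f j) <= C * norm (g j)" shows "nsq f <= C\<^sup>2 * nsq g"
 unfolding nsq_def zs_cmult[symmetric]
proof (intro zs_mono)
 show "fsupp (%j. (norm (f j))\<^sup>2)" "fsupp (%j. C\<^sup>2 * (norm (g j))\<^sup>2)"
  by (rule fsupp_norm2[OF assms(1)]) (rule fsupp_subset[OF assms(2)], simp)
 show "(norm (f j))\<^sup>2 <= C\<^sup>2 * (norm (g j))\<^sup>2" for j
  using power_mono[OF assms(3), of j 2] by (simp add: power_mult_distrib)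
qed

section \<open>Decay of the square sums of the solution and of its gradient\<close>

context monotone_flux
begin

lemma fsupp_evol: "admissible m ==> fsupp (evol n m)"
 using admissible_evol[of m n] by (simp add: admissible_def)

lemma nonneg_evol: "admissible m ==> evol n m j \<in> nonneg"
 using admissible_evol[of m n] by (simp add: admissible_def)

lemma window_1 [simp]: "window (Suc 0) m = m"
 by (simp add: window_def fun_eq_iff)

lemma shift_sum_le:
 assumes m: "admissible m"
 shows "(\<Sum>s<n. shift_nsq k (evol (p + s) m)) <= Qs (window k (evol p m)) / (r * c)"
proof -
 have "r * c * (\<Sum>s<n. shift_nsq k (evol (p + s) m)) <= Qs (window k (evol p m))"
  using shift_decay[OF m, of k p n] Qs_nonneg[of "window k (evol (p + n) m)"]
  unfolding sum_distrib_left by linarith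
 then show ?thesis using r_pos consts_pos by (simp add: pos_le_divide_eq mult.commute)
qed

lemma shift_nsq_nonneg: "0 <= shift_nsq k m"
 by (simp add: shift_nsq_def)

lemma Qs_antimono:
 assumes m: "admissible m" shows "Qs (evol (p + n) m) <= Qs (evol p m)"
proof -
 have "0 <= (\<Sum>s<n. r * c * shift_nsq (Suc 0) (evol (p + s) m))"
  using r_pos consts_pos by (intro sum_nonneg) (simp add: shift_nsq_nonneg)
 then show ?thesis using shift_decay[OF m, of "Suc 0" p n] by simp
qed

text \<open>A value equals the mean over its window minus the mean deviation of the window from it.
  The first part is controlled by the mass and the second by translates; this takes the place of
  Nash's inequality.\<close>

lemma nsq_le_average:
 assumes m: "admissible m" and k: "k \<ge> 1"
 shows "nsq m <= 2 / real k * (1 + (\<Sum>i<k. shift_nsq i m))"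
proof -
 have fm: "fsupp m" using m by (simp add: admissible_def)
 have d: "fsupp (%j. m (j + int i) - m j)" for i by (intro fsupp_diff) (simp_all add: fm)
 have e: "real k *\<^sub>R m j = window k m j - (\<Sum>i<k. m (j + int i) - m j)" for j
  by (simp add: window_def sum_subtractf sum_constant_scaleR del: sum_constant)
 have "(real k)\<^sup>2 * nsq m = nsq (%j. real k *\<^sub>R m j)"
  by (simp add: nsq_def zs_cmult[symmetric] power_mult_distrib)
 also have "... <= 2 * (nsq (window k m) + nsq (%j. \<Sum>i<k. m (j + int i) - m j))"
  unfolding e by (intro nsq_diff_le fsupp_window fm fsupp_sum d)
 also have "... <= 2 * (real k + real (card {..<k}) * (\<Sum>i<k. shift_nsq i m))"
  unfolding shift_nsq_def by (intro mult_left_mono add_mono nsq_window_le m nsq_sum_le d) auto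
 finally have "(real k)\<^sup>2 * nsq m <= real k * (2 * (1 + (\<Sum>i<k. shift_nsq i m)))"
  by (simp add: algebra_simps)
 then have "real k * nsq m <= 2 * (1 + (\<Sum>i<k. shift_nsq i m))"
  using k by (simp add: power2_eq_square)
 then show ?thesis using k by (simp add: field_simps)
qed

text \<open>Summing \<open>nsq_le_average\<close> over n time steps and inserting the dissipation
  bounds gives a multiple of n / k + k, which is smallest for k of order sqrt n. Since
  \<open>Qs\<close> decreases along the scheme, its last value is at most its time average.\<close>

lemma nsq_decay:
 assumes m: "admissible m" and n: "n \<ge> 1"
 shows "nsq (evol n m) <= M * (2 + 4 * M / (r * c)) / b / sqrt (real n)"
proof -
 define k where "k = nat \<lceil>sqrt (real n)\<rceil>"
 have s1: "sqrt (real n) \<ge> 1" using n by simp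
 have k1: "sqrt (real n) <= real k" by (simp add: k_def real_nat_ceiling_ge)
 have "real k <= sqrt (real n) + 1" unfolding k_def using s1 by linarith
 then have k2: "real k <= 2 * sqrt (real n)" using s1 by linarith
 have k: "k \<ge> 1" using k1 s1 by linarith
 have rc: "r * c > 0" using r_pos consts_pos by simp
 have "(\<Sum>s<n. nsq (evol s m)) <= (\<Sum>s<n. 2 / real k * (1 + (\<Sum>i<k. shift_nsq i (evol s m))))"
  by (intro sum_mono nsq_le_average admissible_evol m k)
 also have "... = 2 / real k * (real n + (\<Sum>i<k. \<Sum>s<n. shift_nsq i (evol (0 + s) m)))"
  unfolding sum_distrib_left[symmetric] sum.distrib by (subst sum.swap) simp
 also have "... <= 2 / real k * (real n + (\<Sum>i<k. M * real k / (r * c)))"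
 proof (intro mult_left_mono add_left_mono sum_mono)
  fix i assume i: "i \<in> {..<k}"
  have "(\<Sum>s<n. shift_nsq i (evol (0 + s) m)) <= Qs (window i (evol 0 m)) / (r * c)" by (rule shift_sum_le[OF m])
  also have "Qs (window i (evol 0 m)) <= M * nsq (window i m)"
   using Qs_bounds(2)[OF fsupp_window[OF fsupp_evol[OF m, of 0]]] by simp
  also have "... <= M * real k" using nsq_window_le[OF m, of i] i consts_pos by (intro mult_left_mono) auto
  finally show "(\<Sum>s<n. shift_nsq i (evol (0 + s) m)) <= M * real k / (r * c)"
   using rc by (simp add: divide_right_mono)
 qed simp
 also have "... = 2 * (real n / real k) + 2 * M / (r * c) * real k" using k rc by (simp add: field_simps)
 also have "... <= 2 * sqrt (real n) + 2 * M / (r * c) * (2 * sqrt (real n))"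
 proof (intro add_mono mult_left_mono k2)
  have "real n = sqrt (real n) * sqrt (real n)" by simp
  also have "... <= sqrt (real n) * real k" using k1 by (intro mult_left_mono) auto
  finally show "real n / real k <= sqrt (real n)" using k by (simp add: divide_le_eq)
 qed (use rc consts_pos in auto)
 finally have S: "(\<Sum>s<n. nsq (evol s m)) <= (2 + 4 * M / (r * c)) * sqrt (real n)" by (simp add: algebra_simps)
 have "real n * Qs (evol n m) = (\<Sum>s<n. Qs (evol n m))" by simp
 also have "... <= (\<Sum>s<n. Qs (evol s m))"
 proof (rule sum_mono)
  fix s assume "s \<in> {..<n}"
  then show "Qs (evol n m) <= Qs (evol s m)" using Qs_antimono[OF m, of s "n - s"] by simp
 qed
 also have "... <= (\<Sum>s<n. M * nsq (evol s m))" by (intro sum_mono Qs_bounds fsupp_evol m)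
 also have "... <= M * ((2 + 4 * M / (r * c)) * sqrt (real n))"
  unfolding sum_distrib_left[symmetric] using S consts_pos by (intro mult_left_mono) auto
 finally have "real n * (b * nsq (evol n m)) <= M * ((2 + 4 * M / (r * c)) * sqrt (real n))"
  using Qs_bounds(1)[OF fsupp_evol[OF m, of n]] by (meson mult_left_mono of_nat_0_le_iff order_trans)
 also have "real n * (b * nsq (evol n m)) = (sqrt (real n) * sqrt (real n)) * (b * nsq (evol n m))" by simp
 finally have "sqrt (real n) * (b * nsq (evol n m)) * sqrt (real n) <= M * (2 + 4 * M / (r * c)) * sqrt (real n)"
  by (simp only: mult_ac)
 then have "sqrt (real n) * (b * nsq (evol n m)) <= M * (2 + 4 * M / (r * c))"
  by (rule mult_right_le_imp_le) (use n in simp)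
 then show ?thesis using n consts_pos by (simp add: pos_le_divide_eq mult_ac)
qed

definition fgrad :: "(int => real^'d) => real" where
 "fgrad m = nsq (%j. F (m (j + 1)) - F (m j))"

text \<open>The amount carried across the left boundary of cell j in one time step. Its increments
  are the change of m in that step, so it is the primitive that compares two consecutive
  iterates.\<close>

definition flow :: "(int => real^'d) => int => real^'d" where
 "flow m j = r *\<^sub>R (F (m j) - F (m (j - 1)))"

lemma fsupp_flow: "fsupp m ==> fsupp (flow m)"
proof -
 assume m: "fsupp m"
 have "fsupp (%j. F (m j) - F (m (j - 1)))" by (intro fsupp_diff fsupp_F) (simp_all add: m)
 then show ?thesis unfolding flow_def by (rule fsupp_subset) simp
qed

lemma nsq_flow: "nsq (flow m) = r\<^sup>2 * fgrad m"
 using nsq_shift(1)[of "flow m" 1]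
 by (simp add: fgrad_def flow_def nsq_def zs_cmult[symmetric] power_mult_distrib)

lemma flow_diff: "flow m (j + 1) - flow m j = step m j - m j"
 by (simp add: flow_def step_def scaleR_diff_right scaleR_add_right)

lemma flow_step: "flow (step m) j = flow m j + r *\<^sub>R ((F (step m j) - F (m j)) - (F (step m (j - 1)) - F (m (j - 1))))"
 by (simp add: flow_def scaleR_diff_right)

text \<open>The scheme is autonomous, so the next iterate starts a second solution;
  \<open>nonexpansive\<close> for the pair makes the energy of the flow decrease.\<close>

lemma flow_antimono:
 assumes m: "admissible m" shows "Qs (flow (evol (p + n) m)) <= Qs (flow (evol p m))"
proof (induction n)
 case (Suc n)
 let ?m = "evol (p + n) m"
 have "Qs (flow (step ?m)) + r * c * nsq (%j. step ?m j - ?m j) <= Qs (flow ?m)"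
  using admissible_evol[OF m, of "p + n"] admissible_evol[OF m, of "Suc (p + n)"]
  by (intro nonexpansive[of "step ?m" ?m "flow ?m"])
   (auto simp: admissible_def fsupp_flow flow_diff flow_step)
 moreover have "0 <= r * c * nsq (%j. step ?m j - ?m j)" using r_pos consts_pos by simp
 ultimately show ?case using Suc by simp
qed simp

text \<open>Strong monotonicity and Cauchy-Schwarz give F a Lipschitz inverse on its range. This
  turns decay of the flux gradient back into decay of the gradient of the solution.\<close>

lemma F_expansive:
 assumes "x \<in> nonneg" "y \<in> nonneg" shows "norm (x - y) <= M / c * norm (F x - F y)"
proof (cases "x = y")
 case False
 have "c * (norm (x - y))\<^sup>2 <= norm (F x - F y) * norm (G *v (x - y))"
  using F_mono[OF assms] norm_cauchy_schwarz order_trans by blast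
 also have "... <= norm (F x - F y) * (M * norm (x - y))" by (intro mult_left_mono G_upper) simp
 finally have "(c * norm (x - y)) * norm (x - y) <= (M * norm (F x - F y)) * norm (x - y)"
  by (simp add: power2_eq_square mult_ac)
 then have "c * norm (x - y) <= M * norm (F x - F y)" by (rule mult_right_le_imp_le) (use False in simp)
 then show ?thesis using consts_pos by (simp add: field_simps)
qed simp

lemma fgrad_le:
 assumes "admissible m" shows "fgrad m <= L\<^sup>2 * shift_nsq 1 m" "shift_nsq 1 m <= (M / c)\<^sup>2 * fgrad m"
proof -
 have m: "fsupp m" "!!j. m j \<in> nonneg" using assms by (simp_all add: admissible_def)
 have d: "fsupp (%j. F (m (j + 1)) - F (m j))" "fsupp (%j. m (j + 1) - m j)"
  by (intro fsupp_diff fsupp_F; simp add: m)+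
 show "fgrad m <= L\<^sup>2 * shift_nsq 1 m" "shift_nsq 1 m <= (M / c)\<^sup>2 * fgrad m"
  unfolding fgrad_def shift_nsq_def
  using nsq_mono_cmult[OF d F_lipschitz[OF m(2) m(2)]] nsq_mono_cmult[OF d(2) d(1) F_expansive[OF m(2) m(2)]] by simp_all
qed

text \<open>Mass at most one already bounds the square sum of the values. This is the only estimate
  that reaches down to step zero.\<close>

lemma fgrad_bounded:
 assumes m: "admissible m" shows "fgrad m <= 4 * L\<^sup>2"
proof -
 have fm: "fsupp m" using m by (simp add: admissible_def)
 have "shift_nsq 1 m <= 2 * (nsq (%j. m (j + 1)) + nsq m)"
  unfolding shift_nsq_def using nsq_diff_le[of "%j. m (j + 1)" m] fm by simp
 also have "... <= 4" using nsq_window_le[OF m, of "Suc 0"] by simp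
 finally have "L\<^sup>2 * shift_nsq 1 m <= L\<^sup>2 * 4" by (intro mult_left_mono) auto
 then show ?thesis using fgrad_le(1)[OF m] by simp
qed

text \<open>Over the second half of the time interval the summed gradients are bounded by the energy
  at its beginning, which is of order n^(-1/2). The energy of the flow decreases, so its last value
  is at most the average over that half, which gains a further factor 1/n.\<close>

lemma fgrad_decay:
 assumes m: "admissible m" and n: "n \<ge> 1"
 defines "C \<equiv> M * (2 + 4 * M / (r * c)) / b"
 shows "fgrad (evol n m) <= (9 * (M\<^sup>2 * L\<^sup>2 * C / (c * b * r)) + 4 * L\<^sup>2) / (real n * sqrt (real n))"
\<comment> \<open>Halving needs n at least two. The remaining case is \<open>fgrad_bounded\<close>,
  which explains the summand \<open>4 * L\<^sup>2\<close> of the constant.\<close>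
proof (cases "n = 1")
 case True
 have C: "C \<ge> 0" unfolding C_def using consts_pos r_pos by simp
 have "fgrad (evol n m) <= 4 * L\<^sup>2" by (intro fgrad_bounded admissible_evol m)
 also have "... <= 9 * (M\<^sup>2 * L\<^sup>2 * C / (c * b * r)) + 4 * L\<^sup>2" using C consts_pos r_pos by simp
 finally show ?thesis using True by simp
next
 case False
 define k where "k = n div 2"
 have k: "k \<ge> 1" "n <= 3 * k" "2 * k <= n" using n False unfolding k_def by presburger+
 then have k3: "real n <= 3 * real k" by simp
 have C: "C \<ge> 0" unfolding C_def using consts_pos r_pos by simp
 let ?K = "M\<^sup>2 * L\<^sup>2 * C / (c * b * r)"
 have K: "?K \<ge> 0" using C consts_pos r_pos by simp
 have "real k * Qs (flow (evol n m)) = (\<Sum>s<k. Qs (flow (evol n m)))" by simp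
 also have "... <= (\<Sum>s<k. Qs (flow (evol (k + s) m)))"
 proof (rule sum_mono)
  fix s assume "s \<in> {..<k}"
  then show "Qs (flow (evol n m)) <= Qs (flow (evol (k + s) m))"
   using flow_antimono[OF m, of "k + s" "n - (k + s)"] k by simp
 qed
 also have "... <= (\<Sum>s<k. M * (r\<^sup>2 * (L\<^sup>2 * shift_nsq 1 (evol (k + s) m))))"
 proof (rule sum_mono)
  fix s
  have "Qs (flow (evol (k + s) m)) <= M * nsq (flow (evol (k + s) m))"
   by (intro Qs_bounds fsupp_flow fsupp_evol m)
  also have "... <= M * (r\<^sup>2 * (L\<^sup>2 * shift_nsq 1 (evol (k + s) m)))"
   unfolding nsq_flow using consts_pos by (intro mult_left_mono fgrad_le admissible_evol m) auto
  finally show "Qs (flow (evol (k + s) m)) <= M * (r\<^sup>2 * (L\<^sup>2 * shift_nsq 1 (evol (k + s) m)))" .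
 qed
 also have "... = M * (r\<^sup>2 * (L\<^sup>2 * (\<Sum>s<k. shift_nsq 1 (evol (k + s) m))))" by (simp only: sum_distrib_left)
 also have "... <= M * (r\<^sup>2 * (L\<^sup>2 * (M * (C / sqrt (real k)) / (r * c))))"
 proof (intro mult_left_mono)
  have "(\<Sum>s<k. shift_nsq 1 (evol (k + s) m)) <= Qs (evol k m) / (r * c)"
   using shift_sum_le[OF m, of 1 k k] by simp
  also have "Qs (evol k m) <= M * nsq (evol k m)" by (intro Qs_bounds fsupp_evol m)
  also have "... <= M * (C / sqrt (real k))"
   unfolding C_def using consts_pos by (intro mult_left_mono nsq_decay m k) auto
  finally show "(\<Sum>s<k. shift_nsq 1 (evol (k + s) m)) <= M * (C / sqrt (real k)) / (r * c)"
   using r_pos consts_pos by (simp add: divide_right_mono)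
 qed (use consts_pos in auto)
 finally have "real k * Qs (flow (evol n m)) <= M * (r\<^sup>2 * (L\<^sup>2 * (M * (C / sqrt (real k)) / (r * c))))" .
 moreover have "real k * (b * (r\<^sup>2 * fgrad (evol n m))) <= real k * Qs (flow (evol n m))"
  using Qs_bounds(1)[OF fsupp_flow[OF fsupp_evol[OF m, of n]]] unfolding nsq_flow by (intro mult_left_mono) auto
 ultimately have "real k * (b * (r\<^sup>2 * fgrad (evol n m))) <= M * (r\<^sup>2 * (L\<^sup>2 * (M * (C / sqrt (real k)) / (r * c))))"
  by (rule order_trans[rotated])
 also have "... = (b * r\<^sup>2) * (?K / sqrt (real k))"
  using consts_pos r_pos by (simp add: field_simps power2_eq_square)
 finally have "(b * r\<^sup>2) * (real k * fgrad (evol n m)) <= (b * r\<^sup>2) * (?K / sqrt (real k))" by (simp add: mult_ac)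
 then have "real k * fgrad (evol n m) <= ?K / sqrt (real k)"
  by (rule mult_left_le_imp_le) (use consts_pos r_pos in simp)
 then have "(real k * fgrad (evol n m)) * sqrt (real k) <= ?K" using k by (subst (asm) pos_le_divide_eq) auto
 then have 1: "real k * sqrt (real k) * fgrad (evol n m) <= ?K" by (simp only: mult_ac)
 \<comment> \<open>Uses n <= 3 k in one factor and n <= 9 k under the root; the perfect square makes
   the root rational and gives the factor 9 of the statement.\<close>
 have "real n * sqrt (real n) <= (3 * real k) * sqrt (9 * real k)"
  using k k3 by (intro mult_mono real_sqrt_le_mono) auto
 also have "... = 9 * (real k * sqrt (real k))" by (simp add: real_sqrt_mult)
 finally have "real n * sqrt (real n) * fgrad (evol n m) <= 9 * (real k * sqrt (real k)) * fgrad (evol n m)"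
  by (intro mult_right_mono) (simp_all add: fgrad_def)
 also have "... <= 9 * ?K + 4 * L\<^sup>2" using 1 by (simp add: add_increasing2)
 finally show ?thesis using n by (simp add: field_simps)
qed

lemma decay_ex:
 "\<exists>C>0. \<forall>m. admissible m --> fgrad m <= C & (\<forall>n\<ge>1. nsq (evol n m) <= C / sqrt (real n)
  & shift_nsq 1 (evol n m) <= C / (real n * sqrt (real n))
  & fgrad (evol n m) <= C / (real n * sqrt (real n)))"
proof -
 define A where "A = M * (2 + 4 * M / (r * c)) / b"
 define B where "B = 9 * (M\<^sup>2 * L\<^sup>2 * A / (c * b * r)) + 4 * L\<^sup>2"
 define C where "C = A + (1 + (M / c)\<^sup>2) * B"
 have pos: "A > 0" "B > 0" unfolding A_def B_def using consts_pos r_pos by (simp_all add: add_pos_pos add_nonneg_pos)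
 have "A <= C" "B <= C" "(M / c)\<^sup>2 * B <= C" "C > 0"
  unfolding C_def using pos by (simp_all add: distrib_right add_pos_nonneg)
 have BL: "4 * L\<^sup>2 <= B" unfolding B_def using pos consts_pos r_pos by simp
 show ?thesis
 proof (intro exI[of _ C] conjI allI impI \<open>C > 0\<close>)
  fix m assume m: "admissible m"
  show "fgrad m <= C" using fgrad_bounded[OF m] BL \<open>B <= C\<close> by linarith
  fix n :: nat assume n: "n \<ge> 1"
  have "nsq (evol n m) <= A / sqrt (real n)" using nsq_decay[OF m n] by (simp add: A_def)
  then show "nsq (evol n m) <= C / sqrt (real n)"
   using \<open>A <= C\<close> by (meson divide_right_mono order_trans real_sqrt_ge_zero of_nat_0_le_iff)
  have f: "fgrad (evol n m) <= B / (real n * sqrt (real n))"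
   using fgrad_decay[OF m n] by (simp add: A_def B_def)
  then show "fgrad (evol n m) <= C / (real n * sqrt (real n))"
   using \<open>B <= C\<close> by (meson divide_right_mono order_trans real_sqrt_ge_zero of_nat_0_le_iff mult_nonneg_nonneg)
  have "shift_nsq 1 (evol n m) <= (M / c)\<^sup>2 * (B / (real n * sqrt (real n)))"
   using fgrad_le(2)[OF admissible_evol[OF m, of n]] mult_left_mono[OF f, of "(M / c)\<^sup>2"] by simp
  also have "... = ((M / c)\<^sup>2 * B) / (real n * sqrt (real n))" by simp
  also have "... <= C / (real n * sqrt (real n))"
   using \<open>(M / c)\<^sup>2 * B <= C\<close> by (intro divide_right_mono) auto
  finally show "shift_nsq 1 (evol n m) <= C / (real n * sqrt (real n))" .
 qed
qed

text \<open>One constant for all decay estimates and all admissible data. It depends only on the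
  parameters of the locale and so stays fixed when mesh and initial datum vary.\<close>

definition "K = (SOME C. C > 0 & (\<forall>m. admissible m --> fgrad m <= C & (\<forall>n\<ge>1. nsq (evol n m) <= C / sqrt (real n)
  & shift_nsq 1 (evol n m) <= C / (real n * sqrt (real n))
  & fgrad (evol n m) <= C / (real n * sqrt (real n)))))"

lemma K_pos: "K > 0"
 and fgrad_le_K: "admissible m ==> fgrad m <= K"
 and nsq_evol_le: "admissible m ==> n \<ge> 1 ==> nsq (evol n m) <= K / sqrt (real n)"
 and shift_nsq_evol_le: "admissible m ==> n \<ge> 1 ==> shift_nsq 1 (evol n m) <= K / (real n * sqrt (real n))"
 and fgrad_evol_le: "admissible m ==> n \<ge> 1 ==> fgrad (evol n m) <= K / (real n * sqrt (real n))"
 using someI_ex[OF decay_ex, folded K_def] by blast+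

end

section \<open>Pointwise bounds, Hoelder continuity and weak continuity at time zero\<close>

context monotone_flux
begin

text \<open>Agmon's inequality between the two decay rates: the geometric mean of n^(-1/2) and
  n^(-3/2) is 1/n.\<close>

lemma norm2_evol_le:
 assumes m: "admissible m" and n: "n \<ge> 1"
 shows "(norm (evol n m j))\<^sup>2 <= 2 * K / real n"
proof -
 have "(norm (evol n m j))\<^sup>2 <= 2 * (sqrt (nsq (evol n m)) * sqrt (shift_nsq 1 (evol n m)))"
  using discrete_agmon[OF fsupp_evol[OF m, of n], of j] by (simp add: shift_nsq_def)
 also have "... <= 2 * (sqrt (K / sqrt (real n)) * sqrt (K / (real n * sqrt (real n))))"
  by (intro mult_left_mono mult_mono real_sqrt_le_mono nsq_evol_le shift_nsq_evol_le m n)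
   (simp_all add: shift_nsq_nonneg K_pos less_imp_le)
 also have "sqrt (K / sqrt (real n)) * sqrt (K / (real n * sqrt (real n))) = sqrt ((K / real n)\<^sup>2)"
  unfolding real_sqrt_mult[symmetric] using n by (simp add: power2_eq_square field_simps)
 finally show ?thesis using K_pos by simp
qed

lemma norm2_evol_shift_le:
 assumes m: "admissible m" and n: "n \<ge> 1"
 shows "(norm (evol n m (j + int k) - evol n m j))\<^sup>2 <= real k * (K / (real n * sqrt (real n)))"
proof -
 let ?m = "evol n m"
 have "(norm (?m (j + int k) - ?m j))\<^sup>2 <= real k * nsq (%j. ?m (j + 1) - ?m j)"
  using sum_blocks_le[of "%i. j + int i * int k" k ?m 1] fsupp_evol[OF m, of n]
  by (simp add: algebra_simps)
 also have "... <= real k * (K / (real n * sqrt (real n)))"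
  using shift_nsq_evol_le[OF m n] by (intro mult_left_mono) (auto simp: shift_nsq_def)
 finally show ?thesis .
qed

text \<open>The increment over l steps is the gradient of the accumulated flow W. The squared norm
  of W grows like l^2 while that of its second difference stays bounded in l, so interpolation gives
  a bound linear in l.\<close>

lemma nsq_evol_time_le:
 assumes m: "admissible m" and n: "n \<ge> 1"
 shows "nsq (%j. evol (n + l) m j - evol n m j) <= 2 * r * K * real l / (real n * sqrt (real n))"
proof -
 let ?X = "%n. real n * sqrt (real n)"
 have X: "?X n > 0" using n by simp
 have Xmono: "K / ?X (n + s) <= K / ?X n" for s
  using n K_pos by (intro divide_left_mono mult_mono real_sqrt_le_mono) auto
 define W where "W = (%j. \<Sum>s<l. flow (evol (n + s) m) j)"
 have fW: "fsupp W" unfolding W_def by (intro fsupp_sum fsupp_flow fsupp_evol m)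
 have gW: "W (j + 1) - W j = evol (n + l) m j - evol n m j" for j
 proof -
  have "W (j + 1) - W j = (\<Sum>s<l. evol (n + Suc s) m j - evol (n + s) m j)"
   by (simp add: W_def sum_subtractf[symmetric] flow_diff)
  also have "... = evol (n + l) m j - evol n m j"
   using sum_lessThan_telescope[of "%s. evol (n + s) m j" l] by simp
  finally show ?thesis .
 qed
 have "nsq W <= real (card {..<l}) * (\<Sum>s<l. nsq (flow (evol (n + s) m)))"
  unfolding W_def by (intro nsq_sum_le fsupp_flow fsupp_evol m)
 also have "... <= real (card {..<l}) * (\<Sum>s<l. r\<^sup>2 * (K / ?X n))"
 proof (intro mult_left_mono sum_mono)
  fix s
  have "fgrad (evol (n + s) m) <= K / ?X n"
   using fgrad_evol_le[OF m, of "n + s"] Xmono[of s] n by simp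
  then show "nsq (flow (evol (n + s) m)) <= r\<^sup>2 * (K / ?X n)"
   unfolding nsq_flow by (intro mult_left_mono) auto
 qed simp
 finally have W: "nsq W <= (real l * r)\<^sup>2 * (K / ?X n)" by (simp add: power2_eq_square mult_ac)
 let ?g = "%n j. evol n m (j + 1) - evol n m j"
 have "nsq (%j. (W (j + 2) - W (j + 1)) - (W (j + 1) - W j)) = nsq (%j. ?g (n + l) j - ?g n j)"
 proof -
  have "W (j + 2) - W (j + 1) = evol (n + l) m (j + 1) - evol n m (j + 1)" for j
   using gW[of "j + 1"] by (simp add: add.assoc)
  then show ?thesis by (simp only: gW) (simp add: algebra_simps)
 qed
 also have "... <= 2 * (nsq (?g (n + l)) + nsq (?g n))"
  by (intro nsq_diff_le fsupp_diff) (simp_all add: fsupp_evol m)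
 also have "... <= 2 * (K / ?X n + K / ?X n)"
 proof (intro mult_left_mono add_mono)
  show "nsq (?g (n + l)) <= K / ?X n"
   using shift_nsq_evol_le[OF m, of "n + l"] Xmono[of l] n by (simp add: shift_nsq_def)
  show "nsq (?g n) <= K / ?X n" using shift_nsq_evol_le[OF m n] by (simp add: shift_nsq_def)
 qed simp
 finally have D: "nsq (%j. (W (j + 2) - W (j + 1)) - (W (j + 1) - W j)) <= 2\<^sup>2 * (K / ?X n)" by simp
 have "nsq (%j. evol (n + l) m j - evol n m j) <= sqrt (nsq W) * sqrt (nsq (%j. (W (j + 2) - W (j + 1)) - (W (j + 1) - W j)))"
  using nsq_gradient_eq[OF fW] by (simp add: gW)
 also have "... <= sqrt ((real l * r)\<^sup>2 * (K / ?X n)) * sqrt (2\<^sup>2 * (K / ?X n))"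
  using K_pos by (intro mult_mono real_sqrt_le_mono W D) auto
 also have "... = (real l * r) * 2 * (sqrt (K / ?X n) * sqrt (K / ?X n))"
 proof -
  have "sqrt (a\<^sup>2 * z) * sqrt (2\<^sup>2 * z) = a * 2 * (sqrt z * sqrt z)" if "a \<ge> 0" for a z :: real
   using that by (simp add: real_sqrt_mult del: real_sqrt_mult_self)
  then show ?thesis by this (use r_pos in simp)
 qed
 also have "sqrt (K / ?X n) * sqrt (K / ?X n) = K / ?X n"
  using K_pos X by (simp only: real_sqrt_mult_self) simp
 finally show ?thesis by (simp add: mult_ac)
qed

text \<open>Agmon's inequality for the time increment: its squared norm is linear in l and that of
  its gradient is bounded in l, so its supremum is of order l^(1/4). The factor 6 rounds up 2 sqrt
  8.\<close>

lemma norm2_evol_time_le: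
 assumes m: "admissible m" and n: "n \<ge> 1"
 shows "(norm (evol (n + l) m j - evol n m j))\<^sup>2 <= (6 * sqrt r * K) * sqrt (real l) / (real n * sqrt (real n))"
proof -
 let ?X = "%n. real n * sqrt (real n)"
 have X: "?X n > 0" using n by simp
 let ?q = "%j. evol (n + l) m j - evol n m j"
 let ?g = "%n j. evol n m (j + 1) - evol n m j"
 have "K / ?X (n + l) <= K / ?X n"
  using n K_pos by (intro divide_left_mono mult_mono real_sqrt_le_mono) auto
 then have "nsq (?g (n + l)) <= K / ?X n"
  using shift_nsq_evol_le[OF m, of "n + l"] n by (simp add: shift_nsq_def)
 moreover have "nsq (?g n) <= K / ?X n" using shift_nsq_evol_le[OF m n] by (simp add: shift_nsq_def)
 ultimately have g: "nsq (?g (n + l)) + nsq (?g n) <= K / ?X n + K / ?X n" by (rule add_mono)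
 have "nsq (%j. ?q (j + 1) - ?q j) = nsq (%j. ?g (n + l) j - ?g n j)" by (simp add: algebra_simps)
 also have "... <= 2 * (nsq (?g (n + l)) + nsq (?g n))"
  by (intro nsq_diff_le fsupp_diff) (simp_all add: fsupp_evol m)
 also have "... <= 4 * (K / ?X n)" using g by simp
 finally have D: "nsq (%j. ?q (j + 1) - ?q j) <= 4 * (K / ?X n)" .
 have "(norm (?q j))\<^sup>2 <= 2 * (sqrt (nsq ?q) * sqrt (nsq (%j. ?q (j + 1) - ?q j)))"
  by (intro discrete_agmon fsupp_diff fsupp_evol m)
 also have "... <= 2 * (sqrt (2 * r * K * real l / ?X n) * sqrt (4 * (K / ?X n)))"
  using r_pos K_pos by (intro mult_left_mono mult_mono real_sqrt_le_mono nsq_evol_time_le m n D) auto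
 also have "sqrt (2 * r * K * real l / ?X n) * sqrt (4 * (K / ?X n)) = sqrt (8 * (r * real l) * (K / ?X n)\<^sup>2)"
  unfolding real_sqrt_mult[symmetric] by (simp add: power2_eq_square field_simps)
 also have "... = sqrt 8 * (sqrt r * sqrt (real l)) * (K / ?X n)"
  using K_pos X by (simp only: real_sqrt_mult real_sqrt_abs) simp
 also have "... <= 3 * (sqrt r * sqrt (real l)) * (K / ?X n)"
  using K_pos X r_pos by (intro mult_right_mono real_le_lsqrt) auto
 finally show ?thesis by (simp add: mult_ac)
qed

text \<open>One step changes the pairing by r times the flux gradient paired with the increments of
  \<psi>. The flux gradients have norms of order k^(-3/4), whose sums grow like n^(1/4); step zero
  has only a uniform bound and accounts for the summand 1.\<close>

lemma evol_weak_le: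
 fixes \<psi> :: "int => real^'d"
 assumes m: "admissible m" and S: "!!A. finite A ==> (\<Sum>j\<in>A. (norm (\<psi> (j + 1) - \<psi> j))\<^sup>2) <= S"
 shows "\<bar>zs (%j. \<psi> j \<bullet> evol n m j) - zs (%j. \<psi> j \<bullet> m j)\<bar> <= r * (sqrt K * sqrt S) * (1 + 4 * sqrt (sqrt (real n)))"
proof -
 have fs: "fsupp (%j. \<psi> (j + i) \<bullet> u j)" if "fsupp u" for u i by (rule fsupp_subset[OF that]) simp
 have fs0: "fsupp (%j. \<psi> j \<bullet> u j)" if "fsupp u" for u by (rule fsupp_subset[OF that]) simp
 have step: "\<bar>zs (%j. \<psi> j \<bullet> evol (Suc k) m j) - zs (%j. \<psi> j \<bullet> evol k m j)\<bar> <= r * (sqrt (fgrad (evol k m)) * sqrt S)" for k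
 proof -
  let ?m = "evol k m"
  have fm: "fsupp ?m" by (rule fsupp_evol[OF m])
  define g where "g = (%j. F (?m (j + 1)) - F (?m j))"
  have g: "fsupp g" unfolding g_def by (intro fsupp_diff fsupp_F) (simp_all add: fm)
  have gs: "fsupp (%j. g (j - 1))" by (simp add: g)
  have eq: "\<psi> j \<bullet> step ?m j = \<psi> j \<bullet> ?m j + r * (\<psi> j \<bullet> g j - \<psi> j \<bullet> g (j - 1))" for j
   unfolding step_def g_def inner_add_right inner_scaleR_right inner_diff_right by simp
  have d: "fsupp (%j. \<psi> j \<bullet> g j - \<psi> j \<bullet> g (j - 1))" by (intro fsupp_diff fs0 g gs)
  have rd: "fsupp (%j. r * (\<psi> j \<bullet> g j - \<psi> j \<bullet> g (j - 1)))" by (rule fsupp_subset[OF d]) simp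
  have "zs (%j. \<psi> j \<bullet> step ?m j) = zs (%j. \<psi> j \<bullet> ?m j) + r * (zs (%j. \<psi> j \<bullet> g j) - zs (%j. \<psi> j \<bullet> g (j - 1)))"
   unfolding eq by (subst zs_add[OF fs0[OF fm] rd], subst zs_cmult, subst zs_diff[OF fs0[OF g] fs0[OF gs]]) simp
  also have "zs (%j. \<psi> j \<bullet> g (j - 1)) = zs (%j. \<psi> (j + 1) \<bullet> g j)"
   using zs_shift[of "%j. \<psi> j \<bullet> g (j - 1)" 1] by simp
  also have "zs (%j. \<psi> j \<bullet> g j) - zs (%j. \<psi> (j + 1) \<bullet> g j) = - zs (%j. g j \<bullet> (\<psi> (j + 1) - \<psi> j))"
   using zs_diff[OF fs[OF g, of 1] fs0[OF g]] by (simp add: inner_diff_right inner_commute)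
  finally have "\<bar>zs (%j. \<psi> j \<bullet> step ?m j) - zs (%j. \<psi> j \<bullet> ?m j)\<bar> = r * \<bar>zs (%j. g j \<bullet> (\<psi> (j + 1) - \<psi> j))\<bar>"
   using r_pos by (simp add: abs_mult)
  also have "... <= r * (sqrt (nsq g) * sqrt S)"
   using r_pos by (intro mult_left_mono zs_inner_le g S) auto
  finally show ?thesis by (simp add: g_def fgrad_def)
 qed
 have S0: "0 <= S" using S[of "{}"] by simp
 have bound: "sqrt (fgrad (evol k m)) <= sqrt K * (if k = 0 then 1 else 1 / sqrt (real k * sqrt (real k)))" for k
 proof (cases "k = 0")
  case True
  then show ?thesis using fgrad_le_K[OF m] by simp
 next
  case False
  then have "sqrt (fgrad (evol k m)) <= sqrt (K / (real k * sqrt (real k)))"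
   by (intro real_sqrt_le_mono fgrad_evol_le m) simp
  then show ?thesis using False by (simp add: real_sqrt_divide)
 qed
 have "\<bar>zs (%j. \<psi> j \<bullet> evol n m j) - zs (%j. \<psi> j \<bullet> m j)\<bar>
   <= (\<Sum>k<n. r * (sqrt (fgrad (evol k m)) * sqrt S))"
 proof (induction n)
  case (Suc n)
  then show ?case using step[of n] by simp
 qed simp
 also have "... <= (\<Sum>k<n. r * (sqrt K * (if k = 0 then 1 else 1 / sqrt (real k * sqrt (real k))) * sqrt S))"
  using r_pos S0 by (intro sum_mono mult_left_mono mult_right_mono bound) auto
 also have "... = r * (sqrt K * sqrt S) * (\<Sum>k<n. if k = 0 then 1 else 1 / sqrt (real k * sqrt (real k)))"
  unfolding sum_distrib_left by (intro sum.cong refl) simp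
 also have "... <= r * (sqrt K * sqrt S) * (1 + 4 * sqrt (sqrt (real n)))"
 proof (intro mult_left_mono)
  show "(\<Sum>k<n. if k = 0 then 1 else 1 / sqrt (real k * sqrt (real k))) <= 1 + 4 * sqrt (sqrt (real n))"
  proof (cases n)
   case (Suc p)
   have "(\<Sum>k<Suc p. if k = 0 then 1 else 1 / sqrt (real k * sqrt (real k)))
    = 1 + (\<Sum>s<p. 1 / sqrt (real (Suc s) * sqrt (real (Suc s))))"
    by (subst sum.lessThan_Suc_shift) simp
   also have "... <= 1 + 4 * sqrt (sqrt (real p))" by (intro add_left_mono sum_inverse_sqrt3_le)
   also have "... <= 1 + 4 * sqrt (sqrt (real n))" by (simp add: Suc)
   finally show ?thesis by (simp only: Suc)
  qed simp
 qed (use r_pos K_pos S0 in auto)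
 finally show ?thesis .
qed

end

section \<open>Passage to the continuum\<close>

lemma floor_grid_le:
 fixes x y e :: real
 assumes "x <= y" "e > 0"
 shows "\<lfloor>x / e\<rfloor> <= \<lfloor>y / e\<rfloor>" "real_of_int (\<lfloor>y / e\<rfloor> - \<lfloor>x / e\<rfloor>) <= (y - x) / e + 1"
proof -
 show "\<lfloor>x / e\<rfloor> <= \<lfloor>y / e\<rfloor>" using assms by (intro floor_mono divide_right_mono) auto
 show "real_of_int (\<lfloor>y / e\<rfloor> - \<lfloor>x / e\<rfloor>) <= (y - x) / e + 1"
  unfolding diff_divide_distrib of_int_diff by linarith
qed

locale grid_limit = monotone_flux F G L c b M
 for F :: "real^'d => real^'d" and G L c b M +
 fixes m0 :: "nat => int => real^'d" and eps :: "nat => real"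
 assumes adm: "!!k. admissible (m0 k)"
  and eps_pos: "!!k. eps k > 0"
  and eps_lim: "eps \<longlonglongrightarrow> 0"
begin

text \<open>One step adds r times the second difference of F, while the equation has the factor 1/2
  in front of the second derivative. At mesh \<open>eps k\<close> a step therefore lasts 2 r
  eps^2.\<close>

definition "tau k = 2 * r * (eps k)\<^sup>2"
definition "steps k t = nat \<lfloor>t / tau k\<rfloor>"
definition "grid k t = evol (steps k t) (m0 k)"
text \<open>Lattice values are masses of cells; division by the cell width turns them into
  densities.\<close>

definition approx_sol :: "nat => real => real => real^'d" where
 "approx_sol k t x = (1 / eps k) *\<^sub>R grid k t \<lfloor>x / eps k\<rfloor>"

lemma tau_pos: "tau k > 0"
 using r_pos eps_pos[of k] by (simp add: tau_def)

lemma tau_lim: "tau \<longlonglongrightarrow> 0"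
 unfolding tau_def by (rule tendsto_eq_intros eps_lim refl | simp)+

lemma tau_eventually: "t > 0 ==> eventually (%k. tau k <= t) sequentially"
 by (rule eventually_mono[OF order_tendstoD(2)[OF tau_lim]]) auto

text \<open>Chosen so that the bound 2 tau / t for the inverse number of steps becomes (\<theta>
  eps)^2 / t, see \<open>steps_inverse\<close>.\<close>

definition "\<theta> = 2 * sqrt r"

lemma theta_pos: "\<theta> > 0"
 using r_pos by (simp add: \<theta>_def)

text \<open>Rounding down loses at most half of t / tau once that quotient is at least one.\<close>

lemma steps_bounds:
 assumes "tau k <= t"
 shows "steps k t \<ge> 1" "t / (2 * tau k) <= real (steps k t)" "real (steps k t) <= t / tau k"
proof -
 have 1: "1 <= t / tau k" using assms tau_pos[of k] by simp
 then have "1 <= \<lfloor>t / tau k\<rfloor>" by (simp add: le_floor_iff)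
 then show "steps k t \<ge> 1" by (simp add: steps_def nat_le_eq_zle le_nat_iff)
 have e: "real (steps k t) = real_of_int \<lfloor>t / tau k\<rfloor>" unfolding steps_def using \<open>1 <= \<lfloor>t / tau k\<rfloor>\<close> by simp
 show "real (steps k t) <= t / tau k" unfolding e by linarith
 have half: "z / 2 <= real_of_int \<lfloor>z\<rfloor>" if "1 <= z" "1 <= \<lfloor>z\<rfloor>" for z :: real using that by linarith
 have "t / (2 * tau k) = (t / tau k) / 2" by simp
 also have "... <= real (steps k t)" unfolding e by (rule half) (use 1 \<open>1 <= \<lfloor>t / tau k\<rfloor>\<close> in auto)
 finally show "t / (2 * tau k) <= real (steps k t)" .
qed

lemma steps_inverse:
 assumes "tau k <= t"
 shows "1 / real (steps k t) <= (\<theta> * eps k)\<^sup>2 / t" "1 / sqrt (real (steps k t)) <= \<theta> * eps k / sqrt t"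
  "1 / (real (steps k t) * sqrt (real (steps k t))) <= (\<theta> * eps k) ^ 3 / (t * sqrt t)"
proof -
 have t: "t > 0" using assms tau_pos[of k] by simp
 have "1 / real (steps k t) <= 1 / (t / (2 * tau k))"
  using steps_bounds[OF assms] t tau_pos[of k] by (intro divide_left_mono) auto
 also have "... = (\<theta> * eps k)\<^sup>2 / t" using r_pos by (simp add: tau_def \<theta>_def power_mult_distrib)
 finally show 1: "1 / real (steps k t) <= (\<theta> * eps k)\<^sup>2 / t" .
 then have "sqrt (1 / real (steps k t)) <= sqrt ((\<theta> * eps k)\<^sup>2 / t)" by (rule real_sqrt_le_mono)
 then show 2: "1 / sqrt (real (steps k t)) <= \<theta> * eps k / sqrt t"
  using theta_pos eps_pos[of k] by (simp add: real_sqrt_divide)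
 have "1 / real (steps k t) * (1 / sqrt (real (steps k t))) <= (\<theta> * eps k)\<^sup>2 / t * (\<theta> * eps k / sqrt t)"
  using t by (intro mult_mono 1 2) auto
 then show "1 / (real (steps k t) * sqrt (real (steps k t))) <= (\<theta> * eps k) ^ 3 / (t * sqrt t)"
  by (simp add: power2_eq_square power3_eq_cube mult_ac)
qed

lemma norm2_approx_sol_le:
 assumes "tau k <= t" shows "(norm (approx_sol k t x))\<^sup>2 <= 2 * K * \<theta>\<^sup>2 / t"
proof -
 have "(norm (approx_sol k t x))\<^sup>2 = (norm (grid k t \<lfloor>x / eps k\<rfloor>))\<^sup>2 / (eps k)\<^sup>2"
  by (simp add: approx_sol_def power_divide)
 also have "... <= (2 * K * (1 / real (steps k t))) / (eps k)\<^sup>2"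
  using norm2_evol_le[OF adm steps_bounds(1)[OF assms], of k "\<lfloor>x / eps k\<rfloor>"]
  by (intro divide_right_mono) (auto simp: grid_def)
 also have "... <= (2 * K * ((\<theta> * eps k)\<^sup>2 / t)) / (eps k)\<^sup>2"
  using K_pos by (intro divide_right_mono mult_left_mono steps_inverse assms) auto
 also have "... = 2 * K * \<theta>\<^sup>2 / t" using eps_pos[of k] by (simp add: power_mult_distrib)
 finally show ?thesis .
qed

lemma norm2_sum_le: "(norm (x + y))\<^sup>2 <= 2 * (norm x)\<^sup>2 + 2 * (norm y)\<^sup>2" for x y :: "'a::real_normed_vector"
proof -
 have "(norm (x + y))\<^sup>2 <= (norm x + norm y)\<^sup>2" by (intro power_mono norm_triangle_ineq) simp
 also have "... <= 2 * (norm x)\<^sup>2 + 2 * (norm y)\<^sup>2" using sum_squares_bound[of "norm x" "norm y"] by (simp add: power2_sum)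
 finally show ?thesis .
qed

text \<open>The powers of the mesh cancel: 1 / eps^2 from the densities, eps^3 from the decay rate,
  1 / eps from counting cells. The additional \<open>eps k\<close> accounts for rounding to
  cells.\<close>

lemma approx_sol_space_le:
 assumes t: "tau k <= t" and xy: "x <= y"
 shows "(norm (approx_sol k t y - approx_sol k t x))\<^sup>2 <= K * \<theta> ^ 3 * (y - x + eps k) / (t * sqrt t)"
proof -
 have e: "eps k > 0" by (rule eps_pos)
 let ?n = "real (steps k t) * sqrt (real (steps k t))"
 have tp: "t > 0" using t tau_pos[of k] by simp
 define i where "i = nat (\<lfloor>y / eps k\<rfloor> - \<lfloor>x / eps k\<rfloor>)"
 have i: "\<lfloor>y / eps k\<rfloor> = \<lfloor>x / eps k\<rfloor> + int i" "real i <= (y - x) / eps k + 1"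
  using floor_grid_le[OF xy e] by (simp_all add: i_def)
 have "(norm (approx_sol k t y - approx_sol k t x))\<^sup>2
   = (norm (grid k t (\<lfloor>x / eps k\<rfloor> + int i) - grid k t \<lfloor>x / eps k\<rfloor>))\<^sup>2 / (eps k)\<^sup>2"
  using e by (simp add: approx_sol_def i scaleR_diff_right[symmetric] power_divide del: scaleR_diff_right)
 also have "... <= (real i * (K * (1 / ?n))) / (eps k)\<^sup>2"
  using norm2_evol_shift_le[OF adm steps_bounds(1)[OF t], of k "\<lfloor>x / eps k\<rfloor>" i]
  by (intro divide_right_mono) (auto simp: grid_def)
 also have "... <= (((y - x) / eps k + 1) * (K * ((\<theta> * eps k) ^ 3 / (t * sqrt t)))) / (eps k)\<^sup>2"
  using K_pos xy e i(2) by (intro divide_right_mono mult_mono mult_left_mono steps_inverse t) auto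
 also have "... = K * \<theta> ^ 3 * (y - x + eps k) / (t * sqrt t)"
  using e tp by (simp add: field_simps power2_eq_square power3_eq_cube)
 finally show ?thesis .
qed

lemma steps_diff:
 assumes "tau k <= t" "t <= s"
 obtains l where "steps k s = steps k t + l" "real l <= (s - t + tau k) / tau k"
proof
 have le: "\<lfloor>t / tau k\<rfloor> <= \<lfloor>s / tau k\<rfloor>" using floor_grid_le(1)[OF assms(2) tau_pos] .
 have "0 <= \<lfloor>t / tau k\<rfloor>" using assms tau_pos[of k] by simp
 then show "steps k s = steps k t + nat (\<lfloor>s / tau k\<rfloor> - \<lfloor>t / tau k\<rfloor>)"
  using le by (simp add: steps_def nat_add_distrib[symmetric])
 show "real (nat (\<lfloor>s / tau k\<rfloor> - \<lfloor>t / tau k\<rfloor>)) <= (s - t + tau k) / tau k"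
  using le floor_grid_le(2)[OF assms(2) tau_pos, of k] tau_pos[of k] by (simp add: add_divide_distrib)
qed

lemma approx_sol_time_le:
 assumes t: "tau k <= t" and ts: "t <= s"
 shows "(norm (approx_sol k s x - approx_sol k t x))\<^sup>2 <= 6 * K * \<theta>\<^sup>2 * sqrt (s - t + tau k) / (t * sqrt t)"
proof -
 have e: "eps k > 0" by (rule eps_pos)
 have tp: "t > 0" using t tau_pos[of k] by simp
 let ?n = "real (steps k t) * sqrt (real (steps k t))"
 obtain l where l: "steps k s = steps k t + l" "real l <= (s - t + tau k) / tau k"
  using steps_diff[OF t ts] by blast
 have st: "sqrt (tau k) = sqrt 2 * sqrt r * eps k" using e by (simp add: tau_def real_sqrt_mult)
 have "(norm (approx_sol k s x - approx_sol k t x))\<^sup>2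
   = (norm (grid k s \<lfloor>x / eps k\<rfloor> - grid k t \<lfloor>x / eps k\<rfloor>))\<^sup>2 / (eps k)\<^sup>2"
  using e by (simp add: approx_sol_def scaleR_diff_right[symmetric] power_divide del: scaleR_diff_right)
 also have "... <= ((6 * sqrt r * K) * sqrt (real l) * (1 / ?n)) / (eps k)\<^sup>2"
  using norm2_evol_time_le[OF adm steps_bounds(1)[OF t], of l k "\<lfloor>x / eps k\<rfloor>"]
  by (intro divide_right_mono) (auto simp: grid_def l)
 also have "... <= ((6 * sqrt r * K) * sqrt ((s - t + tau k) / tau k) * ((\<theta> * eps k) ^ 3 / (t * sqrt t))) / (eps k)\<^sup>2"
  using K_pos r_pos ts tau_pos[of k]
  by (intro divide_right_mono mult_mono mult_left_mono steps_inverse t real_sqrt_le_mono l) auto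
 also have "sqrt ((s - t + tau k) / tau k) = sqrt (s - t + tau k) / (sqrt 2 * sqrt r * eps k)"
  by (simp only: real_sqrt_divide st)
 also have "((6 * sqrt r * K) * (sqrt (s - t + tau k) / (sqrt 2 * sqrt r * eps k)) * ((\<theta> * eps k) ^ 3 / (t * sqrt t))) / (eps k)\<^sup>2
   = (6 * K * \<theta> ^ 3 * sqrt (s - t + tau k) / (t * sqrt t)) * (1 / sqrt 2)"
 proof -
  have "((6 * a * K) * (S / (q * a * z)) * ((\<theta> * z) ^ 3 / X)) / z\<^sup>2 = (6 * K * \<theta> ^ 3 * S / X) * (1 / q)"
   if "a > 0" "z > 0" "X > 0" "q > 0" for a S z X q :: real
   using that by (simp add: field_simps power2_eq_square power3_eq_cube)
  then show ?thesis using r_pos e tp by simp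
 qed
 finally have 1: "(norm (approx_sol k s x - approx_sol k t x))\<^sup>2
  <= (6 * K * \<theta> ^ 3 * sqrt (s - t + tau k) / (t * sqrt t)) * (1 / sqrt 2)" .
 \<comment> \<open>What remains is \<theta>^3 / sqrt 2 <= \<theta>^2, that is r <= 1/2. This holds
   because F preserves totals, which forces L >= 1.\<close>
 show ?thesis
 proof -
  have "\<theta> <= sqrt 2"
  proof -
   have "r <= 1 / 2"
   proof -
    have "1 <= L"
    proof -
     let ?x = "axis undefined 1 :: real^'d"
     have x: "?x \<in> nonneg" by (auto simp: nonneg_def axis_def)
     have t1: "total ?x = 1" by (simp add: total_def axis_def)
     have "1 = total (F ?x)" using total_F[OF x] t1 by simp
     also have "... <= (\<Sum>i\<in>UNIV. L * ?x $ i)" unfolding total_def by (intro sum_mono F_component_le x)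
     also have "... = L" using t1 by (simp add: sum_distrib_left[symmetric] total_def)
     finally show ?thesis .
    qed
    then have "2 * r <= 2 * L * r" using r_pos by simp
    then show ?thesis using r_le(2) by simp
   qed
   then have "sqrt (4 * r) <= sqrt 2" by (intro real_sqrt_le_mono) simp
   then show ?thesis by (simp add: \<theta>_def real_sqrt_mult)
  qed
  then have "\<theta> ^ 3 * (1 / sqrt 2) <= \<theta>\<^sup>2"
   using theta_pos by (simp add: power2_eq_square power3_eq_cube divide_le_eq)
  then have "(6 * K * sqrt (s - t + tau k) / (t * sqrt t)) * (\<theta> ^ 3 * (1 / sqrt 2)) <= (6 * K * sqrt (s - t + tau k) / (t * sqrt t)) * \<theta>\<^sup>2"
   using K_pos tp ts tau_pos[of k] by (intro mult_left_mono) auto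
  then show ?thesis using 1 by (simp add: mult_ac)
 qed
qed

definition "modulus k t s d = 2 * (6 * K * \<theta>\<^sup>2 * sqrt (s + tau k) / (t * sqrt t)) + 2 * (K * \<theta> ^ 3 * (d + eps k) / (t * sqrt t))"

lemma approx_sol_equicontinuous:
 assumes t: "tau k <= t" and ts: "t <= s"
 shows "(norm (approx_sol k s y - approx_sol k t x))\<^sup>2 <= modulus k t (s - t) \<bar>x - y\<bar>"
proof -
 have sp: "(norm (approx_sol k t y - approx_sol k t x))\<^sup>2 <= K * \<theta> ^ 3 * (\<bar>x - y\<bar> + eps k) / (t * sqrt t)"
 proof (cases "x <= y")
  case True
  then have "\<bar>x - y\<bar> = y - x" by simp
  then show ?thesis using approx_sol_space_le[OF t True] by (simp only:)
 next
  case False then show ?thesis using approx_sol_space_le[OF t, of y x] by (simp add: norm_minus_commute)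
 qed
 have "(norm ((approx_sol k s y - approx_sol k t y) + (approx_sol k t y - approx_sol k t x)))\<^sup>2
  <= 2 * (norm (approx_sol k s y - approx_sol k t y))\<^sup>2 + 2 * (norm (approx_sol k t y - approx_sol k t x))\<^sup>2"
  by (rule norm2_sum_le)
 also have "... <= modulus k t (s - t) \<bar>x - y\<bar>"
  unfolding modulus_def by (intro add_mono mult_left_mono sp approx_sol_time_le t ts) auto
 finally show ?thesis by simp
qed

lemma modulus_lim:
 assumes "d \<ge> 0"
 shows "(%k. modulus k t s d) \<longlonglongrightarrow> 2 * (6 * K * \<theta>\<^sup>2 * sqrt s / (t * sqrt t)) + 2 * (K * \<theta> ^ 3 * d / (t * sqrt t))"
proof -
 show ?thesis unfolding modulus_def divide_inverse
  by (rule tendsto_eq_intros tau_lim eps_lim refl | simp)+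
qed

text \<open>A diagonal subsequence converges at the rational points of positive time, and the common
  modulus of continuity carries convergence to all points. The approximations are step functions
  whose estimates hold only once \<open>tau k <= t\<close>, so the argument of Arzela and Ascoli is
  carried out directly.\<close>

theorem convergent_subsequence:
 obtains \<sigma> p where "strict_mono \<sigma>" "!!t x. t > 0 ==> (%k. approx_sol (\<sigma> k) t x) \<longlonglongrightarrow> p t x"
proof -
 define S where "S = {z::real \<times> real. fst z \<in> \<rat> & snd z \<in> \<rat> & fst z > 0}"
 have "S \<subseteq> \<rat> \<times> \<rat>" by (auto simp: S_def)
 then have "countable S" by (rule countable_subset) (intro countable_SIGMA countable_rat)
 \<comment> \<open>The factor sqrt t makes the bound uniform over all positive times; approximations
   too coarse for the given time are replaced by zero.\<close>
 define f where "f = (%k (z::real \<times> real). if tau k <= fst z then sqrt (fst z) *\<^sub>R approx_sol k (fst z) (snd z) else 0)"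
 have "norm (f k z) <= sqrt (2 * K * \<theta>\<^sup>2)" if "z \<in> S" for k z
 proof (cases "tau k <= fst z")
  case True
  have z: "fst z > 0" using that by (simp add: S_def)
  have "(norm (f k z))\<^sup>2 = fst z * (norm (approx_sol k (fst z) (snd z)))\<^sup>2"
   using True z by (simp add: f_def power_mult_distrib)
  also have "... <= fst z * (2 * K * \<theta>\<^sup>2 / fst z)" using z by (intro mult_left_mono norm2_approx_sol_le True) auto
  also have "... = 2 * K * \<theta>\<^sup>2" using z by simp
  finally show ?thesis by (rule real_le_rsqrt)
 qed (use K_pos in \<open>simp add: f_def\<close>)
 then obtain \<sigma> where \<sigma>: "strict_mono \<sigma>" "!!z. z \<in> S ==> \<exists>l. (%n. f (\<sigma> n) z) \<longlonglongrightarrow> l"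
  using function_convergent_subsequence[OF \<open>countable S\<close>, of f] by metis
 have ev: "eventually (%k. tau (\<sigma> k) <= t) sequentially" if "t > 0" for t
  using eventually_subseq[OF \<sigma>(1) tau_eventually[OF that]] .
 have conv_S: "Cauchy (%k. approx_sol (\<sigma> k) q z)" if q: "q \<in> \<rat>" "z \<in> \<rat>" "q > 0" for q z
 proof -
  obtain l where l: "(%n. f (\<sigma> n) (q, z)) \<longlonglongrightarrow> l" using \<sigma>(2)[of "(q, z)"] q by (auto simp: S_def)
  have "(%k. (1 / sqrt q) *\<^sub>R f (\<sigma> k) (q, z)) \<longlonglongrightarrow> (1 / sqrt q) *\<^sub>R l" by (intro tendsto_intros l)
  moreover have "eventually (%k. (1 / sqrt q) *\<^sub>R f (\<sigma> k) (q, z) = approx_sol (\<sigma> k) q z) sequentially"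
   using ev[OF q(3)] by eventually_elim (use q in \<open>simp add: f_def\<close>)
  ultimately have "(%k. approx_sol (\<sigma> k) q z) \<longlonglongrightarrow> (1 / sqrt q) *\<^sub>R l" by (blast intro: Lim_transform_eventually)
  then show ?thesis by (rule LIMSEQ_imp_Cauchy)
 qed
 have "convergent (%k. approx_sol (\<sigma> k) t x)" if t: "t > 0" for t x
 proof (rule Cauchy_convergent, rule metric_CauchyI)
  fix e :: real assume e: "e > 0"
  \<comment> \<open>The limit of \<open>modulus\<close> at base time t/2. It tends to zero with d,
    so a rational point within d of (t, x) and with earlier time can stand in for (t, x).\<close>
  define H where "H = (%s d. 2 * (6 * K * \<theta>\<^sup>2 * sqrt s / (t / 2 * sqrt (t / 2))) + 2 * (K * \<theta> ^ 3 * d / (t / 2 * sqrt (t / 2))))"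
  have "((%d. H d d) \<longlongrightarrow> H 0 0) (at_right 0)"
   unfolding H_def divide_inverse by (intro tendsto_intros)
  moreover have "H 0 0 = 0" "0 < (e / 3)\<^sup>2" using e by (simp_all add: H_def zero_less_power)
  ultimately have "eventually (%d. H d d < (e / 3)\<^sup>2) (at_right 0)"
   using order_tendstoD(2)[of "%d. H d d" "H 0 0" "at_right 0" "(e / 3)\<^sup>2"] by simp
  then obtain d0 where d0: "d0 > 0" "!!d. 0 < d ==> d < d0 ==> H d d < (e / 3)\<^sup>2"
   unfolding eventually_at_right_field by auto
  define d where "d = min (d0 / 2) (t / 2)"
  have d: "d > 0" "H d d < (e / 3)\<^sup>2" "d <= t / 2" using d0 t by (auto simp: d_def)
  obtain q where q: "q \<in> \<rat>" "t - d < q" "q < t" using Rats_dense_in_real[of "t - d" t] d by auto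
  obtain z where z: "z \<in> \<rat>" "x - d < z" "z < x" using Rats_dense_in_real[of "x - d" x] d by auto
  have q0: "q > 0" "t / 2 <= q" using q d t by auto
  have Hm: "(%k. modulus (\<sigma> k) (t / 2) d d) \<longlonglongrightarrow> H d d"
   using LIMSEQ_subseq_LIMSEQ[OF modulus_lim[of d "t / 2" d] \<sigma>(1)] d by (simp add: H_def o_def)
  have "eventually (%k. dist (approx_sol (\<sigma> k) t x) (approx_sol (\<sigma> k) q z) < e / 3) sequentially"
   using order_tendstoD(2)[OF Hm d(2)] ev[OF q0(1)]
  proof eventually_elim
   case (elim k)
   let ?k = "\<sigma> k"
   have "(norm (approx_sol ?k t x - approx_sol ?k q z))\<^sup>2 <= modulus ?k q (t - q) \<bar>z - x\<bar>"
    using elim q by (intro approx_sol_equicontinuous) auto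
   also have "... <= modulus ?k (t / 2) d d"
    unfolding modulus_def
    using q q0 z t K_pos theta_pos tau_pos[of ?k] eps_pos[of ?k]
    by (intro add_mono mult_left_mono frac_le mult_mono real_sqrt_le_mono) auto
   also have "... < (e / 3)\<^sup>2" by (rule elim)
   finally show ?case unfolding dist_norm by (rule power2_less_imp_less) (use e in simp)
  qed
  then obtain N1 where N1: "!!k. k \<ge> N1 ==> dist (approx_sol (\<sigma> k) t x) (approx_sol (\<sigma> k) q z) < e / 3"
   unfolding eventually_sequentially by blast
  obtain N2 where N2: "!!k l. k \<ge> N2 ==> l \<ge> N2 ==> dist (approx_sol (\<sigma> k) q z) (approx_sol (\<sigma> l) q z) < e / 3"
   using metric_CauchyD[OF conv_S[OF q(1) z(1) q0(1)], of "e / 3"] e by auto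
  show "\<exists>N. \<forall>m\<ge>N. \<forall>n\<ge>N. dist (approx_sol (\<sigma> m) t x) (approx_sol (\<sigma> n) t x) < e"
  proof (intro exI[of _ "max N1 N2"] allI impI)
   fix m n assume "max N1 N2 <= m" "max N1 N2 <= n"
   then have "dist (approx_sol (\<sigma> m) t x) (approx_sol (\<sigma> m) q z) < e / 3"
    "dist (approx_sol (\<sigma> n) t x) (approx_sol (\<sigma> n) q z) < e / 3"
    "dist (approx_sol (\<sigma> m) q z) (approx_sol (\<sigma> n) q z) < e / 3"
    using N1 N2 by auto
   then show "dist (approx_sol (\<sigma> m) t x) (approx_sol (\<sigma> n) t x) < e"
    using dist_triangle[of "approx_sol (\<sigma> m) t x" "approx_sol (\<sigma> n) t x" "approx_sol (\<sigma> m) q z"]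
     dist_triangle2[of "approx_sol (\<sigma> m) q z" "approx_sol (\<sigma> n) t x" "approx_sol (\<sigma> n) q z"] by linarith
  qed
 qed
 then have "\<exists>p. \<forall>t x. t > 0 --> (%k. approx_sol (\<sigma> k) t x) \<longlonglongrightarrow> p t x"
  by (intro exI[of _ "%t x. lim (%k. approx_sol (\<sigma> k) t x)"]) (simp add: convergent_LIMSEQ_iff)
 then show thesis using \<sigma>(1) that by blast
qed

end

section \<open>Square integrable functions on the line\<close>

text \<open>Borel functions and \<open>lborel\<close> are used internally because Fubini and
  measurability of compositions are easier there; \<open>L2_ex_sq_int\<close> and
  \<open>sq_int_imp_L2\<close> translate to Lebesgue measurable representatives.\<close>

definition sq_int :: "(real => 'v::euclidean_space) => bool" where
 "sq_int f \<longleftrightarrow> f \<in> borel_measurable borel & integrable lborel (%x. (norm (f x))\<^sup>2)"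

definition n2 :: "(real => 'v::euclidean_space) => real" where
 "n2 f = (LINT x|lborel. (norm (f x))\<^sup>2)"

lemma norm2_add_le: "(norm (x + y))\<^sup>2 <= 2 * (norm x)\<^sup>2 + 2 * (norm y)\<^sup>2" for x y :: "'a::real_normed_vector"
proof -
 have "(norm (x + y))\<^sup>2 <= (norm x + norm y)\<^sup>2" by (intro power_mono norm_triangle_ineq) simp
 also have "... <= 2 * (norm x)\<^sup>2 + 2 * (norm y)\<^sup>2" using sum_squares_bound[of "norm x" "norm y"] by (simp add: power2_sum)
 finally show ?thesis .
qed

lemma sq_int_measurable [measurable_dest]: "sq_int f ==> f \<in> borel_measurable borel"
 by (simp add: sq_int_def)

lemma sq_int_integrable: "sq_int f ==> integrable lborel (%x. (norm (f x))\<^sup>2)"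
 by (simp add: sq_int_def)

lemma n2_nonneg [simp]: "0 <= n2 f"
 by (simp add: n2_def)

lemma sq_int_bound:
 assumes f: "f \<in> borel_measurable borel" and g: "integrable lborel g"
  and le: "AE x in lborel. (norm (f x))\<^sup>2 <= g x"
 shows "sq_int f" "n2 f <= integral\<^sup>L lborel g"
proof -
 have fm: "(%x. (norm (f x))\<^sup>2) \<in> borel_measurable lborel" using f by measurable
 have i: "integrable lborel (%x. (norm (f x))\<^sup>2)"
  using le by (intro Bochner_Integration.integrable_bound[OF g fm]) (auto elim!: AE_mp)
 then show "sq_int f" using f by (simp add: sq_int_def)
 show "n2 f <= integral\<^sup>L lborel g" unfolding n2_def by (intro integral_mono_AE i g le)
qed

lemma sq_int_add:
 assumes f: "sq_int f" and g: "sq_int g"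
 shows "sq_int (%x. f x + g x)" "n2 (%x. f x + g x) <= 2 * n2 f + 2 * n2 g"
proof -
 have i: "integrable lborel (%x. 2 * (norm (f x))\<^sup>2 + 2 * (norm (g x))\<^sup>2)"
  using f g by (intro Bochner_Integration.integrable_add integrable_mult_right) (auto simp: sq_int_def)
 have m: "(%x. f x + g x) \<in> borel_measurable borel" using f g by (intro borel_measurable_add) (auto simp: sq_int_def)
 show "sq_int (%x. f x + g x)" by (rule sq_int_bound[OF m i]) (simp add: norm2_add_le)
 have "n2 (%x. f x + g x) <= (LINT x|lborel. 2 * (norm (f x))\<^sup>2 + 2 * (norm (g x))\<^sup>2)"
  by (rule sq_int_bound[OF m i]) (simp add: norm2_add_le)
 also have "... = 2 * n2 f + 2 * n2 g"
  using f g unfolding n2_def by (subst Bochner_Integration.integral_add) (auto simp: sq_int_def)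
 finally show "n2 (%x. f x + g x) <= 2 * n2 f + 2 * n2 g" .
qed

lemma sq_int_scaleR:
 assumes "sq_int f" shows "sq_int (%x. c *\<^sub>R f x)" "n2 (%x. c *\<^sub>R f x) = c\<^sup>2 * n2 f"
 using assms by (auto simp: sq_int_def n2_def power_mult_distrib)

lemma sq_int_minus: "sq_int f ==> sq_int (%x. - f x)" "n2 (%x. - f x) = n2 f"
 by (auto simp: sq_int_def n2_def)

lemma sq_int_diff:
 assumes f: "sq_int f" and g: "sq_int g"
 shows "sq_int (%x. f x - g x)" "n2 (%x. f x - g x) <= 2 * n2 f + 2 * n2 g"
 using sq_int_add[OF f sq_int_minus(1)[OF g]] by (simp_all add: sq_int_minus(2))

lemma n2_commute: "n2 (%x. f x - g x) = n2 (%x. g x - f x)"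
 by (simp add: n2_def norm_minus_commute)

lemma n2_triangle3:
 assumes "sq_int f" "sq_int g" "sq_int h"
 shows "n2 (%x. f x - h x) <= 2 * n2 (%x. f x - g x) + 2 * n2 (%x. g x - h x)"
 using sq_int_add(2)[OF sq_int_diff(1)[OF assms(1,2)] sq_int_diff(1)[OF assms(2,3)]] by simp

lemma lborel_integral_shift:
 fixes f :: "real => 'v::euclidean_space"
 shows "(LINT x|lborel. f (x + y)) = (LINT x|lborel. f x)" "integrable lborel (%x. f (x + y)) \<longleftrightarrow> integrable lborel f"
 using lborel_integral_real_affine[of 1 f y] lborel_integrable_real_affine_iff[of 1 f y] by (simp_all add: add.commute)

lemma sq_int_shift:
 assumes "sq_int f" shows "sq_int (%x. f (x + y))" "n2 (%x. f (x + y)) = n2 f"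
 using assms lborel_integral_shift[of "%x. (norm (f x))\<^sup>2" y] by (auto simp: sq_int_def n2_def)

lemma sq_int_AE_zero:
 assumes "sq_int f" "n2 f = 0" shows "AE x in lborel. f x = 0"
 using integral_nonneg_eq_0_iff_AE[OF sq_int_integrable[OF assms(1)]] assms(2) by (simp add: n2_def)

lemma integrable_norm_mult:
 assumes f: "sq_int f" and g: "sq_int g"
 shows "integrable lborel (%x. norm (f x) * norm (g x))"
  "(LINT x|lborel. norm (f x) * norm (g x)) <= sqrt (n2 f) * sqrt (n2 g)"
proof -
 have fm [measurable]: "f \<in> borel_measurable borel" "g \<in> borel_measurable borel" using f g by (auto simp: sq_int_def)
 have bd: "AE x in lborel. norm (norm (f x) * norm (g x)) <= norm ((norm (f x))\<^sup>2 + (norm (g x))\<^sup>2)"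
 proof (intro AE_I2)
  fix x
  have "norm (f x) * norm (g x) <= (norm (f x))\<^sup>2 + (norm (g x))\<^sup>2"
   using sum_squares_bound[of "norm (f x)" "norm (g x)"] mult_nonneg_nonneg[OF norm_ge_zero[of "f x"] norm_ge_zero[of "g x"]]
   unfolding mult.assoc by linarith
  then show "norm (norm (f x) * norm (g x)) <= norm ((norm (f x))\<^sup>2 + (norm (g x))\<^sup>2)" by simp
 qed
 have "integrable lborel (%x. (norm (f x))\<^sup>2 + (norm (g x))\<^sup>2)"
  using f g by (auto simp: sq_int_def)
 then show i: "integrable lborel (%x. norm (f x) * norm (g x))"
  by (rule Bochner_Integration.integrable_bound[OF _ _ bd]) measurable
 have sq: "(\<integral>\<^sup>+x. ennreal ((norm (h x))\<^sup>2) \<partial>lborel) = ennreal (n2 h)" if "sq_int h" for h :: "real => 'c::euclidean_space"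
  using nn_integral_eq_integral[OF sq_int_integrable[OF that]] by (simp add: n2_def)
 have "(\<integral>\<^sup>+x. ennreal (norm (f x)) * ennreal (norm (g x)) \<partial>lborel) = ennreal (LINT x|lborel. norm (f x) * norm (g x))"
  using nn_integral_eq_integral[OF i] by (simp add: ennreal_mult)
 moreover have "(\<integral>\<^sup>+x. ennreal (norm (f x)) * ennreal (norm (g x)) \<partial>lborel)\<^sup>2
  <= (\<integral>\<^sup>+x. (ennreal (norm (f x)))\<^sup>2 \<partial>lborel) * (\<integral>\<^sup>+x. (ennreal (norm (g x)))\<^sup>2 \<partial>lborel)"
  by (rule Cauchy_Schwarz_nn_integral) measurable
 ultimately have "ennreal ((LINT x|lborel. norm (f x) * norm (g x))\<^sup>2) <= ennreal (n2 f * n2 g)"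
  by (simp add: sq f g ennreal_mult ennreal_power)
 then have "(LINT x|lborel. norm (f x) * norm (g x))\<^sup>2 <= n2 f * n2 g"
  by (subst (asm) ennreal_le_iff) auto
 then show "(LINT x|lborel. norm (f x) * norm (g x)) <= sqrt (n2 f) * sqrt (n2 g)"
  by (simp add: real_le_rsqrt real_sqrt_mult[symmetric])
qed

lemma integrable_inner_sq:
 assumes f: "sq_int f" and g: "sq_int g"
 shows "integrable lborel (%x. f x \<bullet> g x)" "\<bar>LINT x|lborel. f x \<bullet> g x\<bar> <= sqrt (n2 f) * sqrt (n2 g)"
proof -
 have fm [measurable]: "f \<in> borel_measurable borel" "g \<in> borel_measurable borel" using f g by (auto simp: sq_int_def)
 show i: "integrable lborel (%x. f x \<bullet> g x)"
  by (rule Bochner_Integration.integrable_bound[OF integrable_norm_mult(1)[OF f g]]) (auto simp: Cauchy_Schwarz_ineq2)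
 have "\<bar>LINT x|lborel. f x \<bullet> g x\<bar> <= (LINT x|lborel. norm (f x) * norm (g x))"
  by (rule order_trans[OF integral_abs_bound])
   (intro integral_mono integrable_abs i integrable_norm_mult f g Cauchy_Schwarz_ineq2)
 then show "\<bar>LINT x|lborel. f x \<bullet> g x\<bar> <= sqrt (n2 f) * sqrt (n2 g)" using integrable_norm_mult(2)[OF f g] by linarith
qed

lemma integrable_indicator_Icc [simp]: "integrable lborel (indicator {a..b} :: real => real)"
 by (auto intro!: integrable_real_indicator simp: emeasure_lborel_Icc_eq)

lemma sq_int_indicator_real: "sq_int (indicator {a..b} :: real => real)" "a <= b ==> n2 (indicator {a..b} :: real => real) = b - a"
proof -
 have e: "(%x. (norm (indicator {a..b} x :: real))\<^sup>2) = indicator {a..b}" by (auto simp: indicator_def)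
 show "sq_int (indicator {a..b} :: real => real)"
  unfolding sq_int_def e by simp
 show "a <= b ==> n2 (indicator {a..b} :: real => real) = b - a" unfolding n2_def e by simp
qed

lemma sq_int_indicator:
 assumes f: "sq_int f" and A: "A \<in> sets borel" shows "sq_int (%x. indicator A x *\<^sub>R f x)" "n2 (%x. indicator A x *\<^sub>R f x) <= n2 f"
proof -
 have m: "(%x. indicator A x *\<^sub>R f x) \<in> borel_measurable borel" using f A by (auto simp: sq_int_def)
 show "sq_int (%x. indicator A x *\<^sub>R f x)" "n2 (%x. indicator A x *\<^sub>R f x) <= n2 f"
  using sq_int_bound[OF m sq_int_integrable[OF f]] unfolding n2_def by (auto simp: indicator_def)
qed

lemma sq_int_local:
 assumes f: "sq_int f"
 shows "set_integrable lborel {a..b} f"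
  "a <= b ==> (norm (LINT x:{a..b}|lborel. f x))\<^sup>2 <= (b - a) * (LINT x:{a..b}|lborel. (norm (f x))\<^sup>2)"
proof -
 have fm [measurable]: "f \<in> borel_measurable borel" using f by (auto simp: sq_int_def)
 let ?i = "indicator {a..b} :: real => real"
 have f1: "sq_int (%x. ?i x *\<^sub>R f x)" using sq_int_indicator(1)[OF f] by simp
 have e: "norm (?i x) * norm (?i x *\<^sub>R f x) = norm (?i x *\<^sub>R f x)" for x by (simp add: indicator_def)
 have 1: "integrable lborel (%x. norm (?i x *\<^sub>R f x))"
  "(LINT x|lborel. norm (?i x *\<^sub>R f x)) <= sqrt (n2 ?i) * sqrt (n2 (%x. ?i x *\<^sub>R f x))"
  using integrable_norm_mult[OF sq_int_indicator_real(1) f1, of a b] unfolding e by auto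
 then show i: "set_integrable lborel {a..b} f" unfolding set_integrable_def
  by (subst integrable_norm_iff[symmetric]) auto
 assume ab: "a <= b"
 have "norm (LINT x:{a..b}|lborel. f x) <= sqrt (n2 ?i) * sqrt (n2 (%x. ?i x *\<^sub>R f x))"
  unfolding set_lebesgue_integral_def using integral_norm_bound[of lborel "%x. ?i x *\<^sub>R f x"] 1(2) by linarith
 also have "... = sqrt ((b - a) * (LINT x:{a..b}|lborel. (norm (f x))\<^sup>2))"
 proof -
  have "n2 (%x. ?i x *\<^sub>R f x) = (LINT x:{a..b}|lborel. (norm (f x))\<^sup>2)"
   unfolding n2_def set_lebesgue_integral_def by (intro Bochner_Integration.integral_cong) (auto simp: indicator_def)
  then show ?thesis by (simp add: sq_int_indicator_real(2)[OF ab] real_sqrt_mult)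
 qed
 finally have "(norm (LINT x:{a..b}|lborel. f x))\<^sup>2 <= (sqrt ((b - a) * (LINT x:{a..b}|lborel. (norm (f x))\<^sup>2)))\<^sup>2"
  by (rule power_mono) simp
 also have "... = (b - a) * (LINT x:{a..b}|lborel. (norm (f x))\<^sup>2)"
  using ab by (auto simp: set_lebesgue_integral_def intro!: real_sqrt_pow2 mult_nonneg_nonneg Bochner_Integration.integral_nonneg)
 finally show "(norm (LINT x:{a..b}|lborel. f x))\<^sup>2 <= (b - a) * (LINT x:{a..b}|lborel. (norm (f x))\<^sup>2)" .
qed

lemma set_norm2_integrable: "sq_int f ==> A \<in> sets borel ==> set_integrable lborel A (%x. (norm (f x))\<^sup>2)"
 unfolding set_integrable_def by (rule integrable_mult_indicator[of A lborel "%x. (norm (f x))\<^sup>2"]) (auto simp: sq_int_def)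

lemma set_norm2_le_n2:
 assumes f: "sq_int f" and "A \<in> sets borel" shows "(LINT x:A|lborel. (norm (f x))\<^sup>2) <= n2 f"
 unfolding set_lebesgue_integral_def n2_def
 using set_norm2_integrable[OF assms] sq_int_integrable[OF f]
 by (intro integral_mono) (auto simp: set_integrable_def indicator_def)

text \<open>Fatou's lemma in the form in which bounds are transferred to limits.\<close>

lemma sq_int_limit:
 fixes f :: "nat => real => 'v::euclidean_space"
 assumes m: "!!k. f k \<in> borel_measurable borel" and gm: "g \<in> borel_measurable borel"
  and lim: "AE x in lborel. (%k. f k x) \<longlonglongrightarrow> g x"
  and bound: "eventually (%k. (\<integral>\<^sup>+x. ennreal ((norm (f k x))\<^sup>2) \<partial>lborel) <= ennreal (C k)) sequentially"
  and C: "C \<longlonglongrightarrow> C0" and C0: "C0 \<ge> 0"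
 shows "sq_int g" "n2 g <= C0"
proof -
 have "(\<integral>\<^sup>+x. ennreal ((norm (g x))\<^sup>2) \<partial>lborel) = (\<integral>\<^sup>+x. liminf (%k. ennreal ((norm (f k x))\<^sup>2)) \<partial>lborel)"
 proof (rule nn_integral_cong_AE)
  show "AE x in lborel. ennreal ((norm (g x))\<^sup>2) = liminf (%k. ennreal ((norm (f k x))\<^sup>2))"
   using lim
  proof eventually_elim
   case (elim x)
   then have "(%k. ennreal ((norm (f k x))\<^sup>2)) \<longlonglongrightarrow> ennreal ((norm (g x))\<^sup>2)"
    by (intro tendsto_ennrealI tendsto_intros)
   then show ?case using lim_imp_Liminf[OF sequentially_bot] by metis
  qed
 qed
 also have "... <= liminf (%k. \<integral>\<^sup>+x. ennreal ((norm (f k x))\<^sup>2) \<partial>lborel)"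
  using m by (intro nn_integral_liminf) measurable
 also have "... <= liminf (%k. ennreal (C k))" by (rule Liminf_mono[OF bound])
 also have "... = ennreal C0"
  using lim_imp_Liminf[OF sequentially_bot tendsto_ennrealI[OF C]] .
 finally have le: "(\<integral>\<^sup>+x. ennreal ((norm (g x))\<^sup>2) \<partial>lborel) <= ennreal C0" .
 have gm2: "(%x. (norm (g x))\<^sup>2) \<in> borel_measurable lborel" using gm by measurable
 have i: "integrable lborel (%x. (norm (g x))\<^sup>2)"
  using le le_less_trans[OF le] by (intro integrableI_nonneg gm2) auto
 then show "sq_int g" using gm by (simp add: sq_int_def)
 show "n2 g <= C0" using le nn_integral_eq_integral[OF i] C0 by (simp add: n2_def ennreal_le_iff)
qed

lemma n2_less_of_approx:
 assumes "sq_int f" "sq_int u" shows "n2 (%x. f (x + y) - f x) <= 6 * n2 (%x. f x - u x) + 4 * n2 (%x. u (x + y) - u x)"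
proof -
 note s = sq_int_shift[where y = y]
 have "n2 (%x. f (x + y) - f x) <= 2 * n2 (%x. f (x + y) - u (x + y)) + 2 * n2 (%x. u (x + y) - f x)"
  by (rule n2_triangle3) (auto intro: s assms)
 also have "n2 (%x. f (x + y) - u (x + y)) = n2 (%x. f x - u x)"
  using s(2)[OF sq_int_diff(1)[OF assms]] .
 also have "n2 (%x. u (x + y) - f x) <= 2 * n2 (%x. u (x + y) - u x) + 2 * n2 (%x. u x - f x)"
  by (rule n2_triangle3) (auto intro: s assms)
 finally show ?thesis by (simp add: n2_commute[of u])
qed

lemma n2_dominated_tendsto:
 fixes f :: "nat => real => 'v::euclidean_space"
 assumes m: "!!k. f k \<in> borel_measurable borel" and lim: "AE x in lborel. (%k. f k x) \<longlonglongrightarrow> 0"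
  and w: "integrable lborel w" and le: "!!k. AE x in lborel. (norm (f k x))\<^sup>2 <= w x"
 shows "(%k. n2 (f k)) \<longlonglongrightarrow> 0"
proof -
 have "(%k. LINT x|lborel. (norm (f k x))\<^sup>2) \<longlonglongrightarrow> (LINT (x::real)|lborel. (0::real))"
 proof (rule Bochner_Integration.integral_dominated_convergence[where w = w])
  show "(%x. (norm (f k x))\<^sup>2) \<in> borel_measurable lborel" for k using m[of k] by measurable
  show "AE x in lborel. (%k. (norm (f k x))\<^sup>2) \<longlonglongrightarrow> 0"
   using lim by eventually_elim (auto intro!: tendsto_eq_intros)
  show "AE x in lborel. norm ((norm (f k x))\<^sup>2) <= w x" for k using le[of k] by eventually_elim simp
 qed (use w in auto)
 then show ?thesis by (simp add: n2_def)
qed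

section \<open>Continuity of translations in L2\<close>

lemma translation_continuous_aux:
 fixes u :: "real => 'v::euclidean_space"
 assumes c: "continuous_on UNIV u" and supp: "!!x. \<bar>x\<bar> > R ==> u x = 0"
 shows "sq_int u" "((%y. n2 (%x. u (x + y) - u x)) \<longlongrightarrow> 0) (at 0)"
proof -
 have cm: "u \<in> borel_measurable borel" using c by (rule borel_measurable_continuous_onI)
 have "compact (u ` {-R..R})" using c by (intro compact_continuous_image continuous_on_subset[OF c]) auto
 then obtain B where B: "\<forall>x\<in>{-R..R}. norm (u x) <= B"
  using compact_imp_bounded[of "u ` {-R..R}"] unfolding bounded_iff by auto
 have B0: "norm (u x) <= max B 0" for x
  using B supp[of x] by (cases "\<bar>x\<bar> > R") (auto simp: le_max_iff_disj abs_le_iff not_less)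
 have le: "(norm (u x))\<^sup>2 <= (max B 0)\<^sup>2 * indicator {-R..R} x" for x
  using power_mono[OF B0[of x], of 2] supp[of x] by (cases "\<bar>x\<bar> > R") (auto simp: indicator_def abs_le_iff)
 have i: "integrable lborel (%x. (max B 0)\<^sup>2 * indicator {-R..R} x)" by simp
 show u: "sq_int u" by (rule sq_int_bound[OF cm i]) (simp add: le)
 show "((%y. n2 (%x. u (x + y) - u x)) \<longlongrightarrow> 0) (at 0)"
 proof (subst tendsto_at_iff_sequentially, intro allI impI)
  fix Y :: "nat => real" assume Y: "\<forall>i. Y i \<in> UNIV - {0}" "Y \<longlonglongrightarrow> 0"
  have "\<exists>C. \<forall>i. \<bar>Y i\<bar> <= C" using convergent_imp_Bseq[of Y] Y(2) by (auto simp: convergent_def Bseq_def intro: less_imp_le)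
  then obtain C where C: "!!i. \<bar>Y i\<bar> <= C" by blast
  show "((%y. n2 (%x. u (x + y) - u x)) \<circ> Y) \<longlonglongrightarrow> 0"
   unfolding o_def
  proof (rule n2_dominated_tendsto[where w = "%x. 4 * (max B 0)\<^sup>2 * indicator {-R-C..R+C} x"])
   show "(%x. u (x + Y k) - u x) \<in> borel_measurable borel" for k using cm by measurable
   show "AE x in lborel. (%k. u (x + Y k) - u x) \<longlonglongrightarrow> 0"
   proof (intro AE_I2)
    fix x
    have "(%k. x + Y k) \<longlonglongrightarrow> x + 0" by (intro tendsto_intros Y)
    then have "(%k. u (x + Y k)) \<longlonglongrightarrow> u (x + 0)"
     using c by (metis continuous_on_eq_continuous_at isCont_tendsto_compose open_UNIV UNIV_I)
    then show "(%k. u (x + Y k) - u x) \<longlonglongrightarrow> 0" using LIM_zero[of "%k. u (x + Y k)" "u x"] by simp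
   qed
   show "AE x in lborel. (norm (u (x + Y k) - u x))\<^sup>2 <= 4 * (max B 0)\<^sup>2 * indicator {-R-C..R+C} x" for k
   proof (intro AE_I2)
    fix x
    show "(norm (u (x + Y k) - u x))\<^sup>2 <= 4 * (max B 0)\<^sup>2 * indicator {-R-C..R+C} x"
    proof (cases "\<bar>x\<bar> > R + C")
     case True
     then have "u (x + Y k) = 0" "u x = 0" using C[of k] abs_ge_zero[of "Y k"] by (auto intro!: supp)
     then show ?thesis by simp
    next
     case False
     have "norm (u (x + Y k) - u x) <= 2 * max B 0"
      using norm_triangle_ineq4[of "u (x + Y k)" "u x"] B0[of "x + Y k"] B0[of x] by linarith
     then have "(norm (u (x + Y k) - u x))\<^sup>2 <= (2 * max B 0)\<^sup>2" by (intro power_mono) auto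
     moreover have "x \<in> {-R-C..R+C}" using False by auto
     ultimately show ?thesis by (simp add: power_mult_distrib)
    qed
   qed
  qed simp
 qed
qed

text \<open>Values are clipped to a ball and the support is cut off first. The bounded result is an
  almost everywhere limit of continuous functions, and applying the same clipping and cut-off to
  those provides a dominating function.\<close>

lemma continuous_dense:
 fixes f :: "real => 'v::euclidean_space"
 assumes f: "sq_int f" and e: "e > 0"
 obtains u R where "continuous_on UNIV u" "!!x. \<bar>x\<bar> > R ==> u x = 0" "n2 (%x. f x - u x) < e"
proof -
 have fm [measurable]: "f \<in> borel_measurable borel" using f by (simp add: sq_int_def)
 define clip where "clip = (%R (z::'v). closest_point (cball 0 R) z)"
 define cut where "cut = (%R x::real. max 0 (min 1 (R + 1 - \<bar>x\<bar>)))"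
 have clip_c: "continuous_on UNIV (clip R)" if "R \<ge> 0" for R
  unfolding clip_def using that by (intro continuous_on_closest_point) auto
 have clip_le: "norm (clip R z) <= R" if "R \<ge> 0" for R z
  using closest_point_in_set[of "cball 0 R" z] that unfolding clip_def by auto
 have clip_id: "clip R z = z" if "norm z <= R" for R z
  unfolding clip_def using that by (intro closest_point_self) auto
 have clip_n: "norm (clip R z) <= norm z" if "R \<ge> 0" for R z
  using clip_le[OF that, of z] clip_id[of z R] by (cases "norm z <= R") auto
 have cut: "0 <= cut R x" "cut R x <= 1" for R x by (auto simp: cut_def)
 define fR where "fR = (%k x. cut (real k) x *\<^sub>R clip (real k) (f x))"
 have fRm [measurable]: "fR k \<in> borel_measurable borel" for k
 proof -
  have [measurable]: "clip (real k) \<in> borel_measurable borel" by (rule borel_measurable_continuous_onI) (simp add: clip_c)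
  show ?thesis unfolding fR_def cut_def by measurable
 qed
 have fR_le: "norm (fR k x) <= norm (f x)" for k x
  using mult_mono[OF cut(2)[of "real k" x] clip_n[of "real k" "f x"]] cut(1)[of "real k" x] by (simp add: fR_def)
 have "(%k. n2 (%x. f x - fR k x)) \<longlonglongrightarrow> 0"
 proof (rule n2_dominated_tendsto[where w = "%x. 4 * (norm (f x))\<^sup>2"])
  show "AE x in lborel. (%k. f x - fR k x) \<longlonglongrightarrow> 0"
  proof (intro AE_I2)
   fix x
   obtain N :: nat where N: "real N \<ge> max (norm (f x)) \<bar>x\<bar>" using real_arch_simple by blast
   have "eventually (%k. f x - fR k x = 0) sequentially"
    using eventually_ge_at_top[of N]
   proof eventually_elim
    case (elim k)
    then have "real k \<ge> real N" by simp
    then have "norm (f x) <= real k" "\<bar>x\<bar> <= real k" using N by linarith+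
    then show ?case by (simp add: fR_def clip_id cut_def)
   qed
   then show "(%k. f x - fR k x) \<longlonglongrightarrow> 0" by (rule tendsto_eventually)
  qed
  show "AE x in lborel. (norm (f x - fR k x))\<^sup>2 <= 4 * (norm (f x))\<^sup>2" for k
  proof (intro AE_I2)
   fix x
   have "norm (f x - fR k x) <= 2 * norm (f x)" using norm_triangle_ineq4[of "f x" "fR k x"] fR_le[of k x] by linarith
   then show "(norm (f x - fR k x))\<^sup>2 <= 4 * (norm (f x))\<^sup>2" using power_mono[of _ "2 * norm (f x)" 2] by (fastforce simp: power_mult_distrib)
  qed
 qed (use f in \<open>auto simp: sq_int_def\<close>)
 then have "eventually (%k. n2 (%x. f x - fR k x) < e / 4) sequentially"
  using e by (intro order_tendstoD) auto
 then obtain k where k: "n2 (%x. f x - fR k x) < e / 4" unfolding eventually_sequentially by auto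
 have "f \<in> borel_measurable lebesgue" using fm by (simp add: measurable_completion)
 then have "f measurable_on UNIV" by (intro lebesgue_measurable_imp_measurable_on) (auto simp: measurable_restrict_space1)
 then obtain N h where N: "negligible N" and h: "!!n. continuous_on UNIV (h n)" "!!x. x \<notin> N ==> (%n. h n x) \<longlonglongrightarrow> f x"
  unfolding measurable_on_def by auto
 have AEN: "AE x in lborel. x \<notin> N"
 proof -
  have "N \<in> null_sets lebesgue" using N by (simp add: negligible_iff_null_sets)
  then show ?thesis using AE_not_in AE_completion_iff by blast
 qed
 define u where "u = (%n x. cut (real k) x *\<^sub>R clip (real k) (h n x))"
 have uc: "continuous_on UNIV (u n)" for n
  unfolding u_def cut_def by (intro continuous_intros continuous_on_compose2[OF clip_c h(1)]) auto
 have um [measurable]: "u n \<in> borel_measurable borel" for n using uc by (rule borel_measurable_continuous_onI)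
 have us: "u n x = 0" if "\<bar>x\<bar> > real k + 1" for n x using that by (simp add: u_def cut_def)
 have "(%n. n2 (%x. fR k x - u n x)) \<longlonglongrightarrow> 0"
 proof (rule n2_dominated_tendsto[where w = "%x. 4 * (real k)\<^sup>2 * indicator {-real k - 1..real k + 1} x"])
  show "AE x in lborel. (%n. fR k x - u n x) \<longlonglongrightarrow> 0"
   using AEN
  proof eventually_elim
   case (elim x)
   have "(%n. clip (real k) (h n x)) \<longlonglongrightarrow> clip (real k) (f x)"
    using clip_c[of "real k"] h(2)[OF elim] by (metis continuous_on_eq_continuous_at isCont_tendsto_compose open_UNIV UNIV_I of_nat_0_le_iff)
   then have "(%n. fR k x - u n x) \<longlonglongrightarrow> fR k x - fR k x" unfolding u_def by (intro tendsto_intros) (simp add: fR_def tendsto_intros)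
   then show ?case by simp
  qed
  show "AE x in lborel. (norm (fR k x - u n x))\<^sup>2 <= 4 * (real k)\<^sup>2 * indicator {-real k - 1..real k + 1} x" for n
  proof (intro AE_I2)
   fix x
   have c: "norm (cut (real k) x *\<^sub>R clip (real k) z) <= real k" for z
    using mult_mono[OF cut(2)[of "real k" x] clip_le[of "real k" z]] cut(1)[of "real k" x] by simp
   have "norm (fR k x - u n x) <= 2 * real k"
    using norm_triangle_ineq4[of "fR k x" "u n x"] c[of "f x"] c[of "h n x"] unfolding fR_def u_def by linarith
   then have "(norm (fR k x - u n x))\<^sup>2 <= (2 * real k)\<^sup>2" by (intro power_mono) auto
   then show "(norm (fR k x - u n x))\<^sup>2 <= 4 * (real k)\<^sup>2 * indicator {-real k - 1..real k + 1} x"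
    by (cases "\<bar>x\<bar> > real k + 1") (auto simp: us fR_def cut_def indicator_def abs_le_iff power_mult_distrib)
  qed
  show "(%x. fR k x - u n x) \<in> borel_measurable borel" for n by measurable
 qed simp
 then have "eventually (%n. n2 (%x. fR k x - u n x) < e / 4) sequentially"
  using e by (intro order_tendstoD) auto
 then obtain n where n: "n2 (%x. fR k x - u n x) < e / 4" unfolding eventually_sequentially by auto
 have fRs: "sq_int (fR k)"
  by (rule sq_int_bound[OF fRm sq_int_integrable[OF f]]) (use fR_le in \<open>auto intro!: power_mono\<close>)
 have us': "sq_int (u n)" by (rule translation_continuous_aux(1)[of "u n" "real k + 1", OF uc us])
 have "n2 (%x. f x - u n x) < e" using n2_triangle3[OF f fRs us'] k n by linarith
 then show thesis using that[of "u n" "real k + 1"] uc us by blast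
qed

lemma translation_continuous:
 assumes f: "sq_int f" shows "((%y. n2 (%x. f (x + y) - f x)) \<longlongrightarrow> 0) (at 0)"
proof (rule tendstoI)
 fix e :: real assume e: "e > 0"
 then obtain u R where u: "continuous_on UNIV u" "!!x. \<bar>x\<bar> > R ==> u x = 0" "n2 (%x. f x - u x) < e / 16"
  using continuous_dense[OF f, of "e / 16"] by auto
 note uu = translation_continuous_aux[of u R, OF u(1) u(2)]
 have "eventually (%y. n2 (%x. u (x + y) - u x) < e / 16) (at 0)"
  using e by (intro order_tendstoD(2)[OF uu(2)]) auto
 then show "eventually (%y. dist (n2 (%x. f (x + y) - f x)) 0 < e) (at 0)"
 proof eventually_elim
  case (elim y)
  then show ?case using n2_less_of_approx[OF f uu(1), of y] u(3) e by simp
 qed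
qed

section \<open>Primitives of square integrable functions\<close>

text \<open>An element of H1 in concrete form: f is its continuous representative and g a Borel
  representative of the weak derivative.\<close>

definition prim :: "(real => 'v::euclidean_space) => (real => 'v) => bool" where
 "prim f g \<longleftrightarrow> sq_int f & sq_int g & (\<forall>a b. a <= b --> f b - f a = (LINT x:{a..b}|lborel. g x))"

definition dq :: "real => (real => 'v::euclidean_space) => real => 'v" where
 "dq h f x = (1 / h) *\<^sub>R (f (x + h) - f x)"

lemma primD: "prim f g ==> sq_int f" "prim f g ==> sq_int g"
 "prim f g ==> a <= b ==> f b - f a = (LINT x:{a..b}|lborel. g x)"
 by (auto simp: prim_def)

lemma prim_increment_le:
 assumes "prim f g" "a <= b"
 shows "(norm (f b - f a))\<^sup>2 <= (b - a) * (LINT x:{a..b}|lborel. (norm (g x))\<^sup>2)" "(norm (f b - f a))\<^sup>2 <= (b - a) * n2 g"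
proof -
 show 1: "(norm (f b - f a))\<^sup>2 <= (b - a) * (LINT x:{a..b}|lborel. (norm (g x))\<^sup>2)"
  using sq_int_local(2)[OF primD(2)[OF assms(1)] assms(2)] primD(3)[OF assms] by simp
 also have "... <= (b - a) * n2 g"
  using assms by (intro mult_left_mono set_norm2_le_n2 primD(2)[OF assms(1)]) auto
 finally show "(norm (f b - f a))\<^sup>2 <= (b - a) * n2 g" .
qed

lemma prim_increment_le_abs:
 assumes "prim f g" shows "(norm (f y - f x))\<^sup>2 <= \<bar>y - x\<bar> * n2 g"
 using prim_increment_le(2)[OF assms, of x y] prim_increment_le(2)[OF assms, of y x]
 by (cases "x <= y") (auto simp: norm_minus_commute)

lemma prim_continuous:
 assumes "prim f g" shows "continuous_on UNIV f"
proof -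
 have "(f \<longlongrightarrow> f x) (at x)" for x
 proof -
  have "((%y. sqrt (\<bar>y - x\<bar> * n2 g)) \<longlongrightarrow> sqrt (\<bar>x - x\<bar> * n2 g)) (at x)" by (intro tendsto_intros)
  then have "((%y. sqrt (\<bar>y - x\<bar> * n2 g)) \<longlongrightarrow> 0) (at x)" by simp
  moreover have "eventually (%y. norm (f y - f x) <= sqrt (\<bar>y - x\<bar> * n2 g)) (at x)"
   by (intro always_eventually allI real_le_rsqrt prim_increment_le_abs assms)
  ultimately have "((%y. f y - f x) \<longlongrightarrow> 0) (at x)" by (rule Lim_null_comparison[rotated])
  then show ?thesis by (rule LIM_zero_cancel)
 qed
 then show ?thesis by (simp add: continuous_on_eq_continuous_at isCont_def)
qed

text \<open>The Sobolev embedding into bounded functions: f x is compared with f y, and the result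
  is averaged over y in a unit interval.\<close>

lemma prim_bounded:
 assumes p: "prim f g" shows "(norm (f x))\<^sup>2 <= 2 * n2 f + 2 * n2 g"
proof -
 have le: "(norm (f x))\<^sup>2 <= 2 * (norm (f y))\<^sup>2 + 2 * n2 g" if "y \<in> {x..x+1}" for y
 proof -
  have "(norm (f x - f y))\<^sup>2 <= \<bar>x - y\<bar> * n2 g" by (rule prim_increment_le_abs[OF p])
  also have "... <= 1 * n2 g" using that by (intro mult_right_mono) auto
  finally show ?thesis using norm2_add_le[of "f y" "f x - f y"] by simp
 qed
 have i1: "set_integrable lborel {x..x+1} (%y. 2 * (norm (f y))\<^sup>2)"
  by (intro set_integrable_mult_right set_norm2_integrable[OF primD(1)[OF p]]) simp
 have ic: "set_integrable lborel {x..x+1} (%y. 2 * n2 g)" by (simp add: set_integrable_def)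
 have i: "set_integrable lborel {x..x+1} (%y. 2 * (norm (f y))\<^sup>2 + 2 * n2 g)"
  by (rule set_integral_add(1)[OF i1 ic])
 have "(norm (f x))\<^sup>2 = (LINT y:{x..x+1}|lborel. (norm (f x))\<^sup>2)" by (simp add: set_lebesgue_integral_def)
 also have "... <= (LINT y:{x..x+1}|lborel. 2 * (norm (f y))\<^sup>2 + 2 * n2 g)"
  by (rule set_integral_mono[OF _ i]) (auto simp: set_integrable_def intro: le)
 also have "... = 2 * (LINT y:{x..x+1}|lborel. (norm (f y))\<^sup>2) + 2 * n2 g"
 proof -
  have "(LINT y:{x..x+1}|lborel. k) = k" for k :: real by (simp add: set_lebesgue_integral_def)
  then show ?thesis unfolding set_integral_add(2)[OF i1 ic] by simp
 qed
 also have "... <= 2 * n2 f + 2 * n2 g" using set_norm2_le_n2[OF primD(1)[OF p], of "{x..x+1}"] by simp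
 finally show ?thesis .
qed

lemma set_integral_shift_Icc:
 fixes g :: "real => 'v::euclidean_space"
 shows "(LINT y:{a..b}|lborel. g (x + y)) = (LINT z:{x + a..x + b}|lborel. g z)"
proof -
 have "(LINT z:{x + a..x + b}|lborel. g z) = (LINT y|lborel. indicator {x + a..x + b} (y + x) *\<^sub>R g (y + x))"
  unfolding set_lebesgue_integral_def by (rule lborel_integral_shift(1)[symmetric])
 also have "... = (LINT y:{a..b}|lborel. g (x + y))"
  unfolding set_lebesgue_integral_def by (intro Bochner_Integration.integral_cong) (auto simp: indicator_def add.commute)
 finally show ?thesis ..
qed

lemma sq_int_dq: "sq_int f ==> sq_int (dq h f)"
 unfolding dq_def by (intro sq_int_scaleR(1) sq_int_diff(1) sq_int_shift(1))

text \<open>Unlike in \<open>prim\<close>, f itself may fail to be square integrable, as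
  antiderivatives of square integrable functions often do.\<close>

definition antider :: "(real => 'v::euclidean_space) => (real => 'v) => bool" where
 "antider f g \<longleftrightarrow> sq_int g & (\<forall>a b. a <= b --> f b - f a = (LINT x:{a..b}|lborel. g x))"

lemma antiderD: "antider f g ==> sq_int g"
 "antider f g ==> a <= b ==> f b - f a = (LINT x:{a..b}|lborel. g x)"
 by (auto simp: antider_def)

lemma prim_antider: "prim f g \<longleftrightarrow> sq_int f & antider f g"
 by (auto simp: antider_def prim_def)

lemma prim_imp_antider: "prim f g ==> antider f g"
 by (simp add: prim_antider)

lemma continuous_of_increments:
 fixes f g :: "real => 'v::euclidean_space"
 assumes p: "antider f g"
 shows "continuous_on UNIV f" "(norm (f y - f x))\<^sup>2 <= \<bar>y - x\<bar> * n2 g"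
proof -
 note g = antiderD(1)[OF p] and f = antiderD(2)[OF p]
 have 1: "(norm (f b - f a))\<^sup>2 <= (b - a) * n2 g" if "a <= b" for a b
 proof -
  have "(norm (f b - f a))\<^sup>2 <= (b - a) * (LINT x:{a..b}|lborel. (norm (g x))\<^sup>2)"
   using sq_int_local(2)[OF g that] f[OF that] by simp
  also have "... <= (b - a) * n2 g" using that by (intro mult_left_mono set_norm2_le_n2 g) auto
  finally show ?thesis .
 qed
 have 2: "(norm (f y - f x))\<^sup>2 <= \<bar>y - x\<bar> * n2 g" for x y
  using 1[of x y] 1[of y x] by (cases "x <= y") (auto simp: norm_minus_commute)
 then show "(norm (f y - f x))\<^sup>2 <= \<bar>y - x\<bar> * n2 g" .
 have "(f \<longlongrightarrow> f x) (at x)" for x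
 proof -
  have "((%y. sqrt (\<bar>y - x\<bar> * n2 g)) \<longlongrightarrow> sqrt (\<bar>x - x\<bar> * n2 g)) (at x)" by (intro tendsto_intros)
  then have "((%y. sqrt (\<bar>y - x\<bar> * n2 g)) \<longlongrightarrow> 0) (at x)" by simp
  moreover have "eventually (%y. norm (f y - f x) <= sqrt (\<bar>y - x\<bar> * n2 g)) (at x)"
   by (intro always_eventually allI real_le_rsqrt 2)
  ultimately have "((%y. f y - f x) \<longlongrightarrow> 0) (at x)" by (rule Lim_null_comparison[rotated])
  then show ?thesis by (rule LIM_zero_cancel)
 qed
 then show "continuous_on UNIV f" by (simp add: continuous_on_eq_continuous_at isCont_def)
qed

text \<open>The difference quotient minus the derivative is the mean of g (x + y) - g x over 0 <= y
  <= h, to which Cauchy-Schwarz applies.\<close>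

lemma dq_minus_norm2_le:
 assumes p: "antider f g" and h: "h > 0"
 shows "(norm (dq h f x - g x))\<^sup>2 <= (1 / h) * (LINT y:{0..h}|lborel. (norm (g (x + y) - g x))\<^sup>2)"
  "set_integrable lborel {0..h} (%y. (norm (g (x + y) - g x))\<^sup>2)"
proof -
 \<comment> \<open>The constant g x is subtracted on [0, h] only: this keeps u square integrable on
   the line and changes nothing on the interval of integration.\<close>
 define u where "u = (%y. g (x + y) - indicator {0..h} y *\<^sub>R g x)"
 have "sq_int (%y. indicator {0..h} y *\<^sub>R g x)"
 proof (rule sq_int_bound(1))
  show "integrable lborel (%y. indicator {0..h} y * (norm (g x))\<^sup>2)" by simp
 qed (auto simp: indicator_def)
 moreover have "sq_int (%y. g (x + y))" using sq_int_shift(1)[OF antiderD(1)[OF p], of x] by (simp add: add.commute)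
 ultimately have u: "sq_int u" unfolding u_def by (intro sq_int_diff)
 have c: "(LINT y:{0..h}|lborel. k (g (x + y) - g x)) = (LINT y:{0..h}|lborel. k (u y))" for k :: "'a => 'c::euclidean_space"
  unfolding set_lebesgue_integral_def by (intro Bochner_Integration.integral_cong) (auto simp: u_def indicator_def)
 have gi: "set_integrable lborel {0..h} (%y. g (x + y))"
  using sq_int_local(1)[OF sq_int_shift(1)[OF antiderD(1)[OF p], of x], of 0 h] by (simp add: add.commute)
 have "h *\<^sub>R (dq h f x - g x) = (LINT y:{0..h}|lborel. g (x + y)) - (LINT y:{0..h}|lborel. g x)"
  using h antiderD(2)[OF p, of x "x + h"] set_integral_shift_Icc[of 0 h g x]
  by (simp add: dq_def scaleR_diff_right set_lebesgue_integral_def)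
 also have "... = (LINT y:{0..h}|lborel. g (x + y) - g x)"
  using gi by (subst set_integral_diff(2)) (auto simp: set_integrable_def)
 also have "... = (LINT y:{0..h}|lborel. u y)" using c[of "%z. z"] by simp
 finally have e: "h *\<^sub>R (dq h f x - g x) = (LINT y:{0..h}|lborel. u y)" .
 have "h\<^sup>2 * (norm (dq h f x - g x))\<^sup>2 = (norm (LINT y:{0..h}|lborel. u y))\<^sup>2"
  unfolding e[symmetric] using h by (simp add: power_mult_distrib)
 also have "... <= (h - 0) * (LINT y:{0..h}|lborel. (norm (u y))\<^sup>2)" using h by (intro sq_int_local(2)[OF u]) auto
 finally have "h * (h * (norm (dq h f x - g x))\<^sup>2) <= h * (LINT y:{0..h}|lborel. (norm (g (x + y) - g x))\<^sup>2)"
  using c[of "%z. (norm z)\<^sup>2"] by (simp add: power2_eq_square mult_ac)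
 then have "h * (norm (dq h f x - g x))\<^sup>2 <= (LINT y:{0..h}|lborel. (norm (g (x + y) - g x))\<^sup>2)"
  using h by simp
 then show "(norm (dq h f x - g x))\<^sup>2 <= (1 / h) * (LINT y:{0..h}|lborel. (norm (g (x + y) - g x))\<^sup>2)"
  using h by (simp add: field_simps)
 have "set_integrable lborel {0..h} (%y. (norm (u y))\<^sup>2)" by (rule set_norm2_integrable[OF u]) simp
 moreover have "(%y. indicator {0..h} y *\<^sub>R (norm (u y))\<^sup>2) = (%y. indicator {0..h} y *\<^sub>R (norm (g (x + y) - g x))\<^sup>2)"
  by (auto simp: u_def indicator_def fun_eq_iff)
 ultimately show "set_integrable lborel {0..h} (%y. (norm (g (x + y) - g x))\<^sup>2)" unfolding set_integrable_def by simp
qed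

text \<open>Integrate the pointwise bound in x and exchange the integrals; the inner one is then a
  translation error of g.\<close>

lemma dq_minus_n2_le:
 assumes p: "antider f g" and h: "h > 0" and e: "!!y. 0 < y ==> y <= h ==> n2 (%x. g (x + y) - g x) <= e"
 shows "sq_int (%x. dq h f x - g x)" "n2 (%x. dq h f x - g x) <= e"
proof -
 have g: "sq_int g" by (rule antiderD[OF p])
 have gm [measurable]: "g \<in> borel_measurable borel" using g by (simp add: sq_int_def)
 have e0: "0 <= e" using e[OF h] n2_nonneg order_trans by blast
 have ed: "n2 (%x. g (x + y) - g x) <= e" if "y \<in> {0..h}" for y
  using that e[of y] e0 by (cases "y = 0") (auto simp: n2_def)
 have fm [measurable]: "f \<in> borel_measurable borel"
  by (intro borel_measurable_continuous_onI continuous_of_increments(1)[OF p])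
 have dm [measurable]: "(%x. dq h f x - g x) \<in> borel_measurable borel" unfolding dq_def by measurable
 have "(\<integral>\<^sup>+x. ennreal ((norm (dq h f x - g x))\<^sup>2) \<partial>lborel) <= (\<integral>\<^sup>+x. (\<integral>\<^sup>+y. ennreal (1 / h) * (ennreal ((norm (g (x + y) - g x))\<^sup>2) * indicator {0..h} y) \<partial>lborel) \<partial>lborel)"
 proof (rule nn_integral_mono)
  fix x
  have "ennreal ((norm (dq h f x - g x))\<^sup>2) <= ennreal ((1 / h) * (LINT y:{0..h}|lborel. (norm (g (x + y) - g x))\<^sup>2))"
   by (intro ennreal_leI dq_minus_norm2_le[OF p h])
  also have "... = ennreal (1 / h) * ennreal (LINT y:{0..h}|lborel. (norm (g (x + y) - g x))\<^sup>2)"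
   using h by (intro ennreal_mult) (auto simp: set_lebesgue_integral_def intro!: Bochner_Integration.integral_nonneg)
  also have "ennreal (LINT y:{0..h}|lborel. (norm (g (x + y) - g x))\<^sup>2) = (\<integral>\<^sup>+y. ennreal (indicator {0..h} y *\<^sub>R (norm (g (x + y) - g x))\<^sup>2) \<partial>lborel)"
   unfolding set_lebesgue_integral_def
   by (rule nn_integral_eq_integral[symmetric]) (use dq_minus_norm2_le(2)[OF p h, of x] in \<open>auto simp: set_integrable_def\<close>)
  also have "... = (\<integral>\<^sup>+y. ennreal ((norm (g (x + y) - g x))\<^sup>2) * indicator {0..h} y \<partial>lborel)"
   by (intro nn_integral_cong) (auto simp: indicator_def)
  finally show "ennreal ((norm (dq h f x - g x))\<^sup>2) <= (\<integral>\<^sup>+y. ennreal (1 / h) * (ennreal ((norm (g (x + y) - g x))\<^sup>2) * indicator {0..h} y) \<partial>lborel)"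
   by (simp add: nn_integral_cmult)
 qed
 also have "... = (\<integral>\<^sup>+y. (\<integral>\<^sup>+x. ennreal (1 / h) * (ennreal ((norm (g (x + y) - g x))\<^sup>2) * indicator {0..h} y) \<partial>lborel) \<partial>lborel)"
  by (rule lborel_pair.Fubini') measurable
 also have "... <= (\<integral>\<^sup>+y. ennreal (1 / h) * (ennreal e * indicator {0..h} y) \<partial>lborel)"
 proof (rule nn_integral_mono)
  fix y
  have sd: "sq_int (%x. g (x + y) - g x)" by (intro sq_int_diff sq_int_shift g)
  have "(\<integral>\<^sup>+x. ennreal ((norm (g (x + y) - g x))\<^sup>2) \<partial>lborel) = ennreal (n2 (%x. g (x + y) - g x))"
   unfolding n2_def by (rule nn_integral_eq_integral[OF sq_int_integrable[OF sd]]) simp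
  then show "(\<integral>\<^sup>+x. ennreal (1 / h) * (ennreal ((norm (g (x + y) - g x))\<^sup>2) * indicator {0..h} y) \<partial>lborel)
   <= ennreal (1 / h) * (ennreal e * indicator {0..h} y)"
   using ed[of y] by (auto simp: nn_integral_cmult indicator_def intro!: mult_left_mono ennreal_leI)
 qed
 also have "... = ennreal (1 / h) * (ennreal e * ennreal h)"
  using h by (simp add: nn_integral_cmult nn_integral_cmult_indicator)
 also have "... = ennreal e" using h e0 by (simp add: ennreal_mult[symmetric])
 finally have le: "(\<integral>\<^sup>+x. ennreal ((norm (dq h f x - g x))\<^sup>2) \<partial>lborel) <= ennreal e" .
 have "AE x in lborel. (%k::nat. dq h f x - g x) \<longlonglongrightarrow> dq h f x - g x" by simp
 from sq_int_limit[of "%_ x. dq h f x - g x" "%x. dq h f x - g x", OF dm dm this, of "%_. e" e]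
 show "sq_int (%x. dq h f x - g x)" "n2 (%x. dq h f x - g x) <= e" using le e0 by auto
qed

lemma dq_tendsto:
 assumes p: "antider f g"
 shows "((%h. n2 (%x. dq h f x - g x)) \<longlongrightarrow> 0) (at_right 0)"
proof (rule tendstoI)
 fix e :: real assume e: "e > 0"
 have "eventually (%y. n2 (%x. g (x + y) - g x) < e / 2) (at 0)"
  using e by (intro order_tendstoD(2)[OF translation_continuous[OF antiderD(1)[OF p]]]) auto
 then obtain d where d: "d > 0" "!!y. y ~= 0 ==> \<bar>y\<bar> < d ==> n2 (%x. g (x + y) - g x) < e / 2"
  unfolding eventually_at by (auto simp: dist_real_def)
 have "eventually (%h::real. 0 < h & h < d) (at_right 0)"
  using d(1) by (auto simp: eventually_at_right_field intro!: exI[of _ d])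
 then show "eventually (%h. dist (n2 (%x. dq h f x - g x)) 0 < e) (at_right 0)"
 proof eventually_elim
  case (elim h)
  have "n2 (%x. dq h f x - g x) <= e / 2"
   using elim d(2) by (intro dq_minus_n2_le(2)[OF p]) (auto intro: less_imp_le)
  then show ?case using e by simp
 qed
qed

lemma inner_tendsto:
 assumes a: "sq_int a" "!!h. sq_int (A h)" "((%h. n2 (%x. A h x - a x)) \<longlongrightarrow> 0) F"
  and b: "sq_int b" "!!h. sq_int (B h)" "((%h. n2 (%x. B h x - b x)) \<longlongrightarrow> 0) F"
 shows "((%h. LINT x|lborel. A h x \<bullet> B h x) \<longlongrightarrow> (LINT x|lborel. a x \<bullet> b x)) F"
proof (rule LIM_zero_cancel, rule Lim_null_comparison)
 let ?e = "%h. sqrt (n2 (%x. A h x - a x)) * sqrt (n2 (%x. B h x - b x)) + sqrt (n2 (%x. A h x - a x)) * sqrt (n2 b)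
   + sqrt (n2 a) * sqrt (n2 (%x. B h x - b x))"
 show "eventually (%h. norm ((LINT x|lborel. A h x \<bullet> B h x) - (LINT x|lborel. a x \<bullet> b x)) <= ?e h) F"
 proof (intro always_eventually allI)
  fix h
  let ?da = "%x. A h x - a x" and ?db = "%x. B h x - b x"
  have s: "sq_int ?da" "sq_int ?db" using a b by (auto intro: sq_int_diff)
  have "(LINT x|lborel. A h x \<bullet> B h x) = (LINT x|lborel. (?da x \<bullet> ?db x + ?da x \<bullet> b x) + (a x \<bullet> ?db x + a x \<bullet> b x))"
   by (intro Bochner_Integration.integral_cong) (auto simp: inner_diff_left inner_diff_right)
  also have "... = ((LINT x|lborel. ?da x \<bullet> ?db x) + (LINT x|lborel. ?da x \<bullet> b x)) + ((LINT x|lborel. a x \<bullet> ?db x) + (LINT x|lborel. a x \<bullet> b x))"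
   using s a(1) b(1) by (simp add: Bochner_Integration.integral_add integrable_inner_sq)
  finally show "norm ((LINT x|lborel. A h x \<bullet> B h x) - (LINT x|lborel. a x \<bullet> b x)) <= ?e h"
   using integrable_inner_sq(2)[OF s] integrable_inner_sq(2)[OF s(1) b(1)] integrable_inner_sq(2)[OF a(1) s(2)]
   unfolding real_norm_def by linarith
 qed
 have "(?e \<longlongrightarrow> sqrt 0 * sqrt 0 + sqrt 0 * sqrt (n2 b) + sqrt (n2 a) * sqrt 0) F"
  by (intro tendsto_intros a b)
 then show "(?e \<longlongrightarrow> 0) F" by simp
qed

text \<open>Riesz-Fischer. Along indices with squared distances below 8^(-i) the weights 4^i still
  leave a convergent sum, so almost everywhere the increments are eventually at most 2^(-i) and the
  subsequence converges. Fatou's lemma then gives convergence in norm of the whole sequence.\<close>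

lemma sq_int_complete:
 fixes f :: "nat => real => 'v::euclidean_space"
 assumes f: "!!n. sq_int (f n)"
  and C: "!!e. e > 0 ==> \<exists>N. \<forall>m\<ge>N. \<forall>n\<ge>N. n2 (%x. f m x - f n x) < e"
 obtains g where "sq_int g" "(%n. n2 (%x. f n x - g x)) \<longlonglongrightarrow> 0"
proof -
 have fm [measurable]: "f n \<in> borel_measurable borel" for n using f by (simp add: sq_int_def)
 obtain N where N: "!!i m n. m \<ge> N i ==> n \<ge> N i ==> n2 (%x. f m x - f n x) < (1/8) ^ i"
  using C[of "(1/8) ^ _"] by (metis zero_less_power zero_less_divide_1_iff zero_less_numeral)
 define s where "s = (%i. Max (N ` {..i}))"
 have sN: "N j <= s i" if "j <= i" for i j unfolding s_def using that by (intro Max_ge) auto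
 define d where "d = (%i x. f (s (Suc i)) x - f (s i) x)"
 have ds: "sq_int (d i)" for i unfolding d_def by (intro sq_int_diff f)
 have dm [measurable]: "d i \<in> borel_measurable borel" for i using ds by (simp add: sq_int_def)
 have dn: "n2 (d i) <= (1/8) ^ i" for i
  unfolding d_def by (rule less_imp_le[OF N]; rule sN; simp)
 have "(\<integral>\<^sup>+x. (\<Sum>i. ennreal (4 ^ i * (norm (d i x))\<^sup>2)) \<partial>lborel) = (\<Sum>i. \<integral>\<^sup>+x. ennreal (4 ^ i * (norm (d i x))\<^sup>2) \<partial>lborel)"
  by (rule nn_integral_suminf) measurable
 also have "... <= (\<Sum>i. ennreal ((1/2) ^ i))"
 proof (rule suminf_le)
  fix i
  have "(\<integral>\<^sup>+x. ennreal (4 ^ i * (norm (d i x))\<^sup>2) \<partial>lborel) = ennreal (LINT x|lborel. 4 ^ i * (norm (d i x))\<^sup>2)"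
   by (intro nn_integral_eq_integral integrable_mult_right sq_int_integrable ds) simp
  also have "(LINT x|lborel. 4 ^ i * (norm (d i x))\<^sup>2) = 4 ^ i * n2 (d i)" by (simp add: n2_def)
  also have "ennreal (4 ^ i * n2 (d i)) <= ennreal (4 ^ i * (1/8) ^ i)"
   by (intro ennreal_leI mult_left_mono dn) auto
  also have "(4::real) ^ i * (1/8) ^ i = (1/2) ^ i" by (simp add: power_mult_distrib[symmetric])
  finally show "(\<integral>\<^sup>+x. ennreal (4 ^ i * (norm (d i x))\<^sup>2) \<partial>lborel) <= ennreal ((1/2) ^ i)" .
 qed auto
 also have "... < \<infinity>"
  by (subst suminf_ennreal2) (auto simp: summable_geometric)
 finally have "AE x in lborel. (\<Sum>i. ennreal (4 ^ i * (norm (d i x))\<^sup>2)) ~= \<infinity>"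
  by (intro nn_integral_PInf_AE) auto
 then have conv: "AE x in lborel. convergent (%i. f (s i) x)"
 proof eventually_elim
  case (elim x)
  have "summable (%i. 4 ^ i * (norm (d i x))\<^sup>2)"
   using elim by (intro summable_suminf_not_top) auto
  then have "(%i. 4 ^ i * (norm (d i x))\<^sup>2) \<longlonglongrightarrow> 0" by (rule summable_LIMSEQ_zero)
  then have "eventually (%i. 4 ^ i * (norm (d i x))\<^sup>2 < 1) sequentially" by (intro order_tendstoD) auto
  then have ev: "eventually (%i. norm (d i x) <= (1/2) ^ i) sequentially"
  proof eventually_elim
   case (elim i)
   have "(norm (d i x))\<^sup>2 <= ((1/2) ^ i)\<^sup>2"
   proof -
    have "((1/2::real) ^ i)\<^sup>2 * 4 ^ i = 1" by (simp add: power_mult_distrib[symmetric] power2_eq_square)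
    then have "(norm (d i x))\<^sup>2 = ((1/2) ^ i)\<^sup>2 * (4 ^ i * (norm (d i x))\<^sup>2)" by (simp add: mult.assoc[symmetric])
    also have "... <= ((1/2) ^ i)\<^sup>2 * 1" using elim by (intro mult_left_mono) auto
    finally show ?thesis by simp
   qed
   then show ?case by (rule power2_le_imp_le) simp
  qed
  have "summable (%i. d i x)"
   by (rule summable_comparison_test_ev[OF ev]) (simp add: summable_geometric)
  then obtain l where "(%n. \<Sum>i<n. d i x) \<longlonglongrightarrow> l" unfolding summable_def sums_def by blast
  moreover have "(\<Sum>i<n. d i x) = f (s n) x - f (s 0) x" for n
   unfolding d_def by (rule sum_lessThan_telescope)
  ultimately have "(%n. (f (s n) x - f (s 0) x) + f (s 0) x) \<longlonglongrightarrow> l + f (s 0) x" by (intro tendsto_intros) simp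
  then show ?case by (auto simp: convergent_def)
 qed
 define g where "g = (%x. lim (%i. f (s i) x))"
 have gm [measurable]: "g \<in> borel_measurable borel" unfolding g_def by (rule borel_measurable_lim_metric) measurable
 have lim: "AE x in lborel. (%i. f (s i) x) \<longlonglongrightarrow> g x"
  using conv by eventually_elim (simp add: g_def convergent_LIMSEQ_iff)
 have est: "sq_int (%x. f n x - g x) & n2 (%x. f n x - g x) <= (1/8) ^ j" if "n \<ge> N j" for n j
 proof -
  have l: "AE x in lborel. (%i. f n x - f (s i) x) \<longlonglongrightarrow> f n x - g x"
   using lim by eventually_elim (intro tendsto_intros)
  have b: "eventually (%k. (\<integral>\<^sup>+x. ennreal ((norm (f n x - f (s k) x))\<^sup>2) \<partial>lborel) <= ennreal ((1/8) ^ j)) sequentially"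
   using eventually_ge_at_top[of j]
  proof eventually_elim
   case (elim k)
   have "(\<integral>\<^sup>+x. ennreal ((norm (f n x - f (s k) x))\<^sup>2) \<partial>lborel) = ennreal (n2 (%x. f n x - f (s k) x))"
    unfolding n2_def by (intro nn_integral_eq_integral sq_int_integrable sq_int_diff f) simp
   also have "... <= ennreal ((1/8) ^ j)" by (intro ennreal_leI less_imp_le[OF N] that sN elim)
   finally show ?case .
  qed
  show ?thesis
   using sq_int_limit[of "%i x. f n x - f (s i) x" "%x. f n x - g x" "%_. (1/8) ^ j" "(1/8) ^ j"] l b by auto
 qed
 have "sq_int (%x. f (N 0) x - g x)" using est[of 0 "N 0"] by simp
 from sq_int_diff(1)[OF f[of "N 0"] this] have "sq_int g" by simp
 moreover have "(%n. n2 (%x. f n x - g x)) \<longlonglongrightarrow> 0"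
 proof (rule tendstoI)
  fix e :: real assume "e > 0"
  then obtain j where "(1/8) ^ j < e" using real_arch_pow_inv[of e "1/8"] by auto
  then have "\<forall>n\<ge>N j. dist (n2 (%x. f n x - g x)) 0 < e" using est by fastforce
  then show "eventually (%n. dist (n2 (%x. f n x - g x)) 0 < e) sequentially" unfolding eventually_sequentially by blast
 qed
 ultimately show thesis by (rule that)
qed

section \<open>Step functions and dyadic difference quotients\<close>

lemma integrable_indicator_Ico [simp]: "integrable lborel (indicator {a..<b} :: real => real)"
 by (cases "a <= b") (auto intro!: integrable_real_indicator)

lemma integral_step:
 fixes g :: "int => 'v::euclidean_space"
 assumes e: "e > 0"
 shows "(LINT x|lborel. indicator {a * e..<b * e} x *\<^sub>R g \<lfloor>x / e\<rfloor>) = e *\<^sub>R (\<Sum>j\<in>{a..<b}. g j)" (is ?I)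
  and "integrable lborel (%x. indicator {a * e..<b * e} x *\<^sub>R g \<lfloor>x / e\<rfloor>)" (is ?J)
proof -
 have cell: "x \<in> {j * e..<(j + 1) * e} \<longleftrightarrow> j = \<lfloor>x / e\<rfloor>" for x and j :: int
  using e by (auto simp: floor_eq_iff pos_le_divide_eq pos_divide_less_eq eq_commute[of j])
 have range: "x \<in> {a * e..<b * e} \<longleftrightarrow> \<lfloor>x / e\<rfloor> \<in> {a..<b}" for x
  using e by (simp add: le_floor_iff floor_less_iff pos_le_divide_eq pos_divide_less_eq)
 have eq: "indicator {a * e..<b * e} x *\<^sub>R g \<lfloor>x / e\<rfloor> = (\<Sum>j\<in>{a..<b}. indicator {j * e..<(j + 1) * e} x *\<^sub>R g j)" for x
 proof -
  have "(\<Sum>j\<in>{a..<b}. indicator {j * e..<(j + 1) * e} x *\<^sub>R g j) = (\<Sum>j\<in>{a..<b}. if j = \<lfloor>x / e\<rfloor> then g j else 0)"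
   unfolding indicator_def cell by (intro sum.cong refl) simp
  also have "... = indicator {a * e..<b * e} x *\<^sub>R g \<lfloor>x / e\<rfloor>"
   unfolding indicator_def range by (simp add: sum.delta)
  finally show ?thesis ..
 qed
 have i: "integrable lborel (%x. indicator {j * e..<(j + 1) * e} x *\<^sub>R g j)" for j :: int
  by (rule integrable_scaleR_left) simp
 show ?J unfolding eq by (intro Bochner_Integration.integrable_sum i)
 have "(LINT x|lborel. indicator {j * e..<(j + 1) * e} x *\<^sub>R g j) = e *\<^sub>R g j" for j :: int
 proof -
  have "j * e <= (j + 1) * e" using e by (simp add: distrib_right)
  then show ?thesis by (simp add: algebra_simps)
 qed
 then show ?I unfolding eq scaleR_sum_right
  by (subst Bochner_Integration.integral_sum[OF i]) (rule sum.cong[OF refl], assumption)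
qed

lemma floor_scaled_tendsto:
 fixes e :: "nat => real"
 assumes "!!k. e k > 0" "e \<longlonglongrightarrow> 0" shows "(%k. of_int \<lfloor>x / e k\<rfloor> * e k) \<longlonglongrightarrow> x"
proof (rule tendsto_sandwich)
 show "(%k. x - e k) \<longlonglongrightarrow> x" using tendsto_diff[OF tendsto_const assms(2), of x] by simp
 have 1: "x / e k - 1 <= of_int \<lfloor>x / e k\<rfloor>" "of_int \<lfloor>x / e k\<rfloor> <= x / e k" for k by linarith+
 show "\<forall>\<^sub>F k in sequentially. x - e k <= of_int \<lfloor>x / e k\<rfloor> * e k"
 proof (intro always_eventually allI)
  show "x - e k <= of_int \<lfloor>x / e k\<rfloor> * e k" for k
   using mult_right_mono[OF 1(1)[of k], of "e k"] assms(1)[of k] by (simp add: left_diff_distrib)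
 qed
 show "\<forall>\<^sub>F k in sequentially. of_int \<lfloor>x / e k\<rfloor> * e k <= x"
 proof (intro always_eventually allI)
  show "of_int \<lfloor>x / e k\<rfloor> * e k <= x" for k
   using mult_right_mono[OF 1(2)[of k], of "e k"] assms(1)[of k] by simp
 qed
qed simp

text \<open>The difference quotients over the dyadic grid form a martingale. It converges in \<open>L\<^sup>2\<close> when it is bounded.\<close>

definition mesh :: "nat => real" where "mesh k = (1/2) ^ k"

definition slope :: "(real => 'v::euclidean_space) => nat => real => 'v" where
 "slope f k x = (1 / mesh k) *\<^sub>R (f ((\<lfloor>x / mesh k\<rfloor> + 1) * mesh k) - f (\<lfloor>x / mesh k\<rfloor> * mesh k))"

lemma mesh_pos: "mesh k > 0"
 by (simp add: mesh_def)

lemma mesh_lim: "mesh \<longlonglongrightarrow> 0"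
 unfolding mesh_def by (rule LIMSEQ_power_zero) simp

lemma mesh_add: "mesh j = 2 ^ i * mesh (j + i)"
 by (simp add: mesh_def power_add power_mult_distrib[symmetric])

lemma slope_measurable [measurable]: "slope f k \<in> borel_measurable borel"
proof -
 define g where "g = (%j::int. (1 / mesh k) *\<^sub>R (f ((j + 1) * mesh k) - f (j * mesh k)))"
 have "slope f k = (%x. g \<lfloor>x / mesh k\<rfloor>)" by (simp add: slope_def g_def fun_eq_iff)
 moreover have "(%x::real. g \<lfloor>x / mesh k\<rfloor>) \<in> borel_measurable borel" by measurable
 ultimately show ?thesis by simp
qed

lemma slope_integral:
 fixes f :: "real => 'v::euclidean_space"
 assumes "a <= b"
 shows "(LINT x|lborel. indicator {of_int a * mesh k..<of_int b * mesh k} x *\<^sub>R slope f k x) = f (b * mesh k) - f (a * mesh k)"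
  "integrable lborel (%x. indicator {of_int a * mesh k..<of_int b * mesh k} x *\<^sub>R slope f k x)"
proof -
 let ?g = "%j::int. (1 / mesh k) *\<^sub>R (f ((j + 1) * mesh k) - f (j * mesh k))"
 note st = integral_step[OF mesh_pos[of k], of a b ?g]
 show "integrable lborel (%x. indicator {of_int a * mesh k..<of_int b * mesh k} x *\<^sub>R slope f k x)"
  using st(2) by (simp add: slope_def)
 have tel: "(\<Sum>j\<in>{a..<a + int n}. f ((of_int j + 1) * mesh k) - f (of_int j * mesh k)) = f (of_int (a + int n) * mesh k) - f (of_int a * mesh k)" for n
 proof (induction n)
  case (Suc n)
  have "{a..<a + int (Suc n)} = insert (a + int n) {a..<a + int n}" by auto
  then show ?case using Suc by (simp add: algebra_simps)
 qed simp
 have "(LINT x|lborel. indicator {of_int a * mesh k..<of_int b * mesh k} x *\<^sub>R slope f k x) = mesh k *\<^sub>R (\<Sum>j\<in>{a..<b}. ?g j)"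
  using st(1) by (simp add: slope_def)
 also have "... = (\<Sum>j\<in>{a..<b}. f ((of_int j + 1) * mesh k) - f (of_int j * mesh k))"
  using mesh_pos[of k] by (simp add: scaleR_sum_right)
 also have "... = f (b * mesh k) - f (a * mesh k)" using tel[of "nat (b - a)"] assms by simp
 finally show "(LINT x|lborel. indicator {of_int a * mesh k..<of_int b * mesh k} x *\<^sub>R slope f k x) = f (b * mesh k) - f (a * mesh k)" .
qed

text \<open>Between -N h and N h the squared norm is the quadratic variation over the grid divided
  by h; N then tends to infinity by Fatou's lemma.\<close>

lemma slope_bound:
 fixes f :: "real => 'v::euclidean_space"
 assumes qv: "!!x h J. h > 0 ==> (\<Sum>i<J. (norm (f (x + real (Suc i) * h) - f (x + real i * h)))\<^sup>2) <= C * h"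
  and C: "C \<ge> 0"
 shows "sq_int (slope f k)" "n2 (slope f k) <= C"
proof -
 let ?h = "mesh k"
 let ?I = "%N. {of_int (- int N) * ?h..<of_int (int N) * ?h}"
 let ?f = "%N x. indicator (?I N) x *\<^sub>R slope f k x"
 let ?g = "%j::int. (norm ((1 / ?h) *\<^sub>R (f ((j + 1) * ?h) - f (j * ?h))))\<^sup>2"
 have h: "?h > 0" by (rule mesh_pos)
 have b: "(\<integral>\<^sup>+x. ennreal ((norm (?f N x))\<^sup>2) \<partial>lborel) <= ennreal C" for N
 proof -
  have e: "(norm (?f N x))\<^sup>2 = indicator (?I N) x *\<^sub>R ?g \<lfloor>x / ?h\<rfloor>" for x by (simp add: slope_def indicator_def)
  have "(\<integral>\<^sup>+x. ennreal ((norm (?f N x))\<^sup>2) \<partial>lborel) = ennreal (LINT x|lborel. indicator (?I N) x *\<^sub>R ?g \<lfloor>x / ?h\<rfloor>)"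
   unfolding e by (rule nn_integral_eq_integral[OF integral_step(2)[OF h]]) (auto simp: indicator_def)
  also have "(LINT x|lborel. indicator (?I N) x *\<^sub>R ?g \<lfloor>x / ?h\<rfloor>) = ?h * (\<Sum>j\<in>{- int N..<int N}. ?g j)"
   using integral_step(1)[OF h, of "- int N" "int N" ?g] by simp
  also have "(\<Sum>j\<in>{- int N..<int N}. ?g j) = (\<Sum>i<2 * N. ?g (int i - int N))"
   by (rule sum.reindex_bij_witness[where i = "%i. int i - int N" and j = "%j. nat (j + int N)"]) auto
  also have "?h * ... = (1 / ?h) * (\<Sum>i<2 * N. (norm (f (- real N * ?h + real (Suc i) * ?h) - f (- real N * ?h + real i * ?h)))\<^sup>2)"
  proof -
   have "?h * ?g (int i - int N) = (1 / ?h) * (norm (f (- real N * ?h + real (Suc i) * ?h) - f (- real N * ?h + real i * ?h)))\<^sup>2" for i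
   proof -
    have a: "(of_int (int i - int N) + 1) * ?h = - real N * ?h + real (Suc i) * ?h"
     "of_int (int i - int N) * ?h = - real N * ?h + real i * ?h" by (simp_all add: algebra_simps)
    show ?thesis unfolding a using h by (simp add: power_divide power2_eq_square)
   qed
   then show ?thesis by (simp only: sum_distrib_left)
  qed
  also have "... <= (1 / ?h) * (C * ?h)" using h by (intro mult_left_mono qv) auto
  also have "... = C" using h by simp
  finally show ?thesis using C by (simp add: ennreal_leI)
 qed
 have l: "AE x in lborel. (%N. ?f N x) \<longlonglongrightarrow> slope f k x"
 proof (intro AE_I2 tendsto_eventually)
  fix x
  obtain N0 :: nat where N0: "\<bar>x\<bar> / ?h < real N0" using reals_Archimedean2 by blast
  show "\<forall>\<^sub>F N in sequentially. ?f N x = slope f k x"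
   using eventually_ge_at_top[of N0]
  proof eventually_elim
   case (elim N)
   then have "\<bar>x\<bar> / ?h < real N" using N0 by simp
   then have "\<bar>x\<bar> < real N * ?h" using h by (simp add: divide_less_eq)
   then have "x \<in> ?I N" by auto
   then show ?case by simp
  qed
 qed
 show "sq_int (slope f k)" "n2 (slope f k) <= C"
  using sq_int_limit[of ?f "slope f k" "%_. C" C] l b C by auto
qed

text \<open>The martingale property: over a coarse cell the fine and the coarse slope have the same
  integral, and the coarse slope is constant there. So their difference is orthogonal to the coarse
  slope, and Pythagoras applies.\<close>

lemma slope_orthogonal:
 fixes f :: "real => 'v::euclidean_space"
 assumes s: "!!k. sq_int (slope f k)"
 shows "n2 (%x. slope f (j + i) x - slope f j x) = n2 (slope f (j + i)) - n2 (slope f j)"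
proof -
 let ?k = "j + i" and ?h = "mesh j"
 let ?D = "%x. slope f ?k x - slope f j x"
 let ?I = "%N::nat. {of_int (- int N) * ?h..<of_int (int N) * ?h}"
 have D: "sq_int ?D" by (intro sq_int_diff s)
 have int: "integrable lborel (%x. ?D x \<bullet> slope f j x)" by (rule integrable_inner_sq(1)[OF D s])
 have cell0: "(LINT x|lborel. indicator {of_int a * ?h..<of_int (a + 1) * ?h} x *\<^sub>R ?D x) = 0"
   "integrable lborel (%x. indicator {of_int a * ?h..<of_int (a + 1) * ?h} x *\<^sub>R ?D x)" for a
 proof -
  have m: "of_int (b * 2 ^ i) * mesh ?k = of_int b * ?h" for b :: int by (simp add: mesh_add[of j i])
  note 1 = slope_integral[of "a * 2 ^ i" "(a + 1) * 2 ^ i" ?k f, unfolded m]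
  note 2 = slope_integral[of a "a + 1" j f]
  have le: "a * 2 ^ i <= (a + 1) * 2 ^ i" by simp
  show "(LINT x|lborel. indicator {of_int a * ?h..<of_int (a + 1) * ?h} x *\<^sub>R ?D x) = 0"
   using 1[OF le] 2 by (simp add: scaleR_diff_right)
  show "integrable lborel (%x. indicator {of_int a * ?h..<of_int (a + 1) * ?h} x *\<^sub>R ?D x)"
   unfolding scaleR_diff_right by (intro Bochner_Integration.integrable_diff 1(2)[OF le] 2(2)) simp
 qed
 have N0: "(LINT x|lborel. indicator (?I N) x * (?D x \<bullet> slope f j x)) = 0" for N
 proof -
  let ?c = "%a::int. (1 / ?h) *\<^sub>R (f ((a + 1) * ?h) - f (a * ?h))"
  have "indicator (?I N) x * (?D x \<bullet> slope f j x)
   = (\<Sum>a\<in>{- int N..<int N}. (indicator {of_int a * ?h..<of_int (a + 1) * ?h} x *\<^sub>R ?D x) \<bullet> ?c a)" for x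
  proof -
   have cell: "x \<in> {of_int a * ?h..<of_int (a + 1) * ?h} \<longleftrightarrow> a = \<lfloor>x / ?h\<rfloor>" for a :: int
    using mesh_pos[of j] by (auto simp: floor_eq_iff pos_le_divide_eq pos_divide_less_eq eq_commute[of a])
   have range: "x \<in> ?I N \<longleftrightarrow> \<lfloor>x / ?h\<rfloor> \<in> {- int N..<int N}"
    using mesh_pos[of j] by (simp add: le_floor_iff floor_less_iff pos_le_divide_eq pos_divide_less_eq)
   have "(\<Sum>a\<in>{- int N..<int N}. (indicator {of_int a * ?h..<of_int (a + 1) * ?h} x *\<^sub>R ?D x) \<bullet> ?c a)
    = (\<Sum>a\<in>{- int N..<int N}. if a = \<lfloor>x / ?h\<rfloor> then ?D x \<bullet> ?c a else 0)"
    unfolding indicator_def cell by (intro sum.cong refl) simp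
   also have "... = indicator (?I N) x * (?D x \<bullet> slope f j x)"
    unfolding indicator_def range by (simp add: sum.delta slope_def)
   finally show ?thesis ..
  qed
  then have "(LINT x|lborel. indicator (?I N) x * (?D x \<bullet> slope f j x))
   = (\<Sum>a\<in>{- int N..<int N}. LINT x|lborel. (indicator {of_int a * ?h..<of_int (a + 1) * ?h} x *\<^sub>R ?D x) \<bullet> ?c a)"
   by (simp only:) (rule Bochner_Integration.integral_sum, intro integrable_inner_left cell0)
  also have "... = 0"
  proof (rule sum.neutral, rule ballI)
   fix a
   show "(LINT x|lborel. (indicator {of_int a * ?h..<of_int (a + 1) * ?h} x *\<^sub>R ?D x) \<bullet> ?c a) = 0"
    using integral_inner_left[of "?c a" lborel "%x. indicator {of_int a * ?h..<of_int (a + 1) * ?h} x *\<^sub>R ?D x", OF cell0(2)]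
    by (simp only: cell0(1) inner_zero_left)
  qed
  finally show ?thesis .
 qed
 have "(%N. LINT x|lborel. indicator (?I N) x * (?D x \<bullet> slope f j x)) \<longlonglongrightarrow> (LINT x|lborel. ?D x \<bullet> slope f j x)"
 proof (rule integral_dominated_convergence)
  show "integrable lborel (%x. norm (?D x \<bullet> slope f j x))" by (intro integrable_norm int)
  show "AE x in lborel. (%N. indicator (?I N) x * (?D x \<bullet> slope f j x)) \<longlonglongrightarrow> ?D x \<bullet> slope f j x"
  proof (intro AE_I2 tendsto_eventually)
   fix x
   obtain N0 :: nat where N0: "\<bar>x\<bar> / ?h < real N0" using reals_Archimedean2 by blast
   show "\<forall>\<^sub>F N in sequentially. indicator (?I N) x * (?D x \<bullet> slope f j x) = ?D x \<bullet> slope f j x"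
    using eventually_ge_at_top[of N0]
   proof eventually_elim
    case (elim N)
    then have "\<bar>x\<bar> / ?h < real N" using N0 by simp
    then have "\<bar>x\<bar> < real N * ?h" using mesh_pos[of j] by (simp add: divide_less_eq)
    then have "x \<in> ?I N" by auto
    then show ?case by simp
   qed
  qed
 qed (auto simp: indicator_def)
 then have orth: "(LINT x|lborel. ?D x \<bullet> slope f j x) = 0"
  unfolding N0 by (simp add: LIMSEQ_const_iff)
 have "n2 (slope f ?k) = (LINT x|lborel. (norm (?D x))\<^sup>2 + (norm (slope f j x))\<^sup>2 + 2 * (?D x \<bullet> slope f j x))"
  unfolding n2_def by (intro Bochner_Integration.integral_cong refl)
   (simp add: power2_norm_eq_inner inner_diff_left inner_diff_right inner_commute)
 also have "... = n2 ?D + n2 (slope f j)"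
  using sq_int_integrable[OF D] sq_int_integrable[OF s[of j]] int orth by (simp add: n2_def)
 finally show ?thesis by simp
qed

text \<open>By orthogonality the norms of the dyadic slopes increase. Being bounded they converge,
  and then the slopes form a Cauchy sequence in L2. The weak derivative is obtained as a strong
  limit, without weak compactness.\<close>

lemma prim_of_quadratic_variation:
 fixes f :: "real => 'v::euclidean_space"
 assumes f: "sq_int f" "continuous_on UNIV f"
  and qv: "!!x h J. h > 0 ==> (\<Sum>i<J. (norm (f (x + real (Suc i) * h) - f (x + real i * h)))\<^sup>2) <= C * h"
  and C: "C \<ge> 0"
 obtains g where "prim f g" "n2 g <= C"
proof -
 have sl: "sq_int (slope f k)" "n2 (slope f k) <= C" for k
  by (rule slope_bound[of f C]; use qv C in auto)+
 let ?E = "%k. n2 (slope f k)"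
 have mono: "incseq ?E"
 proof (rule incseq_SucI)
  show "?E n <= ?E (Suc n)" for n
   using slope_orthogonal[OF sl(1), of n 1] n2_nonneg[of "%x. slope f (n + 1) x - slope f n x"] by simp
 qed
 obtain E where E: "?E \<longlonglongrightarrow> E" using incseq_convergent[OF mono, of C] sl(2) by blast
 have "\<exists>N. \<forall>m\<ge>N. \<forall>n\<ge>N. n2 (%x. slope f m x - slope f n x) < e" if e: "e > 0" for e
 proof -
  obtain N where N: "!!m n. m \<ge> N ==> n \<ge> N ==> dist (?E m) (?E n) < e"
   using metric_CauchyD[OF LIMSEQ_imp_Cauchy[OF E] e] by blast
  have "n2 (%x. slope f m x - slope f n x) < e" if "m \<ge> N" "n \<ge> N" for m n
  proof (cases "n <= m")
   case True
   then show ?thesis using slope_orthogonal[OF sl(1), of n "m - n"] N[OF that] by (simp add: dist_real_def)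
  next
   case False
   then show ?thesis using slope_orthogonal[OF sl(1), of m "n - m"] N[OF that] n2_commute[of "slope f m" "slope f n"]
    by (simp add: dist_real_def)
  qed
  then show ?thesis by blast
 qed
 then obtain g where g: "sq_int g" "(%k. n2 (%x. slope f k x - g x)) \<longlonglongrightarrow> 0"
  using sq_int_complete[of "slope f"] sl(1) by blast
 have n2_inner: "n2 u = (LINT x|lborel. u x \<bullet> u x)" for u :: "real => 'v" by (simp add: n2_def power2_norm_eq_inner)
 have "(%k. n2 (slope f k)) \<longlonglongrightarrow> n2 g"
  unfolding n2_inner by (intro inner_tendsto g sl(1))
 then have "n2 g <= C" using sl(2) by (intro LIMSEQ_le_const2) auto
 moreover have "f b - f a = (LINT x:{a..b}|lborel. g x)" if ab: "a <= b" for a b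
 proof (rule euclidean_eqI)
  fix u :: 'v assume "u \<in> Basis"
  \<comment> \<open>Between grid points the slope integrates exactly to the increment of f, so both
    end points are rounded down to the grid; continuity of f closes the gap.\<close>
  define ak where "ak = (%k. of_int \<lfloor>a / mesh k\<rfloor> * mesh k)"
  define bk where "bk = (%k. of_int \<lfloor>b / mesh k\<rfloor> * mesh k)"
  have lims: "ak \<longlonglongrightarrow> a" "bk \<longlonglongrightarrow> b"
   unfolding ak_def bk_def by (rule floor_scaled_tendsto[OF mesh_pos mesh_lim])+
  have flc: "isCont f x" for x using f(2) by (simp add: continuous_on_eq_continuous_at)
  have L: "(%k. (f (bk k) - f (ak k)) \<bullet> u) \<longlonglongrightarrow> (f b - f a) \<bullet> u"
   by (intro tendsto_intros isCont_tendsto_compose[OF flc] lims)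
  let ?A = "%k x. indicator {ak k..<bk k} x *\<^sub>R u"
  have sA: "sq_int (%x. indicator {p..<q} x *\<^sub>R u)" for p q :: real
  proof (rule sq_int_bound(1))
   show "integrable lborel (%x. indicator {p..<q} x * (norm u)\<^sup>2)"
    by simp
  qed (auto simp: indicator_def)
  obtain R where R: "!!k. \<bar>ak k\<bar> <= R" "!!k. \<bar>bk k\<bar> <= R" "\<bar>a\<bar> <= R" "\<bar>b\<bar> <= R"
  proof -
   obtain R1 R2 where "!!k. \<bar>ak k\<bar> <= R1" "!!k. \<bar>bk k\<bar> <= R2"
    using convergent_imp_Bseq[of ak] convergent_imp_Bseq[of bk] lims
    by (auto simp: convergent_def Bseq_def)
   then show ?thesis by (intro that[of "max (max R1 R2) (max \<bar>a\<bar> \<bar>b\<bar>)"]) (auto simp: le_max_iff_disj)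
  qed
  have "(%k. n2 (%x. ?A k x - indicator {a..<b} x *\<^sub>R u)) \<longlonglongrightarrow> 0"
  proof (rule n2_dominated_tendsto)
   show "integrable lborel (%x. indicator {-R..R} x * (norm u)\<^sup>2)" by simp
   show "AE x in lborel. (norm (?A k x - indicator {a..<b} x *\<^sub>R u))\<^sup>2 <= indicator {-R..R} x * (norm u)\<^sup>2" for k
   proof (intro AE_I2)
    fix x
    have "\<bar>x\<bar> <= R" if "x \<in> {ak k..<bk k} \<or> x \<in> {a..<b}" using that R(1)[of k] R(2)[of k] R(3,4) by auto
    then show "(norm (?A k x - indicator {a..<b} x *\<^sub>R u))\<^sup>2 <= indicator {-R..R} x * (norm u)\<^sup>2"
     by (cases "x \<in> {ak k..<bk k}"; cases "x \<in> {a..<b}") (auto simp: abs_le_iff)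
   qed
   have "AE x in lborel. x ~= a & x ~= b" using AE_lborel_singleton[of a] AE_lborel_singleton[of b] by eventually_elim simp
   then show "AE x in lborel. (%k. ?A k x - indicator {a..<b} x *\<^sub>R u) \<longlonglongrightarrow> 0"
   proof eventually_elim
    case (elim x)
    have "eventually (%k. ak k <= x \<longleftrightarrow> a <= x) sequentially"
    proof (cases "a < x")
     case True
     show ?thesis using order_tendstoD(2)[OF lims(1) True] by eventually_elim (use True in auto)
    next
     case False
     then have "x < a" using elim by simp
     show ?thesis using order_tendstoD(1)[OF lims(1) \<open>x < a\<close>] by eventually_elim (use \<open>x < a\<close> in auto)
    qed
    moreover have "eventually (%k. x < bk k \<longleftrightarrow> x < b) sequentially"
    proof (cases "b < x")
     case True
     show ?thesis using order_tendstoD(2)[OF lims(2) True] by eventually_elim (use True in auto)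
    next
     case False
     then have "x < b" using elim by simp
     show ?thesis using order_tendstoD(1)[OF lims(2) \<open>x < b\<close>] by eventually_elim (use \<open>x < b\<close> in auto)
    qed
    ultimately have "eventually (%k. ?A k x - indicator {a..<b} x *\<^sub>R u = 0) sequentially"
     by eventually_elim (simp add: indicator_def)
    then show ?case by (rule tendsto_eventually)
   qed
  qed auto
  then have R: "(%k. LINT x|lborel. ?A k x \<bullet> slope f k x) \<longlonglongrightarrow> (LINT x|lborel. (indicator {a..<b} x *\<^sub>R u) \<bullet> g x)"
   by (intro inner_tendsto sA sl(1) g)
  have "(LINT x|lborel. ?A k x \<bullet> slope f k x) = (f (bk k) - f (ak k)) \<bullet> u" for k
  proof -
   have le: "\<lfloor>a / mesh k\<rfloor> <= \<lfloor>b / mesh k\<rfloor>" using ab mesh_pos[of k] by (intro floor_mono divide_right_mono) auto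
   note si = slope_integral[OF le, of k f, folded ak_def bk_def]
   have "(LINT x|lborel. ?A k x \<bullet> slope f k x) = (LINT x|lborel. (indicator {ak k..<bk k} x *\<^sub>R slope f k x) \<bullet> u)"
    by (intro Bochner_Integration.integral_cong refl) (simp add: inner_commute)
   also have "... = (LINT x|lborel. indicator {ak k..<bk k} x *\<^sub>R slope f k x) \<bullet> u"
    using si(2) by (intro integral_inner_left) (simp add: ak_def bk_def)
   finally show ?thesis using si(1) by (simp add: ak_def bk_def)
  qed
  then have "(f b - f a) \<bullet> u = (LINT x|lborel. (indicator {a..<b} x *\<^sub>R u) \<bullet> g x)"
   using LIMSEQ_unique[OF L] R by simp
  also have "... = (LINT x|lborel. (indicator {a..b} x *\<^sub>R g x) \<bullet> u)"
  proof (rule integral_cong_AE)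
   show "AE x in lborel. (indicator {a..<b} x *\<^sub>R u) \<bullet> g x = (indicator {a..b} x *\<^sub>R g x) \<bullet> u"
    using AE_lborel_singleton[of b] by eventually_elim (auto simp: indicator_def inner_commute)
  qed (use g(1) in \<open>auto simp: sq_int_def\<close>)
  also have "... = (LINT x:{a..b}|lborel. g x) \<bullet> u"
   unfolding set_lebesgue_integral_def
   using sq_int_local(1)[OF g(1), of a b] by (intro integral_inner_left) (simp add: set_integrable_def)
  finally show "(f b - f a) \<bullet> u = (LINT x:{a..b}|lborel. g x) \<bullet> u" .
 qed
 ultimately show thesis using that[of g] f(1) g(1) by (simp add: prim_def)
qed

section \<open>Test functions and weak derivatives\<close>

lemma higher_deriv_eq:
 fixes F :: "nat => real => real"
 assumes "!!k x. (F k has_real_derivative F (Suc k) x) (at x)"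
 shows "(deriv ^^ k) (F 0) = F k"
proof (induction k)
 case (Suc k)
 have "deriv (F k) = F (Suc k)" by (rule ext) (rule DERIV_imp_deriv[OF assms])
 then show ?case by (simp add: Suc)
qed simp

lemma test_funsI:
 fixes F :: "nat => real => real"
 assumes "!!k x. (F k has_real_derivative F (Suc k) x) (at x)"
  and "compact K" "K \<subseteq> S" "!!x. x \<notin> K ==> F 0 x = 0"
 shows "F 0 \<in> test_funs S"
proof -
 have "(deriv ^^ k) (F 0) = F k" for k by (rule higher_deriv_eq) (rule assms(1))
 then show ?thesis unfolding test_funs_def using assms by (auto simp: real_differentiable_def)
qed

lemma test_funsD:
 assumes "\<phi> \<in> test_funs S"
 shows "(\<phi> has_real_derivative deriv \<phi> x) (at x)" "continuous_on UNIV (deriv \<phi>)"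
  "\<exists>K. compact K & K \<subseteq> S & (\<forall>x. x \<notin> K --> \<phi> x = 0)"
proof -
 have d: "((deriv ^^ k) \<phi>) differentiable (at x)" for k x using assms by (auto simp: test_funs_def)
 show "(\<phi> has_real_derivative deriv \<phi> x) (at x)" using d[of 0 x] by (simp add: DERIV_deriv_iff_real_differentiable)
 have "isCont (deriv \<phi>) x" for x using differentiable_imp_continuous_within[of "deriv \<phi>" x UNIV] d[of 1 x] by simp
 then show "continuous_on UNIV (deriv \<phi>)" by (simp add: continuous_on_eq_continuous_at)
 show "\<exists>K. compact K & K \<subseteq> S & (\<forall>x. x \<notin> K --> \<phi> x = 0)" using assms by (auto simp: test_funs_def)
qed

text \<open>A polynomial over a power of (x - a) (b - x), times exp (- c / ((x - a) (b - x))). The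
  pair \<open>qk\<close> encodes the rational factor, and the family is closed under differentiation
  by \<open>bump_step\<close>, which settles all derivatives at once. For \<open>qk = (1, 0)\<close>
  and c tending to zero the bump tends to the indicator of the open interval.\<close>

definition bump :: "real => real => real => real poly \<times> nat => real => real" where
 "bump c a b qk x = (if a < x & x < b then poly (fst qk) x / ((x - a) * (b - x)) ^ snd qk * exp (- c / ((x - a) * (b - x))) else 0)"

text \<open>The new pair comes from the product and quotient rules with P = (x - a) (b - x), written
  over the common denominator P^(k + 2).\<close>

definition bump_step :: "real => real => real => real poly \<times> nat => real poly \<times> nat" where
 "bump_step c a b qk = (let P = [:- (a * b), a + b, - 1:] in
  (pderiv (fst qk) * P\<^sup>2 - smult (real (snd qk)) (fst qk * pderiv P * P) + smult c (fst qk * pderiv P), snd qk + 2))"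

lemma DERIV_zero_of_quadratic_bound:
 fixes f :: "real => real"
 assumes "!!y. \<bar>f y\<bar> <= M * (y - x)\<^sup>2" shows "(f has_real_derivative 0) (at x)"
proof -
 have f0: "f x = 0" using assms[of x] by simp
 have "((%y. (f y - f x) / (y - x)) \<longlongrightarrow> 0) (at x)"
 proof (rule Lim_null_comparison)
  show "eventually (%y. norm ((f y - f x) / (y - x)) <= M * \<bar>y - x\<bar>) (at x)"
   using eventually_neq_at_within[of x]
  proof eventually_elim
   case (elim y)
   then have "\<bar>f y\<bar> / \<bar>y - x\<bar> <= M * (y - x)\<^sup>2 / \<bar>y - x\<bar>" using assms by (intro divide_right_mono) auto
   also have "(y - x)\<^sup>2 = \<bar>y - x\<bar> * \<bar>y - x\<bar>" by (simp add: power2_eq_square)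
   also have "M * (\<bar>y - x\<bar> * \<bar>y - x\<bar>) / \<bar>y - x\<bar> = M * \<bar>y - x\<bar>"
   proof -
    have "M * (z * z) / z = M * z" if "z ~= 0" for z :: real using that by simp
    then show ?thesis by this (use elim in simp)
   qed
   finally show ?case by (simp add: f0)
  qed
  have "((%y. M * \<bar>y - x\<bar>) \<longlongrightarrow> M * \<bar>x - x\<bar>) (at x)" by (intro tendsto_intros)
  then show "((%y. M * \<bar>y - x\<bar>) \<longlongrightarrow> 0) (at x)" by simp
 qed
 then show ?thesis by (simp add: has_field_derivative_iff)
qed

text \<open>One term of the exponential series bounds exp (- c / u) by a multiple of u^(k + 2), so
  that u^2 is left after division by u^k. With u = (x - a) (b - x) either factor can then be bounded
  by the length of the interval.\<close>

lemma bump_quadratic_bound: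
 assumes c: "c > 0" and ab: "a < b"
 obtains M where "!!x. \<bar>bump c a b qk x\<bar> <= M * (x - a)\<^sup>2" "!!x. \<bar>bump c a b qk x\<bar> <= M * (x - b)\<^sup>2"
proof -
 obtain q k where qk: "qk = (q, k)" by (cases qk)
 have "compact (poly q ` {a..b})" by (intro compact_continuous_image continuous_intros) auto
 then obtain B where B: "\<forall>x\<in>{a..b}. \<bar>poly q x\<bar> <= B" using compact_imp_bounded[of "poly q ` {a..b}"] unfolding bounded_iff by auto
 define K where "K = fact (k + 2) / c ^ (k + 2)"
 have K: "K > 0" using c by (simp add: K_def)
 have le: "exp (- c / u) / u ^ k <= K * u\<^sup>2" if u: "u > 0" for u :: real
 proof -
  have "(c / u) ^ (k + 2) / fact (k + 2) <= exp (c / u)"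
  proof -
   have "(\<Sum>n\<in>{k + 2}. (c / u) ^ n /\<^sub>R fact n) <= (\<Sum>n. (c / u) ^ n /\<^sub>R fact n)"
    using c u by (intro sum_le_suminf summable_exp_generic) auto
   then show ?thesis by (simp add: exp_def divide_inverse mult.commute)
  qed
  then have "1 / exp (c / u) <= 1 / ((c / u) ^ (k + 2) / fact (k + 2))" using c u by (intro divide_left_mono) auto
  also have "... = K * u ^ (k + 2)" using c u by (simp add: K_def power_divide)
  finally have "exp (- c / u) <= K * u ^ (k + 2)" by (simp add: exp_minus inverse_eq_divide)
  then have "exp (- c / u) / u ^ k <= K * u ^ (k + 2) / u ^ k" using u by (intro divide_right_mono) auto
  also have "... = K * u\<^sup>2" using u by (simp add: power_add power2_eq_square)
  finally show ?thesis .
 qed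
 have B0: "0 <= B" using B ab by (meson abs_ge_zero atLeastAtMost_iff less_imp_le order_refl order_trans)
 have main: "\<bar>bump c a b qk x\<bar> <= B * (K * ((x - a) * (b - x))\<^sup>2)" if "a < x" "x < b" for x
 proof -
  have u: "(x - a) * (b - x) > 0" using that by simp
  have "\<bar>bump c a b qk x\<bar> = \<bar>poly q x\<bar> * (exp (- c / ((x - a) * (b - x))) / ((x - a) * (b - x)) ^ k)"
   using that u by (simp add: bump_def qk abs_mult abs_divide power_abs)
  also have "... <= B * (K * ((x - a) * (b - x))\<^sup>2)"
   using B B0 that u le[OF u] by (intro mult_mono) auto
  finally show ?thesis .
 qed
 define M where "M = B * (K * (b - a)\<^sup>2)"
 have M0: "0 <= M" using B0 K by (simp add: M_def)
 show thesis
 proof (rule that[of M])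
  fix x
  show "\<bar>bump c a b qk x\<bar> <= M * (x - a)\<^sup>2"
  proof (cases "a < x & x < b")
   case True
   then have "(b - x)\<^sup>2 <= (b - a)\<^sup>2" by (intro power_mono) auto
   then have "B * (K * ((x - a)\<^sup>2 * (b - x)\<^sup>2)) <= B * (K * ((x - a)\<^sup>2 * (b - a)\<^sup>2))"
    using B0 K by (intro mult_left_mono) auto
   then show ?thesis using main[of x] True by (simp add: M_def power_mult_distrib mult_ac)
  qed (use M0 in \<open>auto simp: bump_def\<close>)
  show "\<bar>bump c a b qk x\<bar> <= M * (x - b)\<^sup>2"
  proof (cases "a < x & x < b")
   case True
   then have "(x - a)\<^sup>2 <= (b - a)\<^sup>2" by (intro power_mono) auto
   then have "B * (K * ((x - a)\<^sup>2 * (b - x)\<^sup>2)) <= B * (K * ((b - a)\<^sup>2 * (b - x)\<^sup>2))"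
    using B0 K by (intro mult_left_mono mult_right_mono) auto
   then show ?thesis using main[of x] True by (simp add: M_def power_mult_distrib mult_ac power2_commute[of b x])
  qed (use M0 in \<open>auto simp: bump_def\<close>)
 qed
qed

text \<open>Inside the interval this is calculus and outside everything vanishes; at the two end
  points the quadratic bound gives derivative zero.\<close>

lemma bump_deriv:
 assumes c: "c > 0" and ab: "a < b"
 shows "(bump c a b qk has_real_derivative bump c a b (bump_step c a b qk) x) (at x)"
proof -
 obtain q k where qk: "qk = (q, k)" by (cases qk)
 obtain M where M: "!!y. \<bar>bump c a b qk y\<bar> <= M * (y - a)\<^sup>2" "!!y. \<bar>bump c a b qk y\<bar> <= M * (y - b)\<^sup>2"
  using bump_quadratic_bound[OF c ab] by blast
 consider "x = a" | "x = b" | "x < a" | "x > b" | "a < x" "x < b" by linarith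
 then show ?thesis
 proof cases
  case 1
  then show ?thesis using DERIV_zero_of_quadratic_bound[OF M(1)] by (simp add: bump_def[of _ _ _ "bump_step c a b qk"])
 next
  case 2
  then show ?thesis using DERIV_zero_of_quadratic_bound[OF M(2)] by (simp add: bump_def[of _ _ _ "bump_step c a b qk"])
 next
  case 3
  have "((%_. 0) has_real_derivative 0) (at x)" by simp
  then have "(bump c a b qk has_real_derivative 0) (at x)"
   by (rule DERIV_cong_ev[THEN iffD1, rotated 3, OF _ refl _ refl])
    (use eventually_nhds_in_open[of "{..<a}" x] 3 in \<open>auto elim!: eventually_mono simp: bump_def\<close>)
  then show ?thesis using 3 by (simp add: bump_def[of _ _ _ "bump_step c a b qk"])
 next
  case 4
  have "((%_. 0) has_real_derivative 0) (at x)" by simp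
  then have "(bump c a b qk has_real_derivative 0) (at x)"
   by (rule DERIV_cong_ev[THEN iffD1, rotated 3, OF _ refl _ refl])
    (use eventually_nhds_in_open[of "{b<..}" x] 4 in \<open>auto elim!: eventually_mono simp: bump_def\<close>)
  then show ?thesis using 4 by (simp add: bump_def[of _ _ _ "bump_step c a b qk"])
 next
  case 5
  define u where "u = (x - a) * (b - x)"
  define u' where "u' = (a + b - 2 * x)"
  have u: "u > 0" using 5 by (simp add: u_def)
  have du: "((%y. (y - a) * (b - y)) has_real_derivative u') (at x)"
   unfolding u'_def by (auto intro!: derivative_eq_intros)
  have dq: "(poly q has_real_derivative poly (pderiv q) x) (at x)" by (rule poly_DERIV)
  define P where "P = [:- (a * b), a + b, - 1:]"
  have P: "poly P x = u" "poly (pderiv P) x = u'"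
   by (simp_all add: P_def u_def u'_def pderiv_pCons algebra_simps)
  have st: "bump_step c a b qk = (pderiv q * P\<^sup>2 - smult (real k) (q * pderiv P * P) + smult c (q * pderiv P), k + 2)"
   by (simp add: bump_step_def Let_def qk P_def)
  have D: "((%y. poly q y / ((y - a) * (b - y)) ^ k * exp (- c / ((y - a) * (b - y)))) has_real_derivative
   (poly (pderiv q) x * u ^ k - poly q x * (real k * u ^ (k - 1) * u')) / (u ^ k * u ^ k) * exp (- c / u)
   + poly q x / u ^ k * (exp (- c / u) * (c * u' / u\<^sup>2))) (at x)"
  proof -
   have d1: "((%y. ((y - a) * (b - y)) ^ k) has_real_derivative (real k * u ^ (k - 1) * u')) (at x)"
    using DERIV_power[OF du, of k] by (simp add: u_def mult_ac)
   have "((%y. poly q y / ((y - a) * (b - y)) ^ k) has_real_derivative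
     (poly (pderiv q) x * u ^ k - poly q x * (real k * u ^ (k - 1) * u')) / (u ^ k * u ^ k)) (at x)"
   proof -
    have nz: "((x - a) * (b - x)) ^ k ~= 0" unfolding u_def[symmetric] using u by simp
    show ?thesis using DERIV_divide[OF dq d1 nz] unfolding u_def power2_eq_square .
   qed
   moreover have "((%y. exp (- c / ((y - a) * (b - y)))) has_real_derivative exp (- c / u) * (c * u' / u\<^sup>2)) (at x)"
   proof -
    have "((%y. - c / ((y - a) * (b - y))) has_real_derivative (0 * u - (- c) * u') / (u * u)) (at x)"
    proof -
     have nz: "(x - a) * (b - x) ~= 0" unfolding u_def[symmetric] using u by simp
     show ?thesis using DERIV_divide[OF DERIV_const du nz, of "- c"] by (simp add: u_def)
    qed
    then have "((%y. exp (- c / ((y - a) * (b - y)))) has_real_derivative exp (- c / ((x - a) * (b - x))) * ((0 * u - (- c) * u') / (u * u))) (at x)"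
     by (rule DERIV_fun_exp)
    then show ?thesis by (simp add: u_def power2_eq_square)
   qed
   ultimately show ?thesis by (rule DERIV_mult'[THEN DERIV_cong]) (simp add: u_def algebra_simps)
  qed
  have "(poly (pderiv q) x * u ^ k - poly q x * (real k * u ^ (k - 1) * u')) / (u ^ k * u ^ k) * exp (- c / u)
   + poly q x / u ^ k * (exp (- c / u) * (c * u' / u\<^sup>2))
   = (poly (pderiv q) x * u\<^sup>2 - real k * (poly q x * u' * u) + c * (poly q x * u')) / u ^ (k + 2) * exp (- c / u)"
  proof (cases k)
   case 0
   then show ?thesis using u by (simp add: field_simps power2_eq_square)
  next
   case (Suc j)
   then show ?thesis using u by (simp add: field_simps power2_eq_square)
  qed
  also have "... = bump c a b (bump_step c a b qk) x"
   using 5 unfolding bump_def u_def[symmetric] by (simp add: st P mult_ac)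
  finally have "((%y. poly q y / ((y - a) * (b - y)) ^ k * exp (- c / ((y - a) * (b - y)))) has_real_derivative bump c a b (bump_step c a b qk) x) (at x)"
   using D by simp
  then show ?thesis
   by (rule DERIV_cong_ev[THEN iffD1, rotated 3, OF _ refl _ refl])
    (use eventually_nhds_in_open[of "{a<..<b}" x] 5 in \<open>auto elim!: eventually_mono simp: bump_def qk\<close>)
 qed
qed

lemma bump_iterates:
 assumes "c > 0" "a < b"
 shows "(bump c a b ((bump_step c a b ^^ k) qk) has_real_derivative bump c a b ((bump_step c a b ^^ Suc k) qk) x) (at x)"
 using bump_deriv[OF assms] by simp

abbreviation "bump1 c a b \<equiv> bump c a b (1, 0)"

lemma bump1_test:
 assumes "c > 0" "a < b" shows "bump1 c a b \<in> test_funs UNIV"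
proof -
 let ?F = "%k. bump c a b ((bump_step c a b ^^ k) (1, 0))"
 have "?F 0 \<in> test_funs UNIV"
 proof (rule test_funsI[of ?F "{a..b}"])
  show "(?F k has_real_derivative ?F (Suc k) x) (at x)" for k x by (rule bump_iterates[OF assms])
 qed (auto simp: bump_def)
 then show ?thesis by simp
qed

lemma bump1_bounds:
 assumes "c > 0" shows "0 <= bump1 c a b x" "bump1 c a b x <= indicator {a..b} x"
  "continuous_on UNIV (bump1 c a b)"
proof -
 show "0 <= bump1 c a b x" by (simp add: bump_def)
 show "bump1 c a b x <= indicator {a..b} x" using assms by (auto simp: bump_def indicator_def)
 show "continuous_on UNIV (bump1 c a b)"
 proof (cases "a < b")
  case True
  then show ?thesis using bump_deriv[OF assms True] DERIV_isCont by (metis continuous_on_eq_continuous_at open_UNIV)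
 next
  case False
  then have "bump1 c a b = (%x. 0)" by (auto simp: bump_def)
  then show ?thesis by simp
 qed
qed

lemma bump1_lim: "(%n. bump1 (1 / real (Suc n)) a b x) \<longlonglongrightarrow> indicator {a<..<b} x"
proof (cases "a < x & x < b")
 case True
 have "(%n. exp (- (1 / real (Suc n)) / ((x - a) * (b - x)))) \<longlonglongrightarrow> exp (- 0 / ((x - a) * (b - x)))"
  using True by (intro tendsto_intros LIMSEQ_Suc[OF lim_1_over_n]) auto
 then show ?thesis using True by (simp add: bump_def)
qed (auto simp: bump_def)

lemma bump1_integral_lim:
 fixes g :: "real => 'v::euclidean_space"
 assumes "set_integrable lborel {a..b} g" and gm: "g \<in> borel_measurable borel"
 shows "(%n. LINT x|lborel. bump1 (1 / real (Suc n)) a b x *\<^sub>R g x) \<longlonglongrightarrow> (LINT x:{a..b}|lborel. g x)"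
proof -
 have bm [measurable]: "bump1 (1 / real (Suc n)) a b \<in> borel_measurable borel" for n
  by (intro borel_measurable_continuous_onI bump1_bounds) simp
 have "(%n. LINT x|lborel. bump1 (1 / real (Suc n)) a b x *\<^sub>R g x) \<longlonglongrightarrow> (LINT x|lborel. indicator {a..b} x *\<^sub>R g x)"
 proof (rule integral_dominated_convergence)
  show "integrable lborel (%x. norm (indicator {a..b} x *\<^sub>R g x))"
   by (rule integrable_norm) (use assms(1) in \<open>simp add: set_integrable_def\<close>)
  show "AE x in lborel. (%n. bump1 (1 / real (Suc n)) a b x *\<^sub>R g x) \<longlonglongrightarrow> indicator {a..b} x *\<^sub>R g x"
   using AE_lborel_singleton[of a] AE_lborel_singleton[of b]
  proof eventually_elim
   case (elim x)
   then have "indicator {a<..<b} x = (indicator {a..b} x :: real)" by (auto simp: indicator_def)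
   then show ?case using bump1_lim[of a b x] by (intro tendsto_intros) simp
  qed
  show "AE x in lborel. norm (bump1 (1 / real (Suc n)) a b x *\<^sub>R g x) <= norm (indicator {a..b} x *\<^sub>R g x)" for n
   using bump1_bounds(1,2)[of "1 / real (Suc n)" a b] by (auto intro!: mult_right_mono AE_I2)
 qed (use gm in measurable)
 then show ?thesis by (simp add: set_lebesgue_integral_def)
qed

text \<open>Zero is an antiderivative of g, and its difference quotients, all zero, converge to g in
  L2.\<close>

lemma AE_zero_of_interval_integrals:
 assumes g: "sq_int g" and z: "!!a b. a <= b ==> (LINT x:{a..b}|lborel. g x) = 0"
 shows "AE x in lborel. g x = 0"
proof -
 have p: "prim (%x. 0) g" using g z by (auto simp: prim_def sq_int_def)
 have "n2 (%x. dq h (%x. 0) x - g x) = n2 g" for h by (simp add: dq_def n2_def)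
 then have "((%h. n2 g) \<longlongrightarrow> 0) (at_right (0::real))" using dq_tendsto[OF prim_imp_antider[OF p]] by simp
 then have "n2 g = 0" by (simp add: tendsto_const_iff)
 then show ?thesis by (rule sq_int_AE_zero[OF g])
qed

text \<open>Since f is only an indefinite integral, the product rule is replaced by Fubini on the
  triangle s <= x.\<close>

lemma integration_by_parts_test:
 fixes f g :: "real => 'v::euclidean_space"
 assumes ab: "a <= b" and gi: "set_integrable lborel {a..b} g" and gm [measurable]: "g \<in> borel_measurable borel"
  and f: "!!x. x \<in> {a..b} ==> f x - f a = (LINT s:{a..x}|lborel. g s)"
  and d: "!!x. (\<phi> has_real_derivative \<phi>' x) (at x)" and c: "continuous_on UNIV \<phi>'"
  and z: "\<phi> a = 0" "\<phi> b = 0"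
 shows "(LINT x:{a..b}|lborel. \<phi>' x *\<^sub>R f x) = - (LINT x:{a..b}|lborel. \<phi> x *\<^sub>R g x)"
proof -
 have cm [measurable]: "\<phi>' \<in> borel_measurable borel" using c by (rule borel_measurable_continuous_onI)
 have ftc: "(LINT x:{p..q}|lborel. \<phi>' x) = \<phi> q - \<phi> p" if "p <= q" for p q
  unfolding set_lebesgue_integral_def
  by (rule integral_FTC_atLeastAtMost[OF that])
   (use d c in \<open>auto simp: has_real_derivative_iff_has_vector_derivative[symmetric] intro: has_field_derivative_at_within continuous_on_subset\<close>)
 have \<phi>'i: "set_integrable lborel {a..b} \<phi>'"
  unfolding set_integrable_def using c by (intro borel_integrable_compact) (auto intro: continuous_on_subset)
 obtain B where B: "\<forall>x\<in>{a..b}. \<bar>\<phi>' x\<bar> <= B"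
 proof -
  have "compact (\<phi>' ` {a..b})" using c by (intro compact_continuous_image) (auto intro: continuous_on_subset)
  then have "bounded (\<phi>' ` {a..b})" by (rule compact_imp_bounded)
  then show ?thesis using that unfolding bounded_iff real_norm_def by blast
 qed
 have B0: "0 <= B" using B ab abs_ge_zero[of "\<phi>' a"] by (meson atLeastAtMost_iff order_refl order_trans)
 define k where "k = (%x s. (indicator {a..b} x * \<phi>' x * (if s <= x then 1 else 0)) *\<^sub>R (indicator {a..b} s *\<^sub>R g s))"
 have km [measurable]: "case_prod k \<in> borel_measurable (lborel \<Otimes>\<^sub>M lborel)" unfolding k_def by measurable
 have gi': "integrable lborel (%s. indicator {a..b} s *\<^sub>R g s)" using gi by (simp add: set_integrable_def)
 have ki1: "integrable lborel (%s. k x s)" for x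
  by (rule Bochner_Integration.integrable_bound[OF integrable_scaleR_right[OF gi', of "indicator {a..b} x * \<phi>' x"]])
   (auto simp: k_def)
 have ki: "integrable (lborel \<Otimes>\<^sub>M lborel) (case_prod k)"
 proof (rule lborel_pair.Fubini_integrable[OF km])
  show "AE x in lborel. integrable lborel (%y. case_prod k (x, y))" by (simp add: ki1)
  have bd: "(LINT s|lborel. norm (k x s)) <= indicator {a..b} x * (B * (LINT s|lborel. norm (indicator {a..b} s *\<^sub>R g s)))" for x
  proof -
   have "(LINT s|lborel. norm (k x s)) <= (LINT s|lborel. indicator {a..b} x * (B * norm (indicator {a..b} s *\<^sub>R g s)))"
   proof (rule integral_mono)
    show "norm (k x s) <= indicator {a..b} x * (B * norm (indicator {a..b} s *\<^sub>R g s))" for s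
     using B B0 by (auto simp: k_def indicator_def intro!: mult_right_mono)
   qed (intro integrable_norm ki1 integrable_mult_right gi')+
   then show ?thesis by simp
  qed
  show "integrable lborel (%x. LINT y|lborel. norm (case_prod k (x, y)))"
  proof (rule Bochner_Integration.integrable_bound)
   show "integrable lborel (%x. indicator {a..b} x * (B * (LINT s|lborel. norm (indicator {a..b} s *\<^sub>R g s))))" by simp
   show "AE x in lborel. norm (LINT y|lborel. norm (case_prod k (x, y))) <= norm (indicator {a..b} x * (B * (LINT s|lborel. norm (indicator {a..b} s *\<^sub>R g s))))"
   proof (intro AE_I2)
    fix x
    have "norm (LINT y|lborel. norm (case_prod k (x, y))) = (LINT y|lborel. norm (k x y))"
     by (simp add: Bochner_Integration.integral_nonneg)
    also have "... <= norm (indicator {a..b} x * (B * (LINT s|lborel. norm (indicator {a..b} s *\<^sub>R g s))))"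
     by (rule order_trans[OF bd]) simp
    finally show "norm (LINT y|lborel. norm (case_prod k (x, y))) <= norm (indicator {a..b} x * (B * (LINT s|lborel. norm (indicator {a..b} s *\<^sub>R g s))))" .
   qed
  qed measurable
 qed
 have inner: "(LINT s|lborel. k x s) = indicator {a..b} x *\<^sub>R \<phi>' x *\<^sub>R (f x - f a)" for x
 proof (cases "x \<in> {a..b}")
  case True
  have "(LINT s|lborel. k x s) = (LINT s|lborel. \<phi>' x *\<^sub>R (indicator {a..x} s *\<^sub>R g s))"
   using True by (intro Bochner_Integration.integral_cong refl) (auto simp: k_def indicator_def)
  also have "... = \<phi>' x *\<^sub>R (LINT s:{a..x}|lborel. g s)" by (simp add: set_lebesgue_integral_def del: scaleR_scaleR)
  finally show ?thesis using True f[OF True] by simp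
 qed (simp add: k_def)
 have inner2: "(LINT x|lborel. k x s) = indicator {a..b} s *\<^sub>R (- \<phi> s) *\<^sub>R g s" for s
 proof (cases "s \<in> {a..b}")
  case True
  have "(LINT x|lborel. k x s) = (LINT x|lborel. (indicator {s..b} x * \<phi>' x) *\<^sub>R g s)"
   using True by (intro Bochner_Integration.integral_cong refl) (auto simp: k_def indicator_def)
  also have "... = (LINT x|lborel. indicator {s..b} x * \<phi>' x) *\<^sub>R g s"
  proof (rule integral_scaleR_left)
   have "integrable lborel (%x. indicator {s..b} x *\<^sub>R \<phi>' x)"
    using c by (intro borel_integrable_compact) (auto intro: continuous_on_subset)
   then show "integrable lborel (%x. indicator {s..b} x * \<phi>' x)" if "g s ~= 0" by simp
  qed
  also have "(LINT x|lborel. indicator {s..b} x * \<phi>' x) = - \<phi> s"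
   using ftc[of s b] True z(2) by (simp add: set_lebesgue_integral_def)
  finally show ?thesis using True by simp
 qed (simp add: k_def)
 have "(LINT x|lborel. indicator {a..b} x *\<^sub>R \<phi>' x *\<^sub>R (f x - f a)) = (LINT s|lborel. indicator {a..b} s *\<^sub>R (- \<phi> s) *\<^sub>R g s)"
  using lborel_pair.Fubini_integral[OF ki] unfolding inner inner2 by simp
 moreover have "(LINT x|lborel. indicator {a..b} x *\<^sub>R \<phi>' x *\<^sub>R (f x - f a)) = (LINT x:{a..b}|lborel. \<phi>' x *\<^sub>R f x)"
 proof -
  have i1: "integrable lborel (%x. indicator {a..b} x *\<^sub>R \<phi>' x *\<^sub>R (f x - f a))"
   using lborel_pair.integrable_fst[OF ki] unfolding inner .
  have i2: "integrable lborel (%x. (indicator {a..b} x *\<^sub>R \<phi>' x) *\<^sub>R f a)"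
   by (rule integrable_scaleR_left) (use \<phi>'i in \<open>simp add: set_integrable_def\<close>)
  have "(LINT x:{a..b}|lborel. \<phi>' x *\<^sub>R f x) = (LINT x|lborel. indicator {a..b} x *\<^sub>R \<phi>' x *\<^sub>R (f x - f a) + (indicator {a..b} x *\<^sub>R \<phi>' x) *\<^sub>R f a)"
   unfolding set_lebesgue_integral_def by (intro Bochner_Integration.integral_cong refl) (simp add: scaleR_diff_right)
  also have "... = (LINT x|lborel. indicator {a..b} x *\<^sub>R \<phi>' x *\<^sub>R (f x - f a)) + (LINT x|lborel. (indicator {a..b} x *\<^sub>R \<phi>' x) *\<^sub>R f a)"
   by (rule Bochner_Integration.integral_add[OF i1 i2])
  also have "(LINT x|lborel. (indicator {a..b} x *\<^sub>R \<phi>' x) *\<^sub>R f a) = (\<phi> b - \<phi> a) *\<^sub>R f a"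
   using \<phi>'i ftc[OF ab] by (subst integral_scaleR_left) (auto simp: set_integrable_def set_lebesgue_integral_def)
  finally show ?thesis using z by simp
 qed
 ultimately show ?thesis by (simp add: set_lebesgue_integral_def)
qed

section \<open>Borel representatives of Lebesgue measurable functions\<close>

lemma completion_ex_borel:
 fixes f :: "real => 'v::euclidean_space"
 assumes "f \<in> borel_measurable lebesgue"
 obtains f0 where "f0 \<in> borel_measurable borel" "AE x in lborel. f x = f0 x"
proof -
 have "\<exists>g\<in>borel_measurable lborel. (AE x in lborel. f x \<bullet> i = g x)" for i
  by (intro completion_ex_borel_measurable_real borel_measurable_inner assms) simp
 then obtain g where g: "!!i. g i \<in> borel_measurable lborel" "!!i. AE x in lborel. f x \<bullet> i = g i x" by metis
 define f0 where "f0 = (%x. \<Sum>i\<in>Basis. g i x *\<^sub>R i)"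
 have [measurable]: "g i \<in> borel_measurable borel" for i using g(1)[of i] by simp
 have "f0 \<in> borel_measurable borel" unfolding f0_def by measurable
 moreover have "AE x in lborel. \<forall>i\<in>Basis. f x \<bullet> i = g i x" using g(2) by (intro AE_finite_allI) auto
 then have "AE x in lborel. f x = f0 x"
 proof eventually_elim
  case (elim x)
  have "f x = (\<Sum>i\<in>Basis. (f x \<bullet> i) *\<^sub>R i)" by (simp add: euclidean_representation)
  then show ?case using elim by (simp add: f0_def)
 qed
 ultimately show thesis by (rule that)
qed

lemma borel_imp_lebesgue: "f \<in> borel_measurable borel ==> f \<in> borel_measurable lebesgue"
 by (simp add: measurable_completion)

lemma lebesgue_integral_cong:
 fixes f g :: "real => 'v::euclidean_space"
 assumes "f \<in> borel_measurable lebesgue" "g \<in> borel_measurable borel" "AE x in lborel. f x = g x"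
 shows "integrable lebesgue f \<longleftrightarrow> integrable lborel g" "(LINT x|lebesgue. f x) = (LINT x|lborel. g x)"
proof -
 have ae: "AE x in lebesgue. f x = g x" using assms(3) by (rule AE_completion)
 have gm: "g \<in> borel_measurable lebesgue" "g \<in> borel_measurable lborel" using assms(2) by (simp_all add: borel_imp_lebesgue)
 show "integrable lebesgue f \<longleftrightarrow> integrable lborel g"
  using integrable_cong_AE[OF assms(1) gm(1) ae] integrable_completion[OF gm(2)] by simp
 show "(LINT x|lebesgue. f x) = (LINT x|lborel. g x)"
  using integral_cong_AE[OF assms(1) gm(1) ae] integral_completion[OF gm(2)] by simp
qed

lemma L2_ex_sq_int:
 assumes "f \<in> L2" obtains f0 where "sq_int f0" "AE x in lborel. f x = f0 x"
proof -
 have f: "f \<in> borel_measurable lebesgue" "integrable lebesgue (%x. (norm (f x))\<^sup>2)" using assms by (auto simp: L2_def)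
 obtain f0 where f0: "f0 \<in> borel_measurable borel" "AE x in lborel. f x = f0 x" using completion_ex_borel[OF f(1)] .
 have "integrable lborel (%x. (norm (f0 x))\<^sup>2)"
 proof -
  have "AE x in lborel. (norm (f x))\<^sup>2 = (norm (f0 x))\<^sup>2" using f0(2) by eventually_elim simp
  then show ?thesis using lebesgue_integral_cong(1)[of "%x. (norm (f x))\<^sup>2" "%x. (norm (f0 x))\<^sup>2"] f f0 by simp
 qed
 then show thesis using that f0 by (auto simp: sq_int_def)
qed

lemma sq_int_imp_L2:
 assumes "sq_int f0" and "AE x in lborel. f x = f0 x" shows "f \<in> L2" "norm_L2 f = sqrt (n2 f0)"
proof -
 have m0: "f0 \<in> borel_measurable borel" using assms(1) by (simp add: sq_int_def)
 have m: "f \<in> borel_measurable lebesgue"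
 proof (rule borel_measurable_AE[OF borel_imp_lebesgue[OF m0]])
  have "AE x in lborel. f0 x = f x" using assms(2) by eventually_elim simp
  then show "AE x in lebesgue. f0 x = f x" by (rule AE_completion)
 qed
 have a: "AE x in lborel. (norm (f x))\<^sup>2 = (norm (f0 x))\<^sup>2" using assms(2) by eventually_elim simp
 have "(%x. (norm (f x))\<^sup>2) \<in> borel_measurable lebesgue" "(%x. (norm (f0 x))\<^sup>2) \<in> borel_measurable borel"
  using m m0 by measurable
 note c = lebesgue_integral_cong[OF this a]
 show "f \<in> L2" using m c(1) sq_int_integrable[OF assms(1)] by (simp add: L2_def)
 show "norm_L2 f = sqrt (n2 f0)" unfolding norm_L2_def n2_def c(2) ..
qed

lemma inner_L2_eq:
 assumes "f \<in> L2" "g \<in> L2" "sq_int f0" "sq_int g0" "AE x in lborel. f x = f0 x" "AE x in lborel. g x = g0 x"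
 shows "inner_L2 f g = (LINT x|lborel. f0 x \<bullet> g0 x)"
 unfolding inner_L2_def
proof (rule lebesgue_integral_cong(2))
 show "(%x. f x \<bullet> g x) \<in> borel_measurable lebesgue" using assms(1,2) by (auto simp: L2_def)
 show "(%x. f0 x \<bullet> g0 x) \<in> borel_measurable borel" using assms(3,4) by (auto simp: sq_int_def)
 show "AE x in lborel. f x \<bullet> g x = f0 x \<bullet> g0 x" using assms(5,6) by eventually_elim simp
qed

lemma set_integrable_lebesgue:
 fixes f0 :: "real => 'v::euclidean_space"
 assumes "f \<in> borel_measurable lebesgue" "f0 \<in> borel_measurable borel" "AE x in lborel. f x = f0 x" "A \<in> sets borel"
 shows "set_integrable lebesgue A f \<longleftrightarrow> set_integrable lborel A f0" "(LINT x:A|lebesgue. f x) = (LINT x:A|lborel. f0 x)"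
proof -
 have A: "A \<in> sets lebesgue" using assms(4) by simp
 have "(%x. indicator A x *\<^sub>R f x) \<in> borel_measurable lebesgue" using assms(1) A by measurable
 moreover have "(%x. indicator A x *\<^sub>R f0 x) \<in> borel_measurable borel" using assms(2,4) by measurable
 moreover have "AE x in lborel. indicator A x *\<^sub>R f x = indicator A x *\<^sub>R f0 x" using assms(3) by eventually_elim simp
 ultimately show "set_integrable lebesgue A f \<longleftrightarrow> set_integrable lborel A f0" "(LINT x:A|lebesgue. f x) = (LINT x:A|lborel. f0 x)"
  unfolding set_integrable_def set_lebesgue_integral_def by (rule lebesgue_integral_cong)+
qed

lemma compact_subset_Icc:
 fixes K :: "real set"
 assumes "compact K" obtains R where "K \<subseteq> {-R..R}"
proof -
 obtain B where "\<forall>x\<in>K. \<bar>x\<bar> <= B" using compact_imp_bounded[OF assms] unfolding bounded_iff real_norm_def by blast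
 then show thesis by (intro that[of B]) (auto simp: abs_le_iff)
qed

lemma set_integral_Icc_refl [simp]:
 fixes h :: "real => 'v::euclidean_space" shows "(LINT x:{a..a}|lborel. h x) = 0"
 unfolding set_lebesgue_integral_def
proof (rule integral_eq_zero_AE)
 show "AE x in lborel. indicator {a..a} x *\<^sub>R h x = 0"
  using AE_lborel_singleton[of a] by eventually_elim simp
qed

lemma set_integrable_compact:
 fixes f :: "real => 'v::euclidean_space"
 assumes "!!a b. {a..b} \<subseteq> S ==> set_integrable lborel {a..b} f" "compact K" "K \<subseteq> {a..b}" "{a..b} \<subseteq> S"
 shows "set_integrable lborel K f"
 by (rule set_integrable_subset[OF assms(1)[OF assms(4)]]) (use assms in \<open>auto intro: borel_compact\<close>)

lemma test_funs_continuous: "\<phi> \<in> test_funs S ==> continuous_on UNIV \<phi>"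
 by (rule DERIV_continuous_on) (use test_funsD(1) in auto)

lemma has_distr_deriv_iff_lborel:
 fixes f0 g0 :: "real => 'v::euclidean_space"
 assumes f: "f \<in> borel_measurable lebesgue" "f0 \<in> borel_measurable borel" "AE x in lborel. f x = f0 x"
  and g: "g \<in> borel_measurable lebesgue" "g0 \<in> borel_measurable borel" "AE x in lborel. g x = g0 x"
  and S: "open S"
 shows "has_distr_deriv S f g \<longleftrightarrow>
  (\<forall>K. compact K & K \<subseteq> S --> set_integrable lborel K f0 & set_integrable lborel K g0) &
  (\<forall>\<phi>\<in>test_funs S. (LINT x:S|lborel. deriv \<phi> x *\<^sub>R f0 x) = - (LINT x:S|lborel. \<phi> x *\<^sub>R g0 x))"
proof -
 have 1: "locally_integrable S f \<longleftrightarrow> (\<forall>K. compact K & K \<subseteq> S --> set_integrable lborel K f0)"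
  unfolding locally_integrable_def using set_integrable_lebesgue(1)[OF f borel_compact] by auto
 have 2: "locally_integrable S g \<longleftrightarrow> (\<forall>K. compact K & K \<subseteq> S --> set_integrable lborel K g0)"
  unfolding locally_integrable_def using set_integrable_lebesgue(1)[OF g borel_compact] by auto
 have 3: "(LINT x:S|lebesgue. deriv \<phi> x *\<^sub>R f x) = (LINT x:S|lborel. deriv \<phi> x *\<^sub>R f0 x)"
  "(LINT x:S|lebesgue. \<phi> x *\<^sub>R g x) = (LINT x:S|lborel. \<phi> x *\<^sub>R g0 x)" if "\<phi> \<in> test_funs S" for \<phi>
 proof -
  have m: "\<phi> \<in> borel_measurable borel" "deriv \<phi> \<in> borel_measurable borel"
   using test_funs_continuous[OF that] test_funsD(2)[OF that] by (auto intro!: borel_measurable_continuous_onI)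
  note ml = m[THEN borel_imp_lebesgue]
  show "(LINT x:S|lebesgue. deriv \<phi> x *\<^sub>R f x) = (LINT x:S|lborel. deriv \<phi> x *\<^sub>R f0 x)"
  proof (rule set_integrable_lebesgue(2))
   show "(%x. deriv \<phi> x *\<^sub>R f x) \<in> borel_measurable lebesgue" using ml f by measurable
   show "(%x. deriv \<phi> x *\<^sub>R f0 x) \<in> borel_measurable borel" using m f by measurable
   show "AE x in lborel. deriv \<phi> x *\<^sub>R f x = deriv \<phi> x *\<^sub>R f0 x" using f(3) by eventually_elim simp
  qed (use S in simp)
  show "(LINT x:S|lebesgue. \<phi> x *\<^sub>R g x) = (LINT x:S|lborel. \<phi> x *\<^sub>R g0 x)"
  proof (rule set_integrable_lebesgue(2))
   show "(%x. \<phi> x *\<^sub>R g x) \<in> borel_measurable lebesgue" using ml g by measurable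
   show "(%x. \<phi> x *\<^sub>R g0 x) \<in> borel_measurable borel" using m g by measurable
   show "AE x in lborel. \<phi> x *\<^sub>R g x = \<phi> x *\<^sub>R g0 x" using g(3) by eventually_elim simp
  qed (use S in simp)
 qed
 show ?thesis unfolding has_distr_deriv_def 1 2 using 3 by auto
qed

lemma prim_imp_distr_deriv:
 assumes p: "prim f0 g0" and f: "AE x in lborel. f x = f0 x" and g: "AE x in lborel. g x = g0 x"
 shows "has_distr_deriv UNIV f g"
proof -
 have s: "sq_int f0" "sq_int g0" by (rule primD[OF p])+
 have m0: "f0 \<in> borel_measurable borel" "g0 \<in> borel_measurable borel" using s by (auto simp: sq_int_def)
 have m: "f \<in> borel_measurable lebesgue" "g \<in> borel_measurable lebesgue"
  using sq_int_imp_L2(1)[OF s(1) f] sq_int_imp_L2(1)[OF s(2) g] by (auto simp: L2_def)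
 have loc: "set_integrable lborel K f0 & set_integrable lborel K g0" if K: "compact K" for K
 proof -
  obtain a where "K \<subseteq> {-a..a}" using compact_subset_Icc[OF K] .
  then show ?thesis
   using set_integrable_compact[of UNIV f0 K "-a" a, OF sq_int_local(1)[OF s(1)] K]
    set_integrable_compact[of UNIV g0 K "-a" a, OF sq_int_local(1)[OF s(2)] K] by simp
 qed
 have ibp: "(LINT x:UNIV|lborel. deriv \<phi> x *\<^sub>R f0 x) = - (LINT x:UNIV|lborel. \<phi> x *\<^sub>R g0 x)" if t: "\<phi> \<in> test_funs UNIV" for \<phi>
 proof -
  obtain K where K: "compact K" "!!x. x \<notin> K ==> \<phi> x = 0" using test_funsD(3)[OF t] by blast
  obtain R where R: "K \<subseteq> {-R..R}" using compact_subset_Icc[OF K(1)] .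
  define N where "N = \<bar>R\<bar> + 1"
  have z: "\<phi> x = 0" if "\<bar>x\<bar> > \<bar>R\<bar>" for x
  proof (rule K(2), rule notI)
   assume "x \<in> K"
   then have "x \<in> {-R..R}" using R by blast
   then show False using that by auto
  qed
  have dz: "deriv \<phi> x = 0" if "\<bar>x\<bar> > \<bar>R\<bar>" for x
  proof -
   have "open {x. \<bar>x\<bar> > \<bar>R\<bar>}" by (intro open_Collect_less continuous_intros)
   then have "eventually (%y. \<phi> y = 0) (nhds x)" using eventually_nhds_in_open[of "{x. \<bar>x\<bar> > \<bar>R\<bar>}" x] that z by (auto elim: eventually_mono)
   then have "deriv \<phi> x = deriv (%_. 0) x" by (intro deriv_cong_ev) auto
   then show ?thesis by simp
  qed
  have e: "(LINT x:UNIV|lborel. h x) = (LINT x:{-N..N}|lborel. h x)" if "!!x. \<bar>x\<bar> > \<bar>R\<bar> ==> h x = 0" for h :: "real => 'a"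
   unfolding set_lebesgue_integral_def using that by (intro Bochner_Integration.integral_cong refl) (auto simp: indicator_def N_def)
  have "(LINT x:{-N..N}|lborel. deriv \<phi> x *\<^sub>R f0 x) = - (LINT x:{-N..N}|lborel. \<phi> x *\<^sub>R g0 x)"
   by (rule integration_by_parts_test)
    (use s m0 test_funsD(1,2)[OF t] primD(3)[OF p] z in \<open>auto simp: N_def intro: sq_int_local\<close>)
  then show ?thesis using e[of "%x. deriv \<phi> x *\<^sub>R f0 x"] e[of "%x. \<phi> x *\<^sub>R g0 x"] z dz by simp
 qed
 show ?thesis
  by (subst has_distr_deriv_iff_lborel[OF m(1) m0(1) f m(2) m0(2) g]) (use loc ibp in auto)
qed

text \<open>Bumps with c tending to zero turn equality on test functions into equality of the
  integrals over all intervals.\<close>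

lemma distr_deriv_unique:
 assumes g: "g \<in> L2" "sq_int g0" "AE x in lborel. g x = g0 x" and h: "h \<in> L2" "sq_int h0" "AE x in lborel. h x = h0 x"
  and f: "f \<in> L2" and d: "has_distr_deriv UNIV f g" "has_distr_deriv UNIV f h"
 shows "AE x in lborel. g0 x = h0 x"
proof -
 obtain f0 where f0: "sq_int f0" "AE x in lborel. f x = f0 x" using L2_ex_sq_int[OF f] .
 have m: "f \<in> borel_measurable lebesgue" "g \<in> borel_measurable lebesgue" "h \<in> borel_measurable lebesgue"
  using f g h by (auto simp: L2_def)
 have m0: "f0 \<in> borel_measurable borel" "g0 \<in> borel_measurable borel" "h0 \<in> borel_measurable borel"
  using f0 g h by (auto simp: sq_int_def)
 have eq: "(LINT x|lborel. \<phi> x *\<^sub>R g0 x) = (LINT x|lborel. \<phi> x *\<^sub>R h0 x)" if "\<phi> \<in> test_funs UNIV" for \<phi>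
  using d(1)[unfolded has_distr_deriv_iff_lborel[OF m(1) m0(1) f0(2) m(2) m0(2) g(3) open_UNIV]]
   d(2)[unfolded has_distr_deriv_iff_lborel[OF m(1) m0(1) f0(2) m(3) m0(3) h(3) open_UNIV]] that
  by (simp add: set_lebesgue_integral_def)
 have "(LINT x:{a..b}|lborel. g0 x) = (LINT x:{a..b}|lborel. h0 x)" if ab: "a <= b" for a b
 proof (cases "a = b")
  case True
  show ?thesis unfolding True set_integral_Icc_refl ..
 next
  case False
  have "(%n. LINT x|lborel. bump1 (1 / real (Suc n)) a b x *\<^sub>R g0 x) \<longlonglongrightarrow> (LINT x:{a..b}|lborel. g0 x)"
   "(%n. LINT x|lborel. bump1 (1 / real (Suc n)) a b x *\<^sub>R h0 x) \<longlonglongrightarrow> (LINT x:{a..b}|lborel. h0 x)"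
   by (intro bump1_integral_lim sq_int_local g h m0)+
  moreover have "(LINT x|lborel. bump1 (1 / real (Suc n)) a b x *\<^sub>R g0 x) = (LINT x|lborel. bump1 (1 / real (Suc n)) a b x *\<^sub>R h0 x)" for n
   using False ab by (intro eq bump1_test) auto
  ultimately show ?thesis using LIMSEQ_unique by auto
 qed
 then have "(LINT x:{a..b}|lborel. g0 x - h0 x) = 0" if "a <= b" for a b
  using that by (subst set_integral_diff(2)) (auto intro: sq_int_local g h)
 then have "AE x in lborel. g0 x - h0 x = 0" by (intro AE_zero_of_interval_integrals sq_int_diff g h)
 then show ?thesis by eventually_elim simp
qed

text \<open>\<open>weak_deriv\<close> is an arbitrary choice, so it has to be identified through
  uniqueness of the distributional derivative. After that, \<open>norm_H1\<close> can be computed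
  from a \<open>prim\<close> pair.\<close>

lemma prim_imp_H1:
 assumes p: "prim f0 g0" and f: "AE x in lborel. f x = f0 x"
 shows "f \<in> H1" "weak_deriv f \<in> L2" "AE x in lborel. weak_deriv f x = g0 x" "norm_H1 f = sqrt (n2 f0 + n2 g0)"
proof -
 have s: "sq_int f0" "sq_int g0" by (rule primD[OF p])+
 have fL: "f \<in> L2" "norm_L2 f = sqrt (n2 f0)" by (rule sq_int_imp_L2[OF s(1) f])+
 have gL: "g0 \<in> L2" by (rule sq_int_imp_L2[OF s(2)]) simp
 have d: "has_distr_deriv UNIV f g0" by (rule prim_imp_distr_deriv[OF p f]) simp
 show "f \<in> H1" using fL gL d by (auto simp: H1_def)
 have w: "weak_deriv f \<in> L2" "has_distr_deriv UNIV f (weak_deriv f)"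
  using someI[of "%g. g \<in> L2 & has_distr_deriv UNIV f g" g0] gL d by (auto simp: weak_deriv_def)
 show "weak_deriv f \<in> L2" by (rule w)
 obtain w0 where w0: "sq_int w0" "AE x in lborel. weak_deriv f x = w0 x" using L2_ex_sq_int[OF w(1)] .
 have "AE x in lborel. w0 x = g0 x"
  by (rule distr_deriv_unique[OF w(1) w0 gL s(2) _ fL(1) w(2) d]) simp
 then show wg: "AE x in lborel. weak_deriv f x = g0 x" using w0(2) by eventually_elim simp
 have "norm_L2 (weak_deriv f) = sqrt (n2 g0)" by (rule sq_int_imp_L2(2)[OF s(2) wg])
 then show "norm_H1 f = sqrt (n2 f0 + n2 g0)" by (simp add: norm_H1_def fL)
qed

section \<open>H1 functions are indefinite integrals\<close>

lemma ex_antiderivative_sq: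
 fixes g :: "real => 'v::euclidean_space"
 assumes g: "sq_int g"
 obtains G where "!!a b. a <= b ==> G b - G a = (LINT x:{a..b}|lborel. g x)" "G 0 = 0"
proof -
 have gm [measurable]: "g \<in> borel_measurable borel" using g by (simp add: sq_int_def)
 \<comment> \<open>The oriented integral from 0 to x written as one integral: away from the points 0
   and x, \<open>k x\<close> is 1 on [0, x] and -1 on [x, 0].\<close>
 define k where "k = (%x s::real. indicator {0..x} s - indicator {x..0} s :: real)"
 define G where "G = (%x. LINT s|lborel. k x s *\<^sub>R g s)"
 have i: "integrable lborel (%s. k x s *\<^sub>R g s)" for x
  using sq_int_local(1)[OF g, of 0 x] sq_int_local(1)[OF g, of x 0]
  by (simp add: k_def scaleR_diff_left set_integrable_def)
 have "G b - G a = (LINT x:{a..b}|lborel. g x)" if "a <= b" for a b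
 proof -
  have "G b - G a = (LINT s|lborel. k b s *\<^sub>R g s - k a s *\<^sub>R g s)"
   unfolding G_def by (rule Bochner_Integration.integral_diff[symmetric]) (rule i)+
  also have "... = (LINT s|lborel. indicator {a..b} s *\<^sub>R g s)"
  proof (rule integral_cong_AE)
   show "AE s in lborel. k b s *\<^sub>R g s - k a s *\<^sub>R g s = indicator {a..b} s *\<^sub>R g s"
    using AE_lborel_singleton[of 0] AE_lborel_singleton[of a] AE_lborel_singleton[of b]
    by eventually_elim (use that in \<open>auto simp: k_def indicator_def\<close>)
  qed (auto simp: k_def)
  finally show ?thesis by (simp add: set_lebesgue_integral_def)
 qed
 moreover have "G 0 = 0" unfolding G_def k_def by simp
 ultimately show thesis by (rule that)
qed

lemma bump1_integral_pos:
 assumes "c > 0" "a < b" shows "integrable lborel (bump1 c a b)" "(LINT x|lborel. bump1 c a b x) > 0"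
proof -
 have m: "bump1 c a b \<in> borel_measurable lborel" using bump1_bounds(3)[OF assms(1), of a b] by (simp add: borel_measurable_continuous_onI)
 show i: "integrable lborel (bump1 c a b)"
 proof (rule Bochner_Integration.integrable_bound[OF integrable_indicator_Icc m])
  show "AE x in lborel. norm (bump1 c a b x) <= norm (indicator {a..b} x :: real)"
   using bump1_bounds(1,2)[OF assms(1), of a b] by (intro AE_I2) simp
 qed
 have "(LINT x|lborel. bump1 c a b x) ~= 0"
 proof
  assume "(LINT x|lborel. bump1 c a b x) = 0"
  then have "AE x in lborel. bump1 c a b x = 0"
   using integral_nonneg_eq_0_iff_AE[OF i] bump1_bounds(1)[OF assms(1)] by simp
  then have "AE x in lborel. x \<notin> {a<..<b}"
   by eventually_elim (auto simp: bump_def)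
  then have "{a<..<b} \<in> null_sets lborel" by (subst AE_iff_null_sets) auto
  then show False using assms(2) by (auto simp: null_sets_def)
 qed
 moreover have "(LINT x|lborel. bump1 c a b x) \<ge> 0" by (intro Bochner_Integration.integral_nonneg bump1_bounds assms)
 ultimately show "(LINT x|lborel. bump1 c a b x) > 0" by simp
qed

text \<open>Two bumps normalized to integral one differ by a function of integral zero, whose
  antiderivative can be taken with compact support and is therefore a test function.\<close>

lemma normalized_bumps_antiderivative:
 assumes c: "c > 0" and ab: "a1 < b1" "a2 < b2"
 defines "w \<equiv> %x. bump1 c a1 b1 x / (LINT x|lborel. bump1 c a1 b1 x) - bump1 c a2 b2 x / (LINT x|lborel. bump1 c a2 b2 x)"
 obtains \<Phi> where "\<Phi> \<in> test_funs UNIV" "deriv \<Phi> = w"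
proof -
 define I where "I = (%a b. LINT x|lborel. bump1 c a b x)"
 have I: "I a1 b1 > 0" "I a2 b2 > 0" using bump1_integral_pos(2)[OF c] ab by (auto simp: I_def)
 define D where "D = (%k x. bump c a1 b1 ((bump_step c a1 b1 ^^ k) (1, 0)) x / I a1 b1 - bump c a2 b2 ((bump_step c a2 b2 ^^ k) (1, 0)) x / I a2 b2)"
 have D0: "D 0 = w" by (simp add: D_def w_def I_def)
 have dD: "(D k has_real_derivative D (Suc k) x) (at x)" for k x
  unfolding D_def by (intro DERIV_diff DERIV_cdivide bump_iterates c ab)
 have wc: "continuous_on UNIV w" unfolding D0[symmetric] by (rule DERIV_continuous_on) (rule has_field_derivative_at_within[OF dD])
 have "\<exists>F. \<forall>x::real. - \<infinity> < ereal x --> ereal x < \<infinity> --> (F has_vector_derivative w x) (at x)"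
  using wc by (intro einterval_antiderivative) (auto simp: continuous_on_eq_continuous_at)
 then obtain F where F: "!!x. (F has_real_derivative w x) (at x)"
  by (auto simp: has_real_derivative_iff_has_vector_derivative)
 define R where "R = \<bar>a1\<bar> + \<bar>b1\<bar> + \<bar>a2\<bar> + \<bar>b2\<bar>"
 have wz: "w x = 0" if "x \<notin> {-R<..<R}" for x
 proof -
  have "x <= -R \<or> R <= x" using that by auto
  then have "\<not> (a1 < x & x < b1)" "\<not> (a2 < x & x < b2)" unfolding R_def by linarith+
  then have "bump1 c a1 b1 x = 0" "bump1 c a2 b2 x = 0" unfolding bump_def by (simp_all only: if_False)
  then show ?thesis by (simp add: w_def)
 qed
 define \<Phi> where "\<Phi> = (%x. F x - F (-R))"
 have d\<Phi>: "(\<Phi> has_real_derivative w x) (at x)" for x unfolding \<Phi>_def using DERIV_diff[OF F DERIV_const] by simp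
 have R0: "-R <= R" by (auto simp: R_def)
 have "(LINT x|lborel. indicator {-R..R} x *\<^sub>R w x) = \<Phi> R - \<Phi> (-R)"
  by (rule integral_FTC_atLeastAtMost[OF R0])
   (use d\<Phi> wc in \<open>auto simp: has_real_derivative_iff_has_vector_derivative[symmetric] intro: has_field_derivative_at_within continuous_on_subset\<close>)
 moreover have "(LINT x|lborel. indicator {-R..R} x *\<^sub>R w x) = (LINT x|lborel. w x)"
 proof (rule Bochner_Integration.integral_cong[OF refl])
  show "indicator {-R..R} x *\<^sub>R w x = w x" for x using wz[of x] by (cases "x \<in> {-R..R}") auto
 qed
 moreover have "(LINT x|lborel. w x) = 0"
  using bump1_integral_pos(1)[OF c] ab I by (simp add: w_def I_def)
 ultimately have \<Phi>R: "\<Phi> R = 0" by (simp add: \<Phi>_def)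
 have d0: "(\<Phi> has_real_derivative 0) (at x within S)" if "x \<notin> {-R<..<R}" for x S
  using d\<Phi>[of x] wz[OF that] by (simp add: has_field_derivative_at_within)
 have z: "\<Phi> x = 0" if "x \<notin> {-R..R}" for x
 proof (cases "x < -R")
  case True
  have "\<exists>k. \<forall>x\<in>{..-R}. \<Phi> x = k"
   by (rule has_field_derivative_zero_constant) (auto intro!: d0)
  then have "\<Phi> x = \<Phi> (-R)" using True by auto
  then show ?thesis by (simp add: \<Phi>_def)
 next
  case False
  have "\<exists>k. \<forall>x\<in>{R..}. \<Phi> x = k"
   by (rule has_field_derivative_zero_constant) (auto intro!: d0)
  then have "\<Phi> x = \<Phi> R" using False that by auto
  then show ?thesis using \<Phi>R by simp
 qed
 \<comment> \<open>The derivatives of \<Phi> of positive order are the functions D with the index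
   lowered by one.\<close>
 define H where "H = (%k. case k of 0 => \<Phi> | Suc j => D j)"
 have "H 0 \<in> test_funs UNIV"
 proof (rule test_funsI[of H "{-R..R}"])
  show "(H k has_real_derivative H (Suc k) x) (at x)" for k x
   by (cases k) (simp_all add: H_def d\<Phi> D0 dD del: funpow.simps)
 qed (use z in \<open>auto simp: H_def\<close>)
 then have "\<Phi> \<in> test_funs UNIV" by (simp add: H_def)
 moreover have "deriv \<Phi> = w" by (rule ext) (rule DERIV_imp_deriv[OF d\<Phi>])
 ultimately show thesis by (rule that)
qed

text \<open>The difference u of v and an antiderivative of its weak derivative has distributional
  derivative zero. Tested with antiderivatives of differences of normalized bumps, it turns out to
  have the same mean over all intervals, so it is almost everywhere constant.\<close>

lemma H1_ex_prim:
 fixes v :: "real => 'v::euclidean_space"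
 assumes "v \<in> H1"
 obtains f0 g0 where "prim f0 g0" "AE x in lborel. v x = f0 x"
proof -
 obtain g where v: "v \<in> L2" and g: "g \<in> L2" "has_distr_deriv UNIV v g" using assms by (auto simp: H1_def)
 obtain v0 where v0: "sq_int v0" "AE x in lborel. v x = v0 x" using L2_ex_sq_int[OF v] .
 obtain g0 where g0: "sq_int g0" "AE x in lborel. g x = g0 x" using L2_ex_sq_int[OF g(1)] .
 obtain G where G: "!!a b. a <= b ==> G b - G a = (LINT x:{a..b}|lborel. g0 x)" "G 0 = 0"
  using ex_antiderivative_sq[OF g0(1)] by blast
 have Ga: "antider G g0" using g0(1) G(1) by (simp add: antider_def)
 note Gc = continuous_of_increments[OF Ga]
 have Gm [measurable]: "G \<in> borel_measurable borel" using Gc(1) by (rule borel_measurable_continuous_onI)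
 have vm [measurable]: "v0 \<in> borel_measurable borel" "g0 \<in> borel_measurable borel" using v0 g0 by (auto simp: sq_int_def)
 have Gi: "set_integrable lborel {a..b} G" for a b
  unfolding set_integrable_def using Gc(1) by (intro borel_integrable_compact) (auto intro: continuous_on_subset)
 define u where "u = (%x. v0 x - G x)"
 have um [measurable]: "u \<in> borel_measurable borel" unfolding u_def by measurable
 have ui: "set_integrable lborel {a..b} u" for a b
  unfolding u_def by (intro set_integral_diff(1) sq_int_local v0 Gi)
 have ml: "v \<in> borel_measurable lebesgue" "g \<in> borel_measurable lebesgue" using v g by (auto simp: L2_def)
 have dd: "(LINT x|lborel. deriv \<phi> x *\<^sub>R v0 x) = - (LINT x|lborel. \<phi> x *\<^sub>R g0 x)" if "\<phi> \<in> test_funs UNIV" for \<phi>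
  using g(2)[unfolded has_distr_deriv_iff_lborel[OF ml(1) vm(1) v0(2) ml(2) vm(2) g0(2) open_UNIV]] that
  by (simp add: set_lebesgue_integral_def)
 define J where "J = (%n a b. LINT x|lborel. bump1 (1 / real (Suc n)) a b x)"
 \<comment> \<open>The two sides differ by the pairing of u with the derivative of the test function
   from \<open>normalized_bumps_antiderivative\<close>, which is zero; (0, 1) is the reference
   interval.\<close>
 have eqn: "(1 / J n a b) *\<^sub>R (LINT x|lborel. bump1 (1 / real (Suc n)) a b x *\<^sub>R u x)
   = (1 / J n 0 1) *\<^sub>R (LINT x|lborel. bump1 (1 / real (Suc n)) 0 1 x *\<^sub>R u x)" if ab: "a < b" for a b n
 proof -
  let ?c = "1 / real (Suc n)"
  let ?w = "%x. bump1 ?c a b x / J n a b - bump1 ?c 0 1 x / J n 0 1"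
  obtain \<Phi> where \<Phi>: "\<Phi> \<in> test_funs UNIV" "deriv \<Phi> = ?w"
   using normalized_bumps_antiderivative[of ?c a b 0 1] ab unfolding J_def by auto
  obtain K where K: "compact K" "!!x. x \<notin> K ==> \<Phi> x = 0" using test_funsD(3)[OF \<Phi>(1)] by blast
  obtain R0 where R0: "K \<subseteq> {-R0..R0}" using compact_subset_Icc[OF K(1)] .
  define R where "R = max (\<bar>R0\<bar> + 1) (max (\<bar>a\<bar> + 1) (\<bar>b\<bar> + 2))"
  have zK: "x \<notin> K" if "\<bar>x\<bar> \<ge> R" for x
  proof
   assume "x \<in> K"
   then have "x \<in> {-R0..R0}" using R0 by blast
   then have "\<bar>x\<bar> <= \<bar>R0\<bar>" by auto
   moreover have "\<bar>R0\<bar> + 1 <= R" unfolding R_def by (rule max.cobounded1)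
   ultimately show False using that by linarith
  qed
  have z\<Phi>: "\<Phi> x = 0" if "\<bar>x\<bar> \<ge> R" for x by (rule K(2)[OF zK[OF that]])
  have "\<bar>a\<bar> + 1 <= R" "\<bar>b\<bar> + 2 <= R" "R \<ge> 1" by (simp_all add: R_def le_max_iff_disj)
  then have zb: "bump1 ?c a b x = 0" "bump1 ?c 0 1 x = 0" if "\<bar>x\<bar> > R" for x
   using that by (auto simp: bump_def)
  have e: "(LINT x|lborel. h x) = (LINT x:{-R..R}|lborel. h x)" if "!!x. \<bar>x\<bar> > R ==> h x = 0" for h :: "real => 'v"
   unfolding set_lebesgue_integral_def using that by (intro Bochner_Integration.integral_cong refl) (auto simp: indicator_def not_le abs_le_iff)
  have "(LINT x:{-R..R}|lborel. deriv \<Phi> x *\<^sub>R G x) = - (LINT x:{-R..R}|lborel. \<Phi> x *\<^sub>R g0 x)"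
  proof (rule integration_by_parts_test)
   show "G x - G (-R) = (LINT s:{-R..x}|lborel. g0 s)" if "x \<in> {-R..R}" for x using that by (intro G(1)) auto
  qed (use \<open>R \<ge> 1\<close> g0(1) test_funsD(1,2)[OF \<Phi>(1)] z\<Phi> in \<open>auto intro: sq_int_local\<close>)
  also have "... = (LINT x|lborel. deriv \<Phi> x *\<^sub>R v0 x)"
   using dd[OF \<Phi>(1)] e[of "%x. \<Phi> x *\<^sub>R g0 x"] z\<Phi> by simp
  also have "... = (LINT x:{-R..R}|lborel. deriv \<Phi> x *\<^sub>R v0 x)"
   using zb by (intro e) (simp add: \<Phi>(2))
  finally have eq0: "(LINT x:{-R..R}|lborel. deriv \<Phi> x *\<^sub>R G x) = (LINT x:{-R..R}|lborel. deriv \<Phi> x *\<^sub>R v0 x)" .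
  have bnd: "set_integrable lborel {-R..R} (%x. \<psi> x *\<^sub>R h x)"
   if "continuous_on UNIV \<psi>" "set_integrable lborel {-R..R} h" for \<psi> :: "real => real" and h :: "real => 'v"
  proof -
   have "compact (\<psi> ` {-R..R})" using that(1) by (intro compact_continuous_image) (auto intro: continuous_on_subset)
   then obtain B where B: "\<forall>x\<in>{-R..R}. \<bar>\<psi> x\<bar> <= B" using compact_imp_bounded[of "\<psi> ` {-R..R}"] unfolding bounded_iff real_norm_def by auto
   have [measurable]: "\<psi> \<in> borel_measurable borel" using that(1) by (rule borel_measurable_continuous_onI)
   have hm: "(%x. indicator {-R..R} x *\<^sub>R h x) \<in> borel_measurable lborel" using that(2) by (auto simp: set_integrable_def)
   have "integrable lborel (%x. \<psi> x *\<^sub>R (indicator {-R..R} x *\<^sub>R h x))"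
   proof (rule Bochner_Integration.integrable_bound)
    show "integrable lborel (%x. B *\<^sub>R (indicator {-R..R} x *\<^sub>R h x))"
     by (rule integrable_scaleR_right) (use that(2) in \<open>simp add: set_integrable_def\<close>)
    show "(%x. \<psi> x *\<^sub>R (indicator {-R..R} x *\<^sub>R h x)) \<in> borel_measurable lborel" using hm by measurable
    show "AE x in lborel. norm (\<psi> x *\<^sub>R (indicator {-R..R} x *\<^sub>R h x)) <= norm (B *\<^sub>R (indicator {-R..R} x *\<^sub>R h x))"
     using B by (intro AE_I2) (auto simp: indicator_def intro!: mult_right_mono order_trans[OF _ abs_ge_self])
   qed
   then show ?thesis unfolding set_integrable_def by (simp add: mult.commute)
  qed
  have c: "continuous_on UNIV (bump1 ?c p q)" for p q by (rule bump1_bounds) simp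
  have wc: "continuous_on UNIV ?w" using test_funsD(2)[OF \<Phi>(1)] unfolding \<Phi>(2) .
  have "(LINT x:{-R..R}|lborel. ?w x *\<^sub>R u x) = 0"
   using eq0 unfolding \<Phi>(2) u_def scaleR_diff_right
   by (subst set_integral_diff(2)[OF bnd[OF wc sq_int_local(1)[OF v0(1)]] bnd[OF wc Gi]]) simp
  moreover have "(LINT x:{-R..R}|lborel. ?w x *\<^sub>R u x)
   = (1 / J n a b) *\<^sub>R (LINT x:{-R..R}|lborel. bump1 ?c a b x *\<^sub>R u x) - (1 / J n 0 1) *\<^sub>R (LINT x:{-R..R}|lborel. bump1 ?c 0 1 x *\<^sub>R u x)"
  proof -
   have i: "set_integrable lborel {-R..R} (%x. (1 / J n p q) *\<^sub>R (bump1 ?c p q x *\<^sub>R u x))" for p q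
    by (intro set_integrable_scaleR_right bnd c ui)
   show ?thesis unfolding set_integral_scaleR_right[symmetric] set_integral_diff(2)[OF i i, symmetric]
    by (simp add: scaleR_diff_left)
  qed
  ultimately show ?thesis
   using e[of "%x. bump1 ?c a b x *\<^sub>R u x"] e[of "%x. bump1 ?c 0 1 x *\<^sub>R u x"] zb by simp
 qed
 have Jlim: "(%n. J n a b) \<longlonglongrightarrow> b - a" if "a < b" for a b
 proof -
  have "set_integrable lborel {a..b} (%_. 1 :: real)" by (simp add: set_integrable_def)
  from bump1_integral_lim[OF this] show ?thesis using that by (simp add: J_def set_lebesgue_integral_def)
 qed
 define \<kappa> where "\<kappa> = (LINT x:{0..1}|lborel. u x)"
 have mean: "(LINT x:{a..b}|lborel. u x) = (b - a) *\<^sub>R \<kappa>" if ab: "a < b" for a b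
 proof -
  have "(%n. (1 / J n p q) *\<^sub>R (LINT x|lborel. bump1 (1 / real (Suc n)) p q x *\<^sub>R u x)) \<longlonglongrightarrow> (1 / (q - p)) *\<^sub>R (LINT x:{p..q}|lborel. u x)"
   if "p < q" for p q
   using that by (intro tendsto_intros Jlim bump1_integral_lim ui um) auto
  from LIMSEQ_unique[OF this[OF ab, unfolded eqn[OF ab]] this[of 0 1]]
  have "(1 / (b - a)) *\<^sub>R (LINT x:{a..b}|lborel. u x) = \<kappa>" by (simp add: \<kappa>_def)
  then have "(b - a) *\<^sub>R ((1 / (b - a)) *\<^sub>R (LINT x:{a..b}|lborel. u x)) = (b - a) *\<^sub>R \<kappa>" by simp
  then show ?thesis using ab by simp
 qed
 \<comment> \<open>u - \<kappa> is not known to be square integrable on the line, so the vanishing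
   criterion is applied to its restriction to [-N, N] for each N.\<close>
 have AEN: "AE x in lborel. indicator {- real N..real N} x *\<^sub>R (u x - \<kappa>) = 0" for N :: nat
 proof (rule AE_zero_of_interval_integrals)
  let ?h = "%x. indicator {- real N..real N} x *\<^sub>R (u x - \<kappa>)"
  have hG: "sq_int (%x. indicator {- real N..real N} x *\<^sub>R (G x + \<kappa>))"
  proof (rule sq_int_bound(1))
   show "integrable lborel (%x. indicator {- real N..real N} x * (2 * (real N * n2 g0) + 2 * (norm \<kappa>)\<^sup>2))" by simp
   show "AE x in lborel. (norm (indicator {- real N..real N} x *\<^sub>R (G x + \<kappa>)))\<^sup>2 <= indicator {- real N..real N} x * (2 * (real N * n2 g0) + 2 * (norm \<kappa>)\<^sup>2)"
   proof (intro AE_I2)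
    fix x
    have "(norm (G x))\<^sup>2 <= \<bar>x\<bar> * n2 g0" using Gc(2)[of x 0] G(2) by simp
    moreover have "\<bar>x\<bar> * n2 g0 <= real N * n2 g0" if "x \<in> {- real N..real N}" using that by (intro mult_right_mono) auto
    ultimately show "(norm (indicator {- real N..real N} x *\<^sub>R (G x + \<kappa>)))\<^sup>2 <= indicator {- real N..real N} x * (2 * (real N * n2 g0) + 2 * (norm \<kappa>)\<^sup>2)"
     using norm2_add_le[of "G x" \<kappa>] by (cases "x \<in> {- real N..real N}") auto
   qed
  qed measurable
  show "sq_int ?h"
   using sq_int_diff(1)[OF sq_int_indicator(1)[OF v0(1), of "{- real N..real N}"] hG]
   by (simp add: u_def scaleR_diff_right scaleR_add_right diff_diff_eq)
  show "(LINT x:{a..b}|lborel. ?h x) = 0" if "a <= b" for a b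
  proof -
   let ?a = "max a (- real N)" and ?b = "min b (real N)"
   have "(LINT x:{a..b}|lborel. ?h x) = (LINT x:{?a..?b}|lborel. u x - \<kappa>)"
    unfolding set_lebesgue_integral_def by (intro Bochner_Integration.integral_cong refl) (auto simp: indicator_def)
   also have "... = 0"
   proof (cases "?a < ?b")
    case True
    have "(LINT x:{?a..?b}|lborel. u x - \<kappa>) = (LINT x:{?a..?b}|lborel. u x) - (LINT x:{?a..?b}|lborel. \<kappa>)"
     by (intro set_integral_diff(2) ui) (simp add: set_integrable_def)
    also have "(LINT x:{?a..?b}|lborel. \<kappa>) = (?b - ?a) *\<^sub>R \<kappa>" using True by (simp add: set_lebesgue_integral_def)
    finally show ?thesis using mean[OF True] by simp
   next
    case False
    then consider "?a = ?b" | "{?a..?b} = {}" by fastforce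
    then show ?thesis
    proof cases
     case 1
     show ?thesis unfolding 1 by (rule set_integral_Icc_refl)
    next
     case 2
     show ?thesis unfolding 2 by (simp add: set_lebesgue_integral_def)
    qed
   qed
   finally show ?thesis .
  qed
 qed
 have AEu: "AE x in lborel. v0 x = G x + \<kappa>"
 proof -
  have "AE x in lborel. \<forall>N::nat. indicator {- real N..real N} x *\<^sub>R (u x - \<kappa>) = 0"
   unfolding AE_all_countable using AEN by blast
  then show ?thesis
  proof eventually_elim
   case (elim x)
   obtain N :: nat where "\<bar>x\<bar> <= real N" using real_arch_simple by blast
   then have "x \<in> {- real N..real N}" by auto
   then show ?case using elim[rule_format, of N] by (simp add: u_def algebra_simps)
  qed
 qed
 have fs: "sq_int (%x. G x + \<kappa>)"
 proof (rule sq_int_bound(1)[OF _ sq_int_integrable[OF v0(1)]])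
  show "AE x in lborel. (norm (G x + \<kappa>))\<^sup>2 <= (norm (v0 x))\<^sup>2" using AEu by eventually_elim simp
 qed measurable
 have "prim (%x. G x + \<kappa>) g0" using fs g0(1) G(1) by (simp add: prim_def)
 moreover have "AE x in lborel. v x = G x + \<kappa>" using v0(2) AEu by eventually_elim simp
 ultimately show thesis by (rule that)
qed

text \<open>The set where f and g differ is open and null, hence empty. It identifies the continuous
  test function of the initial condition with the first member of its \<open>prim\<close>
  pair.\<close>

lemma continuous_AE_eq:
 fixes f g :: "real => 'v::euclidean_space"
 assumes "continuous_on UNIV f" "continuous_on UNIV g" "AE x in lborel. f x = g x" shows "f = g"
proof (rule ccontr)
 assume "f ~= g"
 let ?S = "{x. f x ~= g x}"
 have "open ?S" using assms(1,2) by (intro open_Collect_neq)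
 moreover have "?S ~= {}" using \<open>f ~= g\<close> by auto
 moreover have "?S \<in> null_sets lborel"
  using assms(3) \<open>open ?S\<close> by (subst AE_iff_null_sets) auto
 then have "negligible ?S" by (simp add: negligible_iff_null_sets null_sets_completionI)
 ultimately show False using open_not_negligible by blast
qed

text \<open>A nonempty compact subset of (0, T) lies in some [a, b] with 0 < a and b < T, where g is
  integrable even if it blows up at time zero.\<close>

lemma time_distr_deriv:
 fixes f g :: "real => real"
 assumes f: "continuous_on {0<..} f" "f \<in> borel_measurable borel" and gm: "g \<in> borel_measurable borel"
  and gi: "!!a b. 0 < a ==> a <= b ==> set_integrable lborel {a..b} g"
  and inc: "!!a b. 0 < a ==> a <= b ==> f b - f a = (LINT x:{a..b}|lborel. g x)"
 shows "has_distr_deriv {0<..<T} f g"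
proof -
 have cover: "\<exists>a b. 0 < a & a <= b & b < T & K \<subseteq> {a<..<b}" if K: "compact K" "K \<subseteq> {0<..<T}" "K ~= {}" for K
 proof -
  obtain m M where m: "m \<in> K" "!!x. x \<in> K ==> m <= x" and M: "M \<in> K" "!!x. x \<in> K ==> x <= M"
   using compact_attains_inf[OF K(1,3)] compact_attains_sup[OF K(1,3)] by metis
  have "0 < m" "M < T" using m(1) M(1) K(2) by auto
  have "m / 2 < x & x < (M + T) / 2" if "x \<in> K" for x using m(2)[OF that] M(2)[OF that] \<open>0 < m\<close> \<open>M < T\<close> by simp
  moreover have "m / 2 <= (M + T) / 2" using m(2)[OF M(1)] \<open>0 < m\<close> \<open>M < T\<close> by simp
  ultimately show ?thesis using \<open>0 < m\<close> \<open>M < T\<close> by (intro exI[of _ "m / 2"] exI[of _ "(M + T) / 2"]) auto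
 qed
 have fi: "set_integrable lborel {a..b} f" if "0 < a" for a b
  unfolding set_integrable_def using f(1) that by (intro borel_integrable_compact) (auto intro: continuous_on_subset)
 have loc: "set_integrable lborel K f & set_integrable lborel K g" if K: "compact K" "K \<subseteq> {0<..<T}" for K
 proof (cases "K = {}")
  case False
  then obtain a b where ab: "0 < a" "a <= b" "K \<subseteq> {a<..<b}" using cover[OF K] by blast
  then have "K \<subseteq> {a..b}" by auto
  then show ?thesis using set_integrable_subset[OF fi[OF ab(1)], of K b] set_integrable_subset[OF gi[OF ab(1,2)], of K] K(1)
   by (auto intro: borel_compact)
 qed (simp add: set_integrable_def)
 have ibp: "(LINT x:{0<..<T}|lborel. deriv \<phi> x *\<^sub>R f x) = - (LINT x:{0<..<T}|lborel. \<phi> x *\<^sub>R g x)" if t: "\<phi> \<in> test_funs {0<..<T}" for \<phi>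
 proof -
  obtain K where K: "compact K" "K \<subseteq> {0<..<T}" "!!x. x \<notin> K ==> \<phi> x = 0" using test_funsD(3)[OF t] by blast
  have dz: "deriv \<phi> x = 0" if "x \<notin> K" for x
  proof -
   have "eventually (%y. \<phi> y = 0) (nhds x)"
    using eventually_nhds_in_open[of "- K" x] that K by (auto elim!: eventually_mono simp: compact_imp_closed open_Compl)
   then have "deriv \<phi> x = deriv (%_. 0) x" by (intro deriv_cong_ev) auto
   then show ?thesis by simp
  qed
  show ?thesis
  proof (cases "K = {}")
   case True
   then show ?thesis using K(3) dz by simp
  next
   case False
   then obtain a b where ab: "0 < a" "a <= b" "b < T" "K \<subseteq> {a<..<b}" using cover[OF K(1,2)] by blast
   have e: "(LINT x:{0<..<T}|lborel. h x) = (LINT x:{a..b}|lborel. h x)" if "!!x. x \<notin> K ==> h x = 0" for h :: "real => real"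
    unfolding set_lebesgue_integral_def
   proof (intro Bochner_Integration.integral_cong refl)
    fix x show "indicator {0<..<T} x *\<^sub>R h x = indicator {a..b} x *\<^sub>R h x"
     using that[of x] ab by (cases "x \<in> K") (auto simp: indicator_def)
   qed
   have "a \<notin> K" "b \<notin> K" using ab(4) by auto
   then have "(LINT x:{a..b}|lborel. deriv \<phi> x *\<^sub>R f x) = - (LINT x:{a..b}|lborel. \<phi> x *\<^sub>R g x)"
    by (intro integration_by_parts_test) (use ab gi gm inc test_funsD(1,2)[OF t] K(3) in auto)
   then show ?thesis using e[of "%x. deriv \<phi> x *\<^sub>R f x"] e[of "%x. \<phi> x *\<^sub>R g x"] dz K(3) by simp
  qed
 qed
 show ?thesis
  by (subst has_distr_deriv_iff_lborel[of f f g g])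
   (use f gm loc ibp in \<open>auto intro: borel_imp_lebesgue\<close>)
qed

section \<open>Weak convergence\<close>

lemma integral_dominated_convergence_ev:
 fixes s :: "nat => 'a => 'b::{banach, second_countable_topology}"
 assumes m: "f \<in> borel_measurable M" "!!i. s i \<in> borel_measurable M" and w: "integrable M w"
  and lim: "AE x in M. (%i. s i x) \<longlonglongrightarrow> f x"
  and bound: "eventually (%i. AE x in M. norm (s i x) <= w x) sequentially"
 shows "(%i. integral\<^sup>L M (s i)) \<longlonglongrightarrow> integral\<^sup>L M f"
proof -
 obtain N where N: "!!i. i \<ge> N ==> AE x in M. norm (s i x) <= w x" using bound unfolding eventually_sequentially by blast
 have "(%i. integral\<^sup>L M (s (i + N))) \<longlonglongrightarrow> integral\<^sup>L M f"
 proof (rule integral_dominated_convergence[OF m(1) m(2) w])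
  show "AE x in M. (%i. s (i + N) x) \<longlonglongrightarrow> f x" using lim by eventually_elim (rule LIMSEQ_ignore_initial_segment)
 qed (simp add: N)
 then show ?thesis by (rule LIMSEQ_offset)
qed

text \<open>The constant is not sharp: 10 = 2 * 4 + 2 comes from comparing with g, whose translation
  error is at most 4 times its squared norm.\<close>

lemma n2_dq_le:
 assumes p: "prim f g" and h: "h > 0" shows "n2 (dq h f) <= 10 * n2 g"
proof -
 note s = primD(1,2)[OF p]
 have "n2 (%x. dq h f x - g x) <= 4 * n2 g"
 proof (rule dq_minus_n2_le(2)[OF prim_imp_antider[OF p] h])
  show "n2 (%x. g (x + y) - g x) <= 4 * n2 g" for y
   using sq_int_diff(2)[OF sq_int_shift(1)[OF s(2)] s(2), of y] sq_int_shift(2)[OF s(2), of y] by simp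
 qed
 moreover have "n2 (dq h f) <= 2 * n2 (%x. dq h f x - g x) + 2 * n2 g"
  using sq_int_add(2)[OF sq_int_diff(1)[OF sq_int_dq[OF s(1)] s(2)] s(2), of h] by simp
 ultimately show ?thesis by simp
qed

text \<open>Restricting v to [-N, N] makes dominated convergence applicable; the tail is small
  uniformly in k because the functions \<open>f k\<close> are eventually bounded in L2.\<close>

lemma inner_weak_tendsto:
 fixes f :: "nat => real => 'v::euclidean_space"
 assumes v: "sq_int v" and f: "!!k. sq_int (f k)" and fn: "eventually (%k. n2 (f k) <= C) sequentially"
  and g: "sq_int g" and lim: "!!x. (%k. f k x) \<longlonglongrightarrow> g x"
  and bd: "eventually (%k. \<forall>x. norm (f k x) <= D) sequentially"
 shows "(%k. LINT x|lborel. v x \<bullet> f k x) \<longlonglongrightarrow> (LINT x|lborel. v x \<bullet> g x)"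
proof -
 have vm [measurable]: "v \<in> borel_measurable borel" "f k \<in> borel_measurable borel" "g \<in> borel_measurable borel" for k
  using v f g by (auto simp: sq_int_def)
 define vR where "vR = (%N::nat. %x. indicator {- real N..real N} x *\<^sub>R v x)"
 have vR: "sq_int (vR N)" for N unfolding vR_def by (rule sq_int_indicator(1)[OF v]) simp
 have tail: "(%N. n2 (%x. vR N x - v x)) \<longlonglongrightarrow> 0"
 proof (rule n2_dominated_tendsto[where w = "%x. (norm (v x))\<^sup>2"])
  show "AE x in lborel. (%N. vR N x - v x) \<longlonglongrightarrow> 0"
  proof (intro AE_I2 tendsto_eventually)
   fix x
   obtain N0 :: nat where "\<bar>x\<bar> <= real N0" using real_arch_simple by blast
   then show "eventually (%N. vR N x - v x = 0) sequentially"
    by (intro eventually_mono[OF eventually_ge_at_top[of N0]]) (auto simp: vR_def indicator_def)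
  qed
 qed (use vR v in \<open>auto simp: sq_int_def vR_def indicator_def\<close>)
 have C0: "C \<ge> 0"
 proof -
  obtain k where "n2 (f k) <= C" using fn unfolding eventually_sequentially by blast
  then show ?thesis using n2_nonneg[of "f k"] by linarith
 qed
 have loc: "(%k. LINT x|lborel. vR N x \<bullet> f k x) \<longlonglongrightarrow> (LINT x|lborel. vR N x \<bullet> g x)" for N
 proof (rule integral_dominated_convergence_ev)
  have "set_integrable lborel {- real N..real N} v" by (rule sq_int_local(1)[OF v])
  then show "integrable lborel (%x. norm (vR N x) * D)" unfolding set_integrable_def vR_def by (intro integrable_mult_left integrable_norm)
  show "AE x in lborel. (%k. vR N x \<bullet> f k x) \<longlonglongrightarrow> vR N x \<bullet> g x" by (intro AE_I2 tendsto_intros lim)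
  show "eventually (%k. AE x in lborel. norm (vR N x \<bullet> f k x) <= norm (vR N x) * D) sequentially"
   using bd
  proof eventually_elim
   case (elim k)
   show ?case
   proof (intro AE_I2)
    fix x
    have "norm (vR N x \<bullet> f k x) <= norm (vR N x) * norm (f k x)" by (simp add: Cauchy_Schwarz_ineq2)
    also have "... <= norm (vR N x) * D" using elim by (intro mult_left_mono) auto
    finally show "norm (vR N x \<bullet> f k x) <= norm (vR N x) * D" .
   qed
  qed
 qed (use vR in \<open>auto simp: sq_int_def vR_def\<close>)
 have err: "\<bar>(LINT x|lborel. v x \<bullet> h x) - (LINT x|lborel. vR N x \<bullet> h x)\<bar> <= sqrt (n2 (%x. vR N x - v x)) * sqrt (n2 h)"
  if h: "sq_int h" for h N
 proof -
  have "(LINT x|lborel. (v x - vR N x) \<bullet> h x) = (LINT x|lborel. v x \<bullet> h x) - (LINT x|lborel. vR N x \<bullet> h x)"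
   by (simp add: inner_diff_left integrable_inner_sq(1) v vR h)
  then show ?thesis using integrable_inner_sq(2)[OF sq_int_diff(1)[OF v vR[of N]] h] n2_commute[of "vR N" v] by simp
 qed
 show ?thesis
 proof (rule tendstoI)
  fix e :: real assume e: "e > 0"
  have "(%N. sqrt (n2 (%x. vR N x - v x)) * (sqrt C + sqrt (n2 g))) \<longlonglongrightarrow> sqrt 0 * (sqrt C + sqrt (n2 g))"
   by (intro tendsto_intros tail)
  then have "eventually (%N. sqrt (n2 (%x. vR N x - v x)) * (sqrt C + sqrt (n2 g)) < e / 2) sequentially"
   using e by (intro order_tendstoD(2)) auto
  then obtain N where N: "sqrt (n2 (%x. vR N x - v x)) * (sqrt C + sqrt (n2 g)) < e / 2" unfolding eventually_sequentially by blast
  have "eventually (%k. dist (LINT x|lborel. vR N x \<bullet> f k x) (LINT x|lborel. vR N x \<bullet> g x) < e / 2) sequentially"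
   using e by (intro tendstoD[OF loc]) auto
  then show "eventually (%k. dist (LINT x|lborel. v x \<bullet> f k x) (LINT x|lborel. v x \<bullet> g x) < e) sequentially"
   using fn
  proof eventually_elim
   case (elim k)
   have "sqrt (n2 (%x. vR N x - v x)) * sqrt (n2 (f k)) <= sqrt (n2 (%x. vR N x - v x)) * sqrt C"
    using elim(2) by (intro mult_left_mono) auto
   then show ?case using err[OF f[of k], of N] err[OF g, of N] elim(1) N
    unfolding dist_real_def distrib_left by linarith
  qed
 qed
qed

section \<open>Smoothing by moving averages\<close>

text \<open>For h > 0 this is the mean of f over [x, x + h], whatever antiderivative is chosen;
  writing it as a difference quotient makes the estimates for \<open>dq\<close> available. It raises
  regularity by one order, as \<open>weak_form_smooth\<close> requires for test functions that are
  only in H1.\<close>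

definition moving_avg :: "real => (real => 'v::euclidean_space) => real => 'v" where
 "moving_avg h f = dq h (SOME G. antider G f)"

lemma moving_avg_eq_dq:
 assumes "antider G f" "h > 0" shows "moving_avg h f = dq h G"
proof -
 have "antider (SOME G. antider G f) f" using assms(1) by (rule someI[where P = "%G. antider G f"])
 then have "dq h (SOME G. antider G f) x = dq h G x" for x
  using antiderD(2)[of _ f x "x + h"] assms by (simp add: dq_def)
 then show ?thesis by (simp add: moving_avg_def fun_eq_iff)
qed

lemma ex_antider: "sq_int f ==> \<exists>G. antider G f"
 using ex_antiderivative_sq[of f] unfolding antider_def by metis

lemma prim_moving_avg:
 assumes f: "sq_int f" and h: "h > 0"
 shows "prim (moving_avg h f) (dq h f)"
proof -
 obtain G where G: "antider G f" using ex_antider[OF f] by blast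
 have e: "moving_avg h f = dq h G" by (rule moving_avg_eq_dq[OF G h])
 have "sq_int (%x. dq h G x - f x)"
 proof (rule dq_minus_n2_le(1)[OF G h])
  show "n2 (%x. f (x + y) - f x) <= 4 * n2 f" for y
   using sq_int_diff(2)[OF sq_int_shift(1)[OF f] f, of y] sq_int_shift(2)[OF f, of y] by simp
 qed
 from sq_int_add(1)[OF this f] have "sq_int (dq h G)" by simp
 moreover have "antider (dq h G) (dq h f)"
  unfolding antider_def
 proof (intro conjI allI impI)
  show "sq_int (dq h f)" by (rule sq_int_dq[OF f])
  fix a b :: real assume ab: "a <= b"
  have i: "set_integrable lborel {a..b} (%x. f (x + h))" "set_integrable lborel {a..b} f"
   by (intro sq_int_local(1) sq_int_shift f)+
  have "(LINT x:{a..b}|lborel. dq h f x) = (1 / h) *\<^sub>R (LINT x:{a..b}|lborel. f (x + h) - f x)"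
   unfolding dq_def by (rule set_integral_scaleR_right)
  also have "(LINT x:{a..b}|lborel. f (x + h) - f x) = (LINT x:{a..b}|lborel. f (x + h)) - (LINT x:{a..b}|lborel. f x)"
   by (rule set_integral_diff(2)[OF i])
  also have "(LINT x:{a..b}|lborel. f (x + h)) = (LINT x:{a + h..b + h}|lborel. f x)"
   using set_integral_shift_Icc[of a b f h] by (simp add: add.commute)
  also have "... = G (b + h) - G (a + h)" using ab by (intro antiderD(2)[OF G, symmetric]) simp
  also have "(LINT x:{a..b}|lborel. f x) = G b - G a" using ab by (intro antiderD(2)[OF G, symmetric]) simp
  finally show "dq h G b - dq h G a = (LINT x:{a..b}|lborel. dq h f x)"
   by (simp add: dq_def scaleR_diff_right)
 qed
 ultimately show ?thesis by (simp add: prim_antider e)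
qed

lemma moving_avg_minus_n2_le:
 assumes f: "sq_int f" and h: "h > 0" and e: "!!y. 0 < y ==> y <= h ==> n2 (%x. f (x + y) - f x) <= e"
 shows "n2 (%x. moving_avg h f x - f x) <= e"
proof -
 obtain G where G: "antider G f" using ex_antider[OF f] by blast
 show ?thesis unfolding moving_avg_eq_dq[OF G h] by (rule dq_minus_n2_le(2)[OF G h e])
qed

lemma moving_avg_n2_le:
 assumes f: "sq_int f" and h: "h > 0" shows "n2 (moving_avg h f) <= 10 * n2 f"
proof -
 have "n2 (%x. moving_avg h f x - f x) <= 4 * n2 f"
 proof (rule moving_avg_minus_n2_le[OF f h])
  show "n2 (%x. f (x + y) - f x) <= 4 * n2 f" for y
   using sq_int_diff(2)[OF sq_int_shift(1)[OF f] f, of y] sq_int_shift(2)[OF f, of y] by simp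
 qed
 moreover have "n2 (moving_avg h f) <= 2 * n2 (%x. moving_avg h f x - f x) + 2 * n2 f"
  using sq_int_add(2)[OF sq_int_diff(1)[OF primD(1)[OF prim_moving_avg[OF f h]] f] f] by simp
 ultimately show ?thesis by simp
qed

lemma moving_avg_tendsto:
 assumes f: "sq_int f" shows "((%h. n2 (%x. moving_avg h f x - f x)) \<longlongrightarrow> 0) (at_right 0)"
proof -
 obtain G where G: "antider G f" using ex_antider[OF f] by blast
 have "eventually (%h. n2 (%x. dq h G x - f x) = n2 (%x. moving_avg h f x - f x)) (at_right 0)"
  using eventually_at_right_less[of 0] by eventually_elim (simp add: moving_avg_eq_dq[OF G])
 from Lim_transform_eventually[OF dq_tendsto[OF G] this] show ?thesis .
qed

lemma moving_avg_diff:
 assumes f: "sq_int f" and g: "sq_int g" and h: "h > 0"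
 shows "moving_avg h (%x. f x - g x) = (%x. moving_avg h f x - moving_avg h g x)"
proof -
 obtain A B where A: "antider A f" and B: "antider B g" using ex_antider[OF f] ex_antider[OF g] by blast
 have "antider (%x. A x - B x) (%x. f x - g x)"
  unfolding antider_def
 proof (intro conjI allI impI)
  show "sq_int (%x. f x - g x)" by (intro sq_int_diff f g)
  fix a b :: real assume "a <= b"
  then show "A b - B b - (A a - B a) = (LINT x:{a..b}|lborel. f x - g x)"
   using antiderD(2)[OF A, of a b] antiderD(2)[OF B, of a b] by (simp add: set_integral_diff sq_int_local(1) f g algebra_simps)
 qed
 from moving_avg_eq_dq[OF this h] show ?thesis unfolding moving_avg_eq_dq[OF A h] moving_avg_eq_dq[OF B h]
  by (simp add: dq_def fun_eq_iff scaleR_diff_right)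
qed

text \<open>The shift by h centres the second difference, which makes it the lattice Laplacian of
  the scheme.\<close>

definition second_dq :: "real => (real => 'v::euclidean_space) => real => 'v" where
 "second_dq h f x = dq h (dq h f) (x - h)"

lemma second_dq_eq: "h ~= 0 ==> h\<^sup>2 *\<^sub>R second_dq h f x = f (x + h) - f x - (f x - f (x - h))"
 by (simp add: second_dq_def dq_def power2_eq_square scaleR_diff_right)

lemma prim_dq:
 assumes p: "prim f g" shows "prim (dq h f) (dq h g)"
 unfolding prim_def
proof (intro conjI allI impI)
 show "sq_int (dq h f)" "sq_int (dq h g)" by (intro sq_int_dq primD[OF p])+
 fix a b :: real assume ab: "a <= b"
 note g = primD(2)[OF p]
 have i: "set_integrable lborel {a..b} (%x. g (x + h))" "set_integrable lborel {a..b} g"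
  by (intro sq_int_local(1) sq_int_shift g)+
 have "(LINT x:{a..b}|lborel. dq h g x) = (1 / h) *\<^sub>R (LINT x:{a..b}|lborel. g (x + h) - g x)"
  unfolding dq_def by (rule set_integral_scaleR_right)
 also have "(LINT x:{a..b}|lborel. g (x + h) - g x) = (LINT x:{a..b}|lborel. g (x + h)) - (LINT x:{a..b}|lborel. g x)"
  by (rule set_integral_diff(2)[OF i])
 also have "(LINT x:{a..b}|lborel. g (x + h)) = (LINT x:{a + h..b + h}|lborel. g x)"
  using set_integral_shift_Icc[of a b g h] by (simp add: add.commute)
 also have "... = f (b + h) - f (a + h)" using ab by (intro primD(3)[OF p, symmetric]) simp
 also have "(LINT x:{a..b}|lborel. g x) = f b - f a" using ab by (intro primD(3)[OF p, symmetric]) simp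
 finally show "dq h f b - dq h f a = (LINT x:{a..b}|lborel. dq h g x)"
  by (simp add: dq_def scaleR_diff_right)
qed

lemma prim_diff:
 assumes p: "prim f g" and q: "prim u v" shows "prim (%x. f x - u x) (%x. g x - v x)"
 unfolding prim_def
 using primD(3)[OF p] primD(3)[OF q]
 by (auto intro!: sq_int_diff primD[OF p] primD[OF q]
   simp: set_integral_diff sq_int_local(1) primD(2)[OF p] primD(2)[OF q] algebra_simps)

lemma sq_int_second_dq: "sq_int f ==> sq_int (second_dq h f)"
 unfolding second_dq_def using sq_int_shift(1)[of "dq h (dq h f)" "- h"] by (simp add: sq_int_dq)

text \<open>The function \<open>dq h f - g\<close> has the derivative \<open>dq h g - k\<close>, so
  \<open>n2_dq_le\<close> bounds its difference quotient by a quantity that tends to zero. The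
  centring costs one translation of k.\<close>

lemma second_dq_tendsto:
 assumes f: "prim f g" and g: "prim g k"
 shows "((%h. n2 (%x. second_dq h f x - k x)) \<longlongrightarrow> 0) (at_right 0)"
proof (rule tendsto_sandwich[where f = "%_. 0"])
 have k: "sq_int k" and gs: "sq_int g" and fs: "sq_int f" by (intro primD[OF g] primD[OF f])+
 let ?e = "%h. n2 (%x. dq h g x - k x)"
 show "eventually (%h. n2 (%x. second_dq h f x - k x) <= 44 * ?e h + 2 * n2 (%x. k (x + - h) - k x)) (at_right 0)"
  using eventually_at_right_less[of 0]
 proof eventually_elim
  case (elim h)
  have "dq h (%x. dq h f x - g x) = (%x. dq h (dq h f) x - dq h g x)"
   by (simp add: dq_def fun_eq_iff scaleR_diff_right)
  then have 1: "n2 (%x. dq h (dq h f) x - dq h g x) <= 10 * ?e h"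
   using n2_dq_le[OF prim_diff[OF prim_dq[OF f, of h] g] elim] by simp
  have 2: "n2 (%x. dq h (dq h f) x - k x) <= 22 * ?e h"
   using n2_triangle3[OF sq_int_dq[OF sq_int_dq[OF fs]] sq_int_dq[OF gs] k, of h h h] 1 by simp
  have 3: "n2 (%x. second_dq h f x - k (x - h)) = n2 (%x. dq h (dq h f) x - k x)"
   unfolding second_dq_def
   using sq_int_shift(2)[of "%x. dq h (dq h f) x - k x" "- h"] by (simp add: sq_int_diff sq_int_dq fs k)
  have "sq_int (%x. k (x - h))" using sq_int_shift(1)[OF k, of "- h"] by simp
  from n2_triangle3[OF sq_int_second_dq[OF fs] this k, of h]
  show ?case using 2 3 by simp
 qed
 have 1: "(?e \<longlongrightarrow> 0) (at_right 0)" by (intro dq_tendsto prim_imp_antider g)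
 have "filterlim uminus (at 0) (at_right (0::real))"
  by (intro filterlim_atI tendsto_eq_intros eventually_mono[OF eventually_at_right_less]) (auto intro: tendsto_ident_at)
 from filterlim_compose[OF translation_continuous[OF k] this]
 have 2: "((%h. n2 (%x. k (x + - h) - k x)) \<longlongrightarrow> 0) (at_right 0)" by simp
 show "((%h. 44 * ?e h + 2 * n2 (%x. k (x + - h) - k x)) \<longlongrightarrow> 0) (at_right 0)"
  by (rule tendsto_eq_intros 1 2 refl)+ simp
qed (auto simp: tendsto_const)

text \<open>Shift invariance of the integral makes the centred second difference symmetric, so it
  can be moved between test function and solution.\<close>

lemma inner_second_dq:
 fixes f u :: "real => 'v::euclidean_space"
 assumes f: "sq_int f" and u: "sq_int u" and h: "h ~= 0"
 shows "h\<^sup>2 * (LINT x|lborel. second_dq h f x \<bullet> u x) = (LINT x|lborel. f x \<bullet> (u (x + h) - u x - (u x - u (x - h))))"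
proof -
 have s: "sq_int (%x. f (x - h))" "sq_int (%x. u (x - h))"
  using sq_int_shift(1)[OF f, of "- h"] sq_int_shift(1)[OF u, of "- h"] by simp_all
 note s = s sq_int_shift(1)[OF f, of h] sq_int_shift(1)[OF u, of h]
 note ii = integrable_inner_sq(1)[OF f u] integrable_inner_sq(1)[OF s(3) u] integrable_inner_sq(1)[OF s(1) u]
  integrable_inner_sq(1)[OF f s(4)] integrable_inner_sq(1)[OF f s(2)]
 have 1: "(LINT x|lborel. f (x + h) \<bullet> u x) = (LINT x|lborel. f x \<bullet> u (x - h))"
  using lborel_integral_shift(1)[of "%x. f x \<bullet> u (x - h)" h] by simp
 have 2: "(LINT x|lborel. f x \<bullet> u (x + h)) = (LINT x|lborel. f (x - h) \<bullet> u x)"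
  using lborel_integral_shift(1)[of "%x. f (x - h) \<bullet> u x" h] by simp
 have "h\<^sup>2 * (LINT x|lborel. second_dq h f x \<bullet> u x) = (LINT x|lborel. (h\<^sup>2 *\<^sub>R second_dq h f x) \<bullet> u x)"
  by simp
 also have "... = (LINT x|lborel. f (x + h) \<bullet> u x) - 2 * (LINT x|lborel. f x \<bullet> u x) + (LINT x|lborel. f (x - h) \<bullet> u x)"
  unfolding second_dq_eq[OF h] inner_diff_left by (simp add: ii)
 also have "... = (LINT x|lborel. f x \<bullet> (u (x + h) - u x - (u x - u (x - h))))"
  unfolding inner_diff_right 1 2[symmetric] by (simp add: ii)
 finally show ?thesis .
qed

section \<open>Step functions on a grid\<close>

lemma half_open_closed_integral:
 fixes f :: "real => 'v::euclidean_space"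
 assumes "f \<in> borel_measurable borel"
 shows "(LINT x|lborel. indicator {a..<b} x *\<^sub>R f x) = (LINT x:{a..b}|lborel. f x)"
 unfolding set_lebesgue_integral_def
proof (rule integral_cong_AE)
 show "AE x in lborel. indicator {a..<b} x *\<^sub>R f x = indicator {a..b} x *\<^sub>R f x"
  using AE_lborel_singleton[of b] by eventually_elim (auto simp: indicator_def)
qed (use assms in measurable)

definition step_fun :: "real => (int => 'v::euclidean_space) => real => 'v" where
 "step_fun e u x = u \<lfloor>x / e\<rfloor>"

lemma step_fun_shift: "e > 0 ==> step_fun e u (x + e) = step_fun e (%j. u (j + 1)) x"
  "e > 0 ==> step_fun e u (x - e) = step_fun e (%j. u (j - 1)) x"
 by (simp_all add: step_fun_def add_divide_distrib diff_divide_distrib)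

lemma step_fun_measurable [measurable]: "step_fun e u \<in> borel_measurable borel"
 unfolding step_fun_def by measurable

lemma step_fun_support:
 fixes e :: real and u :: "int => 'v::euclidean_space"
 assumes e: "e > 0" and u: "fsupp u"
 obtains a b :: int where "a <= b" "!!j. j \<notin> {a..<b} ==> u j = 0"
  "!!x. step_fun e u x = indicator {of_int a * e..<of_int b * e} x *\<^sub>R u \<lfloor>x / e\<rfloor>"
proof -
 have fin: "finite {j. u j ~= 0}" using u by (simp add: fsupp_def)
 obtain a where a: "!!j. u j ~= 0 ==> \<bar>j\<bar> <= a" "a \<ge> 0"
 proof -
  have fi: "finite (insert 0 (abs ` {j. u j ~= 0}))" using fin by simp
  show thesis by (rule that[of "Max (insert 0 (abs ` {j. u j ~= 0}))"]) (auto intro!: Max_ge fi)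
 qed
 have s: "u j = 0" if "j \<notin> {-a..<a + 1}" for j using that a(1)[of j] by fastforce
 have range: "x \<in> {of_int (-a) * e..<of_int (a + 1) * e} \<longleftrightarrow> \<lfloor>x / e\<rfloor> \<in> {-a..<a + 1}" for x :: real
  unfolding atLeastLessThan_iff le_floor_iff floor_less_iff using e by (simp only: pos_le_divide_eq pos_divide_less_eq)
 show thesis
 proof (rule that[of "-a" "a + 1"])
  show "step_fun e u x = indicator {of_int (-a) * e..<of_int (a + 1) * e} x *\<^sub>R u \<lfloor>x / e\<rfloor>" for x
   unfolding step_fun_def indicator_def range using s[of "\<lfloor>x / e\<rfloor>"] by (simp del: atLeastLessThan_iff)
 qed (use s a in auto)
qed

lemma step_fun_integral:
 fixes g :: "int => real"
 assumes e: "e > 0" and g: "fsupp g"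
 shows "integrable lborel (step_fun e g)" "(LINT x|lborel. step_fun e g x) = e * zs g"
proof -
 obtain a b where ab: "a <= b" "!!j. j \<notin> {a..<b} ==> g j = 0"
  "!!x. step_fun e g x = indicator {of_int a * e..<of_int b * e} x *\<^sub>R g \<lfloor>x / e\<rfloor>"
  using step_fun_support[OF e g] by metis
 have sf: "step_fun e g = (%x. indicator {of_int a * e..<of_int b * e} x *\<^sub>R g \<lfloor>x / e\<rfloor>)" by (rule ext) (rule ab(3))
 have z: "zs g = (\<Sum>j\<in>{a..<b}. g j)" by (rule zs_eq_sum) (use ab in auto)
 show "integrable lborel (step_fun e g)" unfolding sf by (rule integral_step(2)[OF e])
 show "(LINT x|lborel. step_fun e g x) = e * zs g" unfolding sf z using integral_step(1)[OF e, of a b g] by simp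
qed

lemma step_fun_sq:
 fixes u :: "int => 'v::euclidean_space"
 assumes e: "e > 0" and u: "fsupp u"
 shows "sq_int (step_fun e u)" "n2 (step_fun e u) = e * nsq u"
proof -
 have e2: "(%x. (norm (step_fun e u x))\<^sup>2) = step_fun e (%j. (norm (u j))\<^sup>2)" by (simp add: step_fun_def fun_eq_iff)
 show "sq_int (step_fun e u)" unfolding sq_int_def e2 using step_fun_integral(1)[OF e fsupp_norm2[OF u]] by simp
 show "n2 (step_fun e u) = e * nsq u" unfolding n2_def e2 nsq_def using step_fun_integral(2)[OF e fsupp_norm2[OF u]] by simp
qed

definition cell_avg :: "real => (real => 'v::euclidean_space) => int => 'v" where
 "cell_avg e v j = (1 / e) *\<^sub>R (LINT x:{of_int j * e..of_int (j + 1) * e}|lborel. v x)"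

lemma inner_step_fun:
 fixes u :: "int => 'v::euclidean_space"
 assumes e: "e > 0" and u: "fsupp u" and v: "sq_int v"
 shows "(LINT x|lborel. v x \<bullet> step_fun e u x) = e * zs (%j. cell_avg e v j \<bullet> u j)"
proof -
 obtain a b where ab: "a <= b" "!!j. j \<notin> {a..<b} ==> u j = 0"
  "!!x. step_fun e u x = indicator {of_int a * e..<of_int b * e} x *\<^sub>R u \<lfloor>x / e\<rfloor>"
  using step_fun_support[OF e u] by metis
 let ?I = "%j x. indicator {of_int j * e..<of_int (j + 1) * e} x :: real"
 have vm: "v \<in> borel_measurable borel" using v by (simp add: sq_int_def)
 have cell: "x \<in> {of_int j * e..<of_int (j + 1) * e} \<longleftrightarrow> j = \<lfloor>x / e\<rfloor>" for x and j :: int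
  using e by (auto simp: floor_eq_iff pos_le_divide_eq pos_divide_less_eq eq_commute[of j])
 have eq: "v x \<bullet> step_fun e u x = (\<Sum>j\<in>{a..<b}. (?I j x *\<^sub>R v x) \<bullet> u j)" for x
 proof -
  have "(\<Sum>j\<in>{a..<b}. (?I j x *\<^sub>R v x) \<bullet> u j) = (\<Sum>j\<in>{a..<b}. if j = \<lfloor>x / e\<rfloor> then v x \<bullet> u j else 0)"
   unfolding indicator_def cell by (intro sum.cong refl) simp
  also have "... = v x \<bullet> step_fun e u x" using ab(2)[of "\<lfloor>x / e\<rfloor>"] by (simp add: sum.delta step_fun_def)
  finally show ?thesis ..
 qed
 have i: "integrable lborel (%x. ?I j x *\<^sub>R v x)" for j :: int
 proof (rule Bochner_Integration.integrable_bound)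
  show "integrable lborel (%x. indicator {of_int j * e..of_int (j + 1) * e} x *\<^sub>R v x)"
   using sq_int_local(1)[OF v] by (simp add: set_integrable_def)
 qed (use vm in \<open>auto simp: indicator_def\<close>)
 have "(LINT x|lborel. v x \<bullet> step_fun e u x) = (\<Sum>j\<in>{a..<b}. LINT x|lborel. (?I j x *\<^sub>R v x) \<bullet> u j)"
  unfolding eq by (rule Bochner_Integration.integral_sum) (intro integrable_inner_left i)
 also have "... = (\<Sum>j\<in>{a..<b}. e * (cell_avg e v j \<bullet> u j))"
 proof (intro sum.cong refl)
  fix j
  have "(LINT x|lborel. (?I j x *\<^sub>R v x) \<bullet> u j) = (LINT x|lborel. ?I j x *\<^sub>R v x) \<bullet> u j" by (rule integral_inner_left[OF i])
  then show "(LINT x|lborel. (?I j x *\<^sub>R v x) \<bullet> u j) = e * (cell_avg e v j \<bullet> u j)"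
   unfolding half_open_closed_integral[OF vm] cell_avg_def using e by simp
 qed
 also have "... = e * zs (%j. cell_avg e v j \<bullet> u j)"
  by (subst zs_eq_sum[of "{a..<b}"]) (use ab in \<open>auto simp: sum_distrib_left\<close>)
 finally show ?thesis .
qed

text \<open>Neighbouring averages differ by the integral of \<open>dq e v\<close> over one cell, and
  Cauchy-Schwarz on the disjoint cells brings out the factor e. This is the bound S that
  \<open>evol_weak_le\<close> asks for.\<close>

lemma cell_avg_gradient_le:
 assumes e: "e > 0" and p: "prim v g" and A: "finite A"
 shows "(\<Sum>j\<in>A. (norm (cell_avg e v (j + 1) - cell_avg e v j))\<^sup>2) <= 10 * (e * n2 g)"
proof -
 note v = primD(1)[OF p]
 let ?d = "dq e v"
 let ?C = "%j. {of_int j * e..of_int (j + 1) * e}"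
 have ds: "sq_int ?d" by (rule sq_int_dq[OF v])
 have 1: "cell_avg e v (j + 1) - cell_avg e v j = (LINT x:?C j|lborel. ?d x)" for j
 proof -
  have "(LINT x:?C (j + 1)|lborel. v x) = (LINT x:?C j|lborel. v (x + e))"
   using set_integral_shift_Icc[of "of_int j * e" "of_int (j + 1) * e" v e] by (simp add: algebra_simps)
  moreover have "(LINT x:?C j|lborel. ?d x) = (1 / e) *\<^sub>R (LINT x:?C j|lborel. v (x + e) - v x)"
   unfolding dq_def by (rule set_integral_scaleR_right)
  moreover have "(LINT x:?C j|lborel. v (x + e) - v x) = (LINT x:?C j|lborel. v (x + e)) - (LINT x:?C j|lborel. v x)"
   by (intro set_integral_diff(2) sq_int_local(1) sq_int_shift v)
  ultimately show ?thesis by (simp add: cell_avg_def scaleR_diff_right)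
 qed
 have N: "set_integrable lborel B (%x. (norm (?d x))\<^sup>2)" if "B \<in> sets borel" for B
  by (rule set_norm2_integrable[OF ds that])
 have m: "(%x. (norm (?d x))\<^sup>2) \<in> borel_measurable borel" using borel_measurable_integrable[OF sq_int_integrable[OF ds]] by simp
 let ?I = "%j x. indicator {of_int j * e..<of_int (j + 1) * e} x :: real"
 have cell: "x \<in> {of_int j * e..<of_int (j + 1) * e} \<longleftrightarrow> j = \<lfloor>x / e\<rfloor>" for x and j :: int
  using e by (auto simp: floor_eq_iff pos_le_divide_eq pos_divide_less_eq eq_commute[of j])
 have 2: "(norm (LINT x:?C j|lborel. ?d x))\<^sup>2 <= e * (LINT x|lborel. ?I j x *\<^sub>R (norm (?d x))\<^sup>2)" for j
  using sq_int_local(2)[OF ds, of "of_int j * e" "of_int (j + 1) * e"] e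
  unfolding half_open_closed_integral[OF m] by (simp add: distrib_right)
 have iI: "integrable lborel (%x. ?I j x *\<^sub>R (norm (?d x))\<^sup>2)" for j
  using N[of "{of_int j * e..<of_int (j + 1) * e}"] by (simp add: set_integrable_def)
 have "(\<Sum>j\<in>A. (norm (cell_avg e v (j + 1) - cell_avg e v j))\<^sup>2) <= (\<Sum>j\<in>A. e * (LINT x|lborel. ?I j x *\<^sub>R (norm (?d x))\<^sup>2))"
  unfolding 1 by (intro sum_mono 2)
 also have "... = e * (LINT x|lborel. (\<Sum>j\<in>A. ?I j x *\<^sub>R (norm (?d x))\<^sup>2))"
  by (subst Bochner_Integration.integral_sum[OF iI]) (simp only: sum_distrib_left)
 also have "... <= e * n2 ?d"
  unfolding n2_def
 proof (intro mult_left_mono integral_mono Bochner_Integration.integrable_sum iI sq_int_integrable ds)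
  fix x
  have "(\<Sum>j\<in>A. ?I j x *\<^sub>R (norm (?d x))\<^sup>2) = (\<Sum>j\<in>A. if j = \<lfloor>x / e\<rfloor> then (norm (?d x))\<^sup>2 else 0)"
   unfolding indicator_def cell by (intro sum.cong refl) simp
  then show "(\<Sum>j\<in>A. ?I j x *\<^sub>R (norm (?d x))\<^sup>2) <= (norm (?d x))\<^sup>2" using A by (simp add: sum.delta)
 qed (use e in simp)
 also have "... <= e * (10 * n2 g)" using e n2_dq_le[OF p e] by (intro mult_left_mono) auto
 finally show ?thesis by simp
qed

lemma nn_integral_n2: "sq_int f ==> (\<integral>\<^sup>+x. ennreal ((norm (f x))\<^sup>2) \<partial>lborel) = ennreal (n2 f)"
 unfolding n2_def by (rule nn_integral_eq_integral[OF sq_int_integrable]) simp_all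

section \<open>The heat kernel\<close>

text \<open>Splitting [a, b] into n equal parts bounds the increment by a multiple of n (1/n)^(3/2).
  This avoids differentiating in time a pairing in which test function and solution both
  move.\<close>

lemma constant_of_superlinear:
 fixes u :: "real => real"
 assumes ab: "a <= b" and u: "!!s t. a <= s ==> s < t ==> t <= b ==> \<bar>u t - u s\<bar> <= C * ((t - s) * sqrt (t - s))"
 shows "u b = u a"
proof (cases "a < b")
 case True
 let ?h = "%n::nat. (b - a) / real (Suc n)"
 have "\<bar>u b - u a\<bar> <= C * (b - a) * sqrt (?h n)" for n
 proof -
  define d where "d = ?h n"
  have d: "0 < d" "real (Suc n) * d = b - a" using True by (simp_all add: d_def)
  have "\<bar>u (a + real (Suc i) * d) - u (a + real i * d)\<bar> <= C * (d * sqrt d)" if "i < Suc n" for i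
  proof -
   have "real (Suc i) * d <= real (Suc n) * d" using that d by (intro mult_right_mono) auto
   then have "a + real (Suc i) * d <= b" unfolding d(2) by linarith
   moreover have "a + real (Suc i) * d - (a + real i * d) = d" by (simp add: distrib_right)
   ultimately show ?thesis
    using u[of "a + real i * d" "a + real (Suc i) * d"] d by simp
  qed
  then have "(\<Sum>i<Suc n. \<bar>u (a + real (Suc i) * d) - u (a + real i * d)\<bar>) <= (\<Sum>i<Suc n. C * (d * sqrt d))"
   by (intro sum_mono) auto
  moreover have "\<bar>\<Sum>i<Suc n. u (a + real (Suc i) * d) - u (a + real i * d)\<bar> <= (\<Sum>i<Suc n. \<bar>u (a + real (Suc i) * d) - u (a + real i * d)\<bar>)"
   by (rule sum_abs)
  moreover have "(\<Sum>i<Suc n. u (a + real (Suc i) * d) - u (a + real i * d)) = u (a + real (Suc n) * d) - u (a + real 0 * d)"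
   by (rule sum_lessThan_telescope[of "%i. u (a + real i * d)"])
  moreover have "(\<Sum>i<Suc n. C * (d * sqrt d)) = C * (real (Suc n) * d) * sqrt d" by simp
  ultimately have "\<bar>u (a + (b - a)) - u (a + real 0 * d)\<bar> <= C * (b - a) * sqrt d" unfolding d(2) by linarith
  then show ?thesis by (simp add: d_def)
 qed
 then have le: "\<forall>n. \<bar>u b - u a\<bar> <= C * (b - a) * sqrt (?h n)" by blast
 have "(%n. C * (b - a) * sqrt (?h n)) \<longlonglongrightarrow> C * (b - a) * sqrt 0"
 proof (intro tendsto_intros)
  show "(%n. ?h n) \<longlonglongrightarrow> 0" using tendsto_mult_right_zero[OF LIMSEQ_inverse_real_of_nat, of "b - a"] by (simp add: field_simps)
 qed
 then have "(%n. C * (b - a) * sqrt (?h n)) \<longlonglongrightarrow> 0" by simp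
 then have "\<bar>u b - u a\<bar> <= 0" by (rule LIMSEQ_le_const) (use le in auto)
 then show ?thesis by simp
qed (use ab in simp)

lemma heat_kernel_exp:
 assumes "t > 0" shows "heat_kernel t x = exp (- x\<^sup>2 / (2 * t) - ln (2 * pi * t) / 2)"
proof -
 have "ln (2 * pi * t) / 2 = ln (sqrt (2 * pi * t))" using assms by (subst ln_sqrt) auto
 then show ?thesis using assms by (simp add: heat_kernel_def exp_diff)
qed

lemma heat_kernel_pos: "t > 0 ==> 0 < heat_kernel t x"
 by (simp add: heat_kernel_exp)

lemma heat_kernel_even: "heat_kernel t (x - y) = heat_kernel t (y - x)"
 by (simp add: heat_kernel_def power2_commute)

lemma heat_kernel_continuous: "continuous_on UNIV (heat_kernel t)"
 unfolding heat_kernel_def divide_inverse by (intro continuous_intros)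

lemma heat_kernel_measurable [measurable]: "heat_kernel t \<in> borel_measurable borel"
 by (rule borel_measurable_continuous_onI[OF heat_kernel_continuous])

definition heat_x :: "real => real => real" where "heat_x t x = - (x / t) * heat_kernel t x"
definition heat_xx :: "real => real => real" where "heat_xx t x = (x\<^sup>2 / t\<^sup>2 - 1 / t) * heat_kernel t x"
text \<open>The second time derivative. By the heat equation it is a quarter of the fourth space
  derivative, whence the Hermite polynomial of degree four.\<close>

definition heat_tt :: "real => real => real" where
 "heat_tt t x = (1 / 4) * (x ^ 4 / t ^ 4 - 6 * x\<^sup>2 / t ^ 3 + 3 / t\<^sup>2) * heat_kernel t x"

lemma heat_kernel_DERIV_x:
 assumes t: "t > 0"
 shows "(heat_kernel t has_real_derivative heat_x t x) (at x)" "(heat_x t has_real_derivative heat_xx t x) (at x)"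
proof -
 have "((%x. exp (- x\<^sup>2 / (2 * t) - ln (2 * pi * t) / 2)) has_real_derivative exp (- x\<^sup>2 / (2 * t) - ln (2 * pi * t) / 2) * (- (x / t))) (at x)" for x
  using t by (auto intro!: derivative_eq_intros)
 note D = this
 have hk: "heat_kernel t = (%x. exp (- x\<^sup>2 / (2 * t) - ln (2 * pi * t) / 2))" by (rule ext) (rule heat_kernel_exp[OF t])
 have 1: "(heat_kernel t has_real_derivative heat_x t x) (at x)" for x
  using D[of x] unfolding heat_x_def hk by (simp only: mult.commute)
 then show "(heat_kernel t has_real_derivative heat_x t x) (at x)" .
 show "(heat_x t has_real_derivative heat_xx t x) (at x)"
  unfolding heat_x_def using t
  by (auto intro!: derivative_eq_intros 1 simp: heat_x_def heat_xx_def field_simps power2_eq_square)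
qed

lemma heat_kernel_DERIV_t:
 assumes t: "t > 0"
 shows "((%t. heat_kernel t x) has_real_derivative heat_xx t x / 2) (at t)"
  "((%t. heat_xx t x / 2) has_real_derivative heat_tt t x) (at t)"
proof -
 have 1: "((%t. heat_kernel t x) has_real_derivative (x\<^sup>2 / (2 * t\<^sup>2) - 1 / (2 * t)) * heat_kernel t x) (at t)"
 proof (rule has_field_derivative_transform_within_open[of "%t. exp (- x\<^sup>2 / (2 * t) - ln (2 * pi * t) / 2)" _ _ "{0<..}"])
  show "((%t. exp (- x\<^sup>2 / (2 * t) - ln (2 * pi * t) / 2)) has_real_derivative (x\<^sup>2 / (2 * t\<^sup>2) - 1 / (2 * t)) * heat_kernel t x) (at t)"
   unfolding heat_kernel_exp[OF t] using t
   by (auto intro!: derivative_eq_intros simp: field_simps power2_eq_square)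
 qed (use t in \<open>auto simp: heat_kernel_exp\<close>)
 have e: "heat_xx t x / 2 = (x\<^sup>2 / (2 * t\<^sup>2) - 1 / (2 * t)) * heat_kernel t x" for t
  by (cases "t = 0") (auto simp: heat_xx_def field_simps)
 show "((%t. heat_kernel t x) has_real_derivative heat_xx t x / 2) (at t)" unfolding e by (rule 1)
 have 2: "((%t. x\<^sup>2 / (2 * t\<^sup>2) - 1 / (2 * t)) has_real_derivative - (x\<^sup>2 / t ^ 3) + 1 / (2 * t\<^sup>2)) (at t)"
  using t by (auto intro!: derivative_eq_intros simp: field_simps power2_eq_square power3_eq_cube)
 have "(- (x\<^sup>2 / t ^ 3) + 1 / (2 * t\<^sup>2)) * h + ((x\<^sup>2 / (2 * t\<^sup>2) - 1 / (2 * t)) * h) * (x\<^sup>2 / (2 * t\<^sup>2) - 1 / (2 * t))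
  = (1 / 4) * (x ^ 4 / t ^ 4 - 6 * x\<^sup>2 / t ^ 3 + 3 / t\<^sup>2) * h" for h
  using t by (simp add: field_simps power2_eq_square power3_eq_cube power4_eq_xxxx)
 from DERIV_mult[OF 2 1, unfolded this]
 show "((%t. heat_xx t x / 2) has_real_derivative heat_tt t x) (at t)" unfolding e heat_tt_def .
qed

text \<open>With y = x^2 / (2 t) the core is (1 + 2 y)^2 <= 8 (1 + y + y^2 / 2) <= 8 exp y.\<close>

lemma heat_kernel_decay:
 assumes t: "t > 0"
 shows "(1 + x\<^sup>2 / t)\<^sup>2 * heat_kernel t x <= 8 / sqrt t"
proof -
 let ?y = "x\<^sup>2 / (2 * t)"
 have y: "0 <= ?y" using t by simp
 have "(1 + x\<^sup>2 / t)\<^sup>2 = (1 + 2 * ?y)\<^sup>2" by simp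
 also have "... <= 8 * (1 + ?y + ?y\<^sup>2 / 2)" using y by (simp only: power2_sum power_mult_distrib) simp
 also have "... <= 8 * exp ?y" using exp_lower_Taylor_quadratic[OF y] by simp
 finally have "(1 + x\<^sup>2 / t)\<^sup>2 * exp (- ?y) <= 8 * exp ?y * exp (- ?y)" by (intro mult_right_mono) auto
 then have 1: "(1 + x\<^sup>2 / t)\<^sup>2 * exp (- ?y) <= 8" by (simp add: mult.assoc flip: exp_add)
 have "sqrt t <= sqrt (2 * pi * t)" using t pi_gt3 by (intro real_sqrt_le_mono) simp
 then have "1 / sqrt (2 * pi * t) <= 1 / sqrt t" using t by (intro divide_left_mono) auto
 from mult_mono[OF 1 this] show ?thesis using t by (simp add: heat_kernel_def mult_ac)
qed

text \<open>The weight 1 / (1 + x^2 / t) is square integrable, as needed for kernels and derivatives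
  that act as test functions. The second time derivative is only paired with a density of mass at
  most one, so a uniform bound suffices for it.\<close>

lemma heat_kernel_bounds:
 assumes t: "t > 0"
 shows "\<bar>heat_kernel t x\<bar> <= (8 / sqrt t) / (1 + x\<^sup>2 / t)" "\<bar>heat_x t x\<bar> <= (8 / t) / (1 + x\<^sup>2 / t)"
  "\<bar>heat_xx t x\<bar> <= (8 / (t * sqrt t)) / (1 + x\<^sup>2 / t)" "\<bar>heat_tt t x\<bar> <= 6 / (t\<^sup>2 * sqrt t)"
proof -
 let ?D = "1 + x\<^sup>2 / t" and ?h = "heat_kernel t x"
 have D: "1 <= ?D" using t by simp
 have h: "0 < ?h" by (rule heat_kernel_pos[OF t])
 have hD2: "?D\<^sup>2 * ?h <= 8 / sqrt t" by (rule heat_kernel_decay[OF t])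
 then have "(?D * ?h) * ?D <= 8 / sqrt t" by (simp only: power2_eq_square mult_ac)
 then have hD: "?D * ?h <= (8 / sqrt t) / ?D" by (rule mult_imp_le_div_pos[rotated]) (use D in linarith)
 have "1 * ?h <= ?D * ?h" using D h by (intro mult_right_mono) auto
 from order_trans[OF this hD] show "\<bar>?h\<bar> <= (8 / sqrt t) / ?D" using h by simp
 have z: "\<bar>x / t\<bar> <= ?D * (1 / sqrt t)"
 proof -
  have "\<bar>z\<bar> <= 1 + z\<^sup>2" for z :: real using sum_squares_bound[of "\<bar>z\<bar>" 1] abs_ge_zero[of z] by (simp del: abs_ge_zero)
  from this[of "x / sqrt t"] have "\<bar>x / sqrt t\<bar> <= 1 + (x / sqrt t)\<^sup>2" .
  then have "\<bar>x / sqrt t\<bar> * (1 / sqrt t) <= (1 + (x / sqrt t)\<^sup>2) * (1 / sqrt t)" using t by (intro mult_right_mono) auto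
  moreover have "\<bar>x / sqrt t\<bar> * (1 / sqrt t) = \<bar>x / t\<bar>" using t by (simp add: abs_divide)
  moreover have "1 + (x / sqrt t)\<^sup>2 = ?D" using t by (simp add: power_divide)
  ultimately show ?thesis by (simp only:)
 qed
 have "\<bar>heat_x t x\<bar> = \<bar>x / t\<bar> * ?h" using h by (simp add: heat_x_def abs_mult)
 also have "... <= (?D * (1 / sqrt t)) * ?h" using h by (intro mult_right_mono z) auto
 also have "... = (1 / sqrt t) * (?D * ?h)" by simp
 also have "... <= (1 / sqrt t) * ((8 / sqrt t) / ?D)" using t by (intro mult_left_mono hD) auto
 also have "... = (8 / (sqrt t * sqrt t)) / ?D" by (simp add: mult.assoc)
 also have "sqrt t * sqrt t = t" using t by simp
 finally show "\<bar>heat_x t x\<bar> <= (8 / t) / ?D" .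
 have "x\<^sup>2 / t\<^sup>2 - 1 / t = (1 / t) * (x\<^sup>2 / t - 1)" using t by (simp add: field_simps power2_eq_square)
 then have "\<bar>x\<^sup>2 / t\<^sup>2 - 1 / t\<bar> = \<bar>1 / t\<bar> * \<bar>x\<^sup>2 / t - 1\<bar>" by (simp only: abs_mult)
 also have "\<bar>1 / t\<bar> = 1 / t" using t by simp
 also have "(1 / t) * \<bar>x\<^sup>2 / t - 1\<bar> <= (1 / t) * ?D"
 proof (rule mult_left_mono)
  show "\<bar>x\<^sup>2 / t - 1\<bar> <= ?D" unfolding abs_le_iff using D by linarith
 qed (use t in simp)
 finally have q: "\<bar>x\<^sup>2 / t\<^sup>2 - 1 / t\<bar> <= (1 / t) * ?D" .
 have "\<bar>heat_xx t x\<bar> = \<bar>x\<^sup>2 / t\<^sup>2 - 1 / t\<bar> * ?h" unfolding heat_xx_def abs_mult using h by simp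
 also have "... <= ((1 / t) * ?D) * ?h" by (rule mult_right_mono[OF q less_imp_le[OF h]])
 also have "... = (1 / t) * (?D * ?h)" by simp
 also have "... <= (1 / t) * ((8 / sqrt t) / ?D)" using t by (intro mult_left_mono hD) auto
 finally show "\<bar>heat_xx t x\<bar> <= (8 / (t * sqrt t)) / ?D" by (simp add: mult_ac)
 define w where "w = x\<^sup>2 / t"
 have w: "0 <= w" using t by (simp add: w_def)
 have e: "x ^ 4 / t ^ 4 - 6 * x\<^sup>2 / t ^ 3 + 3 / t\<^sup>2 = (1 / t\<^sup>2) * (w\<^sup>2 - 6 * w + 3)"
  unfolding w_def using t by (simp add: field_simps power2_eq_square power3_eq_cube power4_eq_xxxx)
 have "(1 + w)\<^sup>2 = 1 + 2 * w + w\<^sup>2" by (simp add: power2_sum)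
 then have "\<bar>w\<^sup>2 - 6 * w + 3\<bar> <= 3 * (1 + w)\<^sup>2" unfolding abs_le_iff using w zero_le_power2[of w] by linarith
 then have m1: "(1 / t\<^sup>2) * \<bar>w\<^sup>2 - 6 * w + 3\<bar> * ?h <= (1 / t\<^sup>2) * (3 * (1 + w)\<^sup>2) * ?h"
  using h by (intro mult_right_mono mult_left_mono) auto
 have eq: "\<bar>heat_tt t x\<bar> = (1/4) * ((1 / t\<^sup>2) * \<bar>w\<^sup>2 - 6 * w + 3\<bar> * ?h)"
  unfolding heat_tt_def e abs_mult using h by simp
 have "\<bar>heat_tt t x\<bar> <= (1/4) * ((1 / t\<^sup>2) * (3 * (1 + w)\<^sup>2) * ?h)"
  unfolding eq by (rule mult_left_mono[OF m1]) simp
 also have "... = (3 / (4 * t\<^sup>2)) * (?D\<^sup>2 * ?h)" by (simp add: w_def)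
 also have "... <= (3 / (4 * t\<^sup>2)) * (8 / sqrt t)" using t by (intro mult_left_mono hD2) auto
 finally show "\<bar>heat_tt t x\<bar> <= 6 / (t\<^sup>2 * sqrt t)" by simp
qed

text \<open>Taylor expansion in time, with the first time derivative replaced by half the second
  space derivative through the heat equation.\<close>

lemma heat_kernel_time_expansion:
 assumes a: "0 < a" "a <= b"
 shows "\<bar>heat_kernel b x - heat_kernel a x\<bar> <= 4 / (a * sqrt a) * (b - a)"
  "\<bar>heat_kernel b x - heat_kernel a x - (b - a) * (heat_xx a x / 2)\<bar> <= 3 / (a\<^sup>2 * sqrt a) * (b - a)\<^sup>2"
proof -
 define diff where "diff = (%(m::nat) t. if m = 0 then heat_kernel t x else if m = 1 then heat_xx t x / 2 else heat_tt t x)"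
 have D: "DERIV (diff m) t :> diff (Suc m) t" if "m < 2" "a <= t" for m t
  using that a heat_kernel_DERIV_t[of t x] by (cases "m = 0") (auto simp: diff_def less_2_cases_iff)
 have "\<bar>heat_kernel b x - heat_kernel a x\<bar> <= 4 / (a * sqrt a) * (b - a)
  & \<bar>heat_kernel b x - heat_kernel a x - (b - a) * (heat_xx a x / 2)\<bar> <= 3 / (a\<^sup>2 * sqrt a) * (b - a)\<^sup>2"
 proof (cases "a = b")
  case False
  then have ab: "a < b" using a by simp
  note TT = Taylor[where diff = diff and f = "%t. heat_kernel t x" and a = a and b = b and c = a and x = b]
  have d0: "diff 0 = (%t. heat_kernel t x)" by (simp add: diff_def fun_eq_iff)
  have DD: "\<forall>m t. m < n & a <= t & t <= b --> DERIV (diff m) t :> diff (Suc m) t" if "n <= 2" for n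
   using that by (auto intro: D)
  have "\<exists>t. (if b < a then b < t & t < a else a < t & t < b) &
   heat_kernel b x = (\<Sum>m<1. (diff m a / fact m) * (b - a)^m) + (diff 1 t / fact 1) * (b - a)^1"
   by (rule TT[OF _ d0 DD]) (use ab in auto)
  then obtain t where t: "a < t" "t < b" "heat_kernel b x = heat_kernel a x + heat_xx t x / 2 * (b - a)"
   using ab by (auto simp: diff_def)
  have "\<exists>t. (if b < a then b < t & t < a else a < t & t < b) &
   heat_kernel b x = (\<Sum>m<2. (diff m a / fact m) * (b - a)^m) + (diff 2 t / fact 2) * (b - a)^2"
   by (rule TT[OF _ d0 DD]) (use ab in auto)
  then obtain q where q: "a < q" "q < b" "heat_kernel b x = heat_kernel a x + heat_xx a x / 2 * (b - a) + heat_tt q x / 2 * (b - a)\<^sup>2"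
   using ab by (auto simp: diff_def numeral_2_eq_2)
  have "\<bar>heat_xx t x\<bar> <= (8 / (t * sqrt t)) / (1 + x\<^sup>2 / t)" using a t by (intro heat_kernel_bounds) auto
  also have "... <= (8 / (t * sqrt t)) / 1" using a t by (intro divide_left_mono) (auto intro!: add_pos_nonneg)
  also have "8 / (t * sqrt t) <= 8 / (a * sqrt a)" using a t by (intro divide_left_mono mult_mono mult_pos_pos) auto
  finally have "\<bar>heat_xx t x / 2\<bar> <= 4 / (a * sqrt a)" by simp
  from mult_right_mono[OF this, of "b - a"]
  have 1: "\<bar>heat_kernel b x - heat_kernel a x\<bar> <= 4 / (a * sqrt a) * (b - a)" using t ab by (simp add: abs_mult)
  have "\<bar>heat_tt q x\<bar> <= 6 / (q\<^sup>2 * sqrt q)" using a q by (intro heat_kernel_bounds) auto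
  also have "... <= 6 / (a\<^sup>2 * sqrt a)" using a q by (intro divide_left_mono mult_mono power_mono mult_pos_pos) auto
  finally have "\<bar>heat_tt q x / 2\<bar> <= 3 / (a\<^sup>2 * sqrt a)" by simp
  from mult_right_mono[OF this, of "(b - a)\<^sup>2"]
  have 2: "\<bar>heat_kernel b x - heat_kernel a x - (b - a) * (heat_xx a x / 2)\<bar> <= 3 / (a\<^sup>2 * sqrt a) * (b - a)\<^sup>2"
   using q by (simp add: abs_mult mult.commute)
  from 1 2 show ?thesis ..
 qed simp
 then show "\<bar>heat_kernel b x - heat_kernel a x\<bar> <= 4 / (a * sqrt a) * (b - a)"
  "\<bar>heat_kernel b x - heat_kernel a x - (b - a) * (heat_xx a x / 2)\<bar> <= 3 / (a\<^sup>2 * sqrt a) * (b - a)\<^sup>2" by auto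
qed

lemma cauchy_density_integrable: "integrable lborel (%x::real. 1 / (1 + x\<^sup>2))"
 using integrable_inverse_1_plus_square by (simp add: set_integrable_def inverse_eq_divide)

lemma sq_int_of_decay:
 fixes f :: "real => real" and e :: "'v::euclidean_space"
 assumes t: "t > 0" and f: "f \<in> borel_measurable borel" and le: "!!x. \<bar>f x\<bar> <= C / (1 + x\<^sup>2 / t)"
 shows "sq_int (%x. f (x - y) *\<^sub>R e)"
  "n2 (%x. f (x - y) *\<^sub>R e) <= (norm e)\<^sup>2 * C\<^sup>2 * max 1 t * (LINT x|lborel. 1 / (1 + (x::real)\<^sup>2))"
proof -
 let ?A = "(norm e)\<^sup>2 * C\<^sup>2 * max 1 t"
 have pt: "(norm (f x *\<^sub>R e))\<^sup>2 <= ?A * (1 / (1 + x\<^sup>2))" for x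
 proof -
  let ?D = "1 + x\<^sup>2 / t"
  have D: "1 <= ?D" using t by simp
  have "1 * (1 + x\<^sup>2) = 1 + t * (x\<^sup>2 / t)" using t by simp
  also have "... <= max 1 t + max 1 t * (x\<^sup>2 / t)" using t by (intro add_mono mult_right_mono) auto
  finally have "1 / ?D <= max 1 t / (1 + x\<^sup>2)" using D by (simp add: field_simps add_pos_nonneg)
  moreover have "(1 / ?D)\<^sup>2 <= 1 / ?D" using D mult_left_mono[of "1 / ?D" 1 "1 / ?D"] by (simp only: power2_eq_square mult_1_right) simp
  ultimately have "(1 / ?D)\<^sup>2 <= max 1 t / (1 + x\<^sup>2)" by linarith
  then have "(norm e)\<^sup>2 * C\<^sup>2 * (1 / ?D)\<^sup>2 <= (norm e)\<^sup>2 * C\<^sup>2 * (max 1 t / (1 + x\<^sup>2))" by (intro mult_left_mono) auto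
  moreover have "\<bar>f x\<bar>\<^sup>2 <= (C / ?D)\<^sup>2" by (intro power_mono le) simp
  then have "(norm e)\<^sup>2 * (f x)\<^sup>2 <= (norm e)\<^sup>2 * (C / ?D)\<^sup>2" by (intro mult_left_mono) auto
  ultimately show ?thesis by (simp add: power_mult_distrib power_divide mult_ac)
 qed
 have 1: "sq_int (%x. f x *\<^sub>R e)" and 2: "n2 (%x. f x *\<^sub>R e) <= (LINT x|lborel. ?A * (1 / (1 + (x::real)\<^sup>2)))"
 proof -
  have fm: "(%x. f x *\<^sub>R e) \<in> borel_measurable borel" using f by measurable
  have i: "integrable lborel (%x::real. ?A * (1 / (1 + x\<^sup>2)))" by (intro integrable_mult_right cauchy_density_integrable)
  have ae: "AE x in lborel. (norm (f x *\<^sub>R e))\<^sup>2 <= ?A * (1 / (1 + x\<^sup>2))" by (intro AE_I2 pt)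
  show "sq_int (%x. f x *\<^sub>R e)" "n2 (%x. f x *\<^sub>R e) <= (LINT x|lborel. ?A * (1 / (1 + (x::real)\<^sup>2)))"
   using sq_int_bound[OF fm i ae] by auto
 qed
 show "sq_int (%x. f (x - y) *\<^sub>R e)" using sq_int_shift(1)[OF 1, of "- y"] by simp
 show "n2 (%x. f (x - y) *\<^sub>R e) <= ?A * (LINT x|lborel. 1 / (1 + (x::real)\<^sup>2))"
  using sq_int_shift(2)[OF 1, of "- y"] 2 by (simp only: integral_mult_right_zero) simp
qed

lemma prim_of_decay:
 fixes f g :: "real => real" and e :: "'v::euclidean_space"
 assumes t: "t > 0" and d: "!!x. (f has_real_derivative g x) (at x)" and c: "continuous_on UNIV g"
  and le: "!!x. \<bar>f x\<bar> <= C / (1 + x\<^sup>2 / t)" "!!x. \<bar>g x\<bar> <= C' / (1 + x\<^sup>2 / t)"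
 shows "prim (%x. f (x - y) *\<^sub>R e) (%x. g (x - y) *\<^sub>R e)"
 unfolding prim_def
proof (intro conjI allI impI)
 have fc: "continuous_on UNIV f" using d by (meson DERIV_continuous_on has_field_derivative_at_within)
 show "sq_int (%x. f (x - y) *\<^sub>R e)" by (rule sq_int_of_decay(1)[OF t borel_measurable_continuous_onI[OF fc] le(1)])
 show "sq_int (%x. g (x - y) *\<^sub>R e)" by (rule sq_int_of_decay(1)[OF t borel_measurable_continuous_onI[OF c] le(2)])
 fix a b :: real assume ab: "a <= b"
 have "integral\<^sup>L lborel (%x. indicator {a..b} x *\<^sub>R (g (x - y) *\<^sub>R e)) = f (b - y) *\<^sub>R e - f (a - y) *\<^sub>R e"
 proof (rule integral_FTC_atLeastAtMost[OF ab])
  fix x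
  have "((%x. f (x - y)) has_real_derivative g (x - y)) (at x)"
   using DERIV_shift[of f "g (x - y)" x "- y"] d[of "x - y"] by simp
  then have "((%x. f (x - y)) has_real_derivative g (x - y)) (at x within {a..b})"
   by (rule has_field_derivative_at_within)
  then show "((%x. f (x - y) *\<^sub>R e) has_vector_derivative g (x - y) *\<^sub>R e) (at x within {a..b})"
   by (auto intro!: derivative_eq_intros)
  show "continuous_on {a..b} (%x. g (x - y) *\<^sub>R e)"
   by (intro continuous_intros continuous_on_compose2[OF c]) auto
 qed
 then show "f (b - y) *\<^sub>R e - f (a - y) *\<^sub>R e = (LINT x:{a..b}|lborel. g (x - y) *\<^sub>R e)" by (simp add: set_lebesgue_integral_def)
qed

lemma prim_heat_kernel:
 fixes e :: "'v::euclidean_space"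
 assumes t: "t > 0"
 shows "prim (%x. heat_kernel t (x - y) *\<^sub>R e) (%x. heat_x t (x - y) *\<^sub>R e)"
  "prim (%x. heat_x t (x - y) *\<^sub>R e) (%x. heat_xx t (x - y) *\<^sub>R e)"
proof -
 have c: "continuous_on UNIV (heat_x t)" "continuous_on UNIV (heat_xx t)"
  unfolding heat_x_def heat_xx_def divide_inverse
  by (intro continuous_intros continuous_on_compose2[OF heat_kernel_continuous] subset_UNIV)+
 show "prim (%x. heat_kernel t (x - y) *\<^sub>R e) (%x. heat_x t (x - y) *\<^sub>R e)"
  by (rule prim_of_decay[OF t heat_kernel_DERIV_x(1)[OF t] c(1) heat_kernel_bounds(1,2)[OF t]])
 show "prim (%x. heat_x t (x - y) *\<^sub>R e) (%x. heat_xx t (x - y) *\<^sub>R e)"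
  by (rule prim_of_decay[OF t heat_kernel_DERIV_x(2)[OF t] c(2) heat_kernel_bounds(2,3)[OF t]])
qed

text \<open>The substitution x = y + sqrt (d n) z turns the kernel into the standard normal density
  for every n, and dominated convergence applies.\<close>

lemma heat_kernel_approximate_identity:
 fixes S :: "real => real"
 assumes S: "continuous_on UNIV S" "!!x. \<bar>S x\<bar> <= B" and d: "!!n. d n > 0" "d \<longlonglongrightarrow> 0"
 shows "(%n. LINT x|lborel. heat_kernel (d n) (x - y) * S x) \<longlonglongrightarrow> S y"
proof -
 have h1: "heat_kernel 1 = std_normal_density" by (simp add: fun_eq_iff heat_kernel_def std_normal_density_def)
 have Sm [measurable]: "S \<in> borel_measurable borel" by (rule borel_measurable_continuous_onI[OF S(1)])
 have eq: "(LINT x|lborel. heat_kernel (d n) (x - y) * S x) = (LINT z|lborel. heat_kernel 1 z * S (y + sqrt (d n) * z))" for n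
 proof -
  have "(LINT x|lborel. heat_kernel (d n) (x - y) * S x)
   = \<bar>sqrt (d n)\<bar> *\<^sub>R (LINT z|lborel. heat_kernel (d n) (y + sqrt (d n) * z - y) * S (y + sqrt (d n) * z))"
   using d(1)[of n] by (intro lborel_integral_real_affine) simp
  also have "... = (LINT z|lborel. sqrt (d n) * heat_kernel (d n) (sqrt (d n) * z) * S (y + sqrt (d n) * z))"
   using d(1)[of n] by (simp add: mult.assoc del: Bochner_Integration.integral_mult_right_zero flip: Bochner_Integration.integral_mult_right_zero)
  also have "... = (LINT z|lborel. heat_kernel 1 z * S (y + sqrt (d n) * z))"
   using d(1)[of n] by (intro Bochner_Integration.integral_cong refl)
    (simp add: heat_kernel_def power_mult_distrib real_sqrt_mult)
  finally show ?thesis .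
 qed
 have "(%n. LINT z|lborel. heat_kernel 1 z * S (y + sqrt (d n) * z)) \<longlonglongrightarrow> (LINT z|lborel. heat_kernel 1 z * S y)"
 proof (rule integral_dominated_convergence[where w = "%z. heat_kernel 1 z * B"])
  show "integrable lborel (%z. heat_kernel 1 z * B)" unfolding h1 by simp
  show "AE z in lborel. (%n. heat_kernel 1 z * S (y + sqrt (d n) * z)) \<longlonglongrightarrow> heat_kernel 1 z * S y"
  proof (intro AE_I2 tendsto_mult tendsto_const)
   fix z
   have "(%n. y + sqrt (d n) * z) \<longlonglongrightarrow> y" by (rule tendsto_eq_intros d(2) refl | simp)+
   then show "(%n. S (y + sqrt (d n) * z)) \<longlonglongrightarrow> S y"
    using continuous_on_tendsto_compose[OF S(1)] by simp
  qed
  show "AE z in lborel. norm (heat_kernel 1 z * S (y + sqrt (d n) * z)) <= heat_kernel 1 z * B" for n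
   by (intro AE_I2) (simp add: abs_mult abs_of_pos heat_kernel_pos mult_left_mono S(2) less_imp_le)
 qed measurable
 then show ?thesis unfolding eq by (simp add: h1)
qed

section \<open>The limit of the lattice approximations\<close>

text \<open>Extending p by zero to t <= 0 makes it Borel measurable on the whole plane and lets many
  facts about time slices hold for every t.\<close>

locale grid_solution = grid_limit F G L c b M m0 eps
 for F :: "real^'d => real^'d" and G L c b M m0 eps +
 fixes p :: "real => real => real^'d"
 assumes conv: "!!t x. t > 0 ==> (%k. approx_sol k t x) \<longlonglongrightarrow> p t x"
  and p_nonpos: "!!t x. t <= 0 ==> p t x = 0"
begin

lemma approx_sol_eq_step: "approx_sol k t = (%x. (1 / eps k) *\<^sub>R step_fun (eps k) (grid k t) x)"
 by (simp add: approx_sol_def step_fun_def fun_eq_iff)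

lemma fsupp_grid: "fsupp (grid k t)"
 unfolding grid_def by (rule fsupp_evol[OF adm])

lemma approx_sol_measurable [measurable]: "approx_sol k t \<in> borel_measurable borel"
 unfolding approx_sol_eq_step by measurable

lemma approx_sol_sq: "sq_int (approx_sol k t)" "n2 (approx_sol k t) = nsq (grid k t) / eps k"
proof -
 note s = step_fun_sq[OF eps_pos[of k] fsupp_grid[of k t]]
 show "sq_int (approx_sol k t)" unfolding approx_sol_eq_step by (intro sq_int_scaleR s)
 show "n2 (approx_sol k t) = nsq (grid k t) / eps k"
  unfolding approx_sol_eq_step sq_int_scaleR(2)[OF s(1)] s(2) using eps_pos[of k] by (simp add: power2_eq_square)
qed

lemma n2_approx_sol_le:
 assumes t: "tau k <= t" shows "n2 (approx_sol k t) <= K * \<theta> / sqrt t"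
proof -
 have "nsq (grid k t) <= K * (1 / sqrt (real (steps k t)))"
  using nsq_evol_le[OF adm steps_bounds(1)[OF t], of k] by (simp add: grid_def)
 also have "... <= K * (\<theta> * eps k / sqrt t)" by (rule mult_left_mono[OF steps_inverse(2)[OF t]]) (use K_pos in simp)
 finally have "nsq (grid k t) / eps k <= K * (\<theta> * eps k / sqrt t) / eps k" using eps_pos[of k] by (intro divide_right_mono) auto
 then show ?thesis using eps_pos[of k] by (simp add: approx_sol_sq)
qed

lemma approx_sol_nonneg: "approx_sol k t x \<in> nonneg"
 using nonneg_evol[OF adm] eps_pos[of k] by (simp add: approx_sol_def grid_def nonneg_def less_imp_le)

lemma p_nonneg: "p t x \<in> nonneg"
proof (cases "t > 0")
 case True
 have "0 <= p t x $ i" for i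
  by (rule LIMSEQ_le_const[OF tendsto_vec_nth[OF conv[OF True]]]) (use approx_sol_nonneg in \<open>auto simp: nonneg_def\<close>)
 then show ?thesis by (simp add: nonneg_def)
qed (simp add: p_nonpos)

lemma norm2_p_le:
 assumes t: "t > 0" shows "(norm (p t x))\<^sup>2 <= 2 * K * \<theta>\<^sup>2 / t"
proof (rule tendsto_upperbound)
 show "(%k. (norm (approx_sol k t x))\<^sup>2) \<longlonglongrightarrow> (norm (p t x))\<^sup>2" by (intro tendsto_intros conv t)
 show "eventually (%k. (norm (approx_sol k t x))\<^sup>2 <= 2 * K * \<theta>\<^sup>2 / t) sequentially"
  using tau_eventually[OF t] by eventually_elim (rule norm2_approx_sol_le)
qed simp

lemma p_increment_le:
 assumes t: "0 < t" "t <= s"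
 shows "(norm (p s y - p t x))\<^sup>2 <= 2 * (6 * K * \<theta>\<^sup>2 * sqrt (s - t) / (t * sqrt t)) + 2 * (K * \<theta> ^ 3 * \<bar>x - y\<bar> / (t * sqrt t))"
proof (rule tendsto_le[OF _ modulus_lim[of "\<bar>x - y\<bar>" t "s - t"]])
 show "(%k. (norm (approx_sol k s y - approx_sol k t x))\<^sup>2) \<longlonglongrightarrow> (norm (p s y - p t x))\<^sup>2"
  using t by (intro tendsto_intros conv) auto
 show "eventually (%k. (norm (approx_sol k s y - approx_sol k t x))\<^sup>2 <= modulus k t (s - t) \<bar>x - y\<bar>) sequentially"
  using tau_eventually[OF t(1)] by eventually_elim (rule approx_sol_equicontinuous[OF _ t(2)])
qed auto

lemma p_continuous: "continuous_on ({0<..} \<times> UNIV) (%z. p (fst z) (snd z))"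
 unfolding continuous_on_def
proof
 fix z0 :: "real \<times> real" assume z0: "z0 \<in> {0<..} \<times> UNIV"
 define t0 x0 where "t0 = fst z0" and "x0 = snd z0"
 have t0: "t0 > 0" using z0 by (auto simp: t0_def)
 define t1 where "t1 = t0 / 2"
 have t1: "t1 > 0" using t0 by (simp add: t1_def)
 let ?W = "%t x. 2 * (6 * K * \<theta>\<^sup>2 * sqrt \<bar>t - t0\<bar> / (t1 * sqrt t1)) + 2 * (K * \<theta> ^ 3 * \<bar>x - x0\<bar> / (t1 * sqrt t1))"
 have le: "(norm (p s y - p t x))\<^sup>2 <= 2 * (6 * K * \<theta>\<^sup>2 * sqrt (s - t) / (t1 * sqrt t1)) + 2 * (K * \<theta> ^ 3 * \<bar>x - y\<bar> / (t1 * sqrt t1))"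
  if "t1 < t" "t <= s" for s t x y
 proof -
  have "t1 * sqrt t1 <= t * sqrt t" using that t1 by (intro mult_mono) auto
  then have "2 * (6 * K * \<theta>\<^sup>2 * sqrt (s - t) / (t * sqrt t)) <= 2 * (6 * K * \<theta>\<^sup>2 * sqrt (s - t) / (t1 * sqrt t1))"
   "2 * (K * \<theta> ^ 3 * \<bar>x - y\<bar> / (t * sqrt t)) <= 2 * (K * \<theta> ^ 3 * \<bar>x - y\<bar> / (t1 * sqrt t1))"
   using that t1 K_pos theta_pos by (auto intro!: mult_left_mono divide_left_mono mult_nonneg_nonneg mult_pos_pos)
  then show ?thesis using p_increment_le[of t s y x] that t1 by linarith
 qed
 have W: "(norm (p t x - p t0 x0))\<^sup>2 <= ?W t x" if "t1 < t" for t x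
 proof (cases "t0 <= t")
  case True
  then show ?thesis using le[of t0 t x x0] t0 by (simp add: t1_def abs_minus_commute)
 next
  case False
  then show ?thesis using le[OF that, of t0 x0 x] by (simp add: norm_minus_commute)
 qed
 let ?F = "at z0 within ({0<..} \<times> UNIV)"
 have lim: "((%z. fst z) \<longlongrightarrow> t0) ?F" "((%z. snd z) \<longlongrightarrow> x0) ?F" unfolding t0_def x0_def by (intro tendsto_intros)+
 have "((%z. sqrt (?W (fst z) (snd z))) \<longlongrightarrow> sqrt (?W t0 x0)) ?F" unfolding divide_inverse by (intro tendsto_intros lim)
 then have W0: "((%z. sqrt (?W (fst z) (snd z))) \<longlongrightarrow> 0) ?F" by simp
 have gt: "eventually (%z. t1 < fst z) ?F"
  using t0 by (intro order_tendstoD(1)[OF lim(1)]) (simp add: t1_def)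
 have "eventually (%z. norm (p (fst z) (snd z) - p t0 x0) <= sqrt (?W (fst z) (snd z))) ?F"
  using gt by eventually_elim (intro real_le_rsqrt W)
 then have "((%z. p (fst z) (snd z) - p t0 x0) \<longlongrightarrow> 0) ?F" by (rule Lim_null_comparison) (rule W0)
 then show "((%z. p (fst z) (snd z)) \<longlongrightarrow> p (fst z0) (snd z0)) ?F" unfolding t0_def x0_def by (rule LIM_zero_cancel)
qed

lemma norm_F_le: "x \<in> nonneg ==> norm (F x) <= L * norm x"
 using F_lipschitz[of x 0] by simp

lemma F_continuous: "continuous_on nonneg F"
proof (rule lipschitz_on_continuous_on)
 show "L-lipschitz_on nonneg F"
  using F_lipschitz consts_pos(1) by (intro lipschitz_onI) (auto simp: dist_norm)
qed

lemma measurable_of_continuous: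
 fixes u :: "real => real => 'v::euclidean_space"
 assumes c: "continuous_on ({0<..} \<times> UNIV) (%z. u (fst z) (snd z))" and z: "!!t x. t <= 0 ==> u t x = 0"
 shows "case_prod u \<in> borel_measurable (borel \<Otimes>\<^sub>M borel)"
proof -
 have "open ({0::real<..} \<times> (UNIV :: real set))" by (intro open_Times) auto
 then have "(%z. indicator ({0<..} \<times> UNIV) z *\<^sub>R u (fst z) (snd z)) \<in> borel_measurable borel"
  by (intro borel_measurable_continuous_on_indicator c) auto
 moreover have "(%z. indicator ({0<..} \<times> UNIV) z *\<^sub>R u (fst z) (snd z)) = case_prod u"
  by (auto simp: fun_eq_iff indicator_def z not_less)
 ultimately show ?thesis by (simp add: borel_prod)
qed

lemma p_measurable [measurable]: "case_prod p \<in> borel_measurable (borel \<Otimes>\<^sub>M borel)"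
 by (rule measurable_of_continuous[OF p_continuous p_nonpos])

lemma Fp_continuous: "continuous_on ({0<..} \<times> UNIV) (%z. F (p (fst z) (snd z)))"
 by (rule continuous_on_compose2[OF F_continuous p_continuous]) (auto simp: p_nonneg)

lemma Fp_measurable [measurable]: "(%(t, x). F (p t x)) \<in> borel_measurable (borel \<Otimes>\<^sub>M borel)"
 using measurable_of_continuous[OF Fp_continuous] by (simp add: p_nonpos)

lemma p_slice_measurable [measurable]: "p t \<in> borel_measurable borel" "(%x. F (p t x)) \<in> borel_measurable borel"
proof -
 have "(%x. case_prod p (t, x)) \<in> borel_measurable borel" by measurable
 then show "p t \<in> borel_measurable borel" by simp
 have "(%x. (%(t, x). F (p t x)) (t, x)) \<in> borel_measurable borel" by measurable
 then show "(%x. F (p t x)) \<in> borel_measurable borel" by simp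
qed

lemma F_sq:
 assumes u: "sq_int u" "!!x. u x \<in> nonneg" "(%x. F (u x)) \<in> borel_measurable borel"
 shows "sq_int (%x. F (u x))" "n2 (%x. F (u x)) <= L\<^sup>2 * n2 u"
proof -
 have 1: "integrable lborel (%x. L\<^sup>2 * (norm (u x))\<^sup>2)" using sq_int_integrable[OF u(1)] by simp
 have 2: "AE x in lborel. (norm (F (u x)))\<^sup>2 <= L\<^sup>2 * (norm (u x))\<^sup>2"
  unfolding power_mult_distrib[symmetric] by (intro AE_I2 power_mono norm_F_le u) simp
 show "sq_int (%x. F (u x))" "n2 (%x. F (u x)) <= L\<^sup>2 * n2 u"
  using sq_int_bound[OF u(3) 1 2] by (simp_all add: n2_def)
qed

lemma p_sq:
 assumes t: "t > 0" shows "sq_int (p t)" "n2 (p t) <= K * \<theta> / sqrt t"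
proof -
 have 1: "AE x in lborel. (%k. approx_sol k t x) \<longlonglongrightarrow> p t x" by (intro AE_I2 conv t)
 have 2: "eventually (%k. (\<integral>\<^sup>+x. ennreal ((norm (approx_sol k t x))\<^sup>2) \<partial>lborel) <= ennreal (K * \<theta> / sqrt t)) sequentially"
  using tau_eventually[OF t] by eventually_elim (simp add: nn_integral_n2[OF approx_sol_sq(1)] ennreal_leI n2_approx_sol_le)
 have 3: "0 <= K * \<theta> / sqrt t" using K_pos theta_pos t by simp
 show "sq_int (p t)" "n2 (p t) <= K * \<theta> / sqrt t"
  using sq_int_limit[OF approx_sol_measurable p_slice_measurable(1) 1 2 tendsto_const 3] by auto
qed

lemma p_sq_all: "sq_int (p t)"
proof (cases "t > 0")
 case False
 then have "p t = (%x. 0)" by (intro ext p_nonpos) simp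
 then show ?thesis by (simp add: sq_int_def)
qed (rule p_sq)

lemma Fp_sq: "sq_int (%x. F (p t x))" "t > 0 ==> n2 (%x. F (p t x)) <= L\<^sup>2 * (K * \<theta> / sqrt t)"
proof -
 note f = F_sq[OF p_sq_all p_nonneg p_slice_measurable(2), of t]
 show "sq_int (%x. F (p t x))" by (rule f)
 show "n2 (%x. F (p t x)) <= L\<^sup>2 * (K * \<theta> / sqrt t)" if "t > 0"
  using f(2) mult_left_mono[OF p_sq(2)[OF that], of "L\<^sup>2"] by simp
qed

text \<open>Fatou's lemma applied to the rescaled lattice estimate \<open>nsq_evol_time_le\<close>:
  away from time zero, p is Hoelder continuous of order 1/2 with values in L2.\<close>

lemma n2_p_diff_le:
 assumes t: "0 < t" "t <= s"
 shows "n2 (%x. p s x - p t x) <= K * \<theta> ^ 3 * (s - t) / (t * sqrt t)"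
proof -
 let ?C = "%k. K * \<theta> ^ 3 * (s - t + tau k) / (t * sqrt t)"
 have 0: "sq_int (%x. approx_sol k s x - approx_sol k t x)" for k by (intro sq_int_diff approx_sol_sq)
 have n: "n2 (%x. approx_sol k s x - approx_sol k t x) <= ?C k" if k: "tau k <= t" for k
 proof -
  let ?n = "real (steps k t) * sqrt (real (steps k t))"
  have e: "eps k > 0" by (rule eps_pos)
  obtain l where l: "steps k s = steps k t + l" "real l <= (s - t + tau k) / tau k"
   using steps_diff[OF k t(2)] by blast
  have fs: "fsupp (%j. grid k s j - grid k t j)" by (intro fsupp_diff fsupp_grid)
  have eq: "(%x. approx_sol k s x - approx_sol k t x) = (%x. (1 / eps k) *\<^sub>R step_fun (eps k) (%j. grid k s j - grid k t j) x)"
   by (simp add: approx_sol_def step_fun_def fun_eq_iff scaleR_diff_right)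
  have "nsq (%j. grid k s j - grid k t j) <= 2 * r * K * real l / ?n"
   unfolding grid_def l(1) by (rule nsq_evol_time_le[OF adm steps_bounds(1)[OF k]])
  also have "... = 2 * r * K * real l * (1 / ?n)" by simp
  also have "... <= 2 * r * K * ((s - t + tau k) / tau k) * ((\<theta> * eps k) ^ 3 / (t * sqrt t))"
   using r_pos K_pos l(2) t tau_pos[of k] theta_pos e
   by (intro mult_mono steps_inverse(3)[OF k] mult_left_mono) auto
  finally have "nsq (%j. grid k s j - grid k t j) / eps k
   <= 2 * r * K * ((s - t + tau k) / tau k) * ((\<theta> * eps k) ^ 3 / (t * sqrt t)) / eps k"
   using e by (intro divide_right_mono) auto
  also have "... = ?C k"
  proof -
   have "2 * r * K * (A / tau k) * ((\<theta> * eps k) ^ 3 / B) / eps k = K * \<theta> ^ 3 * A / B" for A B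
    using e r_pos by (simp add: tau_def power_mult_distrib power2_eq_square power3_eq_cube)
   then show ?thesis .
  qed
  finally show ?thesis
   unfolding eq sq_int_scaleR(2)[OF step_fun_sq(1)[OF e fs]] step_fun_sq(2)[OF e fs]
   using e by (simp add: power2_eq_square)
 qed
 have 1: "AE x in lborel. (%k. approx_sol k s x - approx_sol k t x) \<longlonglongrightarrow> p s x - p t x" using t by (intro AE_I2 tendsto_intros conv) auto
 have 2: "eventually (%k. (\<integral>\<^sup>+x. ennreal ((norm (approx_sol k s x - approx_sol k t x))\<^sup>2) \<partial>lborel) <= ennreal (?C k)) sequentially"
  using tau_eventually[OF t(1)] by eventually_elim (simp add: nn_integral_n2[OF 0] ennreal_leI n)
 have 3: "0 <= K * \<theta> ^ 3 * (s - t) / (t * sqrt t)" using K_pos theta_pos t by simp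
 have 4: "?C \<longlonglongrightarrow> K * \<theta> ^ 3 * (s - t) / (t * sqrt t)"
  unfolding divide_inverse by (rule tendsto_eq_intros tau_lim refl | simp)+
 show ?thesis by (rule sq_int_limit(2)[OF _ _ 1 2 4 3]) measurable
qed

text \<open>A step h spans at most h / eps + 2 cells, so \<open>sum_blocks_le\<close> bounds the
  quadratic variation by the lattice gradient, and the excess 2 eps disappears in the limit. With
  \<open>prim_of_quadratic_variation\<close> this yields the space derivative of p.\<close>

lemma p_quadratic_variation:
 assumes t: "t > 0" and h: "h > 0"
 shows "(\<Sum>i<J. (norm (p t (x + real (Suc i) * h) - p t (x + real i * h)))\<^sup>2) <= (K * \<theta> ^ 3 / (t * sqrt t)) * h"
proof -
 let ?C = "%k. (K * \<theta> ^ 3 / (t * sqrt t)) * (h + 2 * eps k)"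
 have n: "(\<Sum>i<J. (norm (approx_sol k t (x + real (Suc i) * h) - approx_sol k t (x + real i * h)))\<^sup>2) <= ?C k"
  if k: "tau k <= t" for k
 proof -
  let ?n = "real (steps k t) * sqrt (real (steps k t))"
  have e: "eps k > 0" by (rule eps_pos)
  define a where "a = (%i::nat. \<lfloor>(x + real i * h) / eps k\<rfloor>)"
  define N where "N = nat \<lceil>h / eps k + 1\<rceil>"
  have pos: "0 < h / eps k" using h e by simp
  have "0 < \<lceil>h / eps k + 1\<rceil>" unfolding zero_less_ceiling using pos by linarith
  then have "real N = of_int \<lceil>h / eps k + 1\<rceil>" by (simp add: N_def)
  then have N: "real N <= h / eps k + 2" using of_int_ceiling_le_add_one[of "h / eps k + 1"] by linarith
  have xs: "x + real i * h <= x + real (Suc i) * h" for i using h by (simp add: distrib_right)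
  have a1: "a i <= a (Suc i)" for i unfolding a_def by (rule floor_grid_le(1)[OF xs e])
  have a2: "a (Suc i) - a i <= int N" for i
  proof -
   have "real_of_int (a (Suc i) - a i) <= h / eps k + 1"
    using floor_grid_le(2)[OF xs e, of i] by (simp add: a_def algebra_simps)
   also have "... <= real_of_int \<lceil>h / eps k + 1\<rceil>" by (rule le_of_int_ceiling)
   finally have "a (Suc i) - a i <= \<lceil>h / eps k + 1\<rceil>" by simp
   then show ?thesis unfolding N_def by simp
  qed
  have "(\<Sum>i<J. (norm (approx_sol k t (x + real (Suc i) * h) - approx_sol k t (x + real i * h)))\<^sup>2)
   = (\<Sum>i<J. (norm (grid k t (a (Suc i)) - grid k t (a i)))\<^sup>2 / (eps k)\<^sup>2)"
   by (intro sum.cong refl) (simp add: approx_sol_def a_def scaleR_diff_right[symmetric] power_divide)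
  also have "... = (\<Sum>i<J. (norm (grid k t (a (Suc i)) - grid k t (a i)))\<^sup>2) / (eps k)\<^sup>2" by (rule sum_divide_distrib[symmetric])
  also have "... <= (real N * nsq (%j. grid k t (j + 1) - grid k t j)) / (eps k)\<^sup>2"
   by (intro divide_right_mono sum_blocks_le a1 a2 fsupp_grid) simp
  also have "... <= ((h / eps k + 2) * (K * (1 / ?n))) / (eps k)\<^sup>2"
  proof (intro divide_right_mono mult_mono N)
   show "nsq (%j. grid k t (j + 1) - grid k t j) <= K * (1 / ?n)"
    using shift_nsq_evol_le[OF adm steps_bounds(1)[OF k], of k] by (simp add: grid_def shift_nsq_def)
  qed (use h e in auto)
  also have "... <= ((h / eps k + 2) * (K * ((\<theta> * eps k) ^ 3 / (t * sqrt t)))) / (eps k)\<^sup>2"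
   by (intro divide_right_mono mult_left_mono steps_inverse(3)[OF k]) (use h e K_pos in auto)
  also have "... = ?C k"
  proof -
   have "((h / eps k + 2) * (K * ((\<theta> * eps k) ^ 3 / B))) / (eps k)\<^sup>2 = (K * \<theta> ^ 3 / B) * (h + 2 * eps k)" for B
   proof -
    have "((h / eps k + 2) * (C * (eps k) ^ 3)) / (eps k)\<^sup>2 = C * (h + 2 * eps k)" for C
     using e by (simp add: field_simps power2_eq_square power3_eq_cube)
    from this[of "K * \<theta> ^ 3 / B"] show ?thesis by (simp add: power_mult_distrib)
   qed
   then show ?thesis .
  qed
  finally show ?thesis .
 qed
 show ?thesis
 proof (rule tendsto_le)
  show "(%k. \<Sum>i<J. (norm (approx_sol k t (x + real (Suc i) * h) - approx_sol k t (x + real i * h)))\<^sup>2)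
   \<longlonglongrightarrow> (\<Sum>i<J. (norm (p t (x + real (Suc i) * h) - p t (x + real i * h)))\<^sup>2)"
   by (intro tendsto_intros conv t)
  show "?C \<longlonglongrightarrow> (K * \<theta> ^ 3 / (t * sqrt t)) * h" by (rule tendsto_eq_intros eps_lim refl | simp)+
  show "eventually (%k. (\<Sum>i<J. (norm (approx_sol k t (x + real (Suc i) * h) - approx_sol k t (x + real i * h)))\<^sup>2) <= ?C k) sequentially"
   using tau_eventually[OF t] by eventually_elim (rule n)
 qed simp
qed

lemma p_slice_continuous: "t > 0 ==> continuous_on UNIV (p t)"
 using continuous_on_compose2[OF p_continuous, of UNIV "%x. (t, x)"] by (simp add: continuous_on_Pair image_subset_iff)

text \<open>The derivative is chosen for each time separately, so its measurability in t is not at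
  hand; quantities that involve it are treated as limits of difference quotients in time
  integrals.\<close>

definition px :: "real => real => real^'d" where
 "px t = (if t > 0 then SOME g. prim (p t) g & n2 g <= K * \<theta> ^ 3 / (t * sqrt t) else (%x. 0))"

lemma prim_p:
 assumes t: "t > 0" shows "prim (p t) (px t)" "n2 (px t) <= K * \<theta> ^ 3 / (t * sqrt t)"
proof -
 have "0 <= K * \<theta> ^ 3 / (t * sqrt t)" using K_pos theta_pos t by simp
 from prim_of_quadratic_variation[OF p_sq(1)[OF t] p_slice_continuous[OF t] p_quadratic_variation[OF t] this]
 obtain g where "prim (p t) g & n2 g <= K * \<theta> ^ 3 / (t * sqrt t)" by blast
 then have "prim (p t) (px t) & n2 (px t) <= K * \<theta> ^ 3 / (t * sqrt t)" using t unfolding px_def if_P[OF t] by (intro someI[where P = "%g. prim (p t) g & n2 g <= K * \<theta> ^ 3 / (t * sqrt t)"])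
 then show "prim (p t) (px t)" "n2 (px t) <= K * \<theta> ^ 3 / (t * sqrt t)" by auto
qed

lemma prim_p_all: "prim (p t) (px t)"
proof (cases "t > 0")
 case False
 then have "p t = (%x. 0)" by (intro ext p_nonpos) simp
 then show ?thesis using False by (simp add: px_def prim_def sq_int_def set_lebesgue_integral_def)
qed (rule prim_p)

text \<open>\<open>sq_int_limit\<close> is about squares, so it is applied to the square roots of
  the total densities.\<close>

lemma p_mass:
 assumes t: "t > 0"
 shows "integrable lborel (%x. total (p t x))" "(LINT x|lborel. total (p t x)) <= 1"
proof -
 let ?s = "%k x. sqrt (total (approx_sol k t x))" and ?q = "%x. sqrt (total (p t x))"
 have tm: "total \<in> borel_measurable (borel :: (real^'d) measure)" unfolding total_def by measurable
 have eq: "(%x. (norm (?s k x))\<^sup>2) = step_fun (eps k) (%j. (1 / eps k) * total (grid k t j))" for k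
  using total_nonneg[OF approx_sol_nonneg, of k t] by (simp add: fun_eq_iff approx_sol_def step_fun_def)
 have fs: "fsupp (%j. (1 / eps k) * total (grid k t j))" for k by (rule fsupp_subset[OF fsupp_grid[of k t]]) simp
 note si = step_fun_integral[OF eps_pos fs]
 have sm [measurable]: "?s k \<in> borel_measurable borel" for k using tm by measurable
 have qm [measurable]: "?q \<in> borel_measurable borel" using tm by measurable
 have s: "sq_int (?s k)" for k unfolding sq_int_def eq using si(1) sm by simp
 have n: "n2 (?s k) <= 1" for k
 proof -
  have "n2 (?s k) = zs (%j. total (grid k t j))"
   unfolding n2_def eq si(2) zs_cmult using eps_pos[of k] by simp
  then show ?thesis using admissible_evol[OF adm, of "steps k t" k] by (simp add: grid_def admissible_def)
 qed
 have 1: "AE x in lborel. (%k. ?s k x) \<longlonglongrightarrow> ?q x"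
  unfolding total_def by (intro AE_I2 tendsto_intros conv t)
 have 2: "eventually (%k. (\<integral>\<^sup>+x. ennreal ((norm (?s k x))\<^sup>2) \<partial>lborel) <= ennreal 1) sequentially"
  by (simp only: nn_integral_n2[OF s]) (intro always_eventually allI ennreal_leI n)
 have e: "(norm (?q x))\<^sup>2 = total (p t x)" for x using total_nonneg[OF p_nonneg, of t x] by simp
 show "integrable lborel (%x. total (p t x))" "(LINT x|lborel. total (p t x)) <= 1"
  using sq_int_limit[OF sm qm 1 2 tendsto_const] unfolding sq_int_def n2_def e by auto
qed

section \<open>Initial condition and weak form in the limit\<close>

lemma F_approx_sol_sq: "sq_int (%x. F (approx_sol k t x))" "tau k <= t ==> n2 (%x. F (approx_sol k t x)) <= L\<^sup>2 * (K * \<theta> / sqrt t)"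
proof -
 have "(%x. F (approx_sol k t x)) = step_fun (eps k) (%j. F ((1 / eps k) *\<^sub>R grid k t j))"
  by (simp add: approx_sol_def step_fun_def fun_eq_iff)
 then have "(%x. F (approx_sol k t x)) \<in> borel_measurable borel" by simp
 note f = F_sq[OF approx_sol_sq(1) approx_sol_nonneg this]
 show "sq_int (%x. F (approx_sol k t x))" by (rule f)
 show "n2 (%x. F (approx_sol k t x)) <= L\<^sup>2 * (K * \<theta> / sqrt t)" if "tau k <= t"
  using f(2) mult_left_mono[OF n2_approx_sol_le[OF that], of "L\<^sup>2"] by simp
qed

lemma inner_approx_sol:
 assumes v: "sq_int v"
 shows "(LINT x|lborel. v x \<bullet> approx_sol k t x) = zs (%j. cell_avg (eps k) v j \<bullet> grid k t j)"
 unfolding approx_sol_eq_step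
 using inner_step_fun[OF eps_pos[of k] fsupp_grid[of k t] v] eps_pos[of k] by simp

lemma norm_approx_sol_le:
 assumes "tau k <= t" shows "norm (approx_sol k t x) <= sqrt (2 * K * \<theta>\<^sup>2 / t)"
 by (intro real_le_rsqrt norm2_approx_sol_le assms)

lemma inner_approx_sol_tendsto:
 assumes v: "sq_int v" and t: "t > 0"
 shows "(%k. LINT x|lborel. v x \<bullet> approx_sol k t x) \<longlonglongrightarrow> (LINT x|lborel. v x \<bullet> p t x)"
  "(%k. LINT x|lborel. v x \<bullet> F (approx_sol k t x)) \<longlonglongrightarrow> (LINT x|lborel. v x \<bullet> F (p t x))"
proof -
 note ev = tau_eventually[OF t]
 show "(%k. LINT x|lborel. v x \<bullet> approx_sol k t x) \<longlonglongrightarrow> (LINT x|lborel. v x \<bullet> p t x)"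
 proof (rule inner_weak_tendsto[OF v approx_sol_sq(1) _ p_sq_all conv[OF t]])
  show "eventually (%k. n2 (approx_sol k t) <= K * \<theta> / sqrt t) sequentially"
   using ev by eventually_elim (rule n2_approx_sol_le)
  show "eventually (%k. \<forall>x. norm (approx_sol k t x) <= sqrt (2 * K * \<theta>\<^sup>2 / t)) sequentially"
   using ev by eventually_elim (intro allI norm_approx_sol_le)
 qed
 show "(%k. LINT x|lborel. v x \<bullet> F (approx_sol k t x)) \<longlonglongrightarrow> (LINT x|lborel. v x \<bullet> F (p t x))"
 proof (rule inner_weak_tendsto[OF v F_approx_sol_sq(1) _ Fp_sq(1)])
  show "eventually (%k. n2 (%x. F (approx_sol k t x)) <= L\<^sup>2 * (K * \<theta> / sqrt t)) sequentially"
   using ev by eventually_elim (rule F_approx_sol_sq(2))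
  show "(%k. F (approx_sol k t x)) \<longlonglongrightarrow> F (p t x)" for x
   by (rule continuous_on_tendsto_compose[OF F_continuous conv[OF t]]) (auto simp: p_nonneg approx_sol_nonneg)
  show "eventually (%k. \<forall>x. norm (F (approx_sol k t x)) <= L * sqrt (2 * K * \<theta>\<^sup>2 / t)) sequentially"
   using ev
  proof eventually_elim
   case (elim k)
   show ?case
   proof
    fix x
    have "norm (F (approx_sol k t x)) <= L * norm (approx_sol k t x)" by (rule norm_F_le[OF approx_sol_nonneg])
    also have "... <= L * sqrt (2 * K * \<theta>\<^sup>2 / t)" using consts_pos by (intro mult_left_mono norm_approx_sol_le elim) auto
    finally show "norm (F (approx_sol k t x)) <= L * sqrt (2 * K * \<theta>\<^sup>2 / t)" .
   qed
  qed
 qed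
qed

text \<open>The increments of the cell averages contribute sqrt eps, and the fourth root of the
  number of steps contributes eps^(-1/2). The product has a limit of order t^(1/4), while the
  summand for step zero vanishes with sqrt eps.\<close>

lemma initial_pairing:
 assumes v: "prim v g" and t: "t > 0"
  and init: "(%k. zs (%j. cell_avg (eps k) v j \<bullet> m0 k j)) \<longlonglongrightarrow> L0"
 shows "\<bar>(LINT x|lborel. v x \<bullet> p t x) - L0\<bar> <= r * (sqrt K * sqrt (10 * n2 g)) * (4 * sqrt (sqrt (t / (2 * r))))"
proof (rule tendsto_le)
 let ?C = "%k. r * (sqrt K * sqrt (10 * n2 g)) * (sqrt (eps k) + 4 * sqrt (sqrt (t / (2 * r))))"
 show "?C \<longlonglongrightarrow> r * (sqrt K * sqrt (10 * n2 g)) * (4 * sqrt (sqrt (t / (2 * r))))"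
  by (rule tendsto_eq_intros eps_lim refl | simp)+
 show "(%k. \<bar>(LINT x|lborel. v x \<bullet> approx_sol k t x) - zs (%j. cell_avg (eps k) v j \<bullet> m0 k j)\<bar>)
  \<longlonglongrightarrow> \<bar>(LINT x|lborel. v x \<bullet> p t x) - L0\<bar>"
  by (intro tendsto_intros init inner_approx_sol_tendsto primD[OF v] t)
 show "eventually (%k. \<bar>(LINT x|lborel. v x \<bullet> approx_sol k t x) - zs (%j. cell_avg (eps k) v j \<bullet> m0 k j)\<bar> <= ?C k) sequentially"
  using tau_eventually[OF t]
 proof eventually_elim
  case (elim k)
  have e: "eps k > 0" by (rule eps_pos)
  let ?q = "sqrt (sqrt (t / (2 * r)))"
  have "real (steps k t) <= t / tau k" by (rule steps_bounds(3)[OF elim])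
  also have "... = t / (2 * r) / (eps k)\<^sup>2" by (simp add: tau_def)
  finally have "sqrt (sqrt (real (steps k t))) <= sqrt (sqrt (t / (2 * r) / (eps k)\<^sup>2))" by (intro real_sqrt_le_mono)
  also have "... = ?q / sqrt (eps k)" by (simp only: real_sqrt_divide real_sqrt_abs abs_of_pos[OF e])
  finally have q: "sqrt (sqrt (real (steps k t))) <= ?q / sqrt (eps k)" .
  have "\<bar>(LINT x|lborel. v x \<bullet> approx_sol k t x) - zs (%j. cell_avg (eps k) v j \<bullet> m0 k j)\<bar>
   <= r * (sqrt K * sqrt (10 * (eps k * n2 g))) * (1 + 4 * sqrt (sqrt (real (steps k t))))"
   unfolding inner_approx_sol[OF primD(1)[OF v]] unfolding grid_def
   by (intro evol_weak_le adm cell_avg_gradient_le[OF e v])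
  also have "... <= r * (sqrt K * sqrt (10 * (eps k * n2 g))) * (1 + 4 * (?q / sqrt (eps k)))"
   using r_pos K_pos e q by (intro mult_left_mono add_left_mono) (auto intro!: mult_nonneg_nonneg)
  also have "... = ?C k"
  proof -
   have "sqrt (10 * (eps k * n2 g)) = sqrt (10 * n2 g) * sqrt (eps k)" by (simp add: real_sqrt_mult mult_ac)
   moreover have "a * (b * (c * s)) * (1 + 4 * (q / s)) = a * (b * c) * (s + 4 * q)" if "s > 0" for a b c s q :: real
    using that by (simp add: field_simps)
   ultimately show ?thesis using e by simp
  qed
  finally show ?case .
 qed
qed simp

text \<open>The sum of the scheme over the steps between s and t is exactly an integral, since the
  integrand is constant in time on cells of length \<open>tau k\<close>; only the end points are
  rounded.\<close>

lemma approx_weak_form: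
 assumes f: "sq_int f" and s: "0 <= s" "s <= t"
 shows "(LINT x|lborel. f x \<bullet> approx_sol k t x) - (LINT x|lborel. f x \<bullet> approx_sol k s x)
  = (1/2) * (LINT q|lborel. indicator {of_int \<lfloor>s / tau k\<rfloor> * tau k..<of_int \<lfloor>t / tau k\<rfloor> * tau k} q *\<^sub>R
    (LINT x|lborel. second_dq (eps k) f x \<bullet> F (approx_sol k q x)))"
  "integrable lborel (%q. indicator {of_int \<lfloor>s / tau k\<rfloor> * tau k..<of_int \<lfloor>t / tau k\<rfloor> * tau k} q *\<^sub>R
    (LINT x|lborel. second_dq (eps k) f x \<bullet> F (approx_sol k q x)))"
proof -
 have e: "eps k > 0" by (rule eps_pos)
 define \<Phi> where "\<Phi> = (%i::int. LINT x|lborel. second_dq (eps k) f x \<bullet> F ((1 / eps k) *\<^sub>R evol (nat i) (m0 k) \<lfloor>x / eps k\<rfloor>))"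
 define S where "S = (%n. LINT x|lborel. f x \<bullet> step_fun (eps k) (evol n (m0 k)) x)"
 have \<Phi>q: "(LINT x|lborel. second_dq (eps k) f x \<bullet> F (approx_sol k q x)) = \<Phi> \<lfloor>q / tau k\<rfloor>" for q
  by (simp add: \<Phi>_def approx_sol_def grid_def steps_def)
 have n: "int (steps k s) = \<lfloor>s / tau k\<rfloor>" "int (steps k t) = \<lfloor>t / tau k\<rfloor>" "steps k s <= steps k t"
  using s tau_pos[of k] floor_grid_le(1)[OF s(2) tau_pos[of k]] by (auto simp: steps_def)
 have step: "(1 / eps k) * (S (Suc i) - S i) = (tau k / 2) * \<Phi> (int i)" for i
 proof -
  let ?u = "step_fun (eps k) (%j. F (evol i (m0 k) j))"
  have us: "sq_int ?u" by (intro step_fun_sq e fsupp_F fsupp_evol adm)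
  have ms: "sq_int (step_fun (eps k) (evol n (m0 k)))" for n by (intro step_fun_sq e fsupp_evol adm)
  have ev: "step_fun (eps k) (evol (Suc i) (m0 k)) x - step_fun (eps k) (evol i (m0 k)) x
   = r *\<^sub>R (?u (x + eps k) - ?u x - (?u x - ?u (x - eps k)))" for x
   unfolding step_fun_shift[OF e] by (simp add: step_fun_def step_def)
  have "S (Suc i) - S i = (LINT x|lborel. f x \<bullet> (step_fun (eps k) (evol (Suc i) (m0 k)) x - step_fun (eps k) (evol i (m0 k)) x))"
   unfolding S_def by (simp add: inner_diff_right integrable_inner_sq(1) f ms del: evol_simps)
  also have "... = r * ((eps k)\<^sup>2 * (LINT x|lborel. second_dq (eps k) f x \<bullet> ?u x))"
   unfolding ev inner_second_dq[OF f us less_imp_neq[OF e, symmetric]] by simp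
  also have "(LINT x|lborel. second_dq (eps k) f x \<bullet> ?u x) = eps k * \<Phi> (int i)"
   unfolding \<Phi>_def F_scaleR using e by (simp add: step_fun_def)
  finally show ?thesis using e by (simp add: tau_def power2_eq_square)
 qed
 have tele: "(1 / eps k) * (S (n + l) - S n) = (1/2) * (tau k *\<^sub>R (\<Sum>j\<in>{int n..<int (n + l)}. \<Phi> j))" for n l
 proof (induction l)
  case (Suc l)
  have "{int n..<int (n + Suc l)} = insert (int (n + l)) {int n..<int (n + l)}" by auto
  then have sm: "sum \<Phi> {int n..<int (n + Suc l)} = \<Phi> (int (n + l)) + sum \<Phi> {int n..<int (n + l)}" by simp
  have d: "S (n + Suc l) - S n = (S (Suc (n + l)) - S (n + l)) + (S (n + l) - S n)" by simp
  show ?case unfolding d distrib_left step Suc sm by (simp add: distrib_left)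
 qed simp
 have S: "(LINT x|lborel. f x \<bullet> approx_sol k q x) = (1 / eps k) * S (steps k q)" for q
  by (simp add: S_def approx_sol_eq_step grid_def)
 obtain l where l: "steps k t = steps k s + l" using n(3) le_Suc_ex by blast
 have "(LINT x|lborel. f x \<bullet> approx_sol k t x) - (LINT x|lborel. f x \<bullet> approx_sol k s x) = (1 / eps k) * (S (steps k s + l) - S (steps k s))"
  unfolding S l by (simp add: right_diff_distrib)
 also have "... = (1/2) * (tau k *\<^sub>R (\<Sum>j\<in>{\<lfloor>s / tau k\<rfloor>..<\<lfloor>t / tau k\<rfloor>}. \<Phi> j))"
  unfolding tele n(1)[symmetric] n(2)[symmetric] l ..
 finally show "(LINT x|lborel. f x \<bullet> approx_sol k t x) - (LINT x|lborel. f x \<bullet> approx_sol k s x)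
  = (1/2) * (LINT q|lborel. indicator {of_int \<lfloor>s / tau k\<rfloor> * tau k..<of_int \<lfloor>t / tau k\<rfloor> * tau k} q *\<^sub>R
    (LINT x|lborel. second_dq (eps k) f x \<bullet> F (approx_sol k q x)))"
  unfolding \<Phi>q integral_step(1)[OF tau_pos] .
 show "integrable lborel (%q. indicator {of_int \<lfloor>s / tau k\<rfloor> * tau k..<of_int \<lfloor>t / tau k\<rfloor> * tau k} q *\<^sub>R
    (LINT x|lborel. second_dq (eps k) f x \<bullet> F (approx_sol k q x)))"
  unfolding \<Phi>q by (rule integral_step(2)[OF tau_pos])
qed

text \<open>For a test function with two derivatives the second difference converges in norm and the
  flux of the approximations converges weakly at each positive time; dominated convergence handles
  the time integral.\<close>

lemma weak_form_smooth:
 assumes f: "prim f g" and g: "prim g \<kappa>" and s: "0 < s" "s < t"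
 shows "(LINT x|lborel. f x \<bullet> p t x) - (LINT x|lborel. f x \<bullet> p s x)
  = (1/2) * (LINT q:{s..t}|lborel. (LINT x|lborel. \<kappa> x \<bullet> F (p q x)))"
proof -
 have fs: "sq_int f" and ks: "sq_int \<kappa>" by (rule primD[OF f] primD[OF g])+
 let ?J = "%k q. LINT x|lborel. second_dq (eps k) f x \<bullet> F (approx_sol k q x)"
 let ?Jlim = "%q. LINT x|lborel. \<kappa> x \<bullet> F (p q x)"
 let ?a = "%k. of_int \<lfloor>s / tau k\<rfloor> * tau k" and ?b = "%k. of_int \<lfloor>t / tau k\<rfloor> * tau k"
 have alim: "?a \<longlonglongrightarrow> s" and blim: "?b \<longlonglongrightarrow> t" by (intro floor_scaled_tendsto tau_pos tau_lim)+
 have "filterlim eps (at_right 0) sequentially"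
  by (simp add: filterlim_at eps_lim eps_pos less_imp_neq[OF eps_pos, symmetric])
 from filterlim_compose[OF second_dq_tendsto[OF f g] this]
 have dd: "(%k. n2 (%x. second_dq (eps k) f x - \<kappa> x)) \<longlonglongrightarrow> 0" .
 have km [measurable]: "\<kappa> \<in> borel_measurable borel" using ks by (simp add: sq_int_def)
 have Jlim: "(%k. ?J k q) \<longlonglongrightarrow> ?Jlim q" if q: "q > 0" for q
 proof -
  have i: "sq_int (%x. second_dq (eps k) f x - \<kappa> x)" for k by (intro sq_int_diff sq_int_second_dq fs ks)
  have "(%k. LINT x|lborel. (second_dq (eps k) f x - \<kappa> x) \<bullet> F (approx_sol k q x)) \<longlonglongrightarrow> 0"
  proof (rule Lim_null_comparison)
   show "(%k. sqrt (n2 (%x. second_dq (eps k) f x - \<kappa> x)) * sqrt (L\<^sup>2 * (K * \<theta> / sqrt q))) \<longlonglongrightarrow> 0"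
    by (rule tendsto_eq_intros dd refl | simp)+
   show "eventually (%k. norm (LINT x|lborel. (second_dq (eps k) f x - \<kappa> x) \<bullet> F (approx_sol k q x))
    <= sqrt (n2 (%x. second_dq (eps k) f x - \<kappa> x)) * sqrt (L\<^sup>2 * (K * \<theta> / sqrt q))) sequentially"
    using tau_eventually[OF q]
   proof eventually_elim
    case (elim k)
    have "\<bar>LINT x|lborel. (second_dq (eps k) f x - \<kappa> x) \<bullet> F (approx_sol k q x)\<bar>
     <= sqrt (n2 (%x. second_dq (eps k) f x - \<kappa> x)) * sqrt (n2 (%x. F (approx_sol k q x)))"
     by (rule integrable_inner_sq(2)[OF i F_approx_sol_sq(1)])
    also have "... <= sqrt (n2 (%x. second_dq (eps k) f x - \<kappa> x)) * sqrt (L\<^sup>2 * (K * \<theta> / sqrt q))"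
     by (intro mult_left_mono real_sqrt_le_mono F_approx_sol_sq(2) elim) simp
    finally show ?case by simp
   qed
  qed
  from tendsto_add[OF this inner_approx_sol_tendsto(2)[OF ks q]]
  show ?thesis by (simp add: inner_diff_left integrable_inner_sq(1) sq_int_second_dq fs ks F_approx_sol_sq(1))
 qed
 \<comment> \<open>Rounding down may put the lower end of the time interval before s, so the
   integrand is bounded from s/2 on.\<close>
 define D where "D = sqrt (2 + 2 * n2 \<kappa>) * sqrt (L\<^sup>2 * (K * \<theta> / sqrt (s / 2)))"
 have Jbd: "eventually (%k. \<forall>q\<ge>s/2. \<bar>?J k q\<bar> <= D) sequentially"
  using tau_eventually[OF half_gt_zero[OF s(1)]] order_tendstoD(2)[OF dd zero_less_one]
 proof eventually_elim
  case (elim k)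
  show ?case
  proof (intro allI impI)
   fix q assume q: "s / 2 <= q"
   have "n2 (second_dq (eps k) f) <= 2 * n2 (%x. second_dq (eps k) f x - \<kappa> x) + 2 * n2 \<kappa>"
    using sq_int_add(2)[OF sq_int_diff(1)[OF sq_int_second_dq[OF fs] ks] ks, of "eps k"] by simp
   then have d: "n2 (second_dq (eps k) f) <= 2 + 2 * n2 \<kappa>" using elim by simp
   have "K * \<theta> / sqrt q <= K * \<theta> / sqrt (s / 2)"
    using q s K_pos theta_pos by (intro divide_left_mono) auto
   then have "L\<^sup>2 * (K * \<theta> / sqrt q) <= L\<^sup>2 * (K * \<theta> / sqrt (s / 2))" by (intro mult_left_mono) auto
   then have "n2 (%x. F (approx_sol k q x)) <= L\<^sup>2 * (K * \<theta> / sqrt (s / 2))"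
    using F_approx_sol_sq(2)[of k q] elim q by linarith
   then have "sqrt (n2 (second_dq (eps k) f)) * sqrt (n2 (%x. F (approx_sol k q x))) <= D"
    unfolding D_def by (intro mult_mono real_sqrt_le_mono d) auto
   then show "\<bar>?J k q\<bar> <= D" using integrable_inner_sq(2)[OF sq_int_second_dq[OF fs] F_approx_sol_sq(1), of "eps k" k q] by linarith
  qed
 qed
 have J0m: "?Jlim \<in> borel_measurable borel" by measurable
 have "(%k. LINT q|lborel. indicator {?a k..<?b k} q *\<^sub>R ?J k q) \<longlonglongrightarrow> (LINT q|lborel. indicator {s..t} q *\<^sub>R ?Jlim q)"
 proof (rule integral_dominated_convergence_ev[where w = "%q. indicator {s / 2..t} q * D"])
  show "(%q. indicator {s..t} q *\<^sub>R ?Jlim q) \<in> borel_measurable lborel" using J0m by measurable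
  show "(%q. indicator {?a k..<?b k} q *\<^sub>R ?J k q) \<in> borel_measurable lborel" for k
   using borel_measurable_integrable[OF approx_weak_form(2)[OF fs, of s t k]] s by simp
  show "AE q in lborel. (%k. indicator {?a k..<?b k} q *\<^sub>R ?J k q) \<longlonglongrightarrow> indicator {s..t} q *\<^sub>R ?Jlim q"
   using AE_lborel_singleton[of s] AE_lborel_singleton[of t]
  proof eventually_elim
   case (elim q)
   consider "q < s" | "s < q" "q < t" | "t < q" using elim by linarith
   then show ?case
   proof cases
    case 1
    then show ?thesis
     by (intro tendsto_eventually eventually_mono[OF order_tendstoD(1)[OF alim 1]]) (simp add: indicator_def)
   next
    case 2
    have "eventually (%k. ?J k q = indicator {?a k..<?b k} q *\<^sub>R ?J k q) sequentially"
     using order_tendstoD(2)[OF alim 2(1)] order_tendstoD(1)[OF blim 2(2)]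
     by eventually_elim (simp add: indicator_def)
    from Lim_transform_eventually[OF Jlim this] show ?thesis using 2 s by simp
   next
    case 3
    then show ?thesis
     by (intro tendsto_eventually eventually_mono[OF order_tendstoD(2)[OF blim 3]]) (simp add: indicator_def)
   qed
  qed
  have "s / 2 < s" using s by simp
  from order_tendstoD(1)[OF alim this] Jbd
  show "eventually (%k. AE q in lborel. norm (indicator {?a k..<?b k} q *\<^sub>R ?J k q) <= indicator {s / 2..t} q * D) sequentially"
  proof eventually_elim
   case (elim k)
   have "?b k <= t" using tau_pos[of k] by (simp add: pos_le_divide_eq[symmetric])
   then show ?case using elim by (intro AE_I2) (auto simp: indicator_def)
  qed
 qed simp
 note lim = tendsto_mult_left[OF this, of "1/2"]
 have "(%k. (LINT x|lborel. f x \<bullet> approx_sol k t x) - (LINT x|lborel. f x \<bullet> approx_sol k s x))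
  \<longlonglongrightarrow> (1/2) * (LINT q:{s..t}|lborel. ?Jlim q)"
  unfolding set_lebesgue_integral_def approx_weak_form(1)[OF fs less_imp_le[OF s(1)] less_imp_le[OF s(2)]] by (rule lim)
 moreover have "(%k. (LINT x|lborel. f x \<bullet> approx_sol k t x) - (LINT x|lborel. f x \<bullet> approx_sol k s x))
  \<longlonglongrightarrow> (LINT x|lborel. f x \<bullet> p t x) - (LINT x|lborel. f x \<bullet> p s x)"
  using s by (intro tendsto_diff inner_approx_sol_tendsto fs) auto
 ultimately show ?thesis by (rule LIMSEQ_unique[rotated])
qed

end

section \<open>The total density solves the heat equation\<close>

definition ones :: "real^'d" where "ones = (\<chi> i. 1)"

lemma inner_ones [simp]: "ones \<bullet> x = total x"
 by (simp add: inner_vec_def ones_def total_def)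

lemma interval_integral_close:
 fixes J :: "real => real"
 assumes J: "J \<in> borel_measurable borel" and st: "s <= t" and le: "!!q. q \<in> {s..t} ==> \<bar>J q - c\<bar> <= B"
 shows "\<bar>(LINT q:{s..t}|lborel. J q) - (t - s) * c\<bar> <= (t - s) * B"
proof -
 have ii: "set_integrable lborel {s..t} (%q. J q - c)"
  unfolding set_integrable_def
 proof (rule Bochner_Integration.integrable_bound)
  show "integrable lborel (%q. indicator {s..t} q * B)" by simp
  show "AE q in lborel. norm (indicator {s..t} q *\<^sub>R (J q - c)) <= norm (indicator {s..t} q * B)"
   using le by (intro AE_I2) (force simp: indicator_def)
 qed (use J in measurable)
 have cc: "set_integrable lborel {s..t} (%q. c)" by (simp add: set_integrable_def)
 have "(LINT q:{s..t}|lborel. (J q - c) + c) = (LINT q:{s..t}|lborel. J q - c) + (LINT q:{s..t}|lborel. c)"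
  by (rule set_integral_add(2)[OF ii cc])
 then have e: "(LINT q:{s..t}|lborel. J q) - (t - s) * c = (LINT q:{s..t}|lborel. J q - c)"
  using st by (simp add: set_lebesgue_integral_def)
 have "norm (LINT q:{s..t}|lborel. J q - c) <= (LINT q|lborel. indicator {s..t} q * B)"
  unfolding set_lebesgue_integral_def
 proof (rule Bochner_Integration.integral_norm_bound_integral)
  show "integrable lborel (%q. indicator {s..t} q *\<^sub>R (J q - c))" using ii by (simp add: set_integrable_def)
  show "norm (indicator {s..t} q *\<^sub>R (J q - c)) <= indicator {s..t} q * B" for q using le by (simp add: indicator_def)
 qed simp
 also have "... = (t - s) * B" using st by simp
 finally show ?thesis unfolding e by simp
qed

context grid_solution
begin

lemma integrable_mult_mass:
 assumes t: "t > 0" and f: "f \<in> borel_measurable borel" and le: "!!x. \<bar>f x\<bar> <= B"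
 shows "integrable lborel (%x. f x * total (p t x))" "\<bar>LINT x|lborel. f x * total (p t x)\<bar> <= B"
proof -
 note m = p_mass[OF t]
 have tm: "(%x. total (p t x)) \<in> borel_measurable borel" using borel_measurable_integrable[OF m(1)] by simp
 have n: "norm (f x * total (p t x)) <= B * total (p t x)" for x
  using le[of x] total_nonneg[OF p_nonneg, of t x] by (auto simp: abs_mult intro!: mult_right_mono)
 have Bi: "integrable lborel (%x. B * total (p t x))" using m(1) by simp
 show i: "integrable lborel (%x. f x * total (p t x))"
 proof (rule Bochner_Integration.integrable_bound[OF Bi])
  show "AE x in lborel. norm (f x * total (p t x)) <= norm (B * total (p t x))"
   using n abs_ge_self order_trans by (intro AE_I2) fastforce
 qed (use f tm in measurable)
 have B0: "0 <= B" using le[of 0] by linarith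
 have "norm (LINT x|lborel. f x * total (p t x)) <= (LINT x|lborel. B * total (p t x))"
  by (rule Bochner_Integration.integral_norm_bound_integral[OF i Bi n])
 also have "... = B * (LINT x|lborel. total (p t x))" by simp
 also have "... <= B * 1" by (intro mult_left_mono m B0)
 finally show "\<bar>LINT x|lborel. f x * total (p t x)\<bar> <= B" by simp
qed

text \<open>Duality: the kernel with remaining time T0 + d - s solves the backward heat equation in
  s, so its pairing with the total density does not change. The offset d > 0 keeps the kernel smooth
  up to s = T0.\<close>

lemma heat_mass_constant:
 assumes T0: "T0 > 0" and d: "d > 0" and s: "0 < s" "s <= T0"
 shows "(LINT x|lborel. heat_kernel d (x - y) * total (p T0 x)) = (LINT x|lborel. heat_kernel (T0 + d - s) (x - y) * total (p s x))"
proof -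
 define u where "u = (%s. LINT x|lborel. heat_kernel (T0 + d - s) (x - y) * total (p s x))"
 define N where "N = (norm (ones :: real^'d))\<^sup>2 * (8 / (d * sqrt d))\<^sup>2 * max 1 (T0 + d) * (LINT x|lborel. 1 / (1 + (x::real)\<^sup>2))"
 define C where "C = (1/2) * (sqrt N * sqrt (K * \<theta> ^ 3 / (s * sqrt s))) + 3 / (d\<^sup>2 * sqrt d) * sqrt T0"
 have I0: "0 <= (LINT x|lborel. 1 / (1 + (x::real)\<^sup>2))" by (intro Bochner_Integration.integral_nonneg) simp
 have "u T0 = u s"
 \<comment> \<open>The weak form has test functions that do not depend on time, so on a short
   interval the kernel is frozen at its value for the right end point. Two errors remain: the
   variation of p, of order 1/2 in L2 and hence 3/2 after integration in time, and the Taylor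
   remainder of the kernel, of order 2.\<close>
 proof (rule constant_of_superlinear[OF s(2)])
  fix s1 t1 assume st: "s <= s1" "s1 < t1" "t1 <= T0"
  define a b where "a = T0 + d - t1" and "b = T0 + d - s1"
  have a: "0 < a" "d <= a" "a <= T0 + d" and b: "0 < b" and ab: "a <= b" "b - a = t1 - s1"
   using st s d by (auto simp: a_def b_def)
  have s1: "0 < s1" "0 < t1" using st s by auto
  note p1 = prim_heat_kernel(1)[OF a(1), of y "ones :: real^'d"] and p2 = prim_heat_kernel(2)[OF a(1), of y "ones :: real^'d"]
  define J where "J = (%q. LINT x|lborel. heat_xx a (x - y) * total (p q x))"
  have "u t1 - (LINT x|lborel. heat_kernel a (x - y) * total (p s1 x)) = (1/2) * (LINT q:{s1..t1}|lborel. J q)"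
   using weak_form_smooth[OF p1 p2 s1(1) st(2)] by (simp add: u_def J_def a_def total_F p_nonneg)
  have J_eq: "J q = (LINT x|lborel. (heat_xx a (x - y) *\<^sub>R ones) \<bullet> p q x)" for q by (simp add: J_def)
  have xm: "(%x. heat_xx a (x - y) *\<^sub>R (ones :: real^'d)) \<in> borel_measurable borel" using primD(2)[OF p2] by (simp add: sq_int_def)
  have Jm: "J \<in> borel_measurable borel" unfolding J_eq using xm by measurable
  have N: "n2 (%x. heat_xx a (x - y) *\<^sub>R (ones :: real^'d)) <= N"
  proof -
   have xm: "heat_xx a \<in> borel_measurable borel" unfolding heat_xx_def by measurable
   have "n2 (%x. heat_xx a (x - y) *\<^sub>R (ones :: real^'d)) <= (norm (ones :: real^'d))\<^sup>2 * (8 / (a * sqrt a))\<^sup>2 * max 1 a * (LINT x|lborel. 1 / (1 + (x::real)\<^sup>2))"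
    by (rule sq_int_of_decay(2)[OF a(1) xm heat_kernel_bounds(3)[OF a(1)]])
   also have "... <= N"
   proof -
    have "8 / (a * sqrt a) <= 8 / (d * sqrt d)" using a d by (intro divide_left_mono mult_mono mult_pos_pos) auto
    then have "(8 / (a * sqrt a))\<^sup>2 <= (8 / (d * sqrt d))\<^sup>2" using a by (intro power_mono) auto
    then show ?thesis unfolding N_def using a(3) I0
     by (intro mult_right_mono mult_mono mult_left_mono) (auto simp: max_def intro!: mult_nonneg_nonneg)
   qed
   finally show ?thesis .
  qed
  have Jc: "\<bar>J q - J s1\<bar> <= sqrt N * sqrt (K * \<theta> ^ 3 / (s * sqrt s)) * sqrt (t1 - s1)" if q: "q \<in> {s1..t1}" for q
  proof -
   have "J q - J s1 = (LINT x|lborel. (heat_xx a (x - y) *\<^sub>R ones) \<bullet> (p q x - p s1 x))"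
    unfolding J_eq inner_diff_right
    by (rule Bochner_Integration.integral_diff[symmetric]) (intro integrable_inner_sq(1) primD[OF p2] p_sq_all)+
   also have "\<bar>...\<bar> <= sqrt (n2 (%x. heat_xx a (x - y) *\<^sub>R (ones :: real^'d))) * sqrt (n2 (%x. p q x - p s1 x))"
    by (intro integrable_inner_sq(2) primD[OF p2] sq_int_diff p_sq_all)
   also have "... <= sqrt N * sqrt (K * \<theta> ^ 3 / (s * sqrt s) * (t1 - s1))"
   proof (intro mult_mono real_sqrt_le_mono N)
    have "n2 (%x. p q x - p s1 x) <= K * \<theta> ^ 3 * (q - s1) / (s1 * sqrt s1)" using q s1 by (intro n2_p_diff_le) auto
    also have "... <= K * \<theta> ^ 3 * (t1 - s1) / (s * sqrt s)"
     using q st s K_pos theta_pos by (intro frac_le mult_left_mono mult_mono mult_pos_pos mult_nonneg_nonneg) auto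
    finally show "n2 (%x. p q x - p s1 x) <= K * \<theta> ^ 3 / (s * sqrt s) * (t1 - s1)" by simp
   qed (use order_trans[OF n2_nonneg N] in auto)
   finally show ?thesis unfolding real_sqrt_mult[of "K * \<theta> ^ 3 / (s * sqrt s)" "t1 - s1"] by (simp only: mult.assoc)
  qed
  have close: "\<bar>(LINT q:{s1..t1}|lborel. J q) - (t1 - s1) * J s1\<bar>
   <= (t1 - s1) * (sqrt N * sqrt (K * \<theta> ^ 3 / (s * sqrt s)) * sqrt (t1 - s1))"
   by (rule interval_integral_close[OF Jm less_imp_le[OF st(2)] Jc])
  let ?E = "%x. heat_kernel b (x - y) - heat_kernel a (x - y) - (b - a) * (heat_xx a (x - y) / 2)"
  have hb: "\<bar>heat_kernel c (x - y)\<bar> <= 8 / sqrt c" if "c > 0" for c x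
  proof -
   have "\<bar>heat_kernel c (x - y)\<bar> <= (8 / sqrt c) / (1 + (x - y)\<^sup>2 / c)" by (rule heat_kernel_bounds(1)[OF that])
   also have "... <= (8 / sqrt c) / 1" using that by (intro divide_left_mono) (auto intro!: add_pos_nonneg)
   finally show ?thesis by simp
  qed
  have xb: "\<bar>heat_xx a (x - y)\<bar> <= 8 / (a * sqrt a)" for x
  proof -
   have "\<bar>heat_xx a (x - y)\<bar> <= (8 / (a * sqrt a)) / (1 + (x - y)\<^sup>2 / a)" by (rule heat_kernel_bounds(3)[OF a(1)])
   also have "... <= (8 / (a * sqrt a)) / 1" using a by (intro divide_left_mono) (auto intro!: add_pos_nonneg)
   finally show ?thesis by simp
  qed
  have hm: "(%x. heat_kernel c (x - y)) \<in> borel_measurable borel" for c by measurable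
  have xxm: "(%x. heat_xx a (x - y)) \<in> borel_measurable borel" unfolding heat_xx_def by measurable
  note ia = integrable_mult_mass(1)[OF s1(1) hm hb[OF a(1)]] and ib = integrable_mult_mass(1)[OF s1(1) hm hb[OF b]]
   and ix = integrable_mult_mass(1)[OF s1(1) xxm xb]
  have Em: "?E \<in> borel_measurable borel" using hm xxm by measurable
  have "\<bar>?E x\<bar> <= 3 / (d\<^sup>2 * sqrt d) * (t1 - s1)\<^sup>2" for x
  proof -
   have "\<bar>?E x\<bar> <= 3 / (a\<^sup>2 * sqrt a) * (b - a)\<^sup>2" by (rule heat_kernel_time_expansion(2)[OF a(1) ab(1)])
   also have "... <= 3 / (d\<^sup>2 * sqrt d) * (b - a)\<^sup>2"
    using a d by (intro mult_right_mono divide_left_mono mult_mono power_mono mult_pos_pos) auto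
   finally show ?thesis by (simp add: ab)
  qed
  from integrable_mult_mass(2)[OF s1(1) Em this]
  have E: "\<bar>LINT x|lborel. ?E x * total (p s1 x)\<bar> <= 3 / (d\<^sup>2 * sqrt d) * (t1 - s1)\<^sup>2" .
  have "(LINT x|lborel. ?E x * total (p s1 x)) = u s1 - (LINT x|lborel. heat_kernel a (x - y) * total (p s1 x)) - (t1 - s1) / 2 * J s1"
  proof -
   have "?E x * total (p s1 x) = heat_kernel b (x - y) * total (p s1 x) - heat_kernel a (x - y) * total (p s1 x)
    - (t1 - s1) / 2 * (heat_xx a (x - y) * total (p s1 x))" for x unfolding ab(2) by (simp add: algebra_simps)
   then show ?thesis using ia ib ix by (simp add: u_def J_def b_def)
  qed
  \<comment> \<open>The first order parts in the motion of the solution and of the kernel cancel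
    because the total of the flux is the total of p.\<close>
  then have ut: "u t1 - u s1 = (1/2) * ((LINT q:{s1..t1}|lborel. J q) - (t1 - s1) * J s1) - (LINT x|lborel. ?E x * total (p s1 x))"
   using \<open>u t1 - _ = _\<close> by (simp add: field_simps)
  have combine: "\<bar>(1/2) * A - B\<bar> <= (1/2) * a + b" if "\<bar>A\<bar> <= a" "\<bar>B\<bar> <= b" for A B a b :: real
   using that unfolding abs_le_iff by linarith
  have "\<bar>u t1 - u s1\<bar> <= (1/2) * ((t1 - s1) * (sqrt N * sqrt (K * \<theta> ^ 3 / (s * sqrt s)) * sqrt (t1 - s1))) + 3 / (d\<^sup>2 * sqrt d) * (t1 - s1)\<^sup>2"
   unfolding ut by (rule combine[OF close E])
  also have "(t1 - s1)\<^sup>2 = (t1 - s1) * sqrt (t1 - s1) * sqrt (t1 - s1)" using st by (simp add: power2_eq_square mult.assoc)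
  \<comment> \<open>One of the two factors sqrt (t1 - s1) is bounded by sqrt T0, which brings the
    Taylor error to order 3/2 as well.\<close>
  also have "3 / (d\<^sup>2 * sqrt d) * ((t1 - s1) * sqrt (t1 - s1) * sqrt (t1 - s1)) <= 3 / (d\<^sup>2 * sqrt d) * ((t1 - s1) * sqrt (t1 - s1) * sqrt T0)"
   using st s d by (intro mult_left_mono) auto
  also have "(1/2) * ((t1 - s1) * (sqrt N * sqrt (K * \<theta> ^ 3 / (s * sqrt s)) * sqrt (t1 - s1)))
   + 3 / (d\<^sup>2 * sqrt d) * ((t1 - s1) * sqrt (t1 - s1) * sqrt T0) = C * ((t1 - s1) * sqrt (t1 - s1))"
  proof -
   have "(1/2) * (D * (Y * S)) + Z * (D * S * R) = ((1/2) * Y + Z * R) * (D * S)" for D Y S Z R :: real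
    by (simp add: algebra_simps)
   then show ?thesis unfolding C_def .
  qed
  finally show "\<bar>u t1 - u s1\<bar> <= C * ((t1 - s1) * sqrt (t1 - s1))" by simp
 qed
 then show ?thesis by (simp add: u_def)
qed

end

text \<open>The initial condition is stated for the lattice data tested with cell averages of H1
  functions; \<open>a0\<close> carries the proportions \<alpha>.\<close>

locale grid_cauchy = grid_solution F G L c b M m0 eps p
 for F :: "real^'d => real^'d" and G L c b M m0 eps p +
 fixes \<mu> :: "real measure" and a0 :: "real^'d"
 assumes mu: "prob_space \<mu>" "sets \<mu> = sets borel" and a0: "total a0 = 1"
  and init: "!!v g. prim v g ==> (%k. zs (%j. cell_avg (eps k) v j \<bullet> m0 k j)) \<longlonglongrightarrow> (LINT x|\<mu>. v x \<bullet> a0)"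
begin

lemma mu_measurable: "f \<in> borel_measurable borel ==> f \<in> borel_measurable \<mu>" for f :: "real => real"
 using mu(2) by (simp cong: measurable_cong_sets)

lemma heat_kernel_integrable:
 assumes "t > 0" shows "integrable \<mu> (%x. heat_kernel t (x - y))"
proof -
 interpret prob_space \<mu> by (rule mu)
 show ?thesis
 proof (rule integrable_const_bound[where B = "8 / sqrt t"])
  show "AE x in \<mu>. norm (heat_kernel t (x - y)) <= 8 / sqrt t"
  proof (intro AE_I2)
   fix x
   have "\<bar>heat_kernel t (x - y)\<bar> <= (8 / sqrt t) / (1 + (x - y)\<^sup>2 / t)" by (rule heat_kernel_bounds(1)[OF assms])
   also have "... <= (8 / sqrt t) / 1" using assms by (intro divide_left_mono) (auto intro!: add_pos_nonneg)
   finally show "norm (heat_kernel t (x - y)) <= 8 / sqrt t" by simp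
  qed
 qed (rule mu_measurable, measurable)
qed

lemma initial_pairing_tendsto:
 assumes v: "prim v g"
 shows "((%t. LINT x|lborel. v x \<bullet> p t x) \<longlongrightarrow> (LINT x|\<mu>. v x \<bullet> a0)) (at_right 0)"
proof -
 let ?W = "%t. r * (sqrt K * sqrt (10 * n2 g)) * (4 * sqrt (sqrt (t / (2 * r))))"
 have "(?W \<longlongrightarrow> r * (sqrt K * sqrt (10 * n2 g)) * (4 * sqrt (sqrt (0 / (2 * r))))) (at_right 0)"
  unfolding divide_inverse by (intro tendsto_intros)
 then have "(?W \<longlongrightarrow> 0) (at_right 0)" by simp
 moreover have "eventually (%t. norm ((LINT x|lborel. v x \<bullet> p t x) - (LINT x|\<mu>. v x \<bullet> a0)) <= ?W t) (at_right 0)"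
  using eventually_at_right_less[of 0] by eventually_elim (use initial_pairing[OF v _ init[OF v]] in simp)
 ultimately have "((%t. (LINT x|lborel. v x \<bullet> p t x) - (LINT x|\<mu>. v x \<bullet> a0)) \<longlongrightarrow> 0) (at_right 0)" by (rule Lim_null_comparison[rotated])
 then show ?thesis by (rule LIM_zero_cancel)
qed

text \<open>Let s tend to zero in \<open>heat_mass_constant\<close>. Replacing the kernel at time T0
  + d - s by the one at T0 + d costs a multiple of s, after which the test function is fixed and the
  initial condition applies.\<close>

lemma heat_mass_eq:
 assumes T0: "T0 > 0" and d: "d > 0"
 shows "(LINT x|lborel. heat_kernel d (x - y) * total (p T0 x)) = (LINT x|\<mu>. heat_kernel (T0 + d) (x - y))"
proof -
 have Td: "0 < T0 + d" using T0 d by simp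
 note p1 = prim_heat_kernel(1)[OF Td, of y "ones :: real^'d"]
 let ?u = "LINT x|lborel. heat_kernel d (x - y) * total (p T0 x)"
 let ?v = "%s. LINT x|lborel. heat_kernel (T0 + d) (x - y) * total (p s x)"
 have lim: "(?v \<longlongrightarrow> (LINT x|\<mu>. heat_kernel (T0 + d) (x - y))) (at_right 0)"
  using initial_pairing_tendsto[OF p1] by (simp add: a0)
 have le: "\<bar>?v s - ?u\<bar> <= 4 / (d * sqrt d) * s" if s: "0 < s" "s <= T0" for s
 proof -
  let ?f = "%c x. heat_kernel c (x - y)"
  have bd: "\<bar>?f c x\<bar> <= 8 / sqrt c" if "c > 0" for c x
  proof -
   have "\<bar>?f c x\<bar> <= (8 / sqrt c) / (1 + (x - y)\<^sup>2 / c)" by (rule heat_kernel_bounds(1)[OF that])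
   also have "... <= (8 / sqrt c) / 1" using that by (intro divide_left_mono) (auto intro!: add_pos_nonneg)
   finally show ?thesis by simp
  qed
  have A: "0 < T0 + d - s" "d <= T0 + d - s" using s d by auto
  have m: "?f c \<in> borel_measurable borel" for c by measurable
  note i1 = integrable_mult_mass(1)[OF s(1) m bd[OF Td]] and i2 = integrable_mult_mass(1)[OF s(1) m bd[OF A(1)]]
  have E: "\<bar>?f (T0 + d) x - ?f (T0 + d - s) x\<bar> <= 4 / (d * sqrt d) * s" for x
  proof -
   have "\<bar>?f (T0 + d) x - ?f (T0 + d - s) x\<bar> <= 4 / ((T0 + d - s) * sqrt (T0 + d - s)) * (T0 + d - (T0 + d - s))"
    using s by (intro heat_kernel_time_expansion(1) A) simp
   also have "... <= 4 / (d * sqrt d) * (T0 + d - (T0 + d - s))"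
    using A d s by (intro mult_right_mono divide_left_mono mult_mono mult_pos_pos) auto
   finally show ?thesis by simp
  qed
  have "(%x. ?f (T0 + d) x - ?f (T0 + d - s) x) \<in> borel_measurable borel" using m by measurable
  from integrable_mult_mass(2)[OF s(1) this E]
  show ?thesis unfolding heat_mass_constant[OF T0 d s] using i1 i2 by (simp add: left_diff_distrib)
 qed
 have ev: "eventually (%s. 0 < s & s <= T0) (at_right (0::real))"
  unfolding eventually_at_right_field using T0 by (auto intro!: exI[of _ T0])
 have "((%s. ?v s - ?u) \<longlongrightarrow> 0) (at_right 0)"
 proof (rule Lim_null_comparison)
  show "eventually (%s. norm (?v s - ?u) <= 4 / (d * sqrt d) * s) (at_right 0)"
   using ev by eventually_elim (use le in simp)
  have "((%s. 4 / (d * sqrt d) * s) \<longlongrightarrow> 4 / (d * sqrt d) * 0) (at_right 0)" by (intro tendsto_intros)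
  then show "((%s. 4 / (d * sqrt d) * s) \<longlongrightarrow> 0) (at_right 0)" by simp
 qed
 then have "(?v \<longlongrightarrow> ?u) (at_right 0)" by (rule LIM_zero_cancel)
 from tendsto_unique[OF _ this lim] show ?thesis by simp
qed

text \<open>Let d tend to zero in \<open>heat_mass_eq\<close>. Since \<open>total (p t)\<close> is
  continuous and bounded, the approximate identity recovers its value at y, so the formula holds at
  every point and not only almost everywhere.\<close>

theorem total_eq_heat_conv:
 assumes t: "t > 0" shows "total (p t y) = heat_conv \<mu> t y"
proof -
 interpret prob_space \<mu> by (rule mu)
 define d where "d = (%n. 1 / real (Suc n))"
 have d: "d n > 0" for n by (simp add: d_def)
 have dl: "d \<longlonglongrightarrow> 0" unfolding d_def using LIMSEQ_inverse_real_of_nat by (simp add: inverse_eq_divide)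
 have tc: "continuous_on UNIV (%x. total (p t x))"
  unfolding total_def by (intro continuous_intros p_slice_continuous t)
 have tb: "\<bar>total (p t x)\<bar> <= real CARD('d) * sqrt (2 * K * \<theta>\<^sup>2 / t)" for x
 proof -
  have "\<bar>total (p t x)\<bar> <= real CARD('d) * norm (p t x)" by (rule abs_total_le)
  also have "... <= real CARD('d) * sqrt (2 * K * \<theta>\<^sup>2 / t)" by (intro mult_left_mono real_le_rsqrt norm2_p_le t) simp
  finally show ?thesis .
 qed
 have 1: "(%n. LINT x|\<mu>. heat_kernel (t + d n) (x - y)) \<longlonglongrightarrow> total (p t y)"
  using heat_kernel_approximate_identity[OF tc tb d dl] unfolding heat_mass_eq[OF t d] .
 have "(%n. (LINT x|\<mu>. heat_kernel (t + d n) (x - y)) - (LINT x|\<mu>. heat_kernel t (x - y))) \<longlonglongrightarrow> 0"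
 proof (rule Lim_null_comparison)
  show "(%n. 4 / (t * sqrt t) * d n) \<longlonglongrightarrow> 0" by (rule tendsto_eq_intros dl refl | simp)+
  show "eventually (%n. norm ((LINT x|\<mu>. heat_kernel (t + d n) (x - y)) - (LINT x|\<mu>. heat_kernel t (x - y))) <= 4 / (t * sqrt t) * d n) sequentially"
  proof (intro always_eventually allI)
   fix n
   have td: "0 < t + d n" using t d[of n] by simp
   note ii = heat_kernel_integrable[OF td, of y] heat_kernel_integrable[OF t, of y]
   have "norm (LINT x|\<mu>. heat_kernel (t + d n) (x - y) - heat_kernel t (x - y)) <= (LINT x|\<mu>. 4 / (t * sqrt t) * d n)"
   proof (rule Bochner_Integration.integral_norm_bound_integral)
    show "norm (heat_kernel (t + d n) (x - y) - heat_kernel t (x - y)) <= 4 / (t * sqrt t) * d n" for x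
     using heat_kernel_time_expansion(1)[OF t, of "t + d n" "x - y"] d[of n] by simp
   qed (use ii in auto)
   then show "norm ((LINT x|\<mu>. heat_kernel (t + d n) (x - y)) - (LINT x|\<mu>. heat_kernel t (x - y))) <= 4 / (t * sqrt t) * d n"
    using ii by (simp add: prob_space)
  qed
 qed
 then have "(%n. LINT x|\<mu>. heat_kernel (t + d n) (x - y)) \<longlonglongrightarrow> (LINT x|\<mu>. heat_kernel t (x - y))" by (rule LIM_zero_cancel)
 from LIMSEQ_unique[OF 1 this] show ?thesis by (simp add: heat_conv_def heat_kernel_even)
qed

lemma p_nonzero:
 assumes t: "t > 0" shows "p t y ~= 0"
proof
 interpret prob_space \<mu> by (rule mu)
 assume "p t y = 0"
 then have z: "(LINT x|\<mu>. heat_kernel t (x - y)) = 0" using total_eq_heat_conv[OF t, of y] by (simp add: heat_conv_def heat_kernel_even)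
 have "AE x in \<mu>. heat_kernel t (x - y) = 0"
  using integral_nonneg_eq_0_iff_AE[OF heat_kernel_integrable[OF t, of y]] z heat_kernel_pos[OF t] by (simp add: less_imp_le)
 then have "AE x in \<mu>. False" by (rule eventually_mono) (use heat_kernel_pos[OF t] in \<open>metis less_irrefl\<close>)
 then show False by simp
qed

end

section \<open>The weak form\<close>

locale flux_solution = rates lam + grid_cauchy "flux lam" G L c b M m0 eps p \<mu> a0
 for lam :: "'d::finite => real" and G L c b M m0 eps p \<mu> a0
begin

definition Apx :: "real => real => real^'d" where
 "Apx t x = mat_A lam (p t x) *v px t x"

abbreviation "Fp t \<equiv> (%x. flux lam (p t x))"

lemma Apx_eq: "t > 0 ==> 2 *\<^sub>R Apx t x = dflux lam (quot lam (p t x)) (wgt lam (p t x)) (px t x)"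
 unfolding Apx_def by (rule mat_A_eq[OF p_nonneg p_nonzero])

lemma Apx_nonpos: "t <= 0 ==> Apx t x = 0"
 by (simp add: Apx_def px_def)

lemma weighted_nz: "t > 0 ==> weighted lam (p t x) ~= 0"
 using weighted_pos[OF p_nonneg p_nonzero, of t x] by simp

lemma scale_by_continuous: "continuous_on UNIV (scale_by lam)"
 unfolding scale_by_def by (intro continuous_intros)

lemma coefficients_continuous:
 assumes t: "t > 0"
 shows "continuous_on UNIV (%x. quot lam (p t x))" "continuous_on UNIV (%x. wgt lam (p t x))"
proof -
 note c = p_slice_continuous[OF t]
 have w: "continuous_on UNIV (%x. weighted lam (p t x))" unfolding weighted_def by (intro continuous_intros c)
 have tt: "continuous_on UNIV (%x. total (p t x))" unfolding total_def by (intro continuous_intros c)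
 have sc: "continuous_on UNIV (%x. scale_by lam (p t x))" by (rule continuous_on_compose2[OF scale_by_continuous c]) simp
 show "continuous_on UNIV (%x. quot lam (p t x))" unfolding quot_def by (intro continuous_on_divide tt w ballI weighted_nz t)
 show "continuous_on UNIV (%x. wgt lam (p t x))" unfolding wgt_def
  by (intro continuous_on_scaleR continuous_on_divide continuous_on_const w sc ballI weighted_nz t)
qed

lemma dflux_measurable:
 assumes [measurable]: "u \<in> borel_measurable borel" "w \<in> borel_measurable borel" "y \<in> borel_measurable borel"
 shows "(%x. dflux lam (u x) (w x) (y x)) \<in> borel_measurable (borel :: real measure)"
proof -
 have [measurable]: "scale_by lam \<in> borel_measurable borel" "total \<in> borel_measurable (borel :: (real^'d) measure)"
  "weighted lam \<in> borel_measurable borel"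
  unfolding total_def weighted_def by (intro borel_measurable_continuous_onI scale_by_continuous) measurable
 show ?thesis unfolding dflux_def by measurable
qed

lemma coefficient_bounds:
 assumes "t > 0"
 shows "1 / lmax <= quot lam (p t x)" "quot lam (p t x) <= 1 / lmin" "wgt lam (p t x) \<in> nonneg" "total (wgt lam (p t x)) = 1"
 by (intro quot_bounds wgt_nonneg total_wgt p_nonneg p_nonzero assms)+

lemma Apx_sq: "sq_int (Apx t)"
proof (cases "t > 0")
 case True
 have pxs: "sq_int (px t)" by (rule primD[OF prim_p_all])
 then have pm: "px t \<in> borel_measurable borel" by (simp add: sq_int_def)
 have m: "(%x. dflux lam (quot lam (p t x)) (wgt lam (p t x)) (px t x)) \<in> borel_measurable borel"
  by (intro dflux_measurable borel_measurable_continuous_onI coefficients_continuous True pm)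
 have "sq_int (%x. dflux lam (quot lam (p t x)) (wgt lam (p t x)) (px t x))"
 proof (rule sq_int_bound(1)[OF m])
  show "integrable lborel (%x. Lip\<^sup>2 * (norm (px t x))\<^sup>2)" using sq_int_integrable[OF pxs] by simp
  show "AE x in lborel. (norm (dflux lam (quot lam (p t x)) (wgt lam (p t x)) (px t x)))\<^sup>2 <= Lip\<^sup>2 * (norm (px t x))\<^sup>2"
   unfolding power_mult_distrib[symmetric] by (intro AE_I2 power_mono norm_dflux_le coefficient_bounds True) simp
 qed
 then have "sq_int (%x. (1/2) *\<^sub>R (2 *\<^sub>R Apx t x))" unfolding Apx_eq[OF True] by (rule sq_int_scaleR)
 then show ?thesis by simp
next
 case False
 then have "Apx t = (%x. 0)" by (intro ext Apx_nonpos) simp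
 then show ?thesis by (simp add: sq_int_def)
qed

definition hs :: "nat => real" where "hs n = 1 / real (Suc n)"

lemma hs_pos: "hs n > 0" by (simp add: hs_def)
lemma hs_0: "hs \<longlonglongrightarrow> 0" unfolding hs_def using LIMSEQ_inverse_real_of_nat by (simp add: inverse_eq_divide)
lemma hs_lim: "filterlim hs (at_right 0) sequentially"
 by (simp add: filterlim_at hs_0 hs_pos less_imp_neq[OF hs_pos, symmetric])

lemma dq_flux_sq:
 assumes t: "t > 0" shows "sq_int (dq h (Fp t))" "h > 0 ==> n2 (dq h (Fp t)) <= L\<^sup>2 * (10 * n2 (px t))"
proof -
 show s: "sq_int (dq h (Fp t))" by (intro sq_int_dq Fp_sq)
 show "n2 (dq h (Fp t)) <= L\<^sup>2 * (10 * n2 (px t))" if h: "h > 0"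
 proof -
  have i: "integrable lborel (%x. L\<^sup>2 * (norm (dq h (p t) x))\<^sup>2)" using sq_int_integrable[OF sq_int_dq[OF p_sq_all]] by simp
  have "norm (dq h (Fp t) x) <= L * norm (dq h (p t) x)" for x
  proof -
   have "(1 / h) * norm (flux lam (p t (x + h)) - flux lam (p t x)) <= (1 / h) * (L * norm (p t (x + h) - p t x))"
    using h by (intro mult_left_mono F_lipschitz p_nonneg) auto
   then show ?thesis using h by (simp add: dq_def mult_ac)
  qed
  then have "AE x in lborel. (norm (dq h (Fp t) x))\<^sup>2 <= L\<^sup>2 * (norm (dq h (p t) x))\<^sup>2"
   unfolding power_mult_distrib[symmetric] by (intro AE_I2 power_mono) auto
  from sq_int_bound(2)[OF _ i this] s have "n2 (dq h (Fp t)) <= L\<^sup>2 * n2 (dq h (p t))" by (simp add: sq_int_def n2_def)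
  also have "... <= L\<^sup>2 * (10 * n2 (px t))" by (intro mult_left_mono n2_dq_le[OF prim_p_all h]) simp
  finally show ?thesis .
 qed
qed

text \<open>The chain rule in L2. By \<open>flux_diff_exact\<close> the quotient of the flux is
  \<open>dflux\<close> with the coefficient \<open>quot\<close> at x + h and the weights at x,
  applied to the quotient of p. In A the quotient of p has not yet reached \<open>px\<close>, in B
  the coefficient has not yet reached its limit; A is small in norm and B by dominated
  convergence.\<close>

lemma dq_flux_tendsto:
 assumes t: "t > 0" shows "(%n. n2 (%x. dq (hs n) (Fp t) x - 2 *\<^sub>R Apx t x)) \<longlonglongrightarrow> 0"
proof -
 let ?u = "%x. quot lam (p t x)" and ?w = "%x. wgt lam (p t x)" and ?y = "px t"
 have ys: "sq_int ?y" by (rule primD[OF prim_p_all])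
 have ym: "?y \<in> borel_measurable borel" using ys by (simp add: sq_int_def)
 have um: "(%x. ?u (x + h)) \<in> borel_measurable borel" for h
  by (intro borel_measurable_continuous_onI continuous_on_compose2[OF coefficients_continuous(1)[OF t]] continuous_intros) simp
 have wm: "?w \<in> borel_measurable borel" by (intro borel_measurable_continuous_onI coefficients_continuous t)
 define A where "A = (%n x. dflux lam (?u (x + hs n)) (?w x) (dq (hs n) (p t) x - ?y x))"
 define B where "B = (%n x. dflux lam (?u (x + hs n)) (?w x) (?y x) - dflux lam (?u (x + 0)) (?w x) (?y x))"
 have ds: "sq_int (%x. dq (hs n) (p t) x - ?y x)" for n by (intro sq_int_diff sq_int_dq p_sq_all ys)
 have Am: "A n \<in> borel_measurable borel" for n
  unfolding A_def by (intro dflux_measurable um wm) (use ds in \<open>simp add: sq_int_def\<close>)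
 have Bm: "B n \<in> borel_measurable borel" for n
  unfolding B_def by (intro borel_measurable_diff dflux_measurable um wm ym)
 have eq: "dq (hs n) (Fp t) x - 2 *\<^sub>R Apx t x = A n x + B n x" for n x
 proof -
  have "dq (hs n) (Fp t) x = dflux lam (?u (x + hs n)) (?w x) (dq (hs n) (p t) x)"
   by (simp add: dq_def flux_diff_exact p_nonneg p_nonzero t dflux_simps(3))
  then show ?thesis by (simp add: A_def B_def Apx_eq[OF t] dflux_simps(2))
 qed
 have AE: "AE x in lborel. (norm (A n x))\<^sup>2 <= Lip\<^sup>2 * (norm (dq (hs n) (p t) x - ?y x))\<^sup>2" for n
  unfolding power_mult_distrib[symmetric] A_def by (intro AE_I2 power_mono norm_dflux_le coefficient_bounds t) simp
 have Ai: "integrable lborel (%x. Lip\<^sup>2 * (norm (dq (hs n) (p t) x - ?y x))\<^sup>2)" for n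
  using sq_int_integrable[OF ds] by simp
 have A: "sq_int (A n)" "n2 (A n) <= Lip\<^sup>2 * n2 (%x. dq (hs n) (p t) x - ?y x)" for n
  using sq_int_bound[OF Am Ai AE] by (simp_all add: n2_def)
 have Bb: "AE x in lborel. (norm (B n x))\<^sup>2 <= (2 * Lip)\<^sup>2 * (norm (?y x))\<^sup>2" for n
 proof (intro AE_I2)
  fix x
  have "norm (B n x) <= norm (dflux lam (?u (x + hs n)) (?w x) (?y x)) + norm (dflux lam (?u (x + 0)) (?w x) (?y x))"
   unfolding B_def by (rule norm_triangle_ineq4)
  also have "... <= Lip * norm (?y x) + Lip * norm (?y x)" by (intro add_mono norm_dflux_le coefficient_bounds t)
  finally show "(norm (B n x))\<^sup>2 <= (2 * Lip)\<^sup>2 * (norm (?y x))\<^sup>2" unfolding power_mult_distrib[symmetric] by (intro power_mono) auto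
 qed
 have Bi: "integrable lborel (%x. (2 * Lip)\<^sup>2 * (norm (?y x))\<^sup>2)" using sq_int_integrable[OF ys] by simp
 have B: "sq_int (B n)" for n by (rule sq_int_bound(1)[OF Bm Bi Bb])
 have Blim: "AE x in lborel. (%n. B n x) \<longlonglongrightarrow> 0"
 proof (intro AE_I2)
  fix x
  have "(%n. x + hs n) \<longlonglongrightarrow> x" by (rule tendsto_eq_intros hs_0 refl | simp)+
  then have "(%n. ?u (x + hs n)) \<longlonglongrightarrow> ?u x"
   using continuous_on_tendsto_compose[OF coefficients_continuous(1)[OF t]] by simp
  then have "(%n. dflux lam (?u (x + hs n)) (?w x) (?y x)) \<longlonglongrightarrow> dflux lam (?u x) (?w x) (?y x)"
   unfolding dflux_def by (intro tendsto_intros)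
  then have "(%n. dflux lam (?u (x + hs n)) (?w x) (?y x) - dflux lam (?u x) (?w x) (?y x)) \<longlonglongrightarrow> 0"
   by (rule LIM_zero)
  then show "(%n. B n x) \<longlonglongrightarrow> 0" by (simp add: B_def)
 qed
 have B0: "(%n. n2 (B n)) \<longlonglongrightarrow> 0" by (rule n2_dominated_tendsto[OF Bm Blim Bi Bb])
 have D0: "(%n. n2 (%x. dq (hs n) (p t) x - ?y x)) \<longlonglongrightarrow> 0"
  using filterlim_compose[OF dq_tendsto[OF prim_imp_antider[OF prim_p_all]] hs_lim] .
 show ?thesis
 proof (rule tendsto_sandwich[where f = "%_. 0"])
  show "(%n. 2 * (Lip\<^sup>2 * n2 (%x. dq (hs n) (p t) x - ?y x)) + 2 * n2 (B n)) \<longlonglongrightarrow> 0"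
   by (rule tendsto_eq_intros D0 B0 refl | simp)+
  show "eventually (%n. n2 (%x. dq (hs n) (Fp t) x - 2 *\<^sub>R Apx t x) <= 2 * (Lip\<^sup>2 * n2 (%x. dq (hs n) (p t) x - ?y x)) + 2 * n2 (B n)) sequentially"
  proof (intro always_eventually allI)
   fix n
   show "n2 (%x. dq (hs n) (Fp t) x - 2 *\<^sub>R Apx t x) <= 2 * (Lip\<^sup>2 * n2 (%x. dq (hs n) (p t) x - ?y x)) + 2 * n2 (B n)"
    unfolding eq using sq_int_add(2)[OF A(1)[of n] B[of n]] A(2)[of n] by simp
  qed
 qed (simp_all add: always_eventually)
qed

lemma inner_dq_left:
 assumes g: "sq_int g" and u: "sq_int u" and h: "h > 0"
 shows "(LINT x|lborel. dq h g x \<bullet> u x) = - (LINT x|lborel. g (x + h) \<bullet> dq h u x)"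
proof -
 note gh = sq_int_shift(1)[OF g, of h] and uh = sq_int_shift(1)[OF u, of h]
 have 1: "(LINT x|lborel. g (x + h) \<bullet> u (x + h)) = (LINT x|lborel. g x \<bullet> u x)"
  using lborel_integral_shift(1)[of "%x. g x \<bullet> u x" h] .
 have "(LINT x|lborel. dq h g x \<bullet> u x) = (1 / h) * (LINT x|lborel. (g (x + h) - g x) \<bullet> u x)" by (simp add: dq_def)
 also have "(LINT x|lborel. (g (x + h) - g x) \<bullet> u x) = (LINT x|lborel. g (x + h) \<bullet> u x) - (LINT x|lborel. g x \<bullet> u x)"
  unfolding inner_diff_left by (intro Bochner_Integration.integral_diff integrable_inner_sq gh g u)
 also have "... = - ((LINT x|lborel. g (x + h) \<bullet> u (x + h)) - (LINT x|lborel. g (x + h) \<bullet> u x))" unfolding 1 by simp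
 also have "(LINT x|lborel. g (x + h) \<bullet> u (x + h)) - (LINT x|lborel. g (x + h) \<bullet> u x) = (LINT x|lborel. g (x + h) \<bullet> (u (x + h) - u x))"
  unfolding inner_diff_right by (intro Bochner_Integration.integral_diff[symmetric] integrable_inner_sq gh uh u)
 finally show ?thesis by (simp add: dq_def)
qed

text \<open>The weak form for H1 test functions. Smoothing f by \<open>moving_avg\<close> gives a
  function with second derivative \<open>dq (hs n) g\<close>, and a discrete integration by parts
  moves this quotient onto the flux, where it converges to twice \<open>Apx\<close>.\<close>

lemma time_derivative:
 assumes f: "prim f g"
 shows "(%q. LINT x|lborel. g x \<bullet> Apx q x) \<in> borel_measurable borel"
  "0 < s ==> s <= q ==> \<bar>LINT x|lborel. g x \<bullet> Apx q x\<bar> <= sqrt (n2 g) * sqrt (L\<^sup>2 * (10 * (K * \<theta> ^ 3 / (s * sqrt s))))"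
  "0 < s ==> s < t ==> (LINT x|lborel. f x \<bullet> p t x) - (LINT x|lborel. f x \<bullet> p s x) = (LINT q:{s..t}|lborel. - (LINT x|lborel. g x \<bullet> Apx q x))"
proof -
 note fs = primD(1)[OF f] and gs = primD(2)[OF f]
 let ?J = "%n q. LINT x|lborel. dq (hs n) g x \<bullet> Fp q x"
 let ?a = "%q. LINT x|lborel. g x \<bullet> Apx q x"
 have Jm: "?J n \<in> borel_measurable borel" for n
 proof -
  have [measurable]: "dq (hs n) g \<in> borel_measurable borel" using sq_int_dq[OF gs] by (simp add: sq_int_def)
  show ?thesis by measurable
 qed
 have Jlim: "(%n. ?J n q) \<longlonglongrightarrow> - 2 * ?a q" for q
 proof (cases "q > 0")
  case True
  have 1: "(%n. n2 (%x. g (x + hs n) - g x)) \<longlonglongrightarrow> 0"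
   using filterlim_compose[OF translation_continuous[OF gs] filterlim_at[THEN iffD2, of hs]] hs_0 less_imp_neq[OF hs_pos, symmetric] by simp
  have "(%n. LINT x|lborel. g (x + hs n) \<bullet> dq (hs n) (Fp q) x) \<longlonglongrightarrow> (LINT x|lborel. g x \<bullet> (2 *\<^sub>R Apx q x))"
   by (rule inner_tendsto[OF gs _ 1 sq_int_scaleR(1)[OF Apx_sq] _ dq_flux_tendsto[OF True]])
    (intro sq_int_shift gs dq_flux_sq True)+
  from tendsto_minus[OF this] show ?thesis
   by (simp add: inner_dq_left gs Fp_sq hs_pos)
 next
  case False
  then have "?J n q = 0" for n by (simp add: p_nonpos)
  moreover have "?a q = 0" using False by (simp add: Apx_nonpos)
  ultimately show ?thesis by simp
 qed
 \<comment> \<open>\<open>px\<close> is chosen separately at each time, so measurability in time is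
   taken from the functions \<open>?J n\<close>, which converge at every time.\<close>
 show am: "?a \<in> borel_measurable borel"
 proof -
  have "(%q. - 2 * ?a q) \<in> borel_measurable borel" by (rule borel_measurable_LIMSEQ_real[OF Jlim Jm])
  then have "(%q. (- 1 / 2) * (- 2 * ?a q)) \<in> borel_measurable borel" by measurable
  then show ?thesis by simp
 qed
 have Jb: "\<bar>?J n q\<bar> <= sqrt (n2 g) * sqrt (L\<^sup>2 * (10 * (K * \<theta> ^ 3 / (s * sqrt s))))" if s: "0 < s" "s <= q" for n s q
 proof -
  have q: "q > 0" using s by simp
  have "\<bar>?J n q\<bar> = \<bar>LINT x|lborel. g (x + hs n) \<bullet> dq (hs n) (Fp q) x\<bar>" by (simp add: inner_dq_left gs Fp_sq hs_pos)
  also have "... <= sqrt (n2 (%x. g (x + hs n))) * sqrt (n2 (dq (hs n) (Fp q)))"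
   by (intro integrable_inner_sq(2) sq_int_shift gs dq_flux_sq q)
  also have "... <= sqrt (n2 g) * sqrt (L\<^sup>2 * (10 * (K * \<theta> ^ 3 / (s * sqrt s))))"
  proof (intro mult_mono real_sqrt_le_mono)
   have "K * \<theta> ^ 3 / (q * sqrt q) <= K * \<theta> ^ 3 / (s * sqrt s)"
    using s K_pos theta_pos by (intro divide_left_mono mult_mono mult_pos_pos) auto
   then have "n2 (px q) <= K * \<theta> ^ 3 / (s * sqrt s)" using prim_p(2)[OF q] by linarith
   then have "L\<^sup>2 * (10 * n2 (px q)) <= L\<^sup>2 * (10 * (K * \<theta> ^ 3 / (s * sqrt s)))" by (intro mult_left_mono) auto
   then show "n2 (dq (hs n) (Fp q)) <= L\<^sup>2 * (10 * (K * \<theta> ^ 3 / (s * sqrt s)))" using dq_flux_sq(2)[OF q hs_pos[of n]] by linarith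
  qed (auto simp: sq_int_shift(2)[OF gs])
  finally show ?thesis .
 qed
 show "\<bar>?a q\<bar> <= sqrt (n2 g) * sqrt (L\<^sup>2 * (10 * (K * \<theta> ^ 3 / (s * sqrt s))))" if s: "0 < s" "s <= q" for s q
 proof -
  have "\<bar>- 2 * ?a q\<bar> <= sqrt (n2 g) * sqrt (L\<^sup>2 * (10 * (K * \<theta> ^ 3 / (s * sqrt s))))"
   by (rule LIMSEQ_le_const2[OF tendsto_rabs[OF Jlim]]) (use Jb[OF s] in auto)
  then show ?thesis by linarith
 qed
 show "(LINT x|lborel. f x \<bullet> p t x) - (LINT x|lborel. f x \<bullet> p s x) = (LINT q:{s..t}|lborel. - ?a q)" if s: "0 < s" "s < t"
 proof -
  define B where "B = sqrt (n2 g) * sqrt (L\<^sup>2 * (10 * (K * \<theta> ^ 3 / (s * sqrt s))))"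
  have "(%n. LINT q|lborel. indicator {s..t} q *\<^sub>R ?J n q) \<longlonglongrightarrow> (LINT q|lborel. indicator {s..t} q *\<^sub>R (- 2 * ?a q))"
  proof (rule integral_dominated_convergence[where w = "%q. indicator {s..t} q * B"])
   show "AE q in lborel. (%n. indicator {s..t} q *\<^sub>R ?J n q) \<longlonglongrightarrow> indicator {s..t} q *\<^sub>R (- 2 * ?a q)"
    by (intro AE_I2 tendsto_scaleR tendsto_const Jlim)
   show "AE q in lborel. norm (indicator {s..t} q *\<^sub>R ?J n q) <= indicator {s..t} q * B" for n
    using Jb[OF s(1)] by (intro AE_I2) (auto simp: indicator_def B_def)
   show "(%q. indicator {s..t} q *\<^sub>R (- 2 * ?a q)) \<in> borel_measurable lborel" using am by measurable
   show "(%q. indicator {s..t} q *\<^sub>R ?J n q) \<in> borel_measurable lborel" for n using Jm by measurable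
  qed simp
  note lim = tendsto_mult_left[OF this, of "1/2"]
  have ws: "(LINT x|lborel. moving_avg (hs n) f x \<bullet> p t x) - (LINT x|lborel. moving_avg (hs n) f x \<bullet> p s x)
   = (1/2) * (LINT q|lborel. indicator {s..t} q *\<^sub>R ?J n q)" for n
   using weak_form_smooth[OF prim_moving_avg[OF fs hs_pos] prim_dq[OF f] s, of n] by (simp add: set_lebesgue_integral_def)
  have ma: "(%n. n2 (%x. moving_avg (hs n) f x - f x)) \<longlonglongrightarrow> 0"
   using filterlim_compose[OF moving_avg_tendsto[OF fs] hs_lim] .
  have "(%n. LINT x|lborel. moving_avg (hs n) f x \<bullet> p q x) \<longlonglongrightarrow> (LINT x|lborel. f x \<bullet> p q x)" for q
   by (rule inner_tendsto[OF fs _ ma p_sq_all p_sq_all]) (auto intro: primD[OF prim_moving_avg[OF fs hs_pos]] simp: n2_def)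
  from tendsto_diff[OF this this, of t s]
  have "(LINT x|lborel. f x \<bullet> p t x) - (LINT x|lborel. f x \<bullet> p s x) = (1/2) * (LINT q|lborel. indicator {s..t} q *\<^sub>R (- 2 * ?a q))"
   unfolding ws using lim by (rule LIMSEQ_unique)
  also have "... = (LINT q:{s..t}|lborel. - ?a q)"
   unfolding set_lebesgue_integral_def by (subst integral_mult_right_zero[symmetric]) (simp add: algebra_simps)
  finally show ?thesis .
 qed
qed

section \<open>Continuity in time and Bochner measurability\<close>

lemma n2_p_diff_le_abs:
 assumes "0 < a" "a <= s" "a <= t"
 shows "n2 (%x. p s x - p t x) <= K * \<theta> ^ 3 / (a * sqrt a) * \<bar>s - t\<bar>"
proof -
 have 1: "n2 (%x. p s x - p t x) <= K * \<theta> ^ 3 / (a * sqrt a) * \<bar>s - t\<bar>" if "a <= t" "t <= s" for s t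
 proof -
  have "n2 (%x. p s x - p t x) <= K * \<theta> ^ 3 * (s - t) / (t * sqrt t)" using that assms by (intro n2_p_diff_le) auto
  also have "... <= K * \<theta> ^ 3 * (s - t) / (a * sqrt a)"
   using that assms K_pos theta_pos by (intro divide_left_mono mult_mono mult_pos_pos mult_nonneg_nonneg) auto
  finally show ?thesis using that by simp
 qed
 show ?thesis using 1[of t s] 1[of s t] assms n2_commute[of "p s" "p t"] by (cases "t <= s") (auto simp: abs_minus_commute)
qed

lemma n2_p_tendsto:
 assumes t: "t > 0" shows "((%s. n2 (%x. p s x - p t x)) \<longlongrightarrow> 0) (at t)"
proof (rule Lim_null_comparison)
 let ?W = "%s. K * \<theta> ^ 3 / (t / 2 * sqrt (t / 2)) * \<bar>s - t\<bar>"
 have "(?W \<longlongrightarrow> K * \<theta> ^ 3 / (t / 2 * sqrt (t / 2)) * \<bar>t - t\<bar>) (at t)" by (intro tendsto_intros)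
 then show "(?W \<longlongrightarrow> 0) (at t)" by simp
 have "eventually (%s. t / 2 < s) (at t)" using t by (intro order_tendstoD(1)[OF tendsto_ident_at]) auto
 then show "eventually (%s. norm (n2 (%x. p s x - p t x)) <= ?W s) (at t)"
  by eventually_elim (use t n2_p_diff_le_abs[of "t / 2"] in simp)
qed

lemma p_L2: "p t \<in> L2" "norm_L2 (%x. p s x - p t x) = sqrt (n2 (%x. p s x - p t x))" "norm_L2 (p t) = sqrt (n2 (p t))"
 using sq_int_imp_L2[OF p_sq_all[of t], of "p t"] sq_int_imp_L2(2)[OF sq_int_diff(1)[OF p_sq_all[of s] p_sq_all[of t]], of "%x. p s x - p t x"]
 by auto

lemma p_C_into_L: "p \<in> C_into_L {0<..T}"
proof -
 have "((%s. sqrt (n2 (%x. p s x - p t x))) \<longlongrightarrow> 0) (at t within {0<..T})" if "t > 0" for t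
  using tendsto_within_subset[OF tendsto_real_sqrt[OF n2_p_tendsto[OF that]] subset_UNIV] by simp
 then show ?thesis by (auto simp: C_into_L_def p_L2)
qed

text \<open>Continuity in time is known in L2 only, so rounding the time alone does not give
  convergence in H1. A moving average of width \<open>hs n\<close> gains the derivative at the price
  of a factor of order (hs n)^(-2) on squared norms, which the time mesh (hs n)^3 absorbs.\<close>

lemma p_strongly_measurable:
 assumes K: "compact S" "S \<subseteq> {0<..T}"
 shows "strongly_measurable_on H1 norm_H1 S p"
proof -
 obtain a where a: "a > 0" "S \<subseteq> {a..T}"
 proof (cases "S = {}")
  case False
  obtain a where "a \<in> S" "\<forall>t\<in>S. a <= t" using compact_attains_inf[OF K(1) False] by blast
  then show thesis using K by (intro that[of a]) auto
 qed (use that[of 1] in auto)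
 define N where "N = (%n. real (Suc n) ^ 3)"
 have N: "N n > 0" for n by (simp add: N_def)
 \<comment> \<open>Times are rounded up, so they stay above a, where the bounds hold; exceeding T is
   harmless because p is defined for all times.\<close>
 define \<tau> where "\<tau> = (%n t. of_int \<lceil>t * N n\<rceil> / N n)"
 define s where "s = (%n t. moving_avg (hs n) (p (\<tau> n t)))"
 have tau: "t <= \<tau> n t" "\<tau> n t - t <= 1 / N n" for n t
 proof -
  have "t * N n <= of_int \<lceil>t * N n\<rceil>" "of_int \<lceil>t * N n\<rceil> <= t * N n + 1" by linarith+
  then have "t * N n / N n <= \<tau> n t" "\<tau> n t <= (t * N n + 1) / N n"
   unfolding \<tau>_def using N[of n] by (intro divide_right_mono; simp)+
  then show "t <= \<tau> n t" "\<tau> n t - t <= 1 / N n" using N[of n] by (simp_all add: add_divide_distrib)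
 qed
 have prim_s: "prim (s n t) (dq (hs n) (p (\<tau> n t)))" for n t unfolding s_def by (rule prim_moving_avg[OF p_sq_all hs_pos])
 have simple: "simple_function (lebesgue_on S) (s n)" for n
 proof -
  have "simple_function (lebesgue_on S) (\<tau> n)"
  proof (rule simple_function_borel_measurable)
   have "\<tau> n \<in> borel_measurable borel" unfolding \<tau>_def by measurable
   then show "\<tau> n \<in> borel_measurable (lebesgue_on S)" by (intro measurable_restrict_space1 borel_imp_lebesgue)
   have sub: "\<tau> n ` S \<subseteq> (%j. of_int j / N n) ` {\<lceil>a * N n\<rceil>..\<lceil>T * N n\<rceil>}"
   proof
    fix y assume "y \<in> \<tau> n ` S"
    then obtain t where t: "y = \<tau> n t" "a <= t" "t <= T" using a by auto
    then have "\<lceil>t * N n\<rceil> \<in> {\<lceil>a * N n\<rceil>..\<lceil>T * N n\<rceil>}" using N[of n] by (auto intro!: ceiling_mono mult_right_mono)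
    then show "y \<in> (%j. of_int j / N n) ` {\<lceil>a * N n\<rceil>..\<lceil>T * N n\<rceil>}" unfolding t(1) \<tau>_def by (rule imageI)
   qed
   show "finite (\<tau> n ` space (lebesgue_on S))" using finite_subset[OF sub] by simp
  qed
  then show ?thesis unfolding s_def by (rule simple_function_compose1)
 qed
 have lim: "(%n. norm_H1 (%x. p t x - s n t x)) \<longlonglongrightarrow> 0" if t: "t \<in> S" for t
 proof -
  have ta: "a <= t" "t > 0" using t a by auto
  define C where "C = K * \<theta> ^ 3 / (a * sqrt a)"
  have C0: "C \<ge> 0" using a K_pos theta_pos by (simp add: C_def)
  have dt: "n2 (%x. p t x - p (\<tau> n t) x) <= C / N n" for n
  proof -
   have "n2 (%x. p t x - p (\<tau> n t) x) <= C * \<bar>t - \<tau> n t\<bar>"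
    unfolding C_def using a ta tau(1)[where n = n and t = t] by (intro n2_p_diff_le_abs) auto
   also have "... <= C * (1 / N n)" using tau[where n = n and t = t] C0 by (intro mult_left_mono) auto
   finally show ?thesis by simp
  qed
  note ps = p_sq_all and ms = primD(1)[OF prim_moving_avg[OF p_sq_all hs_pos]]
  have e1: "n2 (%x. p t x - s n t x) <= 2 * n2 (%x. moving_avg (hs n) (p t) x - p t x) + 20 * (C / N n)" for n
  proof -
   have "n2 (%x. moving_avg (hs n) (p t) x - s n t x) = n2 (moving_avg (hs n) (%x. p t x - p (\<tau> n t) x))"
    unfolding s_def moving_avg_diff[OF ps ps hs_pos] ..
   also have "... <= 10 * n2 (%x. p t x - p (\<tau> n t) x)" by (intro moving_avg_n2_le sq_int_diff ps hs_pos)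
   finally have "n2 (%x. moving_avg (hs n) (p t) x - s n t x) <= 10 * (C / N n)" using dt[of n] by linarith
   moreover have "n2 (%x. p t x - s n t x) <= 2 * n2 (%x. p t x - moving_avg (hs n) (p t) x) + 2 * n2 (%x. moving_avg (hs n) (p t) x - s n t x)"
    unfolding s_def by (rule n2_triangle3[OF ps ms ms])
   ultimately show ?thesis using n2_commute[of "p t" "moving_avg (hs n) (p t)"] by simp
  qed
  have e2: "n2 (%x. px t x - dq (hs n) (p (\<tau> n t)) x) <= 2 * n2 (%x. dq (hs n) (p t) x - px t x) + 8 * C * hs n" for n
  proof -
   let ?d = "%x. p t x - p (\<tau> n t) x"
   have ds: "sq_int ?d" by (intro sq_int_diff ps)
   have "dq (hs n) (p t) x - dq (hs n) (p (\<tau> n t)) x = (1 / hs n) *\<^sub>R (?d (x + hs n) - ?d x)" for x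
    unfolding dq_def scaleR_diff_right[symmetric] by (rule arg_cong[where f = "scaleR (1 / hs n)"]) (simp add: algebra_simps)
   then have "n2 (%x. dq (hs n) (p t) x - dq (hs n) (p (\<tau> n t)) x) = n2 (%x. (1 / hs n) *\<^sub>R (?d (x + hs n) - ?d x))"
    by (simp only:)
   also have "... = (1 / hs n)\<^sup>2 * n2 (%x. ?d (x + hs n) - ?d x)"
    by (rule sq_int_scaleR(2)[OF sq_int_diff(1)[OF sq_int_shift(1)[OF ds] ds]])
   also have "... <= (1 / hs n)\<^sup>2 * (4 * (C / N n))"
   proof (intro mult_left_mono)
    have "n2 (%x. ?d (x + hs n) - ?d x) <= 2 * n2 (%x. ?d (x + hs n)) + 2 * n2 ?d" by (rule sq_int_diff(2)[OF sq_int_shift(1)[OF ds] ds])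
    then show "n2 (%x. ?d (x + hs n) - ?d x) <= 4 * (C / N n)" unfolding sq_int_shift(2)[OF ds] using dt[of n] by linarith
   qed simp
   also have "... = 4 * C * hs n" by (simp add: N_def hs_def power2_eq_square power3_eq_cube)
   finally have "n2 (%x. dq (hs n) (p t) x - dq (hs n) (p (\<tau> n t)) x) <= 4 * C * hs n" .
   moreover have "n2 (%x. px t x - dq (hs n) (p (\<tau> n t)) x)
    <= 2 * n2 (%x. px t x - dq (hs n) (p t) x) + 2 * n2 (%x. dq (hs n) (p t) x - dq (hs n) (p (\<tau> n t)) x)"
    by (intro n2_triangle3 primD[OF prim_p_all] sq_int_dq ps)
   ultimately show ?thesis using n2_commute[of "px t" "dq (hs n) (p t)"] by simp
  qed
  let ?W = "%n. sqrt ((2 * n2 (%x. moving_avg (hs n) (p t) x - p t x) + 20 * (C / N n)) + (2 * n2 (%x. dq (hs n) (p t) x - px t x) + 8 * C * hs n))"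
  have l1: "(%n. n2 (%x. moving_avg (hs n) (p t) x - p t x)) \<longlonglongrightarrow> 0" using filterlim_compose[OF moving_avg_tendsto[OF ps] hs_lim] .
  have l2: "(%n. n2 (%x. dq (hs n) (p t) x - px t x)) \<longlonglongrightarrow> 0"
   using filterlim_compose[OF dq_tendsto[OF prim_imp_antider[OF prim_p_all]] hs_lim] .
  have "(%n. C * hs n ^ 3) \<longlonglongrightarrow> 0" by (rule tendsto_eq_intros hs_0 refl | simp)+
  then have l3: "(%n. C / N n) \<longlonglongrightarrow> 0" by (simp add: N_def hs_def power_divide)
  show ?thesis
  proof (rule Lim_null_comparison)
   show "?W \<longlonglongrightarrow> 0" by (rule tendsto_eq_intros l1 l2 l3 hs_0 refl | simp)+
   have "norm_H1 (%x. p t x - s n t x) = sqrt (n2 (%x. p t x - s n t x) + n2 (%x. px t x - dq (hs n) (p (\<tau> n t)) x))" for n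
    by (rule prim_imp_H1(4)[OF prim_diff[OF prim_p_all prim_s]]) simp
   then show "eventually (%n. norm (norm_H1 (%x. p t x - s n t x)) <= ?W n) sequentially"
    using e1 e2 by (simp add: add_mono always_eventually)
  qed
 qed
 have pH: "p t \<in> H1" for t by (rule prim_imp_H1(1)[OF prim_p_all[of t]]) simp
 have sH: "s n t \<in> H1" for n t by (rule prim_imp_H1(1)[OF prim_s[of n t]]) simp
 show ?thesis unfolding strongly_measurable_on_def
 proof (intro conjI exI[of _ s] allI)
  show "AE t in lebesgue_on S. p t \<in> H1" by (intro AE_I2 pH)
  show "AE t in lebesgue_on S. (%n. norm_H1 (%x. p t x - s n t x)) \<longlonglongrightarrow> 0" using lim by (intro AE_I2) simp
 qed (use simple sH in auto)
qed

lemma norm_L2_le_H1: "0 <= norm_L2 u" "norm_L2 u <= norm_H1 u"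
proof -
 show "0 <= norm_L2 u" unfolding norm_L2_def by (intro real_sqrt_ge_zero Bochner_Integration.integral_nonneg) simp
 show "norm_L2 u <= norm_H1 u" unfolding norm_H1_def by (rule real_sqrt_sum_squares_ge1)
qed

lemma strongly_measurable_L2:
 assumes "strongly_measurable_on H1 norm_H1 S u" shows "strongly_measurable_on L2 norm_L2 S u"
proof -
 obtain s where s: "\<forall>n. simple_function (lebesgue_on S) (s n) & s n ` S \<subseteq> H1"
  "AE t in lebesgue_on S. (%n. norm_H1 (%x. u t x - s n t x)) \<longlonglongrightarrow> 0" and u: "AE t in lebesgue_on S. u t \<in> H1"
  using assms by (auto simp: strongly_measurable_on_def)
 have "H1 \<subseteq> L2" by (auto simp: H1_def)
 moreover have "AE t in lebesgue_on S. (%n. norm_L2 (%x. u t x - s n t x)) \<longlonglongrightarrow> 0"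
  using s(2)
 proof eventually_elim
  case (elim t)
  then show ?case
   by (rule Lim_null_comparison[rotated]) (simp add: norm_L2_le_H1)
 qed
 ultimately have sub: "H1 \<subseteq> L2" and lim: "AE t in lebesgue_on S. (%n. norm_L2 (%x. u t x - s n t x)) \<longlonglongrightarrow> 0" .
 have "AE t in lebesgue_on S. u t \<in> L2" using u by (rule eventually_mono) (use sub in blast)
 then show ?thesis unfolding strongly_measurable_on_def
  by (intro conjI exI[of _ s] allI lim) (use s(1) sub in blast)+
qed

text \<open>The squared norm of \<open>px t\<close> is the limit of those of the difference
  quotients of \<open>p t\<close>, which are measurable in t because p is jointly
  measurable.\<close>

lemma px_n2_measurable: "(%t. n2 (p t) + n2 (px t)) \<in> borel_measurable borel"
proof -
 have 1: "(%t. n2 (p t)) \<in> borel_measurable borel" unfolding n2_def by measurable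
 have m: "(%t. n2 (dq (hs n) (p t))) \<in> borel_measurable borel" for n
 proof -
  have [measurable]: "(%z. p (fst z) (snd z + hs n)) \<in> borel_measurable (borel \<Otimes>\<^sub>M borel)"
  proof -
   have "(%z. case_prod p (fst z, snd z + hs n)) \<in> borel_measurable (borel \<Otimes>\<^sub>M borel)" by measurable
   then show ?thesis by simp
  qed
  show ?thesis unfolding n2_def dq_def by measurable
 qed
 have l: "(%n. n2 (dq (hs n) (p t))) \<longlonglongrightarrow> n2 (px t)" for t
 proof -
  have "(%n. n2 (%x. dq (hs n) (p t) x - px t x)) \<longlonglongrightarrow> 0"
   using filterlim_compose[OF dq_tendsto[OF prim_imp_antider[OF prim_p_all]] hs_lim] .
  from inner_tendsto[OF primD(2)[OF prim_p_all] _ this primD(2)[OF prim_p_all] _ this]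
  show ?thesis by (simp add: n2_def power2_norm_eq_inner sq_int_dq p_sq_all)
 qed
 have "(%t. n2 (px t)) \<in> borel_measurable borel" by (rule borel_measurable_LIMSEQ_real[OF l m])
 with 1 show ?thesis by measurable
qed

lemma p_solution:
 assumes al: "!!i. a0 $ i = \<alpha> i"
 shows "V_solution lam \<alpha> T \<mu> p"
proof -
 have pH: "p t \<in> H1" and pd: "weak_deriv (p t) \<in> L2" "AE x in lborel. weak_deriv (p t) x = px t x"
  "norm_H1 (p t) = sqrt (n2 (p t) + n2 (px t))" for t
  using prim_imp_H1[OF prim_p_all, of "p t" t] by auto
 have bounds: "\<exists>C. \<forall>t\<in>S. n2 (p t) + n2 (px t) <= C" if K: "compact S" "S \<subseteq> {0<..T}" for S
 proof (cases "S = {}")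
  case False
  obtain a where a: "a \<in> S" "\<forall>t\<in>S. a <= t" using compact_attains_inf[OF K(1) False] by blast
  then have a0: "a > 0" using K by auto
  have "n2 (p t) + n2 (px t) <= K * \<theta> / sqrt a + K * \<theta> ^ 3 / (a * sqrt a)" if "t \<in> S" for t
  proof -
   have t: "a <= t" "t > 0" using that a a0 by auto
   have "K * \<theta> / sqrt t <= K * \<theta> / sqrt a" "K * \<theta> ^ 3 / (t * sqrt t) <= K * \<theta> ^ 3 / (a * sqrt a)"
    using t a0 K_pos theta_pos by (intro divide_left_mono mult_mono mult_pos_pos; simp)+
   then show ?thesis using p_sq(2)[OF t(2)] prim_p(2)[OF t(2)] by linarith
  qed
  then show ?thesis by blast
 qed simp
 have meas: "(%(t, x). p t x) \<in> borel_measurable (lebesgue_on ({0<..T} \<times> UNIV))"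
 proof -
  have "case_prod p \<in> borel_measurable borel" using p_measurable by (simp add: borel_prod)
  then have "case_prod p \<in> borel_measurable lebesgue" by (simp add: measurable_completion)
  then show ?thesis by (rule measurable_restrict_space1)
 qed
 have L2loc: "p \<in> L2_loc {0<..T} H1 norm_H1"
  unfolding L2_loc_def
 proof (intro CollectI allI impI conjI; elim conjE)
  fix S assume K: "compact S" "S \<subseteq> {0<..T}"
  show "strongly_measurable_on H1 norm_H1 S p" by (rule p_strongly_measurable[OF K])
  obtain C where C: "\<forall>t\<in>S. n2 (p t) + n2 (px t) <= C" using bounds[OF K] by blast
  have Sb: "S \<in> sets borel" using K(1) by (simp add: compact_imp_closed borel_closed)
  have e: "(%t. (norm_H1 (p t))\<^sup>2) = (%t. n2 (p t) + n2 (px t))" by (simp add: pd(3) fun_eq_iff add_nonneg_nonneg)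
  have "set_integrable lborel S (%t. n2 (p t) + n2 (px t))"
   unfolding set_integrable_def
  proof (rule Bochner_Integration.integrable_bound)
   show "integrable lborel (%t. indicator {0..T} t * C)" by simp
   show "(%t. indicator S t *\<^sub>R (n2 (p t) + n2 (px t))) \<in> borel_measurable lborel" using px_n2_measurable Sb by measurable
   show "AE t in lborel. norm (indicator S t *\<^sub>R (n2 (p t) + n2 (px t))) <= norm (indicator {0..T} t * C)"
   proof (intro AE_I2)
    fix t
    show "norm (indicator S t *\<^sub>R (n2 (p t) + n2 (px t))) <= norm (indicator {0..T} t * C)"
    proof (cases "t \<in> S")
     case True
     then have "t \<in> {0..T}" using K by auto
     then show ?thesis using True C by (simp add: add_nonneg_nonneg) (meson abs_ge_self order_trans)
    qed simp
   qed
  qed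
  then show "set_integrable lebesgue S (%t. (norm_H1 (p t))\<^sup>2)" unfolding e
   using set_integrable_lebesgue(1)[OF borel_imp_lebesgue[OF px_n2_measurable] px_n2_measurable _ Sb] by simp
 qed
 have Linf: "p \<in> Linf_loc {0<..T} L2 norm_L2"
  unfolding Linf_loc_def
 proof (intro CollectI allI impI conjI; elim conjE)
  fix S assume K: "compact S" "S \<subseteq> {0<..T}"
  show "strongly_measurable_on L2 norm_L2 S p" by (rule strongly_measurable_L2[OF p_strongly_measurable[OF K]])
  obtain C where C: "\<forall>t\<in>S. n2 (p t) + n2 (px t) <= C" using bounds[OF K] by blast
  have "norm_L2 (p t) <= sqrt C" if "t \<in> S" for t
  proof -
   have "n2 (p t) + n2 (px t) <= C" using C that by blast
   then have "n2 (p t) <= C" using n2_nonneg[of "px t"] by linarith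
   then show ?thesis unfolding p_L2(3) by (rule real_sqrt_le_mono)
  qed
  then show "\<exists>C. AE t in lebesgue_on S. norm_L2 (p t) <= C" by (intro exI[of _ "sqrt C"] AE_I2) simp
 qed
 have dom: "p t x \<in> domain_D" if "t > 0" for t x
  using p_nonneg[of t x] p_nonzero[OF that, of x] by (simp add: domain_D_def nonneg_def)
 have weak: "has_distr_deriv {0<..<T} (%t. inner_L2 v (p t))
    (%t. - inner_L2 (weak_deriv v) (%x. mat_A lam (p t x) *v weak_deriv (p t) x))" if v: "v \<in> H1" for v
 proof -
  obtain f g where fg: "prim f g" "AE x in lborel. v x = f x" using H1_ex_prim[OF v] .
  note vd = prim_imp_H1[OF fg]
  note fs = primD(1)[OF fg(1)]
  have vL: "v \<in> L2" using v by (simp add: H1_def)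
  have e1: "inner_L2 v (p t) = (LINT x|lborel. f x \<bullet> p t x)" for t
   by (rule inner_L2_eq[OF vL p_L2(1) fs p_sq_all fg(2)]) simp
  have ae: "AE x in lborel. mat_A lam (p t x) *v weak_deriv (p t) x = Apx t x" for t
   using pd(2)[of t] by eventually_elim (simp add: Apx_def)
  have e2: "inner_L2 (weak_deriv v) (%x. mat_A lam (p t x) *v weak_deriv (p t) x) = (LINT x|lborel. g x \<bullet> Apx t x)" for t
   by (rule inner_L2_eq[OF vd(2) sq_int_imp_L2(1)[OF Apx_sq ae] primD(2)[OF fg(1)] Apx_sq vd(3) ae])
  note td = time_derivative[OF fg(1)]
  have fm: "(%t. LINT x|lborel. f x \<bullet> p t x) \<in> borel_measurable borel"
  proof -
   have [measurable]: "f \<in> borel_measurable borel" using fs by (simp add: sq_int_def)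
   show ?thesis by measurable
  qed
  show ?thesis unfolding e1 e2
  proof (rule time_distr_deriv[OF _ fm])
   show "continuous_on {0<..} (%t. LINT x|lborel. f x \<bullet> p t x)"
    unfolding continuous_on_def
   proof
    fix t :: real assume t: "t \<in> {0<..}"
    have "((%s. LINT x|lborel. f x \<bullet> p s x) \<longlongrightarrow> (LINT x|lborel. f x \<bullet> p t x)) (at t)"
     by (rule inner_tendsto[OF fs fs _ p_sq_all p_sq_all n2_p_tendsto]) (use t in \<open>auto simp: n2_def\<close>)
    then show "((%s. LINT x|lborel. f x \<bullet> p s x) \<longlongrightarrow> (LINT x|lborel. f x \<bullet> p t x)) (at t within {0<..})"
     by (rule tendsto_within_subset) simp
   qed
   show gm: "(%t. - (LINT x|lborel. g x \<bullet> Apx t x)) \<in> borel_measurable borel" using td(1) by measurable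
   show "set_integrable lborel {a..b} (%t. - (LINT x|lborel. g x \<bullet> Apx t x))" if ab: "0 < a" "a <= b" for a b
    unfolding set_integrable_def
   proof (rule Bochner_Integration.integrable_bound)
    let ?B = "sqrt (n2 g) * sqrt (L\<^sup>2 * (10 * (K * \<theta> ^ 3 / (a * sqrt a))))"
    show "integrable lborel (%t. indicator {a..b} t * ?B)" by simp
    show "AE t in lborel. norm (indicator {a..b} t *\<^sub>R - (LINT x|lborel. g x \<bullet> Apx t x)) <= norm (indicator {a..b} t * ?B)"
     using td(2)[OF ab(1)] by (intro AE_I2) (force simp: indicator_def)
   qed (use gm in measurable)
   show "(LINT x|lborel. f x \<bullet> p b x) - (LINT x|lborel. f x \<bullet> p a x) = (LINT t:{a..b}|lborel. - (LINT x|lborel. g x \<bullet> Apx t x))"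
    if ab: "0 < a" "a <= b" for a b
    using td(3)[of a b] ab by (cases "a = b") (auto simp del: atLeastAtMost_singleton)
  qed
 qed
 have ini: "((%t. inner_L2 v (p t)) \<longlongrightarrow> (\<Sum>i\<in>UNIV. \<alpha> i * (LINT x|\<mu>. v x $ i))) (at_right 0)"
  if v: "v \<in> H1" "continuous_on UNIV v" for v
 proof -
  interpret prob_space \<mu> by (rule mu)
  obtain f g where fg: "prim f g" "AE x in lborel. v x = f x" using H1_ex_prim[OF v(1)] .
  \<comment> \<open>Equality everywhere is needed here, because \<mu> may charge Lebesgue null
    sets.\<close>
  have vf: "v = f" by (rule continuous_AE_eq[OF v(2) prim_continuous[OF fg(1)] fg(2)])
  have vL: "v \<in> L2" using v by (simp add: H1_def)
  have e1: "inner_L2 v (p t) = (LINT x|lborel. f x \<bullet> p t x)" for t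
   by (rule inner_L2_eq[OF vL p_L2(1) primD(1)[OF fg(1)] p_sq_all fg(2)]) simp
  have i: "integrable \<mu> (%x. f x $ i)" for i
  proof (rule integrable_const_bound[where B = "sqrt (2 * n2 f + 2 * n2 g)"])
   have "(%x. f x $ i) \<in> borel_measurable borel"
    by (intro borel_measurable_continuous_onI continuous_intros prim_continuous[OF fg(1)])
   then show "(%x. f x $ i) \<in> borel_measurable \<mu>" by (rule mu_measurable)
   have "norm (f x) <= sqrt (2 * n2 f + 2 * n2 g)" for x by (intro real_le_rsqrt prim_bounded fg)
   then show "AE x in \<mu>. norm (f x $ i) <= sqrt (2 * n2 f + 2 * n2 g)"
    using component_le_norm_cart order_trans by (intro AE_I2) (fastforce simp: real_norm_def)
  qed
  have "(LINT x|\<mu>. f x \<bullet> a0) = (LINT x|\<mu>. (\<Sum>i\<in>UNIV. \<alpha> i * (f x $ i)))" by (simp add: inner_vec_def al mult.commute)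
  also have "... = (\<Sum>i\<in>UNIV. LINT x|\<mu>. \<alpha> i * (f x $ i))" by (rule Bochner_Integration.integral_sum) (intro integrable_mult_right i)
  also have "... = (\<Sum>i\<in>UNIV. \<alpha> i * (LINT x|\<mu>. v x $ i))" by (simp add: vf)
  finally show ?thesis using initial_pairing_tendsto[OF fg(1)] unfolding e1 by simp
 qed
 show ?thesis unfolding V_solution_def
  using meas p_C_into_L L2loc Linf weak ini dom by (intro conjI ballI impI AE_I2) auto
qed

end

section \<open>Discretized initial data\<close>

lemma cell_avg_minus_le:
 assumes p: "prim v g" and e: "e > 0" and x: "x \<in> {of_int j * e..of_int (j + 1) * e}"
 shows "norm (cell_avg e v j - v x) <= sqrt (e * n2 g)"
proof -
 let ?C = "{of_int j * e..of_int (j + 1) * e}"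
 have le: "norm (v y - v x) <= sqrt (e * n2 g)" if y: "y \<in> ?C" for y
 proof (rule real_le_rsqrt)
  have "\<bar>y - x\<bar> <= e" using x y by (auto simp: distrib_right)
  then have "\<bar>y - x\<bar> * n2 g <= e * n2 g" by (intro mult_right_mono) auto
  then show "(norm (v y - v x))\<^sup>2 <= e * n2 g" using prim_increment_le_abs[OF p, of y x] by linarith
 qed
 have i: "set_integrable lborel ?C v" by (rule sq_int_local(1)[OF primD(1)[OF p]])
 have ic: "set_integrable lborel ?C (%y. v x)" by (simp add: set_integrable_def)
 have len: "(LINT y:?C|lborel. v x) = e *\<^sub>R v x" using e by (simp add: set_lebesgue_integral_def distrib_right)
 have "e *\<^sub>R (cell_avg e v j - v x) = (LINT y:?C|lborel. v y) - (LINT y:?C|lborel. v x)"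
  unfolding len using e by (simp add: cell_avg_def scaleR_diff_right)
 also have "... = (LINT y:?C|lborel. v y - v x)" by (rule set_integral_diff(2)[OF i ic, symmetric])
 also have "norm ... <= (LINT y|lborel. indicator ?C y * sqrt (e * n2 g))"
  unfolding set_lebesgue_integral_def
 proof (rule Bochner_Integration.integral_norm_bound_integral)
  show "integrable lborel (%y. indicator ?C y *\<^sub>R (v y - v x))" using set_integral_diff(1)[OF i ic] by (simp add: set_integrable_def)
  show "norm (indicator ?C y *\<^sub>R (v y - v x)) <= indicator ?C y * sqrt (e * n2 g)" for y using le[of y] by (simp add: indicator_def)
 qed simp
 also have "... = e * sqrt (e * n2 g)" using e by (simp add: distrib_right)
 finally have "e * norm (cell_avg e v j - v x) <= e * sqrt (e * n2 g)" using e by simp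
 then show ?thesis using e by simp
qed

text \<open>Half-open cells of width 1 / (k + 1) partition the line, so an atom of \<mu> is counted
  once. The index bound (k + 1)^2 makes the covered region reach to about k + 1 on either side: the
  support is finite and yet exhausts the line as k grows.\<close>

definition cell_mass :: "real measure => real^'d => nat => int => real^'d" where
 "cell_mass \<mu> a k j = (if \<bar>j\<bar> <= (int (Suc k))\<^sup>2 then measure \<mu> {of_int j * (1 / real (Suc k))..<of_int (j + 1) * (1 / real (Suc k))} *\<^sub>R a else 0)"

text \<open>The discrete pairing is the \<mu>-integral of the step function made of the cell
  averages of v. These approach v uniformly by its Hoelder continuity, and boundedness of v gives
  the dominating constant.\<close>

lemma cell_mass_facts:
 fixes a :: "real^'d"
 assumes mu: "prob_space \<mu>" "sets \<mu> = sets borel" and a: "a \<in> nonneg" "total a = 1"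
 shows "fsupp (cell_mass \<mu> a k)" "cell_mass \<mu> a k j \<in> nonneg" "zs (%j. total (cell_mass \<mu> a k j)) <= 1"
  "prim v g ==> (%k. zs (%j. cell_avg (1 / real (Suc k)) v j \<bullet> cell_mass \<mu> a k j)) \<longlonglongrightarrow> (LINT x|\<mu>. v x \<bullet> a)"
proof -
 interpret prob_space \<mu> by (rule mu)
 define e where "e = (%k::nat. 1 / real (Suc k))"
 have e: "e k > 0" "e k <= 1" for k by (auto simp: e_def)
 have e0: "e \<longlonglongrightarrow> 0" unfolding e_def using LIMSEQ_inverse_real_of_nat by (simp add: inverse_eq_divide)
 define J where "J = (%k. {- ((int (Suc k))\<^sup>2)..(int (Suc k))\<^sup>2})"
 let ?C = "%k (j::int). {of_int j * e k..<of_int (j + 1) * e k}"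
 have cell: "x \<in> ?C k j \<longleftrightarrow> j = \<lfloor>x / e k\<rfloor>" for x k and j :: int
  using e(1)[of k] by (auto simp: floor_eq_iff pos_le_divide_eq pos_divide_less_eq eq_commute[of j])
 have cm: "cell_mass \<mu> a k j = (if j \<in> J k then measure \<mu> (?C k j) *\<^sub>R a else 0)" for k j
  unfolding cell_mass_def J_def e_def by (auto simp: abs_le_iff)
 have Cs: "?C k j \<in> sets \<mu>" for k j by (simp add: mu)
 show "fsupp (cell_mass \<mu> a k)" unfolding fsupp_def by (rule finite_subset[of _ "J k"]) (auto simp: cm J_def)
 show "cell_mass \<mu> a k j \<in> nonneg" using a by (simp add: cm nonneg_def)
 have "zs (%j. total (cell_mass \<mu> a k j)) = (\<Sum>j\<in>J k. measure \<mu> (?C k j))"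
  by (subst zs_eq_sum[of "J k"]) (auto simp: cm a J_def)
 also have "... = measure \<mu> (\<Union>j\<in>J k. ?C k j)"
 proof (rule finite_measure_finite_Union[symmetric])
  show "?C k ` J k \<subseteq> sets \<mu>" by (rule image_subsetI) (rule Cs)
  show "disjoint_family_on (?C k) (J k)" unfolding disjoint_family_on_def disjoint_iff cell by simp
 qed (simp add: J_def)
 finally show "zs (%j. total (cell_mass \<mu> a k j)) <= 1" by simp
 show "(%k. zs (%j. cell_avg (1 / real (Suc k)) v j \<bullet> cell_mass \<mu> a k j)) \<longlonglongrightarrow> (LINT x|\<mu>. v x \<bullet> a)" if v: "prim v g"
 proof -
  let ?f = "%k x. \<Sum>j\<in>J k. indicator (?C k j) x * (cell_avg (e k) v j \<bullet> a)"
  have fi: "integrable \<mu> (%x. indicator (?C k j) x * (cell_avg (e k) v j \<bullet> a))" for k j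
   by (intro integrable_mult_left) (use Cs in \<open>simp add: integrable_indicator_iff emeasure_eq_measure\<close>)
  have eq: "zs (%j. cell_avg (1 / real (Suc k)) v j \<bullet> cell_mass \<mu> a k j) = (LINT x|\<mu>. ?f k x)" for k
  proof -
   have "zs (%j. cell_avg (e k) v j \<bullet> cell_mass \<mu> a k j) = (\<Sum>j\<in>J k. measure \<mu> (?C k j) * (cell_avg (e k) v j \<bullet> a))"
    by (subst zs_eq_sum[of "J k"]) (auto simp: cm J_def)
   also have "... = (LINT x|\<mu>. ?f k x)"
    by (subst Bochner_Integration.integral_sum[OF fi]) (use Cs in \<open>simp\<close>)
   finally show ?thesis by (simp add: e_def)
  qed
  have f: "?f k x = (if \<lfloor>x / e k\<rfloor> \<in> J k then cell_avg (e k) v \<lfloor>x / e k\<rfloor> \<bullet> a else 0)" for k x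
  proof -
   have "?f k x = (\<Sum>j\<in>J k. if j = \<lfloor>x / e k\<rfloor> then cell_avg (e k) v j \<bullet> a else 0)"
    unfolding indicator_def cell by (intro sum.cong refl) simp
   then show ?thesis by (simp add: sum.delta J_def)
  qed
  have near: "norm (cell_avg (e k) v \<lfloor>x / e k\<rfloor> - v x) <= sqrt (e k * n2 g)" for k x
  proof (rule cell_avg_minus_le[OF v e(1)])
   have "x \<in> ?C k \<lfloor>x / e k\<rfloor>" unfolding cell ..
   then show "x \<in> {of_int \<lfloor>x / e k\<rfloor> * e k..of_int (\<lfloor>x / e k\<rfloor> + 1) * e k}" by auto
  qed
  define D where "D = (sqrt (2 * n2 v + 2 * n2 g) + sqrt (n2 g)) * norm a"
  show ?thesis unfolding eq
  proof (rule integral_dominated_convergence[where w = "%x. D"])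
   have "(%x. v x \<bullet> a) \<in> borel_measurable borel"
    by (intro borel_measurable_continuous_onI continuous_intros prim_continuous[OF v])
   then show "(%x. v x \<bullet> a) \<in> borel_measurable \<mu>" using mu by (simp cong: measurable_cong_sets)
   show "?f k \<in> borel_measurable \<mu>" for k using fi borel_measurable_integrable by (intro borel_measurable_sum) blast
   show "AE x in \<mu>. (%k. ?f k x) \<longlonglongrightarrow> v x \<bullet> a"
   proof (intro AE_I2)
    fix x
    have l: "(%k. cell_avg (e k) v \<lfloor>x / e k\<rfloor> - v x) \<longlonglongrightarrow> 0"
    proof (rule Lim_null_comparison)
     show "(%k. sqrt (e k * n2 g)) \<longlonglongrightarrow> 0" by (rule tendsto_eq_intros e0 refl | simp)+
    qed (simp add: near)
    have lim: "(%k. cell_avg (e k) v \<lfloor>x / e k\<rfloor> \<bullet> a) \<longlonglongrightarrow> v x \<bullet> a"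
     by (intro tendsto_inner tendsto_const LIM_zero_cancel[OF l])
    obtain k0 :: nat where k0: "\<bar>x\<bar> + 1 <= real k0" using real_arch_simple by blast
    have "eventually (%k. cell_avg (e k) v \<lfloor>x / e k\<rfloor> \<bullet> a = ?f k x) sequentially"
     using eventually_ge_at_top[of k0]
    proof eventually_elim
     case (elim k)
     define N where "N = real (Suc k)"
     have N1: "1 <= N" by (simp add: N_def)
     have "real k0 <= real k" using elim by simp
     then have "\<bar>x\<bar> <= N - 1" using k0 unfolding N_def by simp
     then have "\<bar>x\<bar> * N <= (N - 1) * N" using N1 by (intro mult_right_mono) auto
     moreover have "(N - 1) * N = N\<^sup>2 - N" by (simp add: power2_eq_square left_diff_distrib)
     moreover have "\<bar>x * N\<bar> = \<bar>x\<bar> * N" using N1 by (simp add: abs_mult)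
     ultimately have b: "\<bar>x * N\<bar> <= N\<^sup>2" using N1 by linarith
     have z: "real_of_int ((int (Suc k))\<^sup>2) = N\<^sup>2" by (simp add: N_def)
     have lo: "- ((int (Suc k))\<^sup>2) <= \<lfloor>x * N\<rfloor>" unfolding le_floor_iff of_int_minus z using b by linarith
     have "real_of_int \<lfloor>x * N\<rfloor> <= real_of_int ((int (Suc k))\<^sup>2)"
      unfolding z using b of_int_floor_le[of "x * N"] by linarith
     then have "\<lfloor>x * N\<rfloor> <= (int (Suc k))\<^sup>2" by (simp only: of_int_le_iff)
     with lo have "\<lfloor>x * N\<rfloor> \<in> J k" by (simp only: J_def atLeastAtMost_iff simp_thms)
     moreover have "x / e k = x * N" by (simp add: e_def N_def)
     ultimately show ?case unfolding f by (simp only: if_True)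
    qed
    from Lim_transform_eventually[OF lim this] show "(%k. ?f k x) \<longlonglongrightarrow> v x \<bullet> a" .
   qed
   show "AE x in \<mu>. norm (?f k x) <= D" for k
   proof (intro AE_I2)
    fix x
    have "norm (cell_avg (e k) v \<lfloor>x / e k\<rfloor>) <= norm (v x) + norm (cell_avg (e k) v \<lfloor>x / e k\<rfloor> - v x)" by (rule norm_triangle_sub)
    also have "... <= sqrt (2 * n2 v + 2 * n2 g) + sqrt (n2 g)"
    proof (rule add_mono)
     show "norm (v x) <= sqrt (2 * n2 v + 2 * n2 g)" by (intro real_le_rsqrt prim_bounded v)
     have "e k * n2 g <= 1 * n2 g" using e by (intro mult_right_mono) auto
     then have "sqrt (e k * n2 g) <= sqrt (n2 g)" by simp
     with near[of k x] show "norm (cell_avg (e k) v \<lfloor>x / e k\<rfloor> - v x) <= sqrt (n2 g)" by linarith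
    qed
    finally have "norm (cell_avg (e k) v \<lfloor>x / e k\<rfloor>) * norm a <= D" unfolding D_def by (intro mult_right_mono) auto
    then have "\<bar>cell_avg (e k) v \<lfloor>x / e k\<rfloor> \<bullet> a\<bar> <= D" using Cauchy_Schwarz_ineq2[of "cell_avg (e k) v \<lfloor>x / e k\<rfloor>" a] by linarith
    moreover have "0 <= D" by (simp add: D_def)
    ultimately show "norm (?f k x) <= D" unfolding f by simp
   qed
  qed simp
 qed
qed

theorem theorem2p1:
  fixes lam \<alpha> :: "'d::finite \<Rightarrow> real" and T :: real and \<mu> :: "real measure"
 assumes "CARD('d) \<ge> 2"
  and "\<And>i. lam i > 0"
  and "\<And>i. \<alpha> i > 0"
  and "(\<Sum>i\<in>UNIV. \<alpha> i) = 1"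
  and "T > 0"
  and "prob_space \<mu>" and "sets \<mu> = sets borel"
  and "condition_C lam"
 shows "\<exists>p. V_solution lam \<alpha> T \<mu> p \<and> p \<in> C_into_L {0<..T} \<and>
     (AE (t, x) in lebesgue_on ({0<..T} \<times> UNIV).
       (\<Sum>i\<in>UNIV. p t x $ i) = heat_conv \<mu> t x)"
proof -
 interpret rates lam by unfold_locales (rule assms)
 obtain G L c b M where mf: "monotone_flux (flux lam) G L c b M" using flux_monotone[OF assms(8)] .
 interpret mf: monotone_flux "flux lam" G L c b M by (rule mf)
 define a0 :: "real^'d" where "a0 = (\<chi> i. \<alpha> i)"
 have a0: "a0 \<in> nonneg" "total a0 = 1" using assms(3,4) by (auto simp: a0_def nonneg_def total_def less_imp_le)
 define m0 where "m0 = cell_mass \<mu> a0"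
 define e where "e = (%k::nat. 1 / real (Suc k))"
 note cm = cell_mass_facts[OF assms(6,7) a0]
 have e0: "e \<longlonglongrightarrow> 0" unfolding e_def using LIMSEQ_inverse_real_of_nat by (simp add: inverse_eq_divide)
 have epos: "e k > 0" for k by (simp add: e_def)
 have adm: "mf.admissible (m0 k)" for k using cm by (simp add: mf.admissible_def m0_def)
 interpret gl: grid_limit "flux lam" G L c b M m0 e
  by unfold_locales (rule adm epos e0)+
 obtain \<sigma> p0 where \<sigma>: "strict_mono \<sigma>" and p0: "!!t x. t > 0 ==> (%k. gl.approx_sol (\<sigma> k) t x) \<longlonglongrightarrow> p0 t x"
  using gl.convergent_subsequence by blast
 define p where "p = (%t x. if t > 0 then p0 t x else (0 :: real^'d))"
 \<comment> \<open>Passing to the subsequence once and for all: along \<sigma> the data and meshes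
   again form a \<open>grid_limit\<close>, and for that one the whole sequence converges.\<close>
 define m1 e1 where "m1 = (%k. m0 (\<sigma> k))" and "e1 = (%k. e (\<sigma> k))"
 have e1: "e1 \<longlonglongrightarrow> 0" using LIMSEQ_subseq_LIMSEQ[OF e0 \<sigma>] by (simp add: e1_def o_def)
 interpret gs: grid_limit "flux lam" G L c b M m1 e1
  by unfold_locales (auto simp: adm epos e1 m1_def, simp add: e1_def epos)
 have ap: "gs.approx_sol k t x = gl.approx_sol (\<sigma> k) t x" for k t x
  unfolding gs.approx_sol_def gl.approx_sol_def gs.grid_def gl.grid_def gs.steps_def gl.steps_def gs.tau_def gl.tau_def
  by (simp add: m1_def e1_def)
 have ini: "(%k. zs (%j. cell_avg (e1 k) v j \<bullet> m1 k j)) \<longlonglongrightarrow> (LINT x|\<mu>. v x \<bullet> a0)" if v: "prim v g" for v g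
  using LIMSEQ_subseq_LIMSEQ[OF cm(4)[OF v] \<sigma>] by (simp add: e1_def e_def m1_def m0_def o_def)
 have gsol: "grid_solution (flux lam) G L c b M m1 e1 p"
 proof (rule grid_solution.intro[OF gs.grid_limit_axioms grid_solution_axioms.intro])
  show "(%k. gs.approx_sol k t x) \<longlonglongrightarrow> p t x" if "t > 0" for t x
   using p0[OF that, of x] that unfolding ap p_def by simp
  show "p t x = 0" if "t <= 0" for t x using that by (simp add: p_def)
 qed
 have gcau: "grid_cauchy (flux lam) G L c b M m1 e1 p \<mu> a0"
 proof (rule grid_cauchy.intro[OF gsol grid_cauchy_axioms.intro])
  show "(%k. zs (%j. cell_avg (e1 k) v j \<bullet> m1 k j)) \<longlonglongrightarrow> (LINT x|\<mu>. v x \<bullet> a0)" if "prim v g" for v g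
   by (rule ini[OF that])
 qed (rule assms(6) assms(7) a0(2))+
 have "rates lam" by (rule rates.intro) (rule assms(2))
 then interpret fs: flux_solution lam G L c b M m1 e1 p \<mu> a0
  by (rule flux_solution.intro[OF _ gcau])
 show ?thesis
 proof (intro exI[of _ p] conjI)
  show "V_solution lam \<alpha> T \<mu> p" by (rule fs.p_solution) (simp add: a0_def)
  show "p \<in> C_into_L {0<..T}" by (rule fs.p_C_into_L)
  show "AE (t, x) in lebesgue_on ({0<..T} \<times> UNIV). (\<Sum>i\<in>UNIV. p t x $ i) = heat_conv \<mu> t x"
   using fs.total_eq_heat_conv by (intro AE_I2) (auto simp: total_def)
 qed
qed

end
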